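(* Let $\Gamma\subseteq\mathrm{PSL}(2,\mathbb{R})$ be a Fuchsian group of the first kind with $\mathbf{c}>0$ cusps, with automorphic scattering determinant $\phi(s)$ written for $\Re(s)>1$ as $\phi(s)=\pi^{\mathbf{c}/2}\big(\Gamma(s-\tfrac12)/\Gamma(s)\big)^{\mathbf{c}}\sum_{n\ge1} d(n)g_n^{-2s}$ with $0<g_1<g_2<\cdots$, $d(n)\in\mathbb{R}$, $d(1)\neq0$. Let $Z_+(s)=\dfrac{Z(s)}{G_1(s)\,\Gamma(s-\tfrac12)^{\mathbf{c}}}$ and $Z_-(s)=Z_+(s)\phi(s)$, and let $\mathcal{Z}_\pm(s,z)$ be the superzeta functions of $Z_\pm$ (defined in the context). Then for every $z\in X_\pm$ the function $s\mapsto \mathcal{Z}_\pm(s,z)$ has a meromorphic continuation to all of $\mathbb{C}$ which is regular at $s=0$. Furthermore, for $z\in X_+\cap X_-$, $$\phi(z)=\pi^{\mathbf{c}/2}\, d(1)\, g_1^{-2z}\exp\!\left(-\frac{d}{ds}\Big(\mathcal{Z}_-(s,z)-\mathcal{Z}_+(s,z)\Big)\Big|_{s=0}\right).$$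
   Context: Let $M=\Gamma\backslash\mathbb{H}$ have genus $g$, $\mathbf{c}$ cusps, and $\mathbf{e}$ inequivalent elliptic conjugacy classes $\{R\}$, with $d_R$ the order of $R$. The automorphic scattering determinant $\phi(s)$ is the determinant of the scattering matrix $\Phi(s)$ obtained from the constant terms of the parabolic Eisenstein series; it is meromorphic and satisfies $\phi(s)\phi(1-s)=1$. The Selberg zeta function is $Z(s)=\prod_{\{P_0\}}\prod_{n=0}^\infty(1-N(P_0)^{-(s+n)})$ for $\Re(s)>1$, the product over primitive hyperbolic conjugacy classes $\{P_0\}$ of $\Gamma$ with norm $N(P_0)$, extended meromorphically to $\mathbb{C}$. The Barnes double Gamma function is $G(s+1)=(2\pi)^{s/2}\exp\!\big[-\tfrac12((1+\gamma)s^2+s)\big]\prod_{n\ge1}(1+s/n)^n\exp[-s+s^2/(2n)]$ ($\gamma$ Euler's constant). Set $G_E(s)=\prod_{\{R\}}\prod_{m=0}^{d_R-1}G\!\left(\frac{s+m}{d_R}+1\right)$ and $$G_1(s)=\left(\frac{(2\pi)^{-s}G(s+1)^2}{\Gamma(s)}\right)^{2g-2+\mathbf{c}}\big((2\pi)^{-s}G(s+1)^2\big)^{\mathbf{e}}\,G_E(s)^{-2}.$$ Then $Z_\pm$ are entire functions of order two. For an entire function $f$ of order at most two with zeros $y_k$ (repeated with multiplicity), let $X_f=\{z\in\mathbb{C}: z-y_k\notin(-\infty,0]\text{ for all }k\}$ and, for $z\in X_f$, define the superzeta function $\mathcal{Z}_f(s,z)=\sum_k (z-y_k)^{-s}$ (principal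 branch of the logarithm, $\arg\in(-\pi,\pi)$), absolutely convergent for $\Re(s)>2$. Here $X_\pm=X_{Z_\pm}$ and $\mathcal{Z}_\pm=\mathcal{Z}_{Z_\pm}$. *)

theory Defs
  imports "HOL-Complex_Analysis.Complex_Analysis" "HOL-Algebra.Group_Action"
    "HOL-Algebra.Generated_Groups"
begin

(* fps_nth would otherwise compete with vec_nth for the symbol $ *)
no_notation fps_nth (infixl "$" 75)

section \<open>The group PSL(2,R) and its action\<close>

definition SL2R :: "(real^2^2) monoid" where
  "SL2R = \<lparr>carrier = {A. det A = 1}, mult = (**), one = mat 1\<rparr>"

text \<open>The elements of \<open>PSL2R\<close> are the cosets \<open>{A, - A}\<close>.\<close>

definition PSL2R :: "(real^2^2) set monoid" where
  "PSL2R = SL2R Mod {mat 1, - mat 1}"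

definition psl_of :: "real^2^2 \<Rightarrow> (real^2^2) set" where
  "psl_of A = {A, - A}"

definition upper_half_plane :: "complex set" where
  "upper_half_plane = {z. Im z > 0}"

lemma det_uminus2: "det (- A) = det A" for A :: "real^2^2"
  by (simp add: det_2)

lemma matrix_mul_uminus: "(- A) ** B = - (A ** B)" "A ** (- B) = - (A ** B)" for A B :: "real^2^2"
  by (simp_all add: matrix_matrix_mult_def vec_eq_iff sum_negf)

lemma group_SL2R: "group SL2R"
proof (rule groupI)
  show "\<And>x y. x \<in> carrier SL2R \<Longrightarrow> y \<in> carrier SL2R \<Longrightarrow> x \<otimes>\<^bsub>SL2R\<^esub> y \<in> carrier SL2R"
    by (simp add: SL2R_def det_mul)
  show "\<one>\<^bsub>SL2R\<^esub> \<in> carrier SL2R" by (simp add: SL2R_def)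
  show "\<And>x y z. x \<otimes>\<^bsub>SL2R\<^esub> y \<otimes>\<^bsub>SL2R\<^esub> z = x \<otimes>\<^bsub>SL2R\<^esub> (y \<otimes>\<^bsub>SL2R\<^esub> z)"
    by (simp add: SL2R_def matrix_mul_assoc)
  show "\<And>x. \<one>\<^bsub>SL2R\<^esub> \<otimes>\<^bsub>SL2R\<^esub> x = x" by (simp add: SL2R_def)
  fix x assume "x \<in> carrier SL2R"
  then have x: "det x = 1" by (simp add: SL2R_def)
  then obtain y where "y ** x = mat 1"
    by (metis invertible_def invertible_det_nz zero_neq_one)
  then show "\<exists>y\<in>carrier SL2R. y \<otimes>\<^bsub>SL2R\<^esub> x = \<one>\<^bsub>SL2R\<^esub>"
    using x by (auto simp: SL2R_def intro!: exI[of _ y]) (metis det_I det_mul mult.right_neutral)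
qed

lemma normal_center: "{mat 1, - mat 1} \<lhd> SL2R"
proof -
  interpret group SL2R by (rule group_SL2R)
  have sg: "subgroup {mat 1, - mat 1} SL2R"
  proof (rule subgroupI)
    show "{mat 1, - mat 1} \<subseteq> carrier SL2R"
      by (auto simp: SL2R_def det_uminus2)
    fix a :: "real^2^2" assume a: "a \<in> {mat 1, - mat 1}"
    then have "a \<otimes>\<^bsub>SL2R\<^esub> a = \<one>\<^bsub>SL2R\<^esub>" "a \<in> carrier SL2R"
      by (auto simp: SL2R_def matrix_mul_uminus det_uminus2)
    then have "inv\<^bsub>SL2R\<^esub> a = a" by (simp add: inv_equality)
    with a show "inv\<^bsub>SL2R\<^esub> a \<in> {mat 1, - mat 1}" by simp
  qed (auto simp: SL2R_def matrix_mul_uminus)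
  show ?thesis
    by (rule normalI[OF sg]) (auto simp: r_coset_def l_coset_def SL2R_def matrix_mul_uminus)
qed

lemma group_PSL2R: "group PSL2R"
  unfolding PSL2R_def by (rule normal.factorgroup_is_group[OF normal_center])

lemma carrier_PSL2R: "carrier PSL2R = psl_of ` {A. det A = 1}"
  by (auto simp: PSL2R_def FactGroup_def RCOSETS_def r_coset_def SL2R_def psl_of_def
      matrix_mul_uminus)

definition moebius_map :: "real^2^2 \<Rightarrow> complex \<Rightarrow> complex" where
  "moebius_map A z = (of_real (A$1$1) * z + of_real (A$1$2)) / (of_real (A$2$1) * z + of_real (A$2$2))"

definition act :: "(real^2^2) set \<Rightarrow> complex \<Rightarrow> complex" where
  "act \<gamma> z = (THE w. \<exists>A\<in>\<gamma>. w = moebius_map A z)"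

lemma act_psl_of: "act (psl_of A) z = moebius_map A z"
proof -
  have "moebius_map (- A) z =
      - (A$1$1 * z + A$1$2) / - (A$2$1 * z + A$2$2)"
    unfolding moebius_map_def by simp
  also have "\<dots> = moebius_map A z"
    by (simp only: divide_minus_right divide_minus_left minus_minus moebius_map_def)
  finally show ?thesis by (auto simp: act_def psl_of_def)
qed

text \<open>The boundary of the upper half plane is the projective line over the reals; it is
  represented by the type \<open>real option\<close>, with \<open>None\<close> standing for the point at infinity.\<close>

definition moebius_boundary :: "real^2^2 \<Rightarrow> real option \<Rightarrow> real option" where
  "moebius_boundary A p = (case p of
      None \<Rightarrow> if A$2$1 = 0 then None else Some (A$1$1 / A$2$1)
    | Some x \<Rightarrow> if A$2$1 * x + A$2$2 = 0 then None
                else Some ((A$1$1 * x + A$1$2) / (A$2$1 * x + A$2$2)))"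

definition act_bd :: "(real^2^2) set \<Rightarrow> real option \<Rightarrow> real option" where
  "act_bd \<gamma> p = (THE q. \<exists>A\<in>\<gamma>. q = moebius_boundary A p)"

lemma act_bd_psl_of: "act_bd (psl_of A) p = moebius_boundary A p"
proof -
  have "(- A)$2$1 * x + (- A)$2$2 = - (A$2$1 * x + A$2$2)"
    "(- A)$1$1 * x + (- A)$1$2 = - (A$1$1 * x + A$1$2)" for x
    by simp_all
  then have "moebius_boundary (- A) p = moebius_boundary A p"
    unfolding moebius_boundary_def by (cases p) (simp_all only: option.case
      divide_minus_right divide_minus_left minus_minus neg_equal_0_iff_equal vector_uminus_component)
  then show ?thesis by (auto simp: act_bd_def psl_of_def)
qed

definition abs_trace :: "(real^2^2) set \<Rightarrow> real" where
  "abs_trace \<gamma> = (THE t. \<exists>A\<in>\<gamma>. t = \<bar>trace A\<bar>)"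

lemma abs_trace_psl_of: "abs_trace (psl_of A) = \<bar>trace A\<bar>"
proof -
  have "\<bar>trace (- A)\<bar> = \<bar>trace A\<bar>" by (simp add: trace_def sum_negf)
  then show ?thesis by (auto simp: abs_trace_def psl_of_def)
qed

definition hyperbolic :: "(real^2^2) set \<Rightarrow> bool" where
  "hyperbolic \<gamma> \<longleftrightarrow> \<gamma> \<in> carrier PSL2R \<and> abs_trace \<gamma> > 2"

definition parabolic :: "(real^2^2) set \<Rightarrow> bool" where
  "parabolic \<gamma> \<longleftrightarrow> \<gamma> \<in> carrier PSL2R \<and> abs_trace \<gamma> = 2 \<and> \<gamma> \<noteq> \<one>\<^bsub>PSL2R\<^esub>"

definition elliptic :: "(real^2^2) set \<Rightarrow> bool" where
  "elliptic \<gamma> \<longleftrightarrow> \<gamma> \<in> carrier PSL2R \<and> abs_trace \<gamma> < 2"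

abbreviation sub_group :: "(real^2^2) set set \<Rightarrow> (real^2^2) set monoid" where
  "sub_group \<Gamma> \<equiv> PSL2R\<lparr>carrier := \<Gamma>\<rparr>"


section \<open>Fuchsian groups\<close>

definition limit_point :: "(real^2^2) set set \<Rightarrow> real option \<Rightarrow> bool" where
  "limit_point \<Gamma> p \<longleftrightarrow> (\<exists>z\<in>upper_half_plane. case p of
      None \<Rightarrow> \<not> bounded (orbit (sub_group \<Gamma>) act z)
    | Some x \<Rightarrow> complex_of_real x islimpt orbit (sub_group \<Gamma>) act z)"

text \<open>A subgroup \<open>\<Gamma>\<close> of PSL(2,R) is discrete iff its preimage \<open>\<Union>\<Gamma>\<close> in SL(2,R) is.\<close>

definition fuchsian_first_kind :: "(real^2^2) set set \<Rightarrow> bool" where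
  "fuchsian_first_kind \<Gamma> \<longleftrightarrow>
     subgroup \<Gamma> PSL2R \<and> discrete (\<Union>\<Gamma>) \<and> (\<forall>p. limit_point \<Gamma> p)"

text \<open>The quotient has finite hyperbolic area iff some measurable set of finite area
  meets every orbit.\<close>

definition finite_covolume :: "(real^2^2) set set \<Rightarrow> bool" where
  "finite_covolume \<Gamma> \<longleftrightarrow> (\<exists>F\<in>sets borel. F \<subseteq> upper_half_plane \<and>
     (\<forall>z\<in>upper_half_plane. \<exists>\<gamma>\<in>\<Gamma>. act \<gamma> z \<in> F) \<and>
     (\<integral>\<^sup>+z\<in>F. ennreal (1 / (Im z)\<^sup>2) \<partial>lborel) < \<infinity>)"

text \<open>The orbit space carries the quotient topology.\<close>

definition orbit_space :: "(real^2^2) set set \<Rightarrow> complex set topology" where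
  "orbit_space \<Gamma> = topology (\<lambda>U. U \<subseteq> orbits (sub_group \<Gamma>) upper_half_plane act \<and>
     open {z\<in>upper_half_plane. orbit (sub_group \<Gamma>) act z \<in> U})"

lemma openin_orbit_space:
  "openin (orbit_space \<Gamma>) U \<longleftrightarrow> U \<subseteq> orbits (sub_group \<Gamma>) upper_half_plane act \<and>
     open {z\<in>upper_half_plane. orbit (sub_group \<Gamma>) act z \<in> U}"
proof -
  let ?p = "orbit (sub_group \<Gamma>) act" and ?H = upper_half_plane
  have "istopology (\<lambda>U. U \<subseteq> orbits (sub_group \<Gamma>) ?H act \<and> open {z\<in>?H. ?p z \<in> U})"
    unfolding istopology_def
  proof (rule conjI; clarify)
    fix S T assume "open {z\<in>?H. ?p z \<in> S}" "open {z\<in>?H. ?p z \<in> T}"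
    moreover have "{z\<in>?H. ?p z \<in> S \<inter> T} = {z\<in>?H. ?p z \<in> S} \<inter> {z\<in>?H. ?p z \<in> T}" by auto
    ultimately show "S \<inter> T \<subseteq> orbits (sub_group \<Gamma>) ?H act \<and> open {z\<in>?H. ?p z \<in> S \<inter> T}"
      if "S \<subseteq> orbits (sub_group \<Gamma>) ?H act" using that by (auto intro: open_Int)
  next
    fix \<K> assume *: "\<forall>K\<in>\<K>. K \<subseteq> orbits (sub_group \<Gamma>) ?H act \<and> open {z\<in>?H. ?p z \<in> K}"
    have "{z\<in>?H. ?p z \<in> \<Union>\<K>} = (\<Union>K\<in>\<K>. {z\<in>?H. ?p z \<in> K})" by auto
    with * show "\<Union>\<K> \<subseteq> orbits (sub_group \<Gamma>) ?H act \<and> open {z\<in>?H. ?p z \<in> \<Union>\<K>}"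
      by (auto intro!: open_UN)
  qed
  then show ?thesis by (simp add: orbit_space_def)
qed

text \<open>The genus of an orientable surface is the maximal number of pairwise disjoint simple
  closed curves that together do not disconnect it. Punctures do not affect this number, so
  it can be read off the non-compact surface without compactifying it.\<close>

definition surface_genus :: "'a topology \<Rightarrow> nat" where
  "surface_genus X = Max {n. \<exists>\<C>. finite \<C> \<and> card \<C> = n \<and> pairwise disjnt \<C> \<and>
     (\<forall>C\<in>\<C>. C \<subseteq> topspace X \<and> subtopology X C homeomorphic_space nsphere 1) \<and>
     connectedin X (topspace X - \<Union>\<C>)}"

definition genus :: "(real^2^2) set set \<Rightarrow> nat" where
  "genus \<Gamma> = surface_genus (orbit_space \<Gamma>)"

definition is_cusp :: "(real^2^2) set set \<Rightarrow> real option \<Rightarrow> bool" where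
  "is_cusp \<Gamma> p \<longleftrightarrow> (\<exists>\<gamma>\<in>\<Gamma>. parabolic \<gamma> \<and> act_bd \<gamma> p = p)"

definition cusp_classes :: "(real^2^2) set set \<Rightarrow> real option set set" where
  "cusp_classes \<Gamma> = orbits (sub_group \<Gamma>) {p. is_cusp \<Gamma> p} act_bd"

definition num_cusps :: "(real^2^2) set set \<Rightarrow> nat" where
  "num_cusps \<Gamma> = card (cusp_classes \<Gamma>)"

definition conj_class :: "(real^2^2) set set \<Rightarrow> (real^2^2) set \<Rightarrow> (real^2^2) set set" where
  "conj_class \<Gamma> P = {\<gamma> \<otimes>\<^bsub>PSL2R\<^esub> P \<otimes>\<^bsub>PSL2R\<^esub> inv\<^bsub>PSL2R\<^esub> \<gamma> | \<gamma>. \<gamma> \<in> \<Gamma>}"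

text \<open>As usual in the trace formula, an elliptic class \<open>{R}\<close> is represented by an element \<open>R\<close>
  generating a maximal finite cyclic subgroup (the stabilizer of its fixed point), and
  different generators of conjugate subgroups represent the same class. The class is therefore
  encoded as the set of all \<open>\<Gamma>\<close>-conjugates of the subgroup generated by \<open>R\<close>, whose common
  cardinality is the order of \<open>R\<close>.\<close>

definition primitive_elliptic :: "(real^2^2) set set \<Rightarrow> (real^2^2) set \<Rightarrow> bool" where
  "primitive_elliptic \<Gamma> R \<longleftrightarrow> R \<in> \<Gamma> \<and> elliptic R \<and>
     (\<forall>S\<in>\<Gamma>. R \<in> generate PSL2R {S} \<longrightarrow> S \<in> generate PSL2R {R})"

definition elliptic_classes :: "(real^2^2) set set \<Rightarrow> (real^2^2) set set set set" where
  "elliptic_classes \<Gamma> =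
     {{generate PSL2R {R'} | R'. R' \<in> conj_class \<Gamma> R} | R. primitive_elliptic \<Gamma> R}"

definition num_elliptic :: "(real^2^2) set set \<Rightarrow> nat" where
  "num_elliptic \<Gamma> = card (elliptic_classes \<Gamma>)"

definition elliptic_order :: "(real^2^2) set set set \<Rightarrow> nat" where
  "elliptic_order K = (THE d. \<exists>H\<in>K. d = card H)"

definition primitive_hyperbolic :: "(real^2^2) set set \<Rightarrow> (real^2^2) set \<Rightarrow> bool" where
  "primitive_hyperbolic \<Gamma> P \<longleftrightarrow> P \<in> \<Gamma> \<and> hyperbolic P \<and>
     (\<forall>Q\<in>\<Gamma>. \<forall>k::nat. P = Q [^]\<^bsub>PSL2R\<^esub> k \<longrightarrow> k = 1)"

definition primitive_hyperbolic_classes :: "(real^2^2) set set \<Rightarrow> (real^2^2) set set set" where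
  "primitive_hyperbolic_classes \<Gamma> = {conj_class \<Gamma> P | P. primitive_hyperbolic \<Gamma> P}"

definition hyperbolic_norm :: "(real^2^2) set \<Rightarrow> real" where
  "hyperbolic_norm P = (THE N. N > 1 \<and> (\<exists>\<sigma>\<in>carrier PSL2R.
     P = \<sigma> \<otimes>\<^bsub>PSL2R\<^esub> psl_of (vector [vector [sqrt N, 0], vector [0, 1 / sqrt N]])
           \<otimes>\<^bsub>PSL2R\<^esub> inv\<^bsub>PSL2R\<^esub> \<sigma>))"

definition class_norm :: "(real^2^2) set set \<Rightarrow> real" where
  "class_norm K = (THE N. \<exists>P\<in>K. N = hyperbolic_norm P)"


section \<open>The Selberg zeta function\<close>

text \<open>\<open>selberg_product \<Gamma> s w\<close> states that the Euler product over pairs \<open>({P\<^sub>0}, n)\<close> converges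
  absolutely at \<open>s\<close> with value \<open>w\<close>.\<close>

definition selberg_product :: "(real^2^2) set set \<Rightarrow> complex \<Rightarrow> complex \<Rightarrow> bool" where
  "selberg_product \<Gamma> s w \<longleftrightarrow>
     (\<lambda>(K, n). norm (of_real (class_norm K) powr (- (s + of_nat n))))
       summable_on (primitive_hyperbolic_classes \<Gamma> \<times> (UNIV :: nat set)) \<and>
     ((\<lambda>F. \<Prod>(K, n)\<in>F. 1 - of_real (class_norm K) powr (- (s + of_nat n))) \<longlongrightarrow> w)
       (finite_subsets_at_top (primitive_hyperbolic_classes \<Gamma> \<times> (UNIV :: nat set)))"

definition selberg_zeta :: "(real^2^2) set set \<Rightarrow> (complex \<Rightarrow> complex) \<Rightarrow> bool" where
  "selberg_zeta \<Gamma> Z \<longleftrightarrow> Z nicely_meromorphic_on UNIV \<and>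
     (\<forall>s. Re s > 1 \<longrightarrow> selberg_product \<Gamma> s (Z s))"


section \<open>The scattering determinant\<close>

text \<open>\<open>\<sigma> i\<close> maps \<open>\<infinity>\<close> to the \<open>i\<close>-th cusp and conjugates its stabilizer in \<open>\<Gamma>\<close> to the
  translations by integers; the cusps \<open>\<sigma> i \<infinity>\<close> represent each class exactly once.\<close>

definition cusp_stabilizer ::
    "(real^2^2) set set \<Rightarrow> (real^2^2) set \<Rightarrow> (real^2^2) set set" where
  "cusp_stabilizer \<Gamma> \<sigma> = stabilizer (sub_group \<Gamma>) act_bd (act_bd \<sigma> None)"

definition scaling_system ::
    "(real^2^2) set set \<Rightarrow> ('n::finite \<Rightarrow> (real^2^2) set) \<Rightarrow> bool" where
  "scaling_system \<Gamma> \<sigma> \<longleftrightarrow>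
     (\<forall>i. \<sigma> i \<in> carrier PSL2R \<and> is_cusp \<Gamma> (act_bd (\<sigma> i) None) \<and>
        {inv\<^bsub>PSL2R\<^esub> (\<sigma> i) \<otimes>\<^bsub>PSL2R\<^esub> \<gamma> \<otimes>\<^bsub>PSL2R\<^esub> \<sigma> i | \<gamma>. \<gamma> \<in> cusp_stabilizer \<Gamma> (\<sigma> i)}
          = {psl_of (vector [vector [1, of_int n], vector [0, 1]]) | n. n \<in> (UNIV :: int set)}) \<and>
     bij_betw (\<lambda>i. orbit (sub_group \<Gamma>) act_bd (act_bd (\<sigma> i) None)) UNIV (cusp_classes \<Gamma>)"

text \<open>The summand below does not depend on the representative of the coset. The series
  converges absolutely for \<open>Re s > 1\<close>.\<close>

definition eisenstein ::
    "(real^2^2) set set \<Rightarrow> (real^2^2) set \<Rightarrow> complex \<Rightarrow> complex \<Rightarrow> complex" where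
  "eisenstein \<Gamma> \<sigma> z s = (\<Sum>\<^sub>\<infinity>C\<in>rcosets\<^bsub>sub_group \<Gamma>\<^esub> (cusp_stabilizer \<Gamma> \<sigma>).
     of_real (Im (act (inv\<^bsub>PSL2R\<^esub> \<sigma> \<otimes>\<^bsub>PSL2R\<^esub> (SOME \<gamma>. \<gamma> \<in> C)) z)) powr s)"

definition constant_term ::
    "(real^2^2) set set \<Rightarrow> ('n \<Rightarrow> (real^2^2) set) \<Rightarrow> 'n \<Rightarrow> 'n \<Rightarrow> real \<Rightarrow> complex \<Rightarrow> complex" where
  "constant_term \<Gamma> \<sigma> i j y s =
     integral {0..1} (\<lambda>x. eisenstein \<Gamma> (\<sigma> j) (act (\<sigma> i) (Complex x y)) s)"

definition scattering_matrix ::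
    "(real^2^2) set set \<Rightarrow> ('n::finite \<Rightarrow> (real^2^2) set) \<Rightarrow> complex \<Rightarrow> complex^'n^'n" where
  "scattering_matrix \<Gamma> \<sigma> s = (\<chi> i j. THE c. \<forall>y>0.
     constant_term \<Gamma> \<sigma> i j y s =
       (if i = j then 1 else 0) * of_real y powr s + c * of_real y powr (1 - s))"

text \<open>The series defining the entries of the scattering matrix converge for \<open>Re s > 1\<close> only;
  \<open>\<phi>\<close> is the meromorphic continuation of the determinant.\<close>

definition scattering_determinant ::
    "(real^2^2) set set \<Rightarrow> ('n::finite \<Rightarrow> (real^2^2) set) \<Rightarrow> (complex \<Rightarrow> complex) \<Rightarrow> bool" where
  "scattering_determinant \<Gamma> \<sigma> \<phi> \<longleftrightarrow> \<phi> nicely_meromorphic_on UNIV \<and>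
     (\<forall>s. Re s > 1 \<longrightarrow> \<phi> s = det (scattering_matrix \<Gamma> \<sigma> s))"


section \<open>The gamma factors\<close>

definition barnes_G_Suc :: "complex \<Rightarrow> complex" where
  "barnes_G_Suc s =
     of_real (2 * pi) powr (s / 2) * exp (- (1/2) * ((1 + euler_mascheroni) * s\<^sup>2 + s)) *
     (\<Prod>k. (1 + s / of_nat (Suc k)) ^ Suc k * exp (- s + s\<^sup>2 / (2 * of_nat (Suc k))))"

definition barnes_G :: "complex \<Rightarrow> complex" where
  "barnes_G w = barnes_G_Suc (w - 1)"

definition G_E :: "(real^2^2) set set \<Rightarrow> complex \<Rightarrow> complex" where
  "G_E \<Gamma> s = (\<Prod>K\<in>elliptic_classes \<Gamma>. \<Prod>m<elliptic_order K.
     barnes_G ((s + of_nat m) / of_nat (elliptic_order K) + 1))"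

definition G_1 :: "(real^2^2) set set \<Rightarrow> complex \<Rightarrow> complex" where
  "G_1 \<Gamma> s =
     (of_real (2 * pi) powr (- s) * barnes_G (s + 1) ^ 2 / Gamma s)
        powi (2 * int (genus \<Gamma>) - 2 + int (num_cusps \<Gamma>)) *
     (of_real (2 * pi) powr (- s) * barnes_G (s + 1) ^ 2) ^ num_elliptic \<Gamma> *
     G_E \<Gamma> s powi (- 2)"


section \<open>Entire functions and superzeta functions\<close>

definition growth_order :: "(complex \<Rightarrow> complex) \<Rightarrow> ereal" where
  "growth_order f =
     Inf {ereal \<rho> | \<rho>. \<rho> \<ge> 0 \<and> (\<exists>C. \<forall>z. norm (f z) \<le> C * exp (norm z powr \<rho>))}"

definition superzeta_domain :: "(complex \<Rightarrow> complex) \<Rightarrow> complex set" where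
  "superzeta_domain f = {z. \<forall>y. f y = 0 \<longrightarrow> z - y \<notin> \<real>\<^sub>\<le>\<^sub>0}"

text \<open>Zeros are counted with multiplicity \<open>zorder f y\<close>.\<close>

definition superzeta_term ::
    "(complex \<Rightarrow> complex) \<Rightarrow> complex \<Rightarrow> complex \<Rightarrow> complex \<Rightarrow> complex" where
  "superzeta_term f s z y = of_int (zorder f y) * (z - y) powr (- s)"

definition superzeta :: "(complex \<Rightarrow> complex) \<Rightarrow> complex \<Rightarrow> complex \<Rightarrow> complex" where
  "superzeta f s z = (\<Sum>\<^sub>\<infinity>y\<in>{y. f y = 0}. superzeta_term f s z y)"

text \<open>The summability clause excludes the default value of \<open>infsum\<close> for divergent series.\<close>

definition superzeta_continuation ::
    "(complex \<Rightarrow> complex) \<Rightarrow> complex \<Rightarrow> (complex \<Rightarrow> complex) \<Rightarrow> bool" where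
  "superzeta_continuation f z F \<longleftrightarrow> F nicely_meromorphic_on UNIV \<and>
     (\<forall>s. Re s > 2 \<longrightarrow> (\<lambda>y. norm (superzeta_term f s z y)) summable_on {y. f y = 0} \<and>
                       F s = superzeta f s z)"

end

theory Submission imports Defs "HOL-Library.Landau_Symbols" "HOL-Real_Asymp.Real_Asymp" begin

text \<open>For an entire function \<open>f\<close> of order at most two, Hadamard's factorization makes
  \<open>(f'/f)''(w)\<close> equal to \<open>2 (w - y)\<^sup>-\<^sup>3\<close> summed over the zeros \<open>y\<close>, so that
  \<open>(1 - s) (2 - s)\<close> times the superzeta function is \<open>sin (\<pi> s) / \<pi>\<close> times the integral of
  \<open>x\<^sup>2\<^sup>-\<^sup>s (f'/f)''(z + x)\<close> over \<open>x > 0\<close> for \<open>2 < Re s < 3\<close>. The Gamma and Barnes factors have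
  Stirling expansions, while \<open>Z\<close> and the Dirichlet series of \<open>\<phi>\<close>, divided by its leading term, differ from a
  constant by an exponentially small amount; hence \<open>(f'/f)''(z + x)\<close> has a full expansion in powers of \<open>1/x\<close> for \<open>f = Z\<^sub>\<plusminus>\<close>, and
  subtracting it term by term continues the integral to all \<open>s\<close>.
  For the difference of the two superzeta functions the integrand is \<open>(\<phi>'/\<phi>)''(z + x)\<close>, which is asymptotic to
  \<open>- c / x\<^sup>3\<close>. Integrating by parts three times, the derivative at \<open>s = 0\<close> becomes the change of
  \<open>log (\<phi>(z + x) g\<^sub>1\<^sup>2\<^sup>(\<^sup>z\<^sup>+\<^sup>x\<^sup>)) + (c/2) log x\<close> between \<open>x = 0\<close> and infinity, where the leading term of the
  Dirichlet series gives the limit.\<close>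

text \<open>Three derivatives of log \<open>f\<close> are what order two calls for: sums of inverse
  cubes over the zeros converge absolutely, a quadratic exponent as in Hadamard's product is
  annihilated, and the terms s log s and s^2 log s of Stirling's formulas become pure powers of 1/s.
  Without logarithms in the expansion the Mellin integral has only simple poles, at the integers 3 -
  j, and sin (pi s) vanishes there. So (1 - s)(2 - s) times the superzeta function is entire, and 0
  is a regular point because this factor equals 2 there. The factor and the sine come from Gamma (3
  - s) Gamma (s), the constant in the Mellin integral of one resolvent, by the reflection formula.

  No infinite product is formed: the zeros in a disc of radius R are divided out, and for the
  zero-free quotient the third derivative of the logarithm is O(R^(rho - 3)). The expansions of the
  Gamma factors come from solving P(s) - P(s + 1) = summand formally in powers of 1/s. No branch of
  log phi is chosen either; along the ray a primitive of the logarithmic derivative takes its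
  place.\<close>

section \<open>Holomorphic dependence of an integral on a parameter\<close>

text \<open>Cauchy's inequality on discs of half the radius turns the majorant \<open>B\<close> into
  the majorant \<open>2 * B x / r\<close> of the difference quotients, so dominated convergence
  differentiates under the integral. The measure is arbitrary because the lemma serves integrals
  over the ray and, with counting measure, sums over zeros.\<close>

lemma holomorphic_on_integral:
  fixes g :: "complex \<Rightarrow> 'a \<Rightarrow> complex"
  assumes "open U"
    and meas: "\<And>w. w \<in> U \<Longrightarrow> g w \<in> borel_measurable M"
    and hol: "\<And>x. x \<in> space M \<Longrightarrow> (\<lambda>w. g w x) holomorphic_on U"
    and bound: "\<And>w. w \<in> U \<Longrightarrow> \<exists>r>0. \<exists>B. cball w r \<subseteq> U \<and> integrable M B \<and>
        (\<forall>v\<in>cball w r. \<forall>x\<in>space M. norm (g v x) \<le> B x)"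
  shows "(\<lambda>w. \<integral>x. g w x \<partial>M) holomorphic_on U"
  unfolding holomorphic_on_def
proof
  fix w assume "w \<in> U"
  obtain r B where r: "r > 0" "cball w r \<subseteq> U" and B: "integrable M B"
    and gB: "\<And>v x. v \<in> cball w r \<Longrightarrow> x \<in> space M \<Longrightarrow> norm (g v x) \<le> B x"
    using bound[OF \<open>w \<in> U\<close>] by blast
  have int: "integrable M (g v)" if "v \<in> cball w r" for v
    using that r gB[OF that] by (intro Bochner_Integration.integrable_bound[OF B meas]) force+
  have der: "((\<lambda>v. g v x) has_field_derivative deriv (\<lambda>v. g v x) v) (at v)" if "x \<in> space M" "v \<in> U" for x v
    using hol[OF that(1)] assms(1) that(2) by (auto simp: holomorphic_derivI)
  have derB: "norm (deriv (\<lambda>v. g v x) v) \<le> 2 * B x / r" if x: "x \<in> space M" and v: "v \<in> ball w (r/2)" for x v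
  proof -
    have sub: "cball v (r/2) \<subseteq> cball w r"
    proof
      fix y assume "y \<in> cball v (r/2)"
      then show "y \<in> cball w r" using v dist_triangle[of w y v] by auto
    qed
    have "norm ((deriv ^^ 1) (\<lambda>v. g v x) v) \<le> fact 1 * B x / (r/2) ^ 1"
    proof (rule Cauchy_inequality)
      have h: "(\<lambda>v. g v x) holomorphic_on cball v (r/2)"
        using hol[OF x] sub r(2) by (meson holomorphic_on_subset order_trans)
      show "(\<lambda>v. g v x) holomorphic_on ball v (r/2)"
        using h by (rule holomorphic_on_subset) auto
      show "continuous_on (cball v (r/2)) (\<lambda>v. g v x)" using h by (rule holomorphic_on_imp_continuous_on)
      show "\<And>y. norm (v - y) = r / 2 \<Longrightarrow> norm (g y x) \<le> B x"
        using gB[OF _ x] sub by (auto simp: subset_iff dist_norm)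
    qed (use r in auto)
    then show ?thesis by (simp add: field_simps)
  qed
  have lip: "norm (g v x - g w x) \<le> 2 * B x / r * norm (v - w)" if x: "x \<in> space M" and v: "v \<in> ball w (r/2)" for x v
  proof (rule field_differentiable_bound[where S="ball w (r/2)"])
    show "\<And>u. u \<in> ball w (r/2) \<Longrightarrow> ((\<lambda>v. g v x) has_field_derivative deriv (\<lambda>v. g v x) u) (at u within ball w (r/2))"
      using r by (intro has_field_derivative_at_within[OF der[OF x]]) (auto simp: subset_iff)
  qed (use derB x v r in auto)
  have "((\<lambda>w. \<integral>x. g w x \<partial>M) has_field_derivative (\<integral>x. deriv (\<lambda>v. g v x) w \<partial>M)) (at w)"
    unfolding has_field_derivative_iff tendsto_at_iff_sequentially comp_def
  proof (intro allI impI)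
    fix X assume X: "\<forall>i. X i \<in> UNIV - {w}" "X \<longlonglongrightarrow> w"
    let ?q = "\<lambda>i x. (g (X i) x - g w x) / (X i - w)"
    from X(2) have ev: "\<forall>\<^sub>F i in sequentially. X i \<in> ball w (r/2)"
      using r(1) by (meson half_gt_zero centre_in_ball lim_explicit open_ball eventually_sequentially tendsto_def topological_tendstoD)
    then obtain N where N: "\<And>i. i \<ge> N \<Longrightarrow> X i \<in> ball w (r/2)"
      by (auto simp: eventually_sequentially)
    have Nc: "X i \<in> cball w r" if "i \<ge> N" for i using N[OF that] r(1) by auto
    have lim: "(\<lambda>i. ?q i x) \<longlonglongrightarrow> deriv (\<lambda>v. g v x) w" if "x \<in> space M" for x
      using der[OF that \<open>w \<in> U\<close>] X unfolding has_field_derivative_iff tendsto_at_iff_sequentially comp_def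
      by blast
    have qm: "?q (i + N) \<in> borel_measurable M" for i
      using int[OF Nc[of "i+N"]] int[of w] r(1) by (intro borel_measurable_divide borel_measurable_diff) auto
    have m: "(\<lambda>x. deriv (\<lambda>v. g v x) w) \<in> borel_measurable M"
      by (rule borel_measurable_LIMSEQ_metric[where f="\<lambda>i. ?q (i+N)"]) (use qm lim in \<open>auto intro: LIMSEQ_ignore_initial_segment\<close>)
    \<comment> \<open>The majorant is available once \<open>X i\<close> lies in the half disc, but
      dominated convergence wants it for every index; hence the shift by \<open>N\<close>.\<close>
    have "(\<lambda>i. \<integral>x. ?q (i+N) x \<partial>M) \<longlonglongrightarrow> (\<integral>x. deriv (\<lambda>v. g v x) w \<partial>M)"
    proof (rule integral_dominated_convergence[where w="\<lambda>x. 2 * B x / r"])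
      show "integrable M (\<lambda>x. 2 * B x / r)" using B by auto
      show "AE x in M. (\<lambda>i. ?q (i+N) x) \<longlonglongrightarrow> deriv (\<lambda>v. g v x) w"
        using lim by (auto intro!: AE_I2 LIMSEQ_ignore_initial_segment)
      show "AE x in M. norm (?q (i+N) x) \<le> 2 * B x / r" for i
      proof (rule AE_I2)
        fix x assume x: "x \<in> space M"
        have "X (i+N) \<noteq> w" using X by auto
        then show "norm (?q (i+N) x) \<le> 2 * B x / r"
          using lip[OF x N[of "i+N"]] by (simp add: norm_divide pos_divide_le_eq)
      qed
    qed (use qm m in auto)
    also have "(\<lambda>i. \<integral>x. ?q (i+N) x \<partial>M) = (\<lambda>i. ((\<integral>x. g (X (i+N)) x \<partial>M) - (\<integral>x. g w x \<partial>M)) / (X (i+N) - w))"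
      using int Nc r(1) by (subst integral_divide_zero) (simp_all add: Bochner_Integration.integral_diff)
    finally show "(\<lambda>i. ((\<integral>x. g (X i) x \<partial>M) - (\<integral>x. g w x \<partial>M)) / (X i - w)) \<longlonglongrightarrow> (\<integral>x. deriv (\<lambda>v. g v x) w \<partial>M)"
      by (rule LIMSEQ_offset)
  qed
  then show "(\<lambda>w. \<integral>x. g w x \<partial>M) field_differentiable at w within U"
    using field_differentiable_at_within field_differentiable_def by blast
qed

section \<open>The Mellin transform of a cubed resolvent\<close>

abbreviation lpos :: "real measure" where "lpos \<equiv> restrict_space lborel {0<..}"

lemma space_lpos [simp]: "space lpos = {0<..}"
  by (simp add: space_restrict_space)

lemma sigma_finite_lpos: "sigma_finite_measure lpos"
  by (intro sigma_finite_measure_restrict_space lborel.sigma_finite_measure_axioms) auto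

lemma borel_measurable_lpos:
  fixes f :: "real \<Rightarrow> 'b::topological_space"
  shows "continuous_on {0<..} f \<Longrightarrow> f \<in> borel_measurable lpos"
  using borel_measurable_continuous_on_restrict[of "{0<..}" f]
  by (metis measurable_cong_sets sets_lborel sets_restrict_space_cong)

text \<open>No single power of x is integrable at both ends of the ray, so majorants carry one
  exponent near 0 and another near infinity.\<close>

definition powr_bound :: "real \<Rightarrow> real \<Rightarrow> real \<Rightarrow> real" where
  "powr_bound a b x = (if x \<le> 1 then x powr a else x powr b)"

lemma integrable_powr_bound:
  assumes "a > -1" "b < -1"
  shows "integrable lpos (powr_bound a b)"
proof -
  have 1: "integrable lborel (\<lambda>x. indicator {0..1} x *\<^sub>R (x powr a))"
  proof -
    have "(\<lambda>x. x powr a) absolutely_integrable_on {0..1}"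
      using integrable_on_powr_from_0[of a 1] assms by (subst absolutely_integrable_on_iff_nonneg) auto
    then show ?thesis
      unfolding set_integrable_def by (subst (asm) integrable_completion) auto
  qed
  have 2: "integrable lborel (\<lambda>x. indicator {1..} x *\<^sub>R (x powr b))"
  proof -
    have "(\<lambda>x. x powr b) absolutely_integrable_on {1..}"
      using has_integral_powr_to_inf[of b 1] assms
      by (subst absolutely_integrable_on_iff_nonneg) (auto simp: has_integral_iff)
    then show ?thesis
      unfolding set_integrable_def by (subst (asm) integrable_completion) auto
  qed
  have "integrable lborel (\<lambda>x. indicator {0<..} x *\<^sub>R powr_bound a b x)"
    by (rule Bochner_Integration.integrable_bound[OF Bochner_Integration.integrable_add[OF 1 2]])
       (auto simp: powr_bound_def indicator_def)
  then show ?thesis by (subst integrable_restrict_space) auto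
qed

lemma integrable_lpos_powr:
  fixes f :: "real \<Rightarrow> 'b::{banach, second_countable_topology}"
  assumes "f \<in> borel_measurable lpos" "a > -1" "b < -1"
    and "\<And>x. x > 0 \<Longrightarrow> norm (f x) \<le> C * powr_bound a b x"
  shows "integrable lpos f"
  by (rule Bochner_Integration.integrable_bound[OF integrable_mult_right[OF integrable_powr_bound[OF assms(2,3)], of C] assms(1)])
     (auto intro!: AE_I2 order_trans[OF assms(4)] simp: space_restrict_space)

lemma norm_of_real_powr: "x > 0 \<Longrightarrow> norm (complex_of_real x powr s) = x powr Re s"
  by (simp add: norm_powr_real_powr)

lemma Gamma_integral_scaled:
  fixes s :: complex
  assumes a: "a > 0" and s: "Re s > 0"
  shows "has_bochner_integral lpos (\<lambda>t. of_real t powr (s - 1) * of_real (exp (- (a * t))))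
           (Gamma s * of_real a powr (- s))"
proof -
  let ?f = "\<lambda>t. complex_of_real t powr (s - 1) / of_real (exp t)"
  let ?g = "\<lambda>t. indicator {0<..} t *\<^sub>R ?f t"
  have abs: "?f absolutely_integrable_on {0<..}"
    using absolutely_integrable_Gamma_integral'[OF s] .
  have meas: "?g \<in> borel_measurable lborel"
    by (auto intro!: borel_measurable_continuous_on_indicator continuous_intros)
  have "integrable lborel ?g"
    using abs integrable_completion[OF meas] unfolding set_integrable_def by blast
  moreover have "integral\<^sup>L lborel ?g = Gamma s"
  proof -
    have "integral\<^sup>L lborel ?g = (LINT x:{0<..}|lebesgue. ?f x)"
      unfolding set_lebesgue_integral_def using integral_completion[OF meas] by simp
    also have "\<dots> = Gamma s"
      using Gamma_integral_complex'[OF s] set_lebesgue_integral_eq_integral(2)[OF abs] by (simp add: has_integral_iff)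
    finally show ?thesis .
  qed
  ultimately have "has_bochner_integral lborel ?g (Gamma s)" by (simp add: has_bochner_integral_iff)
  then have "has_bochner_integral lborel (\<lambda>t. ?g (0 + a * t)) (Gamma s /\<^sub>R \<bar>a\<bar>)"
    using lborel_has_bochner_integral_real_affine_iff[of a ?g "Gamma s" 0] a by auto
  then have "has_bochner_integral lborel (\<lambda>t. of_real a powr (1 - s) * ?g (0 + a * t)) (of_real a powr (1 - s) * (Gamma s /\<^sub>R \<bar>a\<bar>))"
    by (rule has_bochner_integral_mult_right)
  also have "(\<lambda>t. of_real a powr (1 - s) * ?g (0 + a * t)) =
      (\<lambda>t. indicator {0<..} t *\<^sub>R (of_real t powr (s - 1) * of_real (exp (- (a * t)))))"
  proof
    fix t
    show "of_real a powr (1 - s) * ?g (0 + a * t) = indicator {0<..} t *\<^sub>R (of_real t powr (s - 1) * of_real (exp (- (a * t))))"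
    proof (cases "t > 0")
      case True
      then have "complex_of_real (a * t) powr (s - 1) = of_real a powr (s - 1) * of_real t powr (s - 1)"
        using a by (simp add: powr_times_real)
      moreover have "of_real a powr (1 - s) * complex_of_real a powr (s - 1) = 1"
        using a by (simp flip: powr_add)
      ultimately have "of_real a powr (1 - s) * complex_of_real (a * t) powr (s - 1) = of_real t powr (s - 1)"
        by (metis mult.assoc mult_1)
      then have "of_real a powr (1 - s) * (complex_of_real (a * t) powr (s - 1) / of_real (exp (a * t))) = of_real t powr (s - 1) / of_real (exp (a * t))"
        by (metis times_divide_eq_right)
      then show ?thesis using True a by (simp add: exp_minus field_simps)
    qed (use a in \<open>auto simp: indicator_def zero_less_mult_iff\<close>)
  qed
  also have "of_real a powr (1 - s) * (Gamma s /\<^sub>R \<bar>a\<bar>) = Gamma s * of_real a powr (- s)"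
    using a by (simp add: powr_diff powr_minus scaleR_conv_of_real field_simps)
  finally show ?thesis
    by (auto simp: has_bochner_integral_iff integrable_restrict_space integral_restrict_space)
qed

lemma Gamma_integral_scaled_real:
  fixes s :: real
  assumes a: "a > 0" and s: "s > 0"
  shows "has_bochner_integral lpos (\<lambda>t. t powr (s - 1) * exp (- (a * t))) (Gamma s * a powr (- s))"
proof -
  have "has_bochner_integral lpos (\<lambda>t. complex_of_real t powr (of_real s - 1) * of_real (exp (- (a * t))))
           (Gamma (of_real s) * of_real a powr (- of_real s))"
    by (rule Gamma_integral_scaled) (use assms in auto)
  also have "Gamma (of_real s) * of_real a powr (- of_real s) = complex_of_real (Gamma s * a powr (- s))"
    using a by (simp add: Gamma_complex_of_real powr_of_real[symmetric])
  finally have *: "has_bochner_integral lpos (\<lambda>t. complex_of_real t powr (of_real s - 1) * of_real (exp (- (a * t))))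
     (complex_of_real (Gamma s * a powr (- s)))" .
  have "has_bochner_integral lpos (\<lambda>t. complex_of_real (t powr (s - 1) * exp (- (a * t)))) (complex_of_real (Gamma s * a powr (- s)))"
  proof (rule has_bochner_integral_cong[THEN iffD1, OF refl _ refl *])
    fix t assume "t \<in> space lpos"
    then show "complex_of_real t powr (of_real s - 1) * of_real (exp (- (a * t))) = complex_of_real (t powr (s - 1) * exp (- (a * t)))"
      using powr_of_real[of t "s - 1"] by (simp add: space_restrict_space)
  qed
  then show ?thesis
    unfolding has_bochner_integral_iff complex_of_real_integrable_eq integral_complex_of_real of_real_eq_iff .
qed

text \<open>Insert \<open>2 / (w + x) ^ 3\<close>, the integral of
  \<open>t ^ 2 * exp (- (w + x) * t)\<close> over t > 0, and exchange the integrals: the x-integral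
  gives \<open>Gamma (3 - s)\<close>, and the t-integral then gives
  \<open>Gamma s * w powr (- s)\<close>.\<close>

lemma mellin_kernel_pos:
  fixes s :: complex
  assumes w: "w > 0" and s: "0 < Re s" "Re s < 3"
  shows "(\<integral>x. of_real x powr (2 - s) / (of_real w + of_real x) ^ 3 \<partial>lpos) = Gamma (3 - s) * Gamma s / 2 * of_real w powr (- s)"
proof -
  interpret pair_sigma_finite lpos lpos
    by (simp add: pair_sigma_finite_def sigma_finite_lpos)
  \<comment> \<open>\<open>t ^ 2\<close> is written \<open>t powr (3 - 1)\<close> to match the
    scaled Gamma integral at the argument 3.\<close>
  define f where "f = (\<lambda>x t. complex_of_real x powr (2 - s) * of_real t powr (3 - 1) * of_real (exp (- ((w + x) * t))))"
  have m1: "(\<lambda>x. complex_of_real x powr a) \<in> borel_measurable lpos" for a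
    by (intro borel_measurable_lpos continuous_intros) auto
  have id: "(\<lambda>x. x) \<in> borel_measurable lpos"
    by (intro borel_measurable_lpos continuous_intros)
  note m2 = measurable_compose[OF measurable_fst m1] measurable_compose[OF measurable_snd m1]
     measurable_compose[OF measurable_fst id] measurable_compose[OF measurable_snd id]
  have e: "(\<lambda>p. complex_of_real (exp (- ((w + fst p) * snd p)))) \<in> borel_measurable (lpos \<Otimes>\<^sub>M lpos)"
  proof -
    note [measurable] = m2(3)[of lpos] m2(4)[of lpos]
    show ?thesis by measurable
  qed
  have meas: "case_prod f \<in> borel_measurable (lpos \<Otimes>\<^sub>M lpos)"
    unfolding f_def case_prod_unfold by (intro borel_measurable_times m2 e)
  have inner_t: "has_bochner_integral lpos (f x) (of_real x powr (2 - s) * (2 / (of_real w + of_real x) ^ 3))"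
    if "x > 0" for x
  proof -
    have "has_bochner_integral lpos (f x) (of_real x powr (2 - s) * (Gamma 3 * of_real (w + x) powr (- 3)))"
      unfolding f_def mult.assoc
      using that w by (intro has_bochner_integral_mult_right Gamma_integral_scaled) auto
    also have "Gamma 3 * complex_of_real (w + x) powr (- 3) = 2 / (of_real w + of_real x) ^ 3"
      using that w Gamma_numeral[of "num.Bit1 num.One", where 'a=complex]
      by (simp add: powr_minus fact_numeral field_simps)
    finally show ?thesis .
  qed
  have inner_n: "(\<integral>t. norm (f x t) \<partial>lpos) = 2 * x powr (2 - Re s) * (w + x) powr (-3)" if "x > 0" for x
  proof -
    have "has_bochner_integral lpos (\<lambda>t. x powr (2 - Re s) * (t powr (3 - 1) * exp (- ((w + x) * t)))) (x powr (2 - Re s) * (Gamma 3 * (w + x) powr (-3)))"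
      using that w by (intro has_bochner_integral_mult_right Gamma_integral_scaled_real) auto
    then have "(\<integral>t. x powr (2 - Re s) * (t powr (3 - 1) * exp (- ((w + x) * t))) \<partial>lpos) = x powr (2 - Re s) * (Gamma 3 * (w + x) powr (-3))"
      by (rule has_bochner_integral_integral_eq)
    moreover have "(\<integral>t. norm (f x t) \<partial>lpos) = (\<integral>t. x powr (2 - Re s) * (t powr (3 - 1) * exp (- ((w + x) * t))) \<partial>lpos)"
      by (rule Bochner_Integration.integral_cong)
         (use that in \<open>auto simp: f_def norm_mult norm_power norm_of_real_powr space_restrict_space\<close>)
    ultimately show ?thesis using Gamma_numeral[of "num.Bit1 num.One", where 'a=real] by (simp add: fact_numeral)
  qed
  have "integrable (lpos \<Otimes>\<^sub>M lpos) (case_prod f)"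
  proof (rule Fubini_integrable[OF meas])
    show "AE x in lpos. integrable lpos (\<lambda>t. case_prod f (x, t))"
      using inner_t by (auto intro!: AE_I2 simp: space_restrict_space has_bochner_integral_iff)
    have "integrable lpos (\<lambda>x. 2 * x powr (2 - Re s) * (w + x) powr (-3))"
    proof (rule integrable_lpos_powr[where a="2 - Re s" and b="-1 - Re s" and C="2 * max 1 (w powr -3)"])
      show "(\<lambda>x. 2 * x powr (2 - Re s) * (w + x) powr (-3)) \<in> borel_measurable lpos"
        using w by (intro borel_measurable_lpos continuous_intros) auto
      fix x :: real assume x: "x > 0"
      have a: "(w + x) powr (-3) \<le> w powr (-3)" "(w + x) powr (-3) \<le> x powr (-3)"
        using x w by (intro powr_mono2'; simp)+
      show "norm (2 * x powr (2 - Re s) * (w + x) powr (-3)) \<le> 2 * max 1 (w powr -3) * powr_bound (2 - Re s) (-1 - Re s) x"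
      proof (cases "x \<le> 1")
        case True
        have "x powr (2 - Re s) * (w + x) powr (-3) \<le> x powr (2 - Re s) * max 1 (w powr -3)"
          using a by (intro mult_left_mono) auto
        then show ?thesis using True by (simp add: powr_bound_def mult_ac)
      next
        case False
        have "x powr (2 - Re s) * (w + x) powr (-3) \<le> x powr (2 - Re s) * x powr (-3)"
          using a by (intro mult_left_mono) auto
        also have "\<dots> = x powr (-1 - Re s)" by (simp flip: powr_add)
        also have "\<dots> \<le> max 1 (w powr -3) * x powr (-1 - Re s)"
          using mult_right_mono[of 1 "max 1 (w powr -3)" "x powr (-1 - Re s)"] by simp
        finally show ?thesis using False by (simp add: powr_bound_def mult_ac)
      qed
    qed (use s in auto)
    then show "integrable lpos (\<lambda>x. \<integral>t. norm (case_prod f (x, t)) \<partial>lpos)"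
      by (rule Bochner_Integration.integrable_cong[THEN iffD1, OF refl, rotated])
         (simp add: inner_n space_restrict_space)
  qed
  from Fubini_integral[OF this]
  have "(\<integral>t. (\<integral>x. f x t \<partial>lpos) \<partial>lpos) = (\<integral>x. (\<integral>t. f x t \<partial>lpos) \<partial>lpos)" .
  also have "(\<integral>x. (\<integral>t. f x t \<partial>lpos) \<partial>lpos) = (\<integral>x. 2 * (of_real x powr (2 - s) / (of_real w + of_real x) ^ 3) \<partial>lpos)"
    by (rule Bochner_Integration.integral_cong)
       (auto simp: has_bochner_integral_integral_eq[OF inner_t])
  also have "(\<integral>t. (\<integral>x. f x t \<partial>lpos) \<partial>lpos) = (\<integral>t. Gamma (3 - s) * (of_real t powr (s - 1) * of_real (exp (- (w * t)))) \<partial>lpos)"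
  proof (rule Bochner_Integration.integral_cong[OF refl])
    fix t assume "t \<in> space lpos"
    then have t: "t > 0" by (simp add: space_restrict_space)
    have "has_bochner_integral lpos (\<lambda>x. of_real t powr (3 - 1) * of_real (exp (- (w * t))) * (complex_of_real x powr ((3 - s) - 1) * of_real (exp (- (t * x)))))
       (of_real t powr (3 - 1) * of_real (exp (- (w * t))) * (Gamma (3 - s) * of_real t powr (- (3 - s))))"
      using s t by (intro has_bochner_integral_mult_right Gamma_integral_scaled) auto
    then have "(\<integral>x. of_real t powr (3 - 1) * of_real (exp (- (w * t))) * (complex_of_real x powr ((3 - s) - 1) * of_real (exp (- (t * x)))) \<partial>lpos)
      = of_real t powr (3 - 1) * of_real (exp (- (w * t))) * (Gamma (3 - s) * of_real t powr (- (3 - s)))"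
      by (rule has_bochner_integral_integral_eq)
    also have "(\<lambda>x. of_real t powr (3 - 1) * of_real (exp (- (w * t))) * (complex_of_real x powr ((3 - s) - 1) * of_real (exp (- (t * x))))) = (\<lambda>x. f x t)"
      unfolding f_def by (rule ext) (simp add: algebra_simps exp_diff exp_minus field_simps)
    also have "of_real t powr (3 - 1) * of_real (exp (- (w * t))) * (Gamma (3 - s) * of_real t powr (- (3 - s))) = Gamma (3 - s) * ((of_real t powr (3 - 1) * of_real t powr (- (3 - s))) * of_real (exp (- (w * t))))"
      by (simp add: mult_ac)
    also have "of_real t powr (3 - 1) * complex_of_real t powr (- (3 - s)) = of_real t powr (s - 1)"
      by (subst powr_add[symmetric]) (simp add: algebra_simps)
    finally show "(\<integral>x. f x t \<partial>lpos) = Gamma (3 - s) * (of_real t powr (s - 1) * of_real (exp (- (w * t))))" .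
  qed
  also have "\<dots> = Gamma (3 - s) * (Gamma s * of_real w powr (- s))"
    by (intro has_bochner_integral_integral_eq has_bochner_integral_mult_right Gamma_integral_scaled) (use w s in auto)
  finally show ?thesis unfolding integral_mult_right_zero by (simp add: field_simps)
qed

lemma add_pos_neq_0: "w \<notin> \<real>\<^sub>\<le>\<^sub>0 \<Longrightarrow> x \<ge> 0 \<Longrightarrow> w + complex_of_real x \<noteq> 0"
  by (metis add_eq_0_iff minus_minus nonpos_Reals_of_real_iff neg_0_le_iff_le of_real_minus add.commute add.inverse_inverse)

lemma mellin_kernel_bound:
  assumes "cball w r \<inter> \<real>\<^sub>\<le>\<^sub>0 = {}" "r > 0"
  obtains c where "c > 0" "\<And>v x. v \<in> cball w r \<Longrightarrow> x > 0 \<Longrightarrow> norm (v + complex_of_real x) \<ge> c * max 1 x"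
proof -
  obtain d where d: "d > 0" "\<And>v y. v \<in> cball w r \<Longrightarrow> y \<in> \<real>\<^sub>\<le>\<^sub>0 \<Longrightarrow> d \<le> dist v y"
    using separate_compact_closed[of "cball w r" "\<real>\<^sub>\<le>\<^sub>0"] assms(1) by auto
  define \<rho> where "\<rho> = norm w + r + 1"
  have \<rho>: "\<rho> \<ge> 1" using assms(2) by (simp add: \<rho>_def)
  \<comment> \<open>The 1/2 serves \<open>x \<ge> 2 * \<rho>\<close>, where \<open>v\<close> takes
    away at most half of \<open>x\<close>; the other entry serves smaller \<open>x\<close>, where
    only the distance \<open>d\<close> to the cut is left.\<close>
  define c where "c = min (1/2) (d / (2 * \<rho>))"
  show thesis
  proof
    show "c > 0" using d(1) \<rho> by (simp add: c_def)
    fix v and x :: real assume v: "v \<in> cball w r" and x: "x > 0"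
    have nd: "norm (v + of_real x) \<ge> d"
      using d(2)[OF v, of "- of_real x"] x by (simp add: dist_norm)
    have nv: "norm v \<le> \<rho>"
      using v norm_triangle_ineq2[of v w] by (simp add: \<rho>_def dist_norm norm_minus_commute)
    show "c * max 1 x \<le> norm (v + complex_of_real x)"
    proof (cases "x \<ge> 2 * \<rho>")
      case True
      have "norm (v + complex_of_real x) \<ge> x - \<rho>"
        using norm_triangle_ineq2[of "complex_of_real x" "- v"] nv x by (simp add: add.commute)
      moreover have "c * max 1 x \<le> 1/2 * x"
        using True \<rho> by (intro mult_mono) (auto simp: c_def)
      ultimately show ?thesis using True by linarith
    next
      case False
      have "c * max 1 x \<le> d / (2 * \<rho>) * (2 * \<rho>)"
        using False \<rho> d by (intro mult_mono) (auto simp: c_def)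
      then show ?thesis using nd \<rho> by simp
    qed
  qed
qed

lemma mellin_kernel_norm:
  assumes c: "c > 0" and x: "x > 0" and le: "c * max 1 x \<le> norm (v + complex_of_real x)"
  shows "norm (of_real x powr (2 - s) / (v + of_real x) ^ 3) \<le> 1 / c ^ 3 * powr_bound (2 - Re s) (-1 - Re s) x"
proof -
  have pos: "0 < c * max 1 x" using c by simp
  have "norm (of_real x powr (2 - s) / (v + of_real x) ^ 3) = x powr (2 - Re s) / norm (v + of_real x) ^ 3"
    using x by (simp add: norm_divide norm_power norm_of_real_powr)
  also have "\<dots> \<le> x powr (2 - Re s) / (c * max 1 x) ^ 3"
    using pos le by (intro divide_left_mono power_mono mult_pos_pos[of "_ ^ 3" "_ ^ 3"] zero_less_power powr_ge_zero; linarith)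
  also have "\<dots> = 1 / c ^ 3 * powr_bound (2 - Re s) (-1 - Re s) x"
  proof (cases "x \<le> 1")
    case False
    have "x powr (2 - Re s) / x ^ 3 = x powr (2 - Re s - 3)"
      using x by (simp only: powr_diff powr_numeral)
    also have "2 - Re s - 3 = -1 - Re s" by simp
    finally have "x powr (2 - Re s) / x ^ 3 = x powr (-1 - Re s)" .
    moreover have "x powr (2 - Re s) / (c * x) ^ 3 = 1 / c ^ 3 * (x powr (2 - Re s) / x ^ 3)"
      by (simp add: power_mult_distrib)
    ultimately show ?thesis using False by (simp add: powr_bound_def)
  qed (use c in \<open>simp add: powr_bound_def\<close>)
  finally show ?thesis .
qed

text \<open>Both sides are holomorphic in \<open>w\<close> on the slit plane, which is connected,
  and they agree for positive \<open>w\<close>, where the exponential representation is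
  available.\<close>

lemma mellin_kernel:
  fixes s :: complex
  assumes w: "w \<notin> \<real>\<^sub>\<le>\<^sub>0" and s: "0 < Re s" "Re s < 3"
  shows "(\<integral>x. of_real x powr (2 - s) / (w + of_real x) ^ 3 \<partial>lpos) = Gamma (3 - s) * Gamma s / 2 * w powr (- s)"
proof -
  let ?S = "- \<real>\<^sub>\<le>\<^sub>0 :: complex set"
  let ?I = "\<lambda>w. (\<integral>x. of_real x powr (2 - s) / (w + of_real x) ^ 3 \<partial>lpos)"
  let ?G = "\<lambda>w. Gamma (3 - s) * Gamma s / 2 * w powr (- s)"
  have hol: "?I holomorphic_on ?S"
  proof (rule holomorphic_on_integral)
    show "open ?S" by auto
    fix w :: complex assume w: "w \<in> ?S"
    show "(\<lambda>x. of_real x powr (2 - s) / (w + of_real x) ^ 3) \<in> borel_measurable lpos"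
      using w add_pos_neq_0[of w] by (intro borel_measurable_lpos continuous_intros) auto
    obtain r where r: "r > 0" "cball w r \<subseteq> ?S"
      using w open_contains_cball[of ?S] by auto
    obtain c where c: "c > 0" "\<And>v x. v \<in> cball w r \<Longrightarrow> x > 0 \<Longrightarrow> norm (v + complex_of_real x) \<ge> c * max 1 x"
      using mellin_kernel_bound[of w r] r by (metis disjoint_eq_subset_Compl)
    have "\<forall>v\<in>cball w r. \<forall>x\<in>space lpos. norm (of_real x powr (2 - s) / (v + of_real x) ^ 3) \<le> 1 / c ^ 3 * powr_bound (2 - Re s) (-1 - Re s) x"
      using mellin_kernel_norm[OF c(1)] c(2) by simp
    moreover have "integrable lpos (\<lambda>x. 1 / c ^ 3 * powr_bound (2 - Re s) (-1 - Re s) x)"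
      using s by (intro integrable_mult_right integrable_powr_bound) auto
    ultimately show "\<exists>r>0. \<exists>B. cball w r \<subseteq> ?S \<and> integrable lpos B \<and>
       (\<forall>v\<in>cball w r. \<forall>x\<in>space lpos. norm (of_real x powr (2 - s) / (v + of_real x) ^ 3) \<le> B x)"
      using r by blast
  next
    fix x assume "x \<in> space lpos"
    then show "(\<lambda>w. of_real x powr (2 - s) / (w + of_real x) ^ 3) holomorphic_on ?S"
      using add_pos_neq_0 by (intro holomorphic_intros) auto
  qed
  have hG: "?G holomorphic_on ?S" by (intro holomorphic_intros) auto
  have con: "connected ?S"
  proof -
    have "\<real>\<^sub>\<le>\<^sub>0 = complex_of_real ` {..0}" by (auto simp: nonpos_Reals_def)
    then show ?thesis
      by (metis simply_connected_slotted_complex_plane_left simply_connected_imp_connected)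
  qed
  have "?I w - ?G w = 0"
  proof (rule analytic_continuation[where f = "\<lambda>w. ?I w - ?G w" and S = ?S and U = "of_real ` {0<..}" and \<xi> = 1])
    show "(1::complex) islimpt complex_of_real ` {0<..}"
    proof -
      have "(1::complex) islimpt complex_of_real ` {1<..}"
      proof (rule islimptI)
        fix T :: "complex set" assume "1 \<in> T" "open T"
        then obtain e where e: "e > 0" "ball 1 e \<subseteq> T" by (meson openE)
        then have "complex_of_real (1 + e/2) \<in> T" 
          by (intro subsetD[OF e(2)]) (simp add: dist_norm)
        then show "\<exists>y\<in>complex_of_real ` {1<..}. y \<in> T \<and> y \<noteq> 1"
          using e(1) by (intro bexI[of _ "complex_of_real (1 + e/2)"] imageI) auto
      qed
      then show ?thesis by (rule islimpt_subset) auto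
    qed
    show "?I z - ?G z = 0" if "z \<in> complex_of_real ` {0<..}" for z
      using that mellin_kernel_pos[OF _ s] by auto
  qed (use w con hol hG in \<open>auto intro!: holomorphic_intros\<close>)
  then show ?thesis by simp
qed

section \<open>Zeros of entire functions of order two\<close>

lemma entire_divide_power:
  assumes f: "f holomorphic_on UNIV" and nz: "f a \<noteq> 0"
  obtains h where "h holomorphic_on UNIV" "h y \<noteq> 0" "\<And>w. f w = h w * (w - y) ^ nat (zorder f y)"
proof -
  define n where "n = nat (zorder f y)"
  obtain r where r: "r > 0" "zor_poly f y holomorphic_on cball y r"
     "\<And>w. w \<in> cball y r \<Longrightarrow> f w = zor_poly f y w * (w - y) ^ n \<and> zor_poly f y w \<noteq> 0"
    using zorder_exist_zero[OF f open_UNIV connected_UNIV UNIV_I, of y] nz unfolding n_def by blast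
  define h where "h = (\<lambda>w. if w = y then zor_poly f y y else f w / (w - y) ^ n)"
  have eq: "h w = zor_poly f y w" if "w \<in> ball y r" for w
    using r(3)[of w] that by (auto simp: h_def)
  show thesis
  proof
    show "h y \<noteq> 0" using r by (simp add: h_def)
    show "f w = h w * (w - y) ^ nat (zorder f y)" for w
      using r(3)[of y] r(1) by (auto simp: h_def n_def[symmetric])
    show "h holomorphic_on UNIV"
    proof (rule no_isolated_singularity[where K = "{y}"])
      have "(\<lambda>w. f w / (w - y) ^ n) holomorphic_on UNIV - {y}"
        using f by (intro holomorphic_intros) (auto intro: holomorphic_on_subset)
      then have hh: "h holomorphic_on UNIV - {y}"
        by (rule holomorphic_transform) (auto simp: h_def)
      then show "h holomorphic_on UNIV - {y}" .
      have "continuous_on (ball y r) h"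
        using holomorphic_on_imp_continuous_on[OF holomorphic_on_subset[OF r(2), of "ball y r"]] eq
        by (subst continuous_on_cong[OF refl eq]) auto
      then have "isCont h y" using r(1) by (simp add: continuous_on_eq_continuous_at)
      moreover have "isCont h w" if "w \<noteq> y" for w
        using holomorphic_on_imp_continuous_on[OF hh] that
        by (auto simp: continuous_on_eq_continuous_at open_delete)
      ultimately show "continuous_on UNIV h"
        by (metis continuous_at_imp_continuous_on)
    qed auto
  qed
qed

text \<open>The exponents are orders of \<open>f\<close> and not of the successive quotients; these
  agree because the factors removed so far do not vanish at the new point.\<close>

lemma entire_divide_zeros:
  assumes f: "f holomorphic_on UNIV" and nz: "f a \<noteq> 0" and "finite S"
  shows "\<exists>h. h holomorphic_on UNIV \<and> (\<forall>y\<in>S. h y \<noteq> 0) \<and>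
           (\<forall>w. f w = h w * (\<Prod>y\<in>S. (w - y) ^ nat (zorder f y)))"
  using \<open>finite S\<close>
proof induction
  case empty
  then show ?case using f by auto
next
  case (insert y S)
  then obtain h where h: "h holomorphic_on UNIV" "\<forall>y\<in>S. h y \<noteq> 0"
    "\<And>w. f w = h w * (\<Prod>y\<in>S. (w - y) ^ nat (zorder f y))" by blast
  let ?P = "\<lambda>w. \<Prod>y\<in>S. (w - y) ^ nat (zorder f y)"
  have Py: "?P y \<noteq> 0" using insert by auto
  have Pa: "?P analytic_on {y}" by (intro analytic_intros)
  have ha: "h analytic_on {y}" using h(1) by (metis analytic_on_holomorphic open_UNIV subset_UNIV)
  have "h a \<noteq> 0" using h(3)[of a] nz by auto
  then obtain k where k: "k holomorphic_on UNIV" "k y \<noteq> 0" "\<And>w. h w = k w * (w - y) ^ nat (zorder h y)"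
    using entire_divide_power[OF h(1)] by metis
  have "eventually (\<lambda>w. k w * ?P w \<noteq> 0) (at y)"
  proof -
    have "isCont (\<lambda>w. k w * ?P w) y"
      using holomorphic_on_imp_continuous_on[OF k(1)]
      by (intro continuous_intros) (simp add: continuous_on_eq_continuous_at)
    then show ?thesis
      using k(2) Py by (intro tendsto_imp_eventually_ne[of _ "k y * ?P y"]) (auto simp: isCont_def)
  qed
  then have ev: "eventually (\<lambda>w. h w * ?P w \<noteq> 0) (at y)"
    using eventually_neq_at_within[of y y UNIV]
    by eventually_elim (use k(3) in auto)
  have fe: "(\<lambda>w. h w * ?P w) = f" by (rule ext, rule h(3)[symmetric])
  have "zorder f y = zorder (\<lambda>w. h w * ?P w) y" by (simp only: fe)
  also have "\<dots> = zorder h y + zorder ?P y" by (rule zorder_times_analytic[OF ha Pa ev])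
  also have "zorder ?P y = 0" using Pa Py by (rule zorder_eq_0I)
  finally have z: "zorder h y = zorder f y" by simp
  have "f w = k w * (\<Prod>y\<in>insert y S. (w - y) ^ nat (zorder f y))" for w
    using insert h(3)[of w] k(3)[of w] by (simp add: z mult_ac)
  moreover have "k x \<noteq> 0" if "x \<in> S" for x
    using h(2) that k(3)[of x] by auto
  ultimately show ?case using k by blast
qed

text \<open>Borel-Caratheodory for a third derivative: a logarithm \<open>g\<close> of
  \<open>h\<close> has real part bounded above on the disc, and Schwarz's lemma turns this into a
  bound for \<open>g - g a\<close> on the half disc. Cauchy's inequality there gives 96 = 3! * 2 *
  2^3.\<close>

lemma log_deriv3_bound:
  assumes h: "h holomorphic_on ball a R" and R: "R > 0"
    and nz: "\<And>w. w \<in> ball a R \<Longrightarrow> h w \<noteq> 0" and M: "\<And>w. w \<in> ball a R \<Longrightarrow> norm (h w) \<le> M"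
  shows "norm (deriv (deriv (\<lambda>w. deriv h w / h w)) a) \<le> 96 * (ln M - ln (norm (h a)) + 1) / R ^ 3"
proof -
  obtain g where g: "g holomorphic_on ball a R" "\<And>w. w \<in> ball a R \<Longrightarrow> h w = exp (g w)"
    using contractible_imp_holomorphic_log[OF h convex_imp_contractible[OF convex_ball]] nz by metis
  \<comment> \<open>The summand 1 makes the bound on the real part strict, so that
    \<open>A > 0\<close> even for constant \<open>h\<close>.\<close>
  define A where "A = ln M - ln (norm (h a)) + 1"
  have a: "a \<in> ball a R" using R by simp
  have ReG: "Re (g w - g a) < A" if "w \<in> ball a R" for w
  proof -
    have "norm (h w) = exp (Re (g w))" "norm (h a) = exp (Re (g a))" using g(2) that a by auto
    then have "exp (Re (g w)) \<le> M" "ln (norm (h a)) = Re (g a)" using M[OF that] by auto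
    then have "Re (g w) \<le> ln M" by (metis exp_gt_zero less_le_trans ln_ge_iff)
    then show ?thesis using \<open>ln (norm (h a)) = Re (g a)\<close> by (simp add: A_def)
  qed
  have A: "A > 0" using ReG[OF a] by simp
  \<comment> \<open>The Moebius map \<open>G / (2 * A - G)\<close> takes the half-plane
    \<open>Re G < A\<close> to the unit disc and fixes 0.\<close>
  define \<Phi> where "\<Phi> = (\<lambda>\<zeta>. (g (a + complex_of_real R * \<zeta>) - g a) / (2 * of_real A - (g (a + complex_of_real R * \<zeta>) - g a)))"
  have inb: "a + complex_of_real R * \<zeta> \<in> ball a R" if "norm \<zeta> < 1" for \<zeta>
    using that R by (simp add: dist_norm norm_mult)
  have ne: "2 * of_real A - (g (a + complex_of_real R * \<zeta>) - g a) \<noteq> 0" if "norm \<zeta> < 1" for \<zeta>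
  proof
    assume "2 * of_real A - (g (a + complex_of_real R * \<zeta>) - g a) = 0"
    then have "Re (2 * of_real A - (g (a + complex_of_real R * \<zeta>) - g a)) = 0" by simp
    then show False using ReG[OF inb[OF that]] A by simp
  qed
  have lt: "norm (\<Phi> \<zeta>) < 1" if that: "norm \<zeta> < 1" for \<zeta>
  proof -
    define G where "G = g (a + complex_of_real R * \<zeta>) - g a"
    have "Re G < A" using ReG[OF inb[OF that]] by (simp add: G_def)
    then have "norm G ^ 2 < norm (2 * of_real A - G) ^ 2"
    proof -
      have "0 < 4 * A * (A - Re G)" using A \<open>Re G < A\<close> by simp
      then show ?thesis unfolding cmod_power2 by (simp add: power2_eq_square algebra_simps)
    qed
    then have "norm G < norm (2 * of_real A - G)" by (simp add: power2_less_imp_less)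
    moreover have "\<Phi> \<zeta> = G / (2 * of_real A - G)" unfolding \<Phi>_def G_def ..
    ultimately show ?thesis using norm_ge_zero[of G] by (simp add: norm_divide divide_less_eq)
  qed
  have schwarz: "norm (\<Phi> \<zeta>) \<le> norm \<zeta>" if "norm \<zeta> < 1" for \<zeta>
  proof (rule Schwarz_Lemma(1)[OF _ _ _ that])
    have "(\<lambda>\<zeta>. g (a + complex_of_real R * \<zeta>)) holomorphic_on ball 0 1"
    proof -
      have "(\<lambda>\<zeta>. a + complex_of_real R * \<zeta>) holomorphic_on ball 0 1" by (intro holomorphic_intros)
      moreover have "(\<lambda>\<zeta>. a + complex_of_real R * \<zeta>) ` ball 0 1 \<subseteq> ball a R"
        by (intro image_subsetI inb) simp
      ultimately show ?thesis
        using holomorphic_on_compose_gen[OF _ g(1)] unfolding o_def by blast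
    qed
    then show "\<Phi> holomorphic_on ball 0 1"
      unfolding \<Phi>_def using ne by (intro holomorphic_intros) auto
  qed (use lt in \<open>auto simp: \<Phi>_def\<close>)
  have gb: "norm (g w - g a) \<le> 2 * A" if "w \<in> cball a (R/2)" for w
  proof -
    define \<zeta> where "\<zeta> = (w - a) / R"
    have w: "w = a + complex_of_real R * \<zeta>" using R by (simp add: \<zeta>_def)
    have z: "norm \<zeta> \<le> 1/2" using that R by (simp add: \<zeta>_def norm_divide dist_norm norm_minus_commute)
    let ?G = "g w - g a"
    have "norm (?G / (2 * of_real A - ?G)) \<le> 1/2"
      using schwarz[of \<zeta>] z unfolding \<Phi>_def w by simp
    moreover have "norm (2 * of_real A - ?G) > 0" using ne[of \<zeta>] z w by simp
    ultimately have "norm ?G \<le> 1/2 * norm (2 * of_real A - ?G)"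
      by (simp add: norm_divide divide_le_eq)
    also have "\<dots> \<le> 1/2 * (2 * A + norm ?G)"
      using norm_triangle_ineq4[of "2 * of_real A" ?G] A by simp
    finally show ?thesis by simp
  qed
  have "norm ((deriv ^^ 3) (\<lambda>w. g w - g a) a) \<le> fact 3 * (2 * A) / (R/2) ^ 3"
  proof (rule Cauchy_inequality)
    have h: "(\<lambda>w. g w - g a) holomorphic_on ball a R" using g(1) by (intro holomorphic_intros)
    show "(\<lambda>w. g w - g a) holomorphic_on ball a (R/2)"
      using R by (intro holomorphic_on_subset[OF h] subset_ball) simp
    show "continuous_on (cball a (R/2)) (\<lambda>w. g w - g a)"
      using R by (intro holomorphic_on_imp_continuous_on holomorphic_on_subset[OF h]) (auto simp: subset_iff)
    show "\<And>x. norm (a - x) = R / 2 \<Longrightarrow> norm (g x - g a) \<le> 2 * A"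
      using gb by (auto simp: dist_norm)
  qed (use R in auto)
  also have "(deriv ^^ 3) (\<lambda>w. g w - g a) a = deriv (deriv (\<lambda>w. deriv h w / h w)) a"
  proof -
    have d1: "deriv (\<lambda>w. g w - g a) w = deriv h w / h w" if "w \<in> ball a R" for w
    proof -
      have gd: "(g has_field_derivative deriv g w) (at w)"
        using g(1) that by (auto intro: holomorphic_derivI)
      have "((\<lambda>w. exp (g w)) has_field_derivative exp (g w) * deriv g w) (at w)"
        by (rule DERIV_chain2[OF DERIV_exp gd])
      then have "(h has_field_derivative exp (g w) * deriv g w) (at w)"
        by (rule has_field_derivative_transform_within_open[of _ _ _ "ball a R"]) (use that g(2) in auto)
      then have "deriv h w = h w * deriv g w" using g(2)[OF that] by (simp add: DERIV_imp_deriv)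
      moreover have "deriv (\<lambda>w. g w - g a) w = deriv g w"
        using gd by (intro DERIV_imp_deriv) (auto intro!: derivative_eq_intros)
      ultimately show ?thesis using nz[OF that] by simp
    qed
    have ev: "\<forall>\<^sub>F w in nhds a. w \<in> ball a R" using R by (intro eventually_nhds_in_open) auto
    have "\<forall>\<^sub>F w in nhds a. deriv (\<lambda>w. g w - g a) w = deriv h w / h w"
      using ev d1 by (auto elim: eventually_mono)
    then have "(deriv ^^ 2) (deriv (\<lambda>w. g w - g a)) a = (deriv ^^ 2) (\<lambda>w. deriv h w / h w) a"
      by (rule higher_deriv_cong_ev) simp
    then show ?thesis by (simp add: numeral_3_eq_3 numeral_2_eq_2 funpow_swap1)
  qed
  finally show ?thesis using R by (simp add: A_def fact_numeral power_divide field_simps)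
qed

lemma prod_power_log_deriv:
  assumes "finite S" "\<And>y. y \<in> S \<Longrightarrow> w \<noteq> y" "h field_differentiable (at w)" "h w \<noteq> 0"
  shows "(\<lambda>w. h w * (\<Prod>y\<in>S. (w - y) ^ n y)) field_differentiable (at w) \<and>
     deriv (\<lambda>w. h w * (\<Prod>y\<in>S. (w - y) ^ n y)) w / (h w * (\<Prod>y\<in>S. (w - y) ^ n y)) =
     deriv h w / h w + (\<Sum>y\<in>S. of_nat (n y) / (w - y))"
  using assms(1,2)
proof (induction S)
  case empty
  then show ?case using assms by simp
next
  case (insert y S)
  let ?f = "\<lambda>w. h w * (\<Prod>y\<in>S. (w - y) ^ n y)"
  have d: "(?f has_field_derivative deriv ?f w) (at w)"
    using insert by (simp add: field_differentiable_derivI)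
  have wy: "w - y \<noteq> 0" using insert.prems by auto
  have p: "((\<lambda>w. (w - y) ^ n y) has_field_derivative of_nat (n y) / (w - y) * (w - y) ^ n y) (at w)"
    using wy by (auto intro!: derivative_eq_intros) (cases "n y"; simp add: field_simps)
  have "((\<lambda>w. ?f w * (w - y) ^ n y) has_field_derivative
      (deriv ?f w * (w - y) ^ n y + of_nat (n y) / (w - y) * (w - y) ^ n y * ?f w)) (at w)"
    by (rule DERIV_mult[OF d p])
  moreover have fun_eq: "(\<lambda>w. ?f w * (w - y) ^ n y) = (\<lambda>w. h w * (\<Prod>y\<in>insert y S. (w - y) ^ n y))"
    using insert by (auto simp: mult_ac)
  moreover have "?f w \<noteq> 0" using insert assms(4) by auto
  ultimately show ?case
  proof -
    assume *: "((\<lambda>w. ?f w * (w - y) ^ n y) has_field_derivative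
      (deriv ?f w * (w - y) ^ n y + of_nat (n y) / (w - y) * (w - y) ^ n y * ?f w)) (at w)" and nz: "?f w \<noteq> 0"
    have "(deriv ?f w * (w - y) ^ n y + of_nat (n y) / (w - y) * (w - y) ^ n y * ?f w) / (?f w * (w - y) ^ n y) = deriv ?f w / ?f w + of_nat (n y) / (w - y)"
      using nz wy by (simp add: add_divide_distrib)
    also have "deriv ?f w / ?f w = deriv h w / h w + (\<Sum>y\<in>S. of_nat (n y) / (w - y))"
      using insert by simp
    finally have eq: "deriv (\<lambda>w. ?f w * (w - y) ^ n y) w / (?f w * (w - y) ^ n y) =
        deriv h w / h w + (\<Sum>y\<in>S. of_nat (n y) / (w - y)) + of_nat (n y) / (w - y)"
      by (simp only: DERIV_imp_deriv[OF *])
    have "(\<lambda>w. ?f w * (w - y) ^ n y) field_differentiable (at w)"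
      using * unfolding field_differentiable_def by blast
    moreover have "(\<Sum>y\<in>insert y S. of_nat (n y) / (w - y)) = (\<Sum>y\<in>S. of_nat (n y) / (w - y)) + of_nat (n y) / (w - y)"
      using insert.hyps by simp
    moreover have "(\<lambda>w. ?f w * (w - y) ^ n y) w = h w * (\<Prod>y\<in>insert y S. (w - y) ^ n y)"
      using fun_cong[OF fun_eq] .
    ultimately show ?thesis using eq fun_eq by (metis (no_types, lifting) add.assoc)
  qed
qed

text \<open>The third derivative of log \<open>f\<close>, expressed without a branch.\<close>

definition log_deriv3 :: "(complex \<Rightarrow> complex) \<Rightarrow> complex \<Rightarrow> complex" where
  "log_deriv3 f = deriv (deriv (\<lambda>w. deriv f w / f w))"

lemma zorder_entire_pos:
  assumes "f holomorphic_on UNIV" "f a \<noteq> 0" "f y = 0"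
  shows "zorder f y > 0"
proof -
  have "if f y = 0 then zorder f y > 0 else zorder f y = 0"
    using zorder_exist_zero[OF assms(1) open_UNIV connected_UNIV UNIV_I, of y] assms(2) by blast
  with assms(3) show ?thesis by simp
qed

lemma finite_zeros_cball:
  assumes "f holomorphic_on UNIV" "f a \<noteq> 0"
  shows "finite {y\<in>cball b R. f y = 0}"
proof (cases "\<exists>y. f y = 0")
  case True
  then have "\<not> f constant_on UNIV" using assms(2) by (metis constant_on_def UNIV_I)
  then show ?thesis
    using holomorphic_compact_finite_zeros[OF assms(1) open_UNIV connected_UNIV compact_cball subset_UNIV] by blast
qed simp

text \<open>A form of Jensen's inequality. The zeros within \<open>R\<close> of \<open>a\<close> are
  divided out and the quotient is rescaled to agree with \<open>f\<close> at \<open>a\<close>. On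
  the circle of radius \<open>3 * R\<close> each such zero has
  \<open>norm (w - y) \<ge> 2 * R \<ge> 2 * norm (a - y)\<close>, so each factor gains 2, and the
  maximum principle carries the gain \<open>2 ^ N\<close> inwards.\<close>

lemma disc_factor:
  assumes f: "f holomorphic_on UNIV" and nz: "f a \<noteq> 0" and R: "R > 0"
    and M: "\<And>w. w \<in> cball a (3 * R) \<Longrightarrow> norm (f w) \<le> M"
  defines "Y \<equiv> {y\<in>cball a R. f y = 0}"
  defines "N \<equiv> (\<Sum>y\<in>Y. nat (zorder f y))"
  shows "\<exists>h. h holomorphic_on UNIV \<and> h a = f a \<and>
    (\<forall>w\<in>cball a R. h w \<noteq> 0 \<and> norm (h w) \<le> M / 2 ^ N) \<and>
    (\<forall>w. f w * (\<Prod>y\<in>Y. (a - y) ^ nat (zorder f y)) = h w * (\<Prod>y\<in>Y. (w - y) ^ nat (zorder f y)))"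
proof -
  let ?n = "\<lambda>y. nat (zorder f y)"
  have fin: "finite Y" unfolding Y_def by (rule finite_zeros_cball[OF f nz])
  obtain h0 where h0: "h0 holomorphic_on UNIV" "\<forall>y\<in>Y. h0 y \<noteq> 0"
    "\<forall>w. f w = h0 w * (\<Prod>y\<in>Y. (w - y) ^ ?n y)"
    using entire_divide_zeros[OF f nz fin] by blast
  define Q where "Q = (\<Prod>y\<in>Y. (a - y) ^ ?n y)"
  define P where "P = (\<lambda>w. \<Prod>y\<in>Y. (w - y) ^ ?n y)"
  define h where "h = (\<lambda>w. h0 w * Q)"
  have fP: "f w = h0 w * P w" for w using h0(3) by (simp add: P_def)
  have Q: "Q \<noteq> 0" using nz fP[of a] by (auto simp: P_def Q_def)
  have hh: "h holomorphic_on UNIV" unfolding h_def using h0(1) by (intro holomorphic_intros)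
  have fQ: "f w * Q = h w * P w" for w by (simp add: fP h_def)
  show ?thesis
  proof (intro exI conjI allI ballI)
    show "h holomorphic_on UNIV" by fact
    show "h w \<noteq> 0" if "w \<in> cball a R" for w
    proof (cases "w \<in> Y")
      case True
      then show ?thesis using h0(2) Q by (simp add: h_def)
    next
      case False
      then have "f w \<noteq> 0" using that by (simp add: Y_def)
      then show ?thesis using fQ[of w] Q by auto
    qed
    show "h a = f a" using fQ[of a] Q by (simp add: P_def Q_def)
    show "f w * (\<Prod>y\<in>Y. (a - y) ^ ?n y) = h w * (\<Prod>y\<in>Y. (w - y) ^ ?n y)" for w
      using fQ[of w] by (simp only: P_def Q_def)
    have sph: "norm (h w) \<le> M / 2 ^ N" if w: "w \<in> sphere a (3 * R)" for w
    proof -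
      have "2 ^ N * norm Q = (\<Prod>y\<in>Y. (2 * norm (a - y)) ^ ?n y)"
        by (simp add: N_def Q_def power_sum prod_norm[symmetric] norm_power power_mult_distrib prod.distrib)
      also have "\<dots> \<le> (\<Prod>y\<in>Y. norm (w - y) ^ ?n y)"
      proof (intro prod_mono conjI power_mono)
        fix y assume "y \<in> Y"
        then have "dist a y \<le> R" by (simp add: Y_def)
        moreover have "dist a w = 3 * R" using w by simp
        moreover have "dist a w \<le> dist a y + dist y w" by (rule dist_triangle)
        ultimately show "2 * norm (a - y) \<le> norm (w - y)"
          by (simp add: dist_norm norm_minus_commute)
      qed auto
      also have "\<dots> = norm (P w)" by (simp add: P_def prod_norm[symmetric] norm_power)
      finally have le: "2 ^ N * norm Q \<le> norm (P w)" .
      have "norm (h w) * (2 ^ N * norm Q) \<le> norm (h w) * norm (P w)"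
        using le by (rule mult_left_mono) simp
      also have "\<dots> = norm (f w) * norm Q" by (simp flip: norm_mult fQ)
      also have "\<dots> \<le> M * norm Q" using M[of w] w by (intro mult_right_mono) auto
      finally have "norm (h w) * 2 ^ N \<le> M" using Q by (simp flip: mult.assoc)
      then show ?thesis by (simp add: field_simps)
    qed
    show "norm (h w) \<le> M / 2 ^ N" if "w \<in> cball a R" for w
    proof (rule maximum_modulus_frontier[where S = "cball a (3 * R)" and f = h and \<xi> = w])
      show "h holomorphic_on interior (cball a (3 * R))" using hh by (rule holomorphic_on_subset) simp
      show "continuous_on (closure (cball a (3 * R))) h"
        by (intro holomorphic_on_imp_continuous_on holomorphic_on_subset[OF hh]) simp
      show "\<And>z. z \<in> frontier (cball a (3 * R)) \<Longrightarrow> norm (h z) \<le> M / 2 ^ N"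
        using sph R by simp
      show "w \<in> cball a (3 * R)" using that R by auto
    qed simp
  qed
qed

text \<open>Evaluate the bound on the zero-free quotient at the centre, where it equals
  \<open>f a\<close>.\<close>

lemma zero_count_bound:
  assumes f: "f holomorphic_on UNIV" and nz: "f a \<noteq> 0" and R: "R > 0"
    and M: "\<And>w. w \<in> cball a (3 * R) \<Longrightarrow> norm (f w) \<le> M"
  shows "ln 2 * (\<Sum>y\<in>{y\<in>cball a R. f y = 0}. real_of_int (zorder f y)) \<le> ln M - ln (norm (f a))"
proof -
  let ?Y = "{y\<in>cball a R. f y = 0}"
  define N where "N = (\<Sum>y\<in>?Y. nat (zorder f y))"
  obtain h where h: "h a = f a" "\<forall>w\<in>cball a R. h w \<noteq> 0 \<and> norm (h w) \<le> M / 2 ^ N"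
    using disc_factor[OF f nz R M] unfolding N_def by blast
  have "norm (f a) \<le> M / 2 ^ N" using h(2)[rule_format, of a] h(1) R by simp
  then have le: "norm (f a) * 2 ^ N \<le> M" by (simp add: field_simps)
  have "ln (norm (f a) * 2 ^ N) \<le> ln M"
    using le nz by (intro ln_mono) (auto intro: less_le_trans[OF _ le])
  then have "ln (norm (f a)) + N * ln 2 \<le> ln M"
    using nz by (simp add: ln_mult ln_realpow)
  moreover have "real N = (\<Sum>y\<in>?Y. real_of_int (zorder f y))"
    unfolding N_def of_nat_sum by (rule sum.cong) (use zorder_entire_pos[OF f nz] in \<open>auto intro!: of_nat_nat simp: less_imp_le\<close>)
  ultimately show ?thesis by (simp add: mult.commute)
qed

text \<open>This stands in for Hadamard's factorization. Dividing out the zeros in the disc changes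
  \<open>log_deriv3\<close> by the displayed sum; the quotient is zero-free there with the same
  bound \<open>M\<close>, so Borel-Caratheodory applies. For growth of order below 3 the error
  vanishes as \<open>R\<close> grows.\<close>

lemma log_deriv3_partial_sum:
  assumes f: "f holomorphic_on UNIV" and nz: "f a \<noteq> 0" and R: "R > 0"
    and M: "\<And>w. w \<in> cball a (3 * R) \<Longrightarrow> norm (f w) \<le> M"
  shows "norm (log_deriv3 f a - (\<Sum>y\<in>{y\<in>cball a R. f y = 0}. of_int (zorder f y) * (2 / (a - y) ^ 3)))
     \<le> 96 * (ln M - ln (norm (f a)) + 1) / R ^ 3"
proof -
  define Y where "Y = {y\<in>cball a R. f y = 0}"
  define n where "n = (\<lambda>y. nat (zorder f y))"
  define N where "N = (\<Sum>y\<in>Y. n y)"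
  have fin: "finite Y" unfolding Y_def by (rule finite_zeros_cball[OF f nz])
  obtain h where h: "h holomorphic_on UNIV" "h a = f a"
    "\<forall>w\<in>cball a R. h w \<noteq> 0 \<and> norm (h w) \<le> M / 2 ^ N"
    "\<forall>w. f w * (\<Prod>y\<in>Y. (a - y) ^ n y) = h w * (\<Prod>y\<in>Y. (w - y) ^ n y)"
    using disc_factor[OF f nz R M] unfolding N_def Y_def n_def by blast
  define Q where "Q = (\<Prod>y\<in>Y. (a - y) ^ n y)"
  have Q: "Q \<noteq> 0"
    using fin nz by (auto simp: Q_def Y_def)
  have "norm (f a) \<le> M" using M[of a] R by simp
  then have M0: "M > 0" using nz by (simp add: less_le_trans[OF _ \<open>norm (f a) \<le> M\<close>])
  have hM: "norm (h w) \<le> M" if "w \<in> cball a R" for w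
  proof -
    have "M / 2 ^ N \<le> M / 1" using M0 by (intro divide_left_mono) auto
    then show ?thesis using h(3) that by fastforce
  qed
  define u where "u = (\<lambda>w. deriv h w / h w)"
  define v where "v = (\<lambda>w. \<Sum>y\<in>Y. of_nat (n y) / (w - y))"
  have ub: "norm (deriv (deriv u) a) \<le> 96 * (ln M - ln (norm (f a)) + 1) / R ^ 3"
    unfolding u_def h(2)[symmetric]
    by (rule log_deriv3_bound) (use holomorphic_on_subset[OF h(1) subset_UNIV] h(3) hM R in simp_all)
  have "isCont f a" using holomorphic_on_imp_continuous_on[OF f] by (simp add: continuous_on_eq_continuous_at)
  then have "\<forall>\<^sub>F w in nhds a. f w \<noteq> 0"
    using nz by (simp add: continuous_within tendsto_imp_eventually_ne eventually_nhds_conv_at)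
  then obtain S where S: "open S" "a \<in> S" "\<And>w. w \<in> S \<Longrightarrow> f w \<noteq> 0" by (auto simp: eventually_nhds)
  define B where "B = S \<inter> ball a R"
  have B: "open B" "a \<in> B" "\<And>w. w \<in> B \<Longrightarrow> f w \<noteq> 0" "\<And>w. w \<in> B \<Longrightarrow> h w \<noteq> 0" "\<And>w y. w \<in> B \<Longrightarrow> y \<in> Y \<Longrightarrow> w \<noteq> y"
    using S R h(3) by (auto simp: B_def Y_def)
  have ld: "deriv f w / f w = u w + v w" if w: "w \<in> B" for w
  proof -
    have fd: "f field_differentiable at w" "h field_differentiable at w"
      using f h(1) by (auto simp: holomorphic_on_def)
    have "deriv (\<lambda>w. h w * (\<Prod>y\<in>Y. (w - y) ^ n y)) w / (h w * (\<Prod>y\<in>Y. (w - y) ^ n y)) = u w + v w"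
      unfolding u_def v_def
      using prod_power_log_deriv[OF fin _ fd(2), of n] B w by blast
    also have "(\<lambda>w. h w * (\<Prod>y\<in>Y. (w - y) ^ n y)) = (\<lambda>w. f w * Q)"
      using h(4) by (simp add: Q_def)
    also have "deriv (\<lambda>w. f w * Q) w = deriv f w * Q"
      using fd(1) by simp
    finally show ?thesis using Q by simp
  qed
  have hu: "u holomorphic_on B"
    unfolding u_def using B h(1) by (intro holomorphic_intros holomorphic_deriv[of _ UNIV, THEN holomorphic_on_subset]) (auto intro: holomorphic_on_subset)
  have hv: "v holomorphic_on B"
    unfolding v_def using B by (intro holomorphic_intros) auto
  have "log_deriv3 f a = (deriv ^^ 2) (\<lambda>w. deriv f w / f w) a"
    by (simp add: log_deriv3_def numeral_2_eq_2)
  also have "\<dots> = (deriv ^^ 2) (\<lambda>w. u w + v w) a"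
    by (rule higher_deriv_cong_ev) (use B ld in \<open>auto simp: eventually_nhds\<close>)
  also have "\<dots> = (deriv ^^ 2) u a + (deriv ^^ 2) v a"
    by (rule higher_deriv_add[OF hu hv B(1,2)])
  also have "(deriv ^^ 2) v a = (\<Sum>y\<in>Y. of_nat (n y) * (2 / (a - y) ^ 3))"
  proof -
    have d1: "deriv v w = (\<Sum>y\<in>Y. - of_nat (n y) / (w - y) ^ 2)" if "w \<in> B" for w
      unfolding v_def
      by (rule DERIV_imp_deriv, rule DERIV_sum)
         (use B(5)[OF that] in \<open>auto intro!: derivative_eq_intros simp: power2_eq_square\<close>)
    have d2: "((\<lambda>w. \<Sum>y\<in>Y. - of_nat (n y) / (w - y) ^ 2) has_field_derivative (\<Sum>y\<in>Y. of_nat (n y) * (2 / (a - y) ^ 3))) (at a)"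
    proof (rule DERIV_sum)
      fix y assume "y \<in> Y"
      then have "a - y \<noteq> 0" using B(5)[OF B(2)] by auto
      then have "((\<lambda>w. (w - y) powi (-2)) has_field_derivative of_int (-2) * (a - y) powi (-2 - 1) * 1) (at a)"
        by (intro derivative_eq_intros refl | simp)+
      then have "((\<lambda>w. - of_nat (n y) * (w - y) powi (-2)) has_field_derivative - of_nat (n y) * (of_int (-2) * (a - y) powi (-2 - 1) * 1)) (at a)"
        by (rule DERIV_cmult)
      then show "((\<lambda>w. - of_nat (n y) / (w - y) ^ 2) has_field_derivative of_nat (n y) * (2 / (a - y) ^ 3)) (at a)"
        by (simp add: power_int_minus field_simps)
    qed
    have "deriv (deriv v) a = deriv (\<lambda>w. \<Sum>y\<in>Y. - of_nat (n y) / (w - y) ^ 2) a"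
      by (rule deriv_cong_ev) (use B(1,2) d1 in \<open>auto simp: eventually_nhds\<close>)
    then show ?thesis using DERIV_imp_deriv[OF d2] by (simp add: numeral_2_eq_2)
  qed
  also have "(\<Sum>y\<in>Y. of_nat (n y) * (2 / (a - y) ^ 3)) = (\<Sum>y\<in>Y. of_int (zorder f y) * (2 / (a - y) ^ 3))"
    by (rule sum.cong) (use zorder_entire_pos[OF f nz] in \<open>auto simp: Y_def n_def less_imp_le\<close>)
  finally show ?thesis using ub by (simp add: Y_def numeral_2_eq_2)
qed

text \<open>Dyadic shells: the points with \<open>r y\<close> between \<open>2 ^ k\<close> and
  \<open>2 ^ (k + 1)\<close> contribute at most a constant times
  \<open>2 powr (k * (\<rho> - \<sigma>))\<close>, a geometric series. The finitely many points of
  radius at most 1 are collected in \<open>C0\<close>.\<close>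

lemma summable_on_powr_count:
  fixes r m :: "'a \<Rightarrow> real"
  assumes m: "\<And>y. y \<in> X \<Longrightarrow> m y \<ge> 0" and r: "\<And>y. y \<in> X \<Longrightarrow> r y > 0"
    and fin: "\<And>R. finite {y\<in>X. r y \<le> R}"
    and count: "\<And>R. R \<ge> 1 \<Longrightarrow> (\<Sum>y\<in>{y\<in>X. r y \<le> R}. m y) \<le> K * R powr \<rho>"
    and \<sigma>: "\<sigma> > \<rho>" "\<sigma> > 0"
  shows "(\<lambda>y. m y * r y powr (- \<sigma>)) summable_on X"
proof (rule nonneg_bdd_above_summable_on)
  show "\<And>y. y \<in> X \<Longrightarrow> 0 \<le> m y * r y powr (- \<sigma>)" using m by simp
  define q where "q = (2::real) powr (\<rho> - \<sigma>)"
  have q: "0 < q" "q < 1" using \<sigma> by (auto simp: q_def powr_less_one)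
  have K: "K \<ge> 0" using count[of 1] sum_nonneg[of "{y\<in>X. r y \<le> 1}" m] m by force
  define C0 where "C0 = (\<Sum>y\<in>{y\<in>X. r y \<le> 1}. m y * r y powr (- \<sigma>))"
  have "sum (\<lambda>y. m y * r y powr (- \<sigma>)) F \<le> C0 + K * 2 powr \<rho> * (1 / (1 - q))"
    if F: "F \<subseteq> X" "finite F" for F
  proof -
    let ?t = "\<lambda>y. m y * r y powr (- \<sigma>)"
    define F1 where "F1 = {y\<in>F. r y \<le> 1}"
    define F2 where "F2 = {y\<in>F. r y > 1}"
    have "sum ?t F = sum ?t F1 + sum ?t F2"
      unfolding F1_def F2_def using F by (subst sum.union_disjoint[symmetric]) (auto intro!: sum.cong)
    moreover have "sum ?t F1 \<le> C0"
      unfolding C0_def by (rule sum_mono2) (use fin F m in \<open>auto simp: F1_def\<close>)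
    moreover have "sum ?t F2 \<le> K * 2 powr \<rho> * (1 / (1 - q))"
    proof -
      \<comment> \<open>Any \<open>n\<close> for which \<open>2 ^ n\<close> dominates all radii in
        \<open>F2\<close> will do, since the final bound does not depend on it.\<close>
      define n where "n = Suc (nat \<lceil>Max (insert 1 (r ` F2))\<rceil>)"
      have fin2: "finite F2" using F by (simp add: F2_def)
      have rn: "r y \<le> 2 ^ n" if "y \<in> F2" for y
      proof -
        have "r y \<le> Max (insert 1 (r ` F2))" using that fin2 by simp
        also have "\<dots> \<le> real n" by (simp add: n_def) linarith
        also have "\<dots> \<le> 2 ^ n" using of_nat_less_two_power[of n, where 'a=real] by simp
        finally show ?thesis .
      qed
      have bnd: "?t y \<le> (\<Sum>k<n. if r y \<le> 2 ^ Suc k then m y * (2 ^ k) powr (- \<sigma>) else 0)" if y: "y \<in> F2" for y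
      proof -
        \<comment> \<open>The smallest shell reaching \<open>y\<close>. Minimality gives
          \<open>2 ^ k \<le> r y\<close>; for \<open>k = 0\<close> this is the restriction to
          \<open>r y > 1\<close>.\<close>
        define k where "k = (LEAST k. r y \<le> 2 ^ Suc k)"
        have ex: "r y \<le> 2 ^ Suc (n - 1)" using rn[OF y] by (simp add: n_def)
        have k1: "r y \<le> 2 ^ Suc k" unfolding k_def using ex by (rule LeastI)
        have "k \<le> n - 1" unfolding k_def using ex by (rule Least_le)
        then have kn: "k < n" by (simp add: n_def)
        have k2: "2 ^ k \<le> r y"
        proof (cases k)
          case 0
          then show ?thesis using y by (simp add: F2_def)
        next
          case (Suc j)
          have "\<not> r y \<le> 2 ^ Suc j"
            using not_less_Least[of j "\<lambda>k. r y \<le> 2 ^ Suc k"] Suc by (simp add: k_def)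
          then show ?thesis using Suc by simp
        qed
        have m0: "m y \<ge> 0" using m y F by (auto simp: F2_def)
        have "?t y \<le> m y * (2 ^ k) powr (- \<sigma>)"
          using k2 \<sigma> m0 by (intro mult_left_mono powr_mono2') auto
        also have "\<dots> = (\<Sum>k\<in>{k}. if r y \<le> 2 ^ Suc k then m y * (2 ^ k) powr (- \<sigma>) else 0)" using k1 by simp
        also have "\<dots> \<le> (\<Sum>k<n. if r y \<le> 2 ^ Suc k then m y * (2 ^ k) powr (- \<sigma>) else 0)"
          by (rule sum_mono2) (use kn m0 in auto)
        finally show ?thesis .
      qed
      have "sum ?t F2 \<le> (\<Sum>y\<in>F2. \<Sum>k<n. if r y \<le> 2 ^ Suc k then m y * (2 ^ k) powr (- \<sigma>) else 0)"
        by (rule sum_mono) (rule bnd)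
      also have "\<dots> = (\<Sum>k<n. \<Sum>y\<in>F2. if r y \<le> 2 ^ Suc k then m y * (2 ^ k) powr (- \<sigma>) else 0)"
        by (rule sum.swap)
      also have "\<dots> \<le> (\<Sum>k<n. K * 2 powr \<rho> * q ^ k)"
      proof (rule sum_mono)
        fix k
        have "(\<Sum>y\<in>F2. if r y \<le> 2 ^ Suc k then m y * (2 ^ k) powr (- \<sigma>) else 0) =
            (\<Sum>y\<in>{y\<in>F2. r y \<le> 2 ^ Suc k}. m y * (2 ^ k) powr (- \<sigma>))"
          using fin2 by (subst sum.inter_filter) auto
        also have "\<dots> = (\<Sum>y\<in>{y\<in>F2. r y \<le> 2 ^ Suc k}. m y) * (2 ^ k) powr (- \<sigma>)"
          by (simp add: sum_distrib_right)
        also have "\<dots> \<le> (\<Sum>y\<in>{y\<in>X. r y \<le> 2 ^ Suc k}. m y) * (2 ^ k) powr (- \<sigma>)"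
          by (intro mult_right_mono sum_mono2 fin) (use m F in \<open>auto simp: F2_def\<close>)
        also have "\<dots> \<le> (K * (2 ^ Suc k) powr \<rho>) * (2 ^ k) powr (- \<sigma>)"
          by (intro mult_right_mono count) (auto simp del: power_Suc simp: one_le_power)
        also have "\<dots> = K * 2 powr \<rho> * q ^ k"
        proof -
          have "((2::real) ^ k) powr \<rho> * (2 ^ k) powr (- \<sigma>) = (2 powr (\<rho> - \<sigma>)) ^ k"
            by (simp add: powr_add[symmetric] powr_realpow[symmetric] powr_powr algebra_simps)
          moreover have "((2::real) ^ Suc k) powr \<rho> = 2 powr \<rho> * (2 ^ k) powr \<rho>" by (simp add: powr_mult)
          ultimately show ?thesis by (simp add: q_def mult.assoc)
        qed
        finally show "(\<Sum>y\<in>F2. if r y \<le> 2 ^ Suc k then m y * (2 ^ k) powr (- \<sigma>) else 0) \<le> K * 2 powr \<rho> * q ^ k" .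
      qed
      also have "\<dots> = K * 2 powr \<rho> * (\<Sum>k<n. q ^ k)" by (simp add: sum_distrib_left)
      also have "\<dots> \<le> K * 2 powr \<rho> * (1 / (1 - q))"
      proof (intro mult_left_mono)
        show "(\<Sum>k<n. q ^ k) \<le> 1 / (1 - q)"
          using sum_le_suminf[of "\<lambda>k. q ^ k" "{..<n}"] q by (simp add: suminf_geometric summable_geometric)
      qed (use K in auto)
      finally show ?thesis .
    qed
    ultimately show ?thesis by linarith
  qed
  then show "bdd_above (sum (\<lambda>y. m y * r y powr (- \<sigma>)) ` {F. F \<subseteq> X \<and> finite F})"
    by (intro bdd_aboveI2[where M = "C0 + K * 2 powr \<rho> * (1 / (1 - q))"]) auto
qed

text \<open>Since \<open>ln M\<close> is at most a constant times \<open>R powr \<rho>\<close>,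
  counting zeros in discs gives summability for every exponent above \<open>\<rho>\<close>, and the
  partial sums over discs have error \<open>O(R powr (\<rho> - 3))\<close>. Hence the condition
  \<open>\<rho> < 3\<close>, which also makes the sum of inverse cubes absolutely
  convergent.\<close>

lemma
  assumes f: "f holomorphic_on UNIV" and nz: "f a \<noteq> 0"
    and growth: "\<And>w. norm (f w) \<le> C * exp (norm w powr \<rho>)" and \<rho>: "0 < \<rho>" "\<rho> < 3"
  shows zeros_summable: "\<And>\<sigma>. \<sigma> > \<rho> \<Longrightarrow> (\<lambda>y. real_of_int (zorder f y) * norm (a - y) powr (- \<sigma>)) summable_on {y. f y = 0}"
    and log_deriv3_has_sum: "((\<lambda>y. of_int (zorder f y) * (2 / (a - y) ^ 3)) has_sum log_deriv3 f a) {y. f y = 0}"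
proof -
  let ?M = "\<lambda>R. C * exp ((norm a + 3 * R) powr \<rho>)"
  have C: "C > 0"
  proof -
    have "0 < C * exp (norm a powr \<rho>)" using nz growth[of a] by (meson less_le_trans zero_less_norm_iff)
    then show ?thesis by (simp add: zero_less_mult_iff)
  qed
  have M: "norm (f w) \<le> ?M R" if "w \<in> cball a (3 * R)" for w R
  proof -
    have "norm w \<le> norm a + 3 * R"
      using that norm_triangle_ineq2[of w a] by (simp add: dist_norm norm_minus_commute)
    then have "norm w powr \<rho> \<le> (norm a + 3 * R) powr \<rho>"
      using \<rho> by (intro powr_mono2) auto
    then show ?thesis using growth[of w] C by (meson exp_le_cancel_iff mult_left_mono order_trans less_imp_le)
  qed
  define K where "K = \<bar>ln C - ln (norm (f a))\<bar> + 1 + (norm a + 3) powr \<rho>"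
  have lnM: "ln (?M R) - ln (norm (f a)) + 1 \<le> K * R powr \<rho>" if R: "R \<ge> 1" for R
  proof -
    have 1: "R powr \<rho> \<ge> 1" using R \<rho> by (simp add: ge_one_powr_ge_zero)
    have "(norm a + 3 * R) powr \<rho> \<le> ((norm a + 3) * R) powr \<rho>"
      using R \<rho> mult_left_mono[of 1 R "norm a"] by (intro powr_mono2) (auto simp: algebra_simps)
    also have "\<dots> = (norm a + 3) powr \<rho> * R powr \<rho>" using R by (simp add: powr_mult)
    finally have 2: "(norm a + 3 * R) powr \<rho> \<le> (norm a + 3) powr \<rho> * R powr \<rho>" .
    have 3: "ln C - ln (norm (f a)) + 1 \<le> (\<bar>ln C - ln (norm (f a))\<bar> + 1) * R powr \<rho>"
    proof -
      have "(\<bar>ln C - ln (norm (f a))\<bar> + 1) * 1 \<le> (\<bar>ln C - ln (norm (f a))\<bar> + 1) * R powr \<rho>"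
        by (rule mult_left_mono[OF 1]) simp
      moreover have "ln C - ln (norm (f a)) + 1 \<le> (\<bar>ln C - ln (norm (f a))\<bar> + 1) * 1" by simp
      ultimately show ?thesis by (rule order_trans[rotated])
    qed
    have "ln (?M R) = ln C + (norm a + 3 * R) powr \<rho>" using C by (simp add: ln_mult)
    then show ?thesis using 2 3 by (simp add: K_def algebra_simps)
  qed
  have r: "norm (a - y) > 0" if "f y = 0" for y using that nz by auto
  have fin: "finite {y. f y = 0 \<and> norm (a - y) \<le> R}" for R
    using finite_zeros_cball[OF f nz, of a R] by (simp add: dist_norm conj_commute)
  have set_eq: "{y\<in>cball a R. f y = 0} = {y\<in>{y. f y = 0}. norm (a - y) \<le> R}" for R
    by (auto simp: dist_norm)
  show sum: "(\<lambda>y. real_of_int (zorder f y) * norm (a - y) powr (- \<sigma>)) summable_on {y. f y = 0}" if \<sigma>: "\<sigma> > \<rho>" for \<sigma>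
  proof (rule summable_on_powr_count[where K = "K / ln 2"])
    fix R :: real assume R: "R \<ge> 1"
    have "ln 2 * (\<Sum>y\<in>{y\<in>cball a R. f y = 0}. real_of_int (zorder f y)) \<le> K * R powr \<rho>"
    proof -
      have "ln 2 * (\<Sum>y\<in>{y\<in>cball a R. f y = 0}. real_of_int (zorder f y)) \<le> ln (?M R) - ln (norm (f a))"
        by (rule zero_count_bound[OF f nz _ M]) (use R in simp_all)
      then show ?thesis using lnM[OF R] by linarith
    qed
    then show "(\<Sum>y\<in>{y\<in>{y. f y = 0}. norm (a - y) \<le> R}. real_of_int (zorder f y)) \<le> K / ln 2 * R powr \<rho>"
      unfolding set_eq by (simp add: field_simps)
  qed (use \<sigma> \<rho> r fin zorder_entire_pos[OF f nz] in \<open>auto simp: less_imp_le\<close>)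
  let ?t = "\<lambda>y. of_int (zorder f y) * (2 / (a - y) ^ 3)"
  have abs: "(\<lambda>y. norm (?t y)) summable_on {y. f y = 0}"
  proof -
    have "(\<lambda>y. 2 * (real_of_int (zorder f y) * norm (a - y) powr (- 3))) summable_on {y. f y = 0}"
      using sum[OF \<rho>(2)] by (rule summable_on_cmult_right)
    also have "?this \<longleftrightarrow> ?thesis"
      using zorder_entire_pos[OF f nz] r
      by (intro summable_on_cong) (auto simp: norm_mult norm_divide norm_power powr_minus field_simps less_imp_le)
    finally show ?thesis .
  qed
  then have "?t summable_on {y. f y = 0}" by (rule abs_summable_summable)
  then have hs: "(?t has_sum infsum ?t {y. f y = 0}) {y. f y = 0}" by (rule has_sum_infsum)
  let ?Y = "\<lambda>n::nat. {y\<in>cball a (real n). f y = 0}"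
  \<comment> \<open>Growing discs eventually contain every finite set of zeros, so the unordered sum
    is the limit of the sums over discs.\<close>
  have "filterlim ?Y (finite_subsets_at_top {y. f y = 0}) sequentially"
    unfolding filterlim_finite_subsets_at_top
  proof (intro allI impI)
    fix X assume X: "finite X \<and> X \<subseteq> {y. f y = 0}"
    obtain N :: nat where N: "Max (insert 0 ((\<lambda>y. dist a y) ` X)) \<le> N" using real_arch_simple by blast
    have "dist a y \<le> n" if "y \<in> X" "n \<ge> N" for y and n :: nat
    proof -
      have "dist a y \<le> Max (insert 0 ((\<lambda>y. dist a y) ` X))" using X that by simp
      also have "\<dots> \<le> n" using N that by linarith
      finally show ?thesis .
    qed
    then show "\<forall>\<^sub>F n in sequentially. finite (?Y n) \<and> X \<subseteq> ?Y n \<and> ?Y n \<subseteq> {y. f y = 0}"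
      using X finite_zeros_cball[OF f nz] by (auto simp: eventually_sequentially intro!: exI[of _ N])
  qed
  with hs have "(\<lambda>n. sum ?t (?Y n)) \<longlonglongrightarrow> infsum ?t {y. f y = 0}"
    unfolding has_sum_def by (rule filterlim_compose)
  moreover have "(\<lambda>n. sum ?t (?Y n)) \<longlonglongrightarrow> log_deriv3 f a"
  proof (rule LIM_zero_cancel)
    have lim0: "(\<lambda>n. 96 * K * real n powr (\<rho> - 3)) \<longlonglongrightarrow> 0"
      using \<rho> by real_asymp
    show "(\<lambda>n. sum ?t (?Y n) - log_deriv3 f a) \<longlonglongrightarrow> 0"
    proof (rule Lim_null_comparison[OF _ lim0])
      show "\<forall>\<^sub>F n in sequentially. norm (sum ?t (?Y n) - log_deriv3 f a) \<le> 96 * K * real n powr (\<rho> - 3)"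
        using eventually_ge_at_top[of 1]
      proof eventually_elim
        case (elim n)
        have "norm (sum ?t (?Y n) - log_deriv3 f a) \<le> 96 * (ln (?M n) - ln (norm (f a)) + 1) / real n ^ 3"
        proof -
          have "norm (log_deriv3 f a - sum ?t (?Y n)) \<le> 96 * (ln (?M n) - ln (norm (f a)) + 1) / real n ^ 3"
            by (rule log_deriv3_partial_sum[OF f nz _ M]) (use elim in simp_all)
          then show ?thesis by (simp only: norm_minus_commute)
        qed
        also have "\<dots> \<le> 96 * (K * real n powr \<rho>) / real n ^ 3"
          using lnM[of n] elim by (intro divide_right_mono mult_left_mono) auto
        also have "\<dots> = 96 * K * real n powr (\<rho> - 3)"
          using elim by (simp add: powr_diff)
        finally show ?case .
      qed
    qed
  qed
  ultimately have "infsum ?t {y. f y = 0} = log_deriv3 f a" by (rule LIMSEQ_unique)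
  then show "(?t has_sum log_deriv3 f a) {y. f y = 0}" using hs by simp
qed

text \<open>Far zeros are kept away from the ray by the sector; the finitely many others only
  because \<open>z\<close> lies in the superzeta domain, so their constant is a minimum of positive
  numbers.\<close>

lemma zeros_sector_bound:
  assumes f: "f holomorphic_on UNIV" and z: "z \<in> superzeta_domain f" and nz: "f z \<noteq> 0"
    and \<epsilon>: "\<epsilon> > 0" and sector: "\<And>y. f y = 0 \<Longrightarrow> Re y \<ge> R \<Longrightarrow> \<bar>Im y\<bar> \<ge> \<epsilon> * Re y"
  obtains \<delta> where "\<delta> > 0"
    "\<And>y x. f y = 0 \<Longrightarrow> x \<ge> 0 \<Longrightarrow> norm (z - y + complex_of_real x) \<ge> \<delta> * (norm (z - y) + x)"
proof -
  \<comment> \<open>The distance from 0 to the ray \<open>w + [0, inf)\<close>: attained at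
    \<open>x = 0\<close> if \<open>Re w \<ge> 0\<close>, and at \<open>x = - Re w\<close>
    otherwise.\<close>
  define d where "d = (\<lambda>w. if Re w \<ge> 0 then norm w else \<bar>Im w\<bar>)"
  have dw: "norm (w + complex_of_real x) \<ge> d w" if "x \<ge> 0" for w x
  proof (cases "Re w \<ge> 0")
    case True
    have "(Re w)\<^sup>2 \<le> (Re w + x)\<^sup>2" using True that by (intro power_mono) auto
    then show ?thesis using True by (simp add: d_def cmod_def)
  next
    case False
    then show ?thesis using abs_Im_le_cmod[of "w + complex_of_real x"] by (simp add: d_def)
  qed
  \<comment> \<open>Beyond \<open>K\<close>, the terms caused by moving the apex of the sector to
    \<open>z\<close>, and by zeros left of \<open>R\<close>, amount to at most half of
    \<open>norm w\<close>.\<close>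
  define K where "K = 2 * (\<bar>Re z\<bar> + \<bar>R\<bar>) + 2 * (\<epsilon> * norm z + norm z) / \<epsilon>"
  define \<delta>1 where "\<delta>1 = 1 / (2 * (1 + 1 / \<epsilon>))"
  have \<delta>1: "\<delta>1 > 0" "\<delta>1 \<le> 1/2" using \<epsilon> by (auto simp: \<delta>1_def field_simps)
  have far: "d (z - y) \<ge> \<delta>1 * norm (z - y)" if y: "f y = 0" "norm (z - y) > K" for y
  proof -
    define w where "w = z - y"
    have w: "norm w > 2 * (\<bar>Re z\<bar> + \<bar>R\<bar>)" "norm w > 2 * (\<epsilon> * norm z + norm z) / \<epsilon>"
    proof -
      have "2 * (\<epsilon> * norm z + norm z) / \<epsilon> \<ge> 0" using \<epsilon> by simp
      then show "norm w > 2 * (\<bar>Re z\<bar> + \<bar>R\<bar>)" using y(2) by (simp add: w_def K_def)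
      show "norm w > 2 * (\<epsilon> * norm z + norm z) / \<epsilon>" using y(2) by (simp add: w_def K_def)
    qed
    have aux1: "n / 2 \<le> b" if "a \<le> S" "2 * S < n" "n \<le> a + b" for n a b S :: real
      using that by linarith
    have aux2: "n / 2 \<le> (1 + 1 / \<epsilon>) * b" if "a \<le> b / \<epsilon> + X / \<epsilon>" "2 * X / \<epsilon> < n" "n \<le> a + b" for n a b X :: real
    proof -
      have "2 * X / \<epsilon> = 2 * (X / \<epsilon>)" "(1 + 1 / \<epsilon>) * b = b + b / \<epsilon>" by (simp_all add: distrib_right)
      then show ?thesis using that by linarith
    qed
    have tri: "norm w \<le> \<bar>Re w\<bar> + \<bar>Im w\<bar>" by (rule cmod_le)
    show ?thesis
    proof (cases "Re w \<ge> 0")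
      case True
      have "\<delta>1 * norm w \<le> 1 * norm w" using \<delta>1 by (intro mult_right_mono) auto
      then show ?thesis using True by (simp add: d_def flip: w_def)
    next
      case False
      have "\<delta>1 * norm w \<le> \<bar>Im w\<bar>"
      proof (cases "Re y \<ge> R")
        case False
        then have "\<bar>Re w\<bar> \<le> \<bar>Re z\<bar> + \<bar>R\<bar>" using \<open>\<not> Re w \<ge> 0\<close> by (simp add: w_def)
        then have "norm w / 2 \<le> \<bar>Im w\<bar>" using aux1 w(1) tri by blast
        moreover have "\<delta>1 * norm w \<le> 1/2 * norm w" using \<delta>1 by (intro mult_right_mono) auto
        ultimately show ?thesis by simp
      next
        case True
        have "\<epsilon> * (Re z - Re w) \<le> \<bar>Im y\<bar>" using sector[OF y(1) True] by (simp add: w_def)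
        also have "\<bar>Im y\<bar> \<le> \<bar>Im w\<bar> + \<bar>Im z\<bar>" by (simp add: w_def)
        finally have "\<epsilon> * \<bar>Re w\<bar> \<le> \<bar>Im w\<bar> + \<bar>Im z\<bar> - \<epsilon> * Re z"
          using False by (simp add: algebra_simps)
        also have "- (\<epsilon> * Re z) \<le> \<epsilon> * norm z"
          using mult_left_mono[of "- Re z" "norm z" \<epsilon>] \<epsilon> abs_Re_le_cmod[of z] by auto
        then have "\<bar>Im w\<bar> + \<bar>Im z\<bar> - \<epsilon> * Re z \<le> \<bar>Im w\<bar> + (\<epsilon> * norm z + norm z)"
          using abs_Im_le_cmod[of z] by linarith
        finally have "\<bar>Re w\<bar> \<le> \<bar>Im w\<bar> / \<epsilon> + (\<epsilon> * norm z + norm z) / \<epsilon>"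
          using \<epsilon> by (simp add: field_simps)
        then have "norm w / 2 \<le> (1 + 1 / \<epsilon>) * \<bar>Im w\<bar>"
          using aux2 w(2) tri by blast
        then show ?thesis using \<epsilon> by (simp add: \<delta>1_def field_simps add_pos_pos)
      qed
      then show ?thesis using False by (simp add: d_def flip: w_def)
    qed
  qed
  have dpos: "d (z - y) > 0" "norm (z - y) > 0" if "f y = 0" for y
  proof -
    have n: "z - y \<notin> \<real>\<^sub>\<le>\<^sub>0" using z that by (auto simp: superzeta_domain_def)
    show "norm (z - y) > 0" using that nz by auto
    then show "d (z - y) > 0"
      using n by (auto simp: d_def complex_nonpos_Reals_iff)
  qed
  define Y where "Y = {y\<in>cball z K. f y = 0}"
  have finY: "finite Y" unfolding Y_def by (rule finite_zeros_cball[OF f nz])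
  define \<delta>2 where "\<delta>2 = Min (insert \<delta>1 ((\<lambda>y. d (z - y) / norm (z - y)) ` Y))"
  have \<delta>2: "\<delta>2 > 0" unfolding \<delta>2_def
    using finY dpos \<delta>1 by (subst Min_gr_iff) (auto simp: Y_def)
  have \<delta>21: "\<delta>2 \<le> 1/2" 
  proof -
    have "\<delta>2 \<le> \<delta>1" unfolding \<delta>2_def using finY by (intro Min_le) auto
    then show ?thesis using \<delta>1 by simp
  qed
  have all: "d (z - y) \<ge> \<delta>2 * norm (z - y)" if "f y = 0" for y
  proof (cases "y \<in> Y")
    case True
    then have "\<delta>2 \<le> d (z - y) / norm (z - y)" unfolding \<delta>2_def using finY by (intro Min_le) auto
    then show ?thesis using dpos[OF that] by (simp add: field_simps)
  next
    case False
    then have "norm (z - y) > K" using that by (auto simp: Y_def dist_norm)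
    then have "d (z - y) \<ge> \<delta>1 * norm (z - y)" by (rule far[OF that])
    moreover have "\<delta>2 * norm (z - y) \<le> \<delta>1 * norm (z - y)"
      unfolding \<delta>2_def using finY by (intro mult_right_mono Min_le) auto
    ultimately show ?thesis by linarith
  qed
  show thesis
  proof
    \<comment> \<open>\<open>\<delta>2 * norm (z - y)\<close> is at most the norm to be bounded and
      \<open>\<delta>2 * x\<close> at most twice that norm, so together they cost a factor
      3.\<close>
    show "\<delta>2 / 3 > 0" using \<delta>2 by simp
    fix y and x :: real assume y: "f y = 0" and x: "x \<ge> 0"
    let ?n = "norm (z - y + complex_of_real x)"
    have 1: "\<delta>2 * norm (z - y) \<le> ?n" using all[OF y] dw[OF x, of "z - y"] by linarith
    have "x = norm ((z - y + complex_of_real x) - (z - y))" using x by simp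
    also have "\<dots> \<le> ?n + norm (z - y)" by (rule norm_triangle_ineq4)
    finally have "\<delta>2 * x \<le> \<delta>2 * ?n + \<delta>2 * norm (z - y)" using \<delta>2 by (simp flip: distrib_left)
    also have "\<delta>2 * ?n \<le> 1 * ?n" using \<delta>21 by (intro mult_right_mono) auto
    finally have "\<delta>2 * x \<le> 2 * ?n" using 1 by simp
    then show "\<delta>2 / 3 * (norm (z - y) + x) \<le> ?n" using 1 by (simp add: algebra_simps)
  qed
qed

lemma integrable_mellin_kernel:
  fixes s :: complex
  assumes w: "w \<notin> \<real>\<^sub>\<le>\<^sub>0" and s: "0 < Re s" "Re s < 3"
  shows "integrable lpos (\<lambda>x. of_real x powr (2 - s) / (w + of_real x) ^ 3)"
proof -
  obtain r where r: "r > 0" "cball w r \<subseteq> - \<real>\<^sub>\<le>\<^sub>0"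
    using w open_contains_cball[of "- \<real>\<^sub>\<le>\<^sub>0 :: complex set"] by auto
  obtain c where c: "c > 0" "\<And>v x. v \<in> cball w r \<Longrightarrow> x > 0 \<Longrightarrow> norm (v + complex_of_real x) \<ge> c * max 1 x"
    using mellin_kernel_bound[of w r] r by (metis disjoint_eq_subset_Compl)
  show ?thesis
  proof (rule integrable_lpos_powr[where C = "1 / c ^ 3" and a = "2 - Re s" and b = "-1 - Re s"])
    show "(\<lambda>x. of_real x powr (2 - s) / (w + of_real x) ^ 3) \<in> borel_measurable lpos"
      using w add_pos_neq_0[of w] by (intro borel_measurable_lpos continuous_intros) auto
    show "norm (of_real x powr (2 - s) / (w + of_real x) ^ 3) \<le> 1 / c ^ 3 * powr_bound (2 - Re s) (-1 - Re s) x"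
      if x: "x > 0" for x
      using mellin_kernel_norm[OF c(1) x c(2)[of w]] r x by simp
  qed (use s in auto)
qed

lemma mellin_kernel_real:
  fixes \<sigma> :: real
  assumes w: "w > 0" and \<sigma>: "0 < \<sigma>" "\<sigma> < 3"
  shows "integrable lpos (\<lambda>x. x powr (2 - \<sigma>) / (w + x) ^ 3)"
    and "(\<integral>x. x powr (2 - \<sigma>) / (w + x) ^ 3 \<partial>lpos) = Gamma (3 - \<sigma>) * Gamma \<sigma> / 2 * w powr (- \<sigma>)"
proof -
  have eq: "complex_of_real x powr (2 - of_real \<sigma>) / (of_real w + of_real x) ^ 3 = of_real (x powr (2 - \<sigma>) / (w + x) ^ 3)"
    if "x \<in> space lpos" for x
    using that powr_of_real[of x "2 - \<sigma>"] by simp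
  have "integrable lpos (\<lambda>x. complex_of_real x powr (2 - of_real \<sigma>) / (of_real w + of_real x) ^ 3)"
    by (rule integrable_mellin_kernel) (use w \<sigma> in auto)
  also have "?this \<longleftrightarrow> integrable lpos (\<lambda>x. complex_of_real (x powr (2 - \<sigma>) / (w + x) ^ 3))"
    by (rule Bochner_Integration.integrable_cong[OF refl]) (simp only: eq)
  finally show "integrable lpos (\<lambda>x. x powr (2 - \<sigma>) / (w + x) ^ 3)"
    by (simp only: complex_of_real_integrable_eq)
  have "complex_of_real (\<integral>x. x powr (2 - \<sigma>) / (w + x) ^ 3 \<partial>lpos) =
      (\<integral>x. complex_of_real x powr (2 - of_real \<sigma>) / (of_real w + of_real x) ^ 3 \<partial>lpos)"
    unfolding integral_complex_of_real[symmetric]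
    by (rule Bochner_Integration.integral_cong[OF refl]) (simp only: eq)
  also have "\<dots> = Gamma (3 - of_real \<sigma>) * Gamma (of_real \<sigma>) / 2 * of_real w powr (- of_real \<sigma>)"
    by (rule mellin_kernel) (use w \<sigma> in auto)
  also have "\<dots> = complex_of_real (Gamma (3 - \<sigma>) * Gamma \<sigma> / 2 * w powr (- \<sigma>))"
    using w powr_of_real[of w "- \<sigma>"] Gamma_complex_of_real[of "3 - \<sigma>"] by (simp add: Gamma_complex_of_real)
  finally show "(\<integral>x. x powr (2 - \<sigma>) / (w + x) ^ 3 \<partial>lpos) = Gamma (3 - \<sigma>) * Gamma \<sigma> / 2 * w powr (- \<sigma>)"
    by (simp only: of_real_eq_iff)
qed

lemma norm_powr_le:
  fixes w s :: complex
  shows "norm (w powr s) \<le> norm w powr Re s * exp (pi * \<bar>Im s\<bar>)"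
proof (cases "w = 0")
  case False
  have "- (Im s * Im (Ln w)) \<le> pi * \<bar>Im s\<bar>"
  proof -
    have "\<bar>Im s * Im (Ln w)\<bar> \<le> \<bar>Im s\<bar> * pi"
      unfolding abs_mult using False Im_Ln_le_pi[of w] mpi_less_Im_Ln[of w] by (intro mult_left_mono) auto
    then show ?thesis by (simp add: mult.commute)
  qed
  then show ?thesis using False
    by (simp add: powr_def exp_add[symmetric] algebra_simps)
qed simp

lemma norm_superzeta_term_le:
  "norm (superzeta_term f s z y) \<le> \<bar>real_of_int (zorder f y)\<bar> * norm (z - y) powr (- Re s) * exp (pi * \<bar>Im s\<bar>)"
  using norm_powr_le[of "z - y" "- s"] unfolding superzeta_term_def norm_mult
  by (simp add: mult_left_mono mult.assoc)

section \<open>The superzeta function as a Mellin transform\<close>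

text \<open>The order is an infimum and need not be attained, so the bound is taken at some exponent
  below \<open>\<rho>\<close> and raised to \<open>\<rho>\<close> at the price of a factor
  \<open>exp 1\<close>, which covers small \<open>w\<close>.\<close>

lemma growth_order_bound:
  assumes "growth_order f = 2" and "\<rho> > 2"
  shows "\<exists>C. \<forall>w. norm (f w) \<le> C * exp (norm w powr \<rho>)"
proof -
  have "growth_order f < ereal \<rho>" using assms by simp
  then obtain \<rho>' C where r: "\<rho>' \<ge> 0" "\<rho>' < \<rho>" and "\<forall>w. norm (f w) \<le> C * exp (norm w powr \<rho>')"
    unfolding growth_order_def Inf_less_iff by auto
  then have C: "norm (f w) \<le> C * exp (norm w powr \<rho>')" for w by blast
  have C0: "C \<ge> 0" using C[of 0] norm_ge_zero[of "f 0"] by (smt (verit) exp_gt_zero zero_le_mult_iff)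
  have "norm (f w) \<le> (C * exp 1) * exp (norm w powr \<rho>)" for w
  proof -
    have "norm w powr \<rho>' \<le> 1 + norm w powr \<rho>"
    proof (cases "norm w \<ge> 1")
      case True
      then have "norm w powr \<rho>' \<le> norm w powr \<rho>" using r by (intro powr_mono) auto
      then show ?thesis by simp
    next
      case False
      then have "norm w powr \<rho>' \<le> 1" using r by (intro powr_le1) auto
      then show ?thesis by (simp add: add_increasing2)
    qed
    then have "C * exp (norm w powr \<rho>') \<le> C * exp (1 + norm w powr \<rho>)"
      using C0 by (intro mult_left_mono) auto
    then show ?thesis using C[of w] by (simp add: exp_add mult.assoc)
  qed
  then show ?thesis by blast
qed

text \<open>Growth is required only for exponents above 2, all that order two guarantees. The point
  \<open>z\<close> is fixed because everything is read off the ray from \<open>z\<close> to the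
  right, which meets no zero.\<close>

locale order_two =
  fixes f :: "complex \<Rightarrow> complex" and z :: complex
  assumes hol: "f holomorphic_on UNIV"
    and growth: "\<And>\<rho>. \<rho> > 2 \<Longrightarrow> \<exists>C. \<forall>w. norm (f w) \<le> C * exp (norm w powr \<rho>)"
    and dom: "z \<in> superzeta_domain f"
begin

lemma nonzero: "f (z + of_real x) \<noteq> 0" if "x \<ge> 0"
proof
  assume "f (z + of_real x) = 0"
  then have "z - (z + of_real x) \<notin> \<real>\<^sub>\<le>\<^sub>0" using dom unfolding superzeta_domain_def by blast
  then show False using that by simp
qed

lemma nz: "f z \<noteq> 0" using nonzero[of 0] by simp

lemma zorder_pos: "f y = 0 \<Longrightarrow> zorder f y > 0"
  by (rule zorder_entire_pos[OF hol nz])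

lemma slit: "f y = 0 \<Longrightarrow> z - y \<notin> \<real>\<^sub>\<le>\<^sub>0"
  using dom by (auto simp: superzeta_domain_def)

text \<open>Makes counting measure on the zeros sigma-finite, as Fubini's theorem demands.\<close>

lemma countable_zeros: "countable {y. f y = 0}"
proof -
  have "{y. f y = 0} = (\<Union>n::nat. {y\<in>cball z n. f y = 0})"
    by (auto intro: real_arch_simple)
  also have "countable \<dots>"
    by (intro countable_UN[OF countableI_type] countable_finite finite_zeros_cball[OF hol nz])
  finally show ?thesis .
qed

lemma zeros_sum: "\<sigma> > 2 \<Longrightarrow> (\<lambda>y. real_of_int (zorder f y) * norm (z - y) powr (- \<sigma>)) summable_on {y. f y = 0}"
proof -
  assume \<sigma>: "\<sigma> > 2"
  define \<rho> where "\<rho> = (2 + min \<sigma> 3) / 2"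
  have \<rho>: "\<rho> > 2" "\<rho> < 3" "\<rho> < \<sigma>" using \<sigma> by (auto simp: \<rho>_def)
  obtain C where "\<And>w. norm (f w) \<le> C * exp (norm w powr \<rho>)" using growth[OF \<rho>(1)] by blast
  then show ?thesis using zeros_summable[OF hol nz, of C \<rho> \<sigma>] \<rho> by simp
qed

lemma log_deriv3_sum:
  assumes "x \<ge> 0"
  shows "((\<lambda>y. of_int (zorder f y) * (2 / (z - y + of_real x) ^ 3)) has_sum log_deriv3 f (z + of_real x)) {y. f y = 0}"
proof -
  \<comment> \<open>Any exponent strictly between 2 and 3 serves.\<close>
  obtain C where "\<And>w. norm (f w) \<le> C * exp (norm w powr (5/2))" using growth[of "5/2"] by auto
  from log_deriv3_has_sum[OF hol nonzero[OF assms] this]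
  show ?thesis by (simp add: algebra_simps)
qed

lemma superzeta_abs_summable:
  assumes "Re s > 2"
  shows "(\<lambda>y. norm (superzeta_term f s z y)) summable_on {y. f y = 0}"
proof (rule summable_on_comparison_test)
  show "(\<lambda>y. exp (pi * \<bar>Im s\<bar>) * (real_of_int (zorder f y) * norm (z - y) powr (- Re s))) summable_on {y. f y = 0}"
    by (intro summable_on_cmult_right zeros_sum assms)
  show "norm (superzeta_term f s z y) \<le> exp (pi * \<bar>Im s\<bar>) * (real_of_int (zorder f y) * norm (z - y) powr (- Re s))"
    if "y \<in> {y. f y = 0}" for y
    using norm_superzeta_term_le[of f s z y] zorder_pos[of y] that by (simp add: mult_ac)
qed simp

text \<open>As an integral over counting measure, the series falls under the lemmas on parameter
  integrals and on iterated integrals.\<close>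

lemma superzeta_lebesgue:
  assumes "Re s > 2"
  shows "superzeta f s z = (\<integral>y. superzeta_term f s z y \<partial>count_space {y. f y = 0})"
  using superzeta_abs_summable[OF assms] unfolding superzeta_def
  by (simp add: infsetsum_infsum[symmetric] abs_summable_equivalent infsetsum_def)

lemma superzeta_holomorphic: "(\<lambda>s. superzeta f s z) holomorphic_on {s. Re s > 2}"
proof -
  have "(\<lambda>s. \<integral>y. superzeta_term f s z y \<partial>count_space {y. f y = 0}) holomorphic_on {s. Re s > 2}"
  proof (rule holomorphic_on_integral)
    show "open {s. Re s > 2}" by (rule open_halfspace_Re_gt)
    show "(\<lambda>s. superzeta_term f s z y) holomorphic_on {s. Re s > 2}"
      if "y \<in> space (count_space {y. f y = 0})" for y
      unfolding superzeta_term_def using slit[of y] that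
      by (intro holomorphic_intros) auto
    fix s :: complex assume s: "s \<in> {s. Re s > 2}"
    define r where "r = (Re s - 2) / 2"
    have r: "r > 0" "Re s - r > 2" using s by (auto simp: r_def field_simps)
    \<comment> \<open>Over the disc the real part of the exponent varies by \<open>r\<close>: the
      first power dominates for distances at least 1, the second for distances below 1. The
      exponential pays for the argument of \<open>z - y\<close>.\<close>
    let ?B = "\<lambda>y. exp (pi * (\<bar>Im s\<bar> + r)) * (real_of_int (zorder f y) * norm (z - y) powr (- (Re s - r)) +
                   real_of_int (zorder f y) * norm (z - y) powr (- (Re s + r)))"
    have sub: "cball s r \<subseteq> {s. Re s > 2}"
    proof
      fix v assume "v \<in> cball s r"
      then have "\<bar>Re (s - v)\<bar> \<le> r" using abs_Re_le_cmod[of "s - v"] by (simp add: dist_norm)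
      then show "v \<in> {s. Re s > 2}" using r by simp
    qed
    have "(\<lambda>y. ?B y) summable_on {y. f y = 0}"
      by (intro summable_on_cmult_right summable_on_add zeros_sum) (use r in auto)
    moreover have "norm (?B y) = ?B y" if "f y = 0" for y
      using zorder_pos[OF that] by simp
    ultimately have "(\<lambda>y. norm (?B y)) summable_on {y. f y = 0}"
      by (subst summable_on_cong) auto
    then have int: "integrable (count_space {y. f y = 0}) ?B"
      by (simp only: abs_summable_equivalent abs_summable_on_def)
    have "norm (superzeta_term f v z y) \<le> ?B y" if v: "v \<in> cball s r" and y: "f y = 0" for v y
    proof -
      have R: "\<bar>Re (s - v)\<bar> \<le> r" "\<bar>Im (s - v)\<bar> \<le> r"
        using v abs_Re_le_cmod[of "s - v"] abs_Im_le_cmod[of "s - v"] by (auto simp: dist_norm)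
      have o: "real_of_int (zorder f y) \<ge> 0" using zorder_pos[OF y] by simp
      have "norm (z - y) powr (- Re v) \<le> norm (z - y) powr (- (Re s - r)) + norm (z - y) powr (- (Re s + r))"
      proof (cases "norm (z - y) \<ge> 1")
        case True
        then have "norm (z - y) powr (- Re v) \<le> norm (z - y) powr (- (Re s - r))"
          using R by (intro powr_mono) auto
        then show ?thesis by (simp add: add_increasing2)
      next
        case False
        then have "norm (z - y) powr (- Re v) \<le> norm (z - y) powr (- (Re s + r))"
          using R by (intro powr_mono') auto
        then show ?thesis by (simp add: add_increasing)
      qed
      then have "real_of_int (zorder f y) * norm (z - y) powr (- Re v) \<le> real_of_int (zorder f y) * norm (z - y) powr (- (Re s - r)) +
                   real_of_int (zorder f y) * norm (z - y) powr (- (Re s + r))"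
        using mult_left_mono[OF _ o] by (simp flip: distrib_left)
      moreover have "exp (pi * \<bar>Im v\<bar>) \<le> exp (pi * (\<bar>Im s\<bar> + r))"
      proof -
        have "\<bar>Im v\<bar> \<le> \<bar>Im s\<bar> + r" using R(2) by simp
        then show ?thesis by simp
      qed
      ultimately have "(real_of_int (zorder f y) * norm (z - y) powr (- Re v)) * exp (pi * \<bar>Im v\<bar>) \<le> (real_of_int (zorder f y) * norm (z - y) powr (- (Re s - r)) +
                   real_of_int (zorder f y) * norm (z - y) powr (- (Re s + r))) * exp (pi * (\<bar>Im s\<bar> + r))"
        using o by (intro mult_mono) auto
      then show ?thesis
        using norm_superzeta_term_le[of f v z y] o by (simp only: abs_of_nonneg mult.commute)
    qed
    then show "\<exists>r>0. \<exists>B. cball s r \<subseteq> {s. Re s > 2} \<and> integrable (count_space {y. f y = 0}) B \<and>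
        (\<forall>v\<in>cball s r. \<forall>y\<in>space (count_space {y. f y = 0}). norm (superzeta_term f v z y) \<le> B y)"
      using r(1) sub int by (intro exI[of _ r] conjI exI[of _ ?B]) auto
  qed simp
  then show ?thesis by (rule holomorphic_transform) (simp add: superzeta_lebesgue)
qed

text \<open>Integrate the sum for \<open>log_deriv3\<close> against \<open>x powr (2 - s)\<close>
  term by term. The sum over zeros converges for \<open>Re s > 2\<close>, the kernel is integrable
  at 0 for \<open>Re s < 3\<close>; this is the strip. The reflection formula rewrites
  \<open>Gamma (3 - s) * Gamma s\<close> as
  \<open>(1 - s) * (2 - s) * pi / sin (pi * s)\<close>.\<close>

lemma superzeta_mellin:
  fixes s :: complex
  assumes s: "2 < Re s" "Re s < 3"
    and \<epsilon>: "\<epsilon> > 0" and sector: "\<And>y. f y = 0 \<Longrightarrow> Re y \<ge> R \<Longrightarrow> \<bar>Im y\<bar> \<ge> \<epsilon> * Re y"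
  shows "(1 - s) * (2 - s) * superzeta f s z =
     sin (pi * s) / pi * (\<integral>x. of_real x powr (2 - s) * log_deriv3 f (z + of_real x) \<partial>lpos)"
proof -
  let ?X = "{y. f y = 0}"
  let ?\<sigma> = "Re s"
  obtain \<delta> where \<delta>: "\<delta> > 0"
    "\<And>y x. f y = 0 \<Longrightarrow> x \<ge> 0 \<Longrightarrow> norm (z - y + complex_of_real x) \<ge> \<delta> * (norm (z - y) + x)"
    using zeros_sector_bound[OF hol dom nz \<epsilon> sector] by blast
  interpret P: pair_sigma_finite "count_space ?X" lpos
    by (simp add: pair_sigma_finite_def sigma_finite_lpos sigma_finite_measure_count_space_countable countable_zeros)
  define F where "F = (\<lambda>y x. (2 * of_int (zorder f y)) * (of_real x powr (2 - s) / (z - y + of_real x) ^ 3))"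
  have int_x: "integrable lpos (F y)" if "f y = 0" for y
    unfolding F_def using slit[OF that] s by (intro integrable_mult_right integrable_mellin_kernel) auto
  have pos: "norm (z - y) > 0" if "f y = 0" for y using that nz by auto
  \<comment> \<open>The sector bound compares the integrand with the real kernel at
    \<open>norm (z - y)\<close>, whose Mellin integral is known exactly.\<close>
  have norm_F: "(\<integral>x. norm (F y x) \<partial>lpos) \<le> Gamma (3 - ?\<sigma>) * Gamma ?\<sigma> / \<delta> ^ 3 * (real_of_int (zorder f y) * norm (z - y) powr (- ?\<sigma>))"
    if y: "f y = 0" for y
  proof -
    have o: "real_of_int (zorder f y) > 0" using zorder_pos[OF y] by simp
    have "(\<integral>x. norm (F y x) \<partial>lpos) \<le> (\<integral>x. (2 * real_of_int (zorder f y) / \<delta> ^ 3) * (x powr (2 - ?\<sigma>) / (norm (z - y) + x) ^ 3) \<partial>lpos)"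
    proof (rule integral_mono)
      show "integrable lpos (\<lambda>x. norm (F y x))" using int_x[OF y] by (rule integrable_norm)
      show "integrable lpos (\<lambda>x. (2 * real_of_int (zorder f y) / \<delta> ^ 3) * (x powr (2 - ?\<sigma>) / (norm (z - y) + x) ^ 3))"
        using s by (intro integrable_mult_right mellin_kernel_real pos[OF y]) auto
      fix x assume "x \<in> space lpos"
      then have x: "x > 0" by simp
      have p: "0 < \<delta> * (norm (z - y) + x)" using \<delta>(1) x by (simp add: add_nonneg_pos)
      have "norm (F y x) = 2 * real_of_int (zorder f y) * (x powr (2 - ?\<sigma>) / norm (z - y + of_real x) ^ 3)"
        using x o by (simp add: F_def norm_mult norm_divide norm_power norm_of_real_powr)
      also have "\<dots> \<le> 2 * real_of_int (zorder f y) * (x powr (2 - ?\<sigma>) / (\<delta> * (norm (z - y) + x)) ^ 3)"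
      proof (intro mult_left_mono divide_left_mono power_mono \<delta>(2)[OF y])
        show "0 < norm (z - y + complex_of_real x) ^ 3 * (\<delta> * (norm (z - y) + x)) ^ 3"
          using less_le_trans[OF p \<delta>(2)[OF y, of x]] p x by (intro mult_pos_pos[of "_ ^ 3" "_ ^ 3"] zero_less_power) simp_all
      qed (use o p x in auto)
      also have "\<dots> = (2 * real_of_int (zorder f y) / \<delta> ^ 3) * (x powr (2 - ?\<sigma>) / (norm (z - y) + x) ^ 3)"
        by (simp add: power_mult_distrib)
      finally show "norm (F y x) \<le> (2 * real_of_int (zorder f y) / \<delta> ^ 3) * (x powr (2 - ?\<sigma>) / (norm (z - y) + x) ^ 3)" .
    qed
    also have "\<dots> = (2 * real_of_int (zorder f y) / \<delta> ^ 3) * (Gamma (3 - ?\<sigma>) * Gamma ?\<sigma> / 2 * norm (z - y) powr (- ?\<sigma>))"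
    proof -
      have "(\<integral>x. x powr (2 - ?\<sigma>) / (norm (z - y) + x) ^ 3 \<partial>lpos) = Gamma (3 - ?\<sigma>) * Gamma ?\<sigma> / 2 * norm (z - y) powr (- ?\<sigma>)"
        by (rule mellin_kernel_real(2)[OF pos[OF y]]) (use s in auto)
      then show ?thesis by (simp only: integral_mult_right_zero)
    qed
    finally show ?thesis by (simp add: mult_ac)
  qed
  have FI: "integrable (count_space ?X \<Otimes>\<^sub>M lpos) (case_prod F)"
  proof (rule P.Fubini_integrable)
    show "case_prod F \<in> borel_measurable (count_space ?X \<Otimes>\<^sub>M lpos)"
      by (rule measurable_pair_measure_countable1[OF countable_zeros])
         (use int_x in auto)
    show "AE y in count_space ?X. integrable lpos (\<lambda>x. case_prod F (y, x))"
      using int_x by (auto simp: AE_count_space)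
    have "(\<lambda>y. norm (\<integral>x. norm (F y x) \<partial>lpos)) summable_on ?X"
    proof (rule summable_on_comparison_test)
      show "(\<lambda>y. Gamma (3 - ?\<sigma>) * Gamma ?\<sigma> / \<delta> ^ 3 * (real_of_int (zorder f y) * norm (z - y) powr (- ?\<sigma>))) summable_on ?X"
        by (intro summable_on_cmult_right zeros_sum s)
      show "norm (\<integral>x. norm (F y x) \<partial>lpos) \<le> Gamma (3 - ?\<sigma>) * Gamma ?\<sigma> / \<delta> ^ 3 * (real_of_int (zorder f y) * norm (z - y) powr (- ?\<sigma>))"
        if "y \<in> ?X" for y using norm_F[of y] that by simp
    qed simp
    then show "integrable (count_space ?X) (\<lambda>y. \<integral>x. norm (case_prod F (y, x)) \<partial>lpos)"
      by (simp only: abs_summable_equivalent abs_summable_on_def case_prod_conv)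
  qed
  have "(\<integral>x. (\<integral>y. F y x \<partial>count_space ?X) \<partial>lpos) = (\<integral>y. (\<integral>x. F y x \<partial>lpos) \<partial>count_space ?X)"
    by (rule P.Fubini_integral[OF FI])
  also have "\<dots> = (\<integral>y. Gamma (3 - s) * Gamma s * superzeta_term f s z y \<partial>count_space ?X)"
  proof (rule Bochner_Integration.integral_cong[OF refl])
    fix y assume "y \<in> space (count_space ?X)"
    then have y: "f y = 0" by simp
    have "(\<integral>x. F y x \<partial>lpos) = 2 * of_int (zorder f y) * (Gamma (3 - s) * Gamma s / 2 * (z - y) powr (- s))"
    proof -
      have "(\<integral>x. of_real x powr (2 - s) / (z - y + of_real x) ^ 3 \<partial>lpos) = Gamma (3 - s) * Gamma s / 2 * (z - y) powr (- s)"
        by (rule mellin_kernel[OF slit[OF y]]) (use s in auto)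
      then show ?thesis by (simp only: F_def integral_mult_right_zero)
    qed
    then show "(\<integral>x. F y x \<partial>lpos) = Gamma (3 - s) * Gamma s * superzeta_term f s z y"
      by (simp add: superzeta_term_def mult_ac)
  qed
  also have "\<dots> = Gamma (3 - s) * Gamma s * superzeta f s z"
    using s by (simp add: superzeta_lebesgue)
  also have "(\<integral>x. (\<integral>y. F y x \<partial>count_space ?X) \<partial>lpos) = (\<integral>x. of_real x powr (2 - s) * log_deriv3 f (z + of_real x) \<partial>lpos)"
  proof (rule Bochner_Integration.integral_cong[OF refl])
    fix x assume "x \<in> space lpos"
    then have x: "x > 0" by simp
    let ?t = "\<lambda>y. of_int (zorder f y) * (2 / (z - y + of_real x) ^ 3)"
    have hs: "(?t has_sum log_deriv3 f (z + of_real x)) ?X" using log_deriv3_sum[of x] x by simp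
    have abs: "(\<lambda>y. norm (?t y)) summable_on ?X"
    proof (rule summable_on_comparison_test)
      show "(\<lambda>y. 2 / \<delta> ^ 3 * (real_of_int (zorder f y) * norm (z - y) powr (- 3))) summable_on ?X"
        by (intro summable_on_cmult_right zeros_sum) auto
      fix y assume "y \<in> ?X"
      then have y: "f y = 0" by simp
      have p: "0 < \<delta> * norm (z - y)" using \<delta>(1) pos[OF y] by simp
      have "\<delta> * norm (z - y) \<le> \<delta> * (norm (z - y) + x)" using \<delta>(1) x by simp
      also have "\<dots> \<le> norm (z - y + of_real x)" using \<delta>(2)[OF y] x by simp
      finally have le: "\<delta> * norm (z - y) \<le> norm (z - y + of_real x)" .
      have "norm (?t y) = real_of_int (zorder f y) * (2 / norm (z - y + of_real x) ^ 3)"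
        using zorder_pos[OF y] by (simp add: norm_mult norm_divide norm_power)
      also have "\<dots> \<le> real_of_int (zorder f y) * (2 / (\<delta> * norm (z - y)) ^ 3)"
        using le p zorder_pos[OF y]
        by (intro mult_left_mono divide_left_mono power_mono mult_pos_pos[of "_ ^ 3" "_ ^ 3"] zero_less_power) auto
      also have "\<dots> = 2 / \<delta> ^ 3 * (real_of_int (zorder f y) * norm (z - y) powr (- 3))"
        using pos[OF y] by (simp add: powr_minus power_mult_distrib divide_inverse)
      finally show "norm (?t y) \<le> 2 / \<delta> ^ 3 * (real_of_int (zorder f y) * norm (z - y) powr (- 3))" .
    qed simp
    have "(\<integral>y. F y x \<partial>count_space ?X) = (\<integral>y. of_real x powr (2 - s) * ?t y \<partial>count_space ?X)"
      by (rule Bochner_Integration.integral_cong) (auto simp: F_def)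
    also have "\<dots> = of_real x powr (2 - s) * (\<integral>y. ?t y \<partial>count_space ?X)" by (rule integral_mult_right_zero)
    also have "(\<integral>y. ?t y \<partial>count_space ?X) = infsum ?t ?X"
      using abs by (simp only: infsetsum_infsum[symmetric] abs_summable_equivalent infsetsum_def)
    also have "\<dots> = log_deriv3 f (z + of_real x)" using hs by (rule infsumI)
    finally show "(\<integral>y. F y x \<partial>count_space ?X) = of_real x powr (2 - s) * log_deriv3 f (z + of_real x)" .
  qed
  finally have eq: "(\<integral>x. of_real x powr (2 - s) * log_deriv3 f (z + of_real x) \<partial>lpos) = Gamma (3 - s) * Gamma s * superzeta f s z" .
  \<comment> \<open>The open strip contains no integers, so neither the Gamma factors nor the sine
    degenerate.\<close>
  have nint: "s \<notin> \<int>"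
  proof
    assume "s \<in> \<int>"
    then obtain n where "s = of_int n" by (elim Ints_cases)
    then have "2 < n" "n < 3" using s by simp_all
    then show False by simp
  qed
  have n1: "1 - s \<notin> \<int>\<^sub>\<le>\<^sub>0" "2 - s \<notin> \<int>\<^sub>\<le>\<^sub>0"
    using nint nonpos_Ints_Int[of "1 - s"] nonpos_Ints_Int[of "2 - s"]
      Ints_diff[of 1 "1 - s"] Ints_diff[of 2 "2 - s"] by auto
  have "Gamma (3 - s) = (2 - s) * Gamma (2 - s)"
    using Gamma_plus1[OF n1(2)] by (simp add: algebra_simps)
  also have "Gamma (2 - s) = (1 - s) * Gamma (1 - s)"
    using Gamma_plus1[OF n1(1)] by (simp add: algebra_simps)
  finally have "Gamma (3 - s) * Gamma s = (1 - s) * (2 - s) * (Gamma s * Gamma (1 - s))"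
    by (simp only: mult_ac)
  then have G: "Gamma (3 - s) * Gamma s = (1 - s) * (2 - s) * (of_real pi / sin (of_real pi * s))"
    by (simp only: Gamma_reflection_complex)
  have "sin (of_real pi * s) \<noteq> 0"
    using nint by (auto simp: sin_eq_0)
  then show ?thesis unfolding eq G by (simp add: field_simps)
qed

end

section \<open>Asymptotic expansions in horizontal strips\<close>

text \<open>All Landau symbols below refer to this filter. The width \<open>B\<close> stays a
  parameter, as Cauchy's inequality and affine substitutions lead from one strip to another.\<close>

definition strip :: "real \<Rightarrow> complex filter" where
  "strip B = inf (filtercomap Re at_top) (principal {s. \<bar>Im s\<bar> \<le> B})"

lemma eventually_strip:
  "eventually P (strip B) \<longleftrightarrow> (\<exists>R. \<forall>s. Re s \<ge> R \<longrightarrow> \<bar>Im s\<bar> \<le> B \<longrightarrow> P s)"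
  unfolding strip_def eventually_inf_principal eventually_filtercomap_at_top_linorder by auto

lemma eventually_strip_Re_ge: "eventually (\<lambda>s. Re s \<ge> c) (strip B)"
  unfolding eventually_strip by auto

lemma eventually_strip_Im_le: "eventually (\<lambda>s. \<bar>Im s\<bar> \<le> B) (strip B)"
  unfolding eventually_strip by auto

lemma eventually_strip_norm_le: "eventually (\<lambda>s. norm s \<le> 2 * Re s \<and> Re s \<ge> 1) (strip B)"
  using eventually_strip_Re_ge[of "max 1 B"] eventually_strip_Im_le
proof eventually_elim
  case (elim s)
  then show ?case using cmod_le[of s] by auto
qed

lemma eventually_strip_ne_0: "eventually (\<lambda>s. s \<noteq> 0) (strip B)"
  using eventually_strip_norm_le by eventually_elim auto

lemma filterlim_strip_affine:
  assumes "\<alpha> > 0"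
  shows "filterlim (\<lambda>s. complex_of_real \<alpha> * s + \<beta>) (strip (\<alpha> * B + \<bar>Im \<beta>\<bar>)) (strip B)"
  unfolding filterlim_iff eventually_strip
proof (intro allI impI)
  fix P assume "\<exists>R. \<forall>s. R \<le> Re s \<longrightarrow> \<bar>Im s\<bar> \<le> \<alpha> * B + \<bar>Im \<beta>\<bar> \<longrightarrow> P s"
  then obtain R where R: "\<And>s. R \<le> Re s \<Longrightarrow> \<bar>Im s\<bar> \<le> \<alpha> * B + \<bar>Im \<beta>\<bar> \<Longrightarrow> P s" by blast
  have "P (complex_of_real \<alpha> * s + \<beta>)" if "Re s \<ge> (R - Re \<beta>) / \<alpha>" "\<bar>Im s\<bar> \<le> B" for s
  proof (rule R)
    show "R \<le> Re (complex_of_real \<alpha> * s + \<beta>)" using that(1) assms by (simp add: field_simps)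
    have "\<bar>\<alpha> * Im s + Im \<beta>\<bar> \<le> \<bar>\<alpha> * Im s\<bar> + \<bar>Im \<beta>\<bar>" by (rule abs_triangle_ineq)
    also have "\<bar>\<alpha> * Im s\<bar> = \<alpha> * \<bar>Im s\<bar>" using assms by (simp add: abs_mult)
    also have "\<dots> \<le> \<alpha> * B" using assms that(2) by (intro mult_left_mono) auto
    finally show "\<bar>Im (complex_of_real \<alpha> * s + \<beta>)\<bar> \<le> \<alpha> * B + \<bar>Im \<beta>\<bar>" by simp
  qed
  then show "\<exists>R. \<forall>s. R \<le> Re s \<longrightarrow> \<bar>Im s\<bar> \<le> B \<longrightarrow> P (complex_of_real \<alpha> * s + \<beta>)" by blast
qed

lemma tendsto_inverse_strip: "((\<lambda>s. 1 / s) \<longlongrightarrow> 0) (strip B)"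
proof (rule tendstoI)
  fix e :: real assume e: "e > 0"
  show "\<forall>\<^sub>F s in strip B. dist (1 / s) 0 < e"
    using eventually_strip_Re_ge[of "1 / e + 1"]
  proof eventually_elim
    case (elim s)
    have "norm s \<ge> 1 / e + 1" using elim complex_Re_le_cmod[of s] by linarith
    then have "1 / e < norm s" by simp
    moreover from this have "norm s > 0" using e by (meson divide_pos_pos less_trans zero_less_one)
    ultimately show ?case using e by (simp add: norm_divide divide_less_eq mult.commute)
  qed
qed

text \<open>\<open>h\<close> has a full asymptotic expansion in powers \<open>s\<^sup>-\<^sup>j\<close> with \<open>j \<ge> m\<close> in every horizontal strip.\<close>

definition expansion :: "nat \<Rightarrow> (complex \<Rightarrow> complex) \<Rightarrow> bool" where
  "expansion m h \<longleftrightarrow> (\<forall>B n. \<exists>p. (\<lambda>s. h s - (1 / s) ^ m * poly p (1 / s)) \<in> O[strip B](\<lambda>s. (1 / s) ^ n))"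

lemma expansionI: "(\<And>B n. \<exists>p. (\<lambda>s. h s - (1 / s) ^ m * poly p (1 / s)) \<in> O[strip B](\<lambda>s. (1 / s) ^ n)) \<Longrightarrow> expansion m h"
  by (simp add: expansion_def)

lemma expansionD: "expansion m h \<Longrightarrow> \<exists>p. (\<lambda>s. h s - (1 / s) ^ m * poly p (1 / s)) \<in> O[strip B](\<lambda>s. (1 / s) ^ n)"
  by (simp add: expansion_def)

lemma expansion_add:
  assumes "expansion m f" "expansion m g" shows "expansion m (\<lambda>s. f s + g s)"
proof (rule expansionI)
  fix B n
  obtain p q where "(\<lambda>s. f s - (1 / s) ^ m * poly p (1 / s)) \<in> O[strip B](\<lambda>s. (1 / s) ^ n)"
    "(\<lambda>s. g s - (1 / s) ^ m * poly q (1 / s)) \<in> O[strip B](\<lambda>s. (1 / s) ^ n)"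
    using expansionD[OF assms(1)] expansionD[OF assms(2)] by blast
  from sum_in_bigo(1)[OF this] show "\<exists>p. (\<lambda>s. f s + g s - (1 / s) ^ m * poly p (1 / s)) \<in> O[strip B](\<lambda>s. (1 / s) ^ n)"
    by (intro exI[of _ "p + q"]) (simp add: algebra_simps)
qed

lemma expansion_cmult:
  assumes "expansion m f" shows "expansion m (\<lambda>s. c * f s)"
proof (rule expansionI)
  fix B n
  obtain p where "(\<lambda>s. f s - (1 / s) ^ m * poly p (1 / s)) \<in> O[strip B](\<lambda>s. (1 / s) ^ n)"
    using expansionD[OF assms] by blast
  then have "(\<lambda>s. c * (f s - (1 / s) ^ m * poly p (1 / s))) \<in> O[strip B](\<lambda>s. (1 / s) ^ n)"
    by (cases "c = 0") auto
  then show "\<exists>p. (\<lambda>s. c * f s - (1 / s) ^ m * poly p (1 / s)) \<in> O[strip B](\<lambda>s. (1 / s) ^ n)"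
    by (intro exI[of _ "smult c p"]) (simp add: algebra_simps)
qed

lemma expansion_negligible:
  assumes "\<And>B n. h \<in> O[strip B](\<lambda>s. (1 / s) ^ n)" shows "expansion m h"
  using assms by (intro expansionI exI[of _ 0]) simp

lemma expansion_zero: "expansion m (\<lambda>s. 0)" by (rule expansion_negligible) simp

lemma expansion_cong:
  assumes "\<And>B. eventually (\<lambda>s. f s = g s) (strip B)" "expansion m g" shows "expansion m f"
proof (rule expansionI)
  fix B n
  obtain p where p: "(\<lambda>s. g s - (1 / s) ^ m * poly p (1 / s)) \<in> O[strip B](\<lambda>s. (1 / s) ^ n)"
    using expansionD[OF assms(2)] by blast
  have "eventually (\<lambda>s. f s - (1 / s) ^ m * poly p (1 / s) = g s - (1 / s) ^ m * poly p (1 / s)) (strip B)"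
    using assms(1)[of B] by eventually_elim simp
  from landau_o.big.in_cong[OF this] p
  show "\<exists>p. (\<lambda>s. f s - (1 / s) ^ m * poly p (1 / s)) \<in> O[strip B](\<lambda>s. (1 / s) ^ n)" by blast
qed

lemma expansion_mono:
  assumes "expansion (m + k) h" shows "expansion m h"
proof (rule expansionI)
  fix B n
  obtain p where p: "(\<lambda>s. h s - (1 / s) ^ (m + k) * poly p (1 / s)) \<in> O[strip B](\<lambda>s. (1 / s) ^ n)"
    using expansionD[OF assms] by blast
  have "(1 / s) ^ (m + k) * poly p (1 / s) = (1 / s) ^ m * poly (monom 1 k * p) (1 / s)" for s :: complex
    by (simp add: poly_monom power_add)
  with p show "\<exists>p. (\<lambda>s. h s - (1 / s) ^ m * poly p (1 / s)) \<in> O[strip B](\<lambda>s. (1 / s) ^ n)"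
    by (auto intro!: exI[of _ "monom 1 k * p"])
qed

lemma expansion_mult_ident:
  assumes "expansion (Suc m) h" shows "expansion m (\<lambda>s. s * h s)"
proof (rule expansionI)
  fix B n
  obtain p where p: "(\<lambda>s. h s - (1 / s) ^ Suc m * poly p (1 / s)) \<in> O[strip B](\<lambda>s. (1 / s) ^ Suc n)"
    using expansionD[OF assms] by blast
  have 1: "(\<lambda>s. s * (h s - (1 / s) ^ Suc m * poly p (1 / s))) \<in> O[strip B](\<lambda>s. s * (1 / s) ^ Suc n)"
    by (rule landau_o.big.mult[OF landau_o.big_refl p])
  have "eventually (\<lambda>s. s * (1 / s) ^ Suc n = (1 / s) ^ n) (strip B)"
    using eventually_strip_ne_0 by eventually_elim simp
  from landau_o.big.cong[OF this] 1 have "(\<lambda>s. s * (h s - (1 / s) ^ Suc m * poly p (1 / s))) \<in> O[strip B](\<lambda>s. (1 / s) ^ n)"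
    by simp
  moreover have "eventually (\<lambda>s. s * (h s - (1 / s) ^ Suc m * poly p (1 / s)) = s * h s - (1 / s) ^ m * poly p (1 / s)) (strip B)"
    using eventually_strip_ne_0 by eventually_elim (simp add: algebra_simps)
  from landau_o.big.in_cong[OF this] calculation
  show "\<exists>p. (\<lambda>s. s * h s - (1 / s) ^ m * poly p (1 / s)) \<in> O[strip B](\<lambda>s. (1 / s) ^ n)" by blast
qed

text \<open>Split off one Taylor coefficient at a time: \<open>(k u - k 0) / u\<close> is again
  holomorphic.\<close>

lemma Taylor_bigo:
  assumes "k holomorphic_on ball 0 r" "r > 0"
  shows "\<exists>p. (\<lambda>u. k u - poly p u) \<in> O[nhds 0](\<lambda>u. u ^ n)"
  using assms(1)
proof (induction n arbitrary: k)
  case 0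
  have "isCont k 0"
    using holomorphic_on_imp_continuous_on[OF 0] assms(2) by (simp add: continuous_on_eq_continuous_at)
  then have "(k \<longlongrightarrow> k 0) (nhds 0)" by (simp add: continuous_within tendsto_nhds_iff)
  then have "k \<in> O[nhds 0](\<lambda>u. 1)"
    by (intro bigoI_tendsto[where c = "k 0"]) auto
  then show ?case by (intro exI[of _ 0]) simp
next
  case (Suc n)
  define k1 where "k1 = (\<lambda>u. if u = 0 then deriv k 0 else (k u - k 0) / (u - 0))"
  have "k1 holomorphic_on ball 0 r"
    unfolding k1_def using Suc.prems assms(2) by (intro pole_lemma) auto
  from Suc.IH[OF this] obtain p where p: "(\<lambda>u. k1 u - poly p u) \<in> O[nhds 0](\<lambda>u. u ^ n)" by blast
  have "(\<lambda>u. u * (k1 u - poly p u)) \<in> O[nhds 0](\<lambda>u. u * u ^ n)"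
    by (rule landau_o.big.mult[OF landau_o.big_refl p])
  moreover have "(\<lambda>u. u * (k1 u - poly p u)) = (\<lambda>u. k u - poly (pCons (k 0) p) u)"
  proof
    fix u
    have "u * ((k u - k 0) / u) = k u - k 0" if "u \<noteq> 0" using that by simp
    then show "u * (k1 u - poly p u) = k u - poly (pCons (k 0) p) u"
      by (cases "u = 0") (simp_all add: k1_def right_diff_distrib[of u "_ / _"] del: times_divide_eq_right)
  qed
  ultimately show ?case by (intro exI[of _ "pCons (k 0) p"]) simp
qed

lemma expansion_analytic:
  assumes "k holomorphic_on ball 0 r" "r > 0"
  shows "expansion m (\<lambda>s. (1 / s) ^ m * k (1 / s))"
proof (rule expansionI)
  fix B n
  obtain p where p: "(\<lambda>u. k u - poly p u) \<in> O[nhds 0](\<lambda>u. u ^ n)" using Taylor_bigo[OF assms] by blast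
  have "(\<lambda>u. u ^ m * (k u - poly p u)) \<in> O[nhds 0](\<lambda>u. 1 * u ^ n)"
  proof (rule landau_o.big.mult[OF _ p])
    have "((\<lambda>u. u ^ m) \<longlongrightarrow> 0 ^ m) (nhds (0::complex))" by (intro tendsto_intros filterlim_ident)
    then show "(\<lambda>u. u ^ m) \<in> O[nhds 0](\<lambda>u. 1 :: complex)" by (intro bigoI_tendsto[where c = "0 ^ m"]) auto
  qed
  from landau_o.big.compose[OF this tendsto_inverse_strip[of B]]
  show "\<exists>p. (\<lambda>s. (1 / s) ^ m * k (1 / s) - (1 / s) ^ m * poly p (1 / s)) \<in> O[strip B](\<lambda>s. (1 / s) ^ n)"
    by (intro exI[of _ p]) (simp add: algebra_simps)
qed

text \<open>With \<open>u = 1 / s\<close> the new variable is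
  \<open>1 / (\<alpha> * s + \<beta>) = u / (\<alpha> + \<beta> * u)\<close>, holomorphic near
  \<open>u = 0\<close>, so a polynomial in it re-expands in powers of \<open>u\<close>.\<close>

lemma expansion_affine:
  assumes h: "expansion m h" and \<alpha>: "\<alpha> > 0"
  shows "expansion m (\<lambda>s. h (complex_of_real \<alpha> * s + \<beta>))"
proof (rule expansionI)
  fix B n
  let ?t = "\<lambda>s. complex_of_real \<alpha> * s + \<beta>"
  obtain p where p: "(\<lambda>s. h s - (1 / s) ^ m * poly p (1 / s)) \<in> O[strip (\<alpha> * B + \<bar>Im \<beta>\<bar>)](\<lambda>s. (1 / s) ^ n)"
    using expansionD[OF h] by blast
  have 1: "(\<lambda>s. h (?t s) - (1 / ?t s) ^ m * poly p (1 / ?t s)) \<in> O[strip B](\<lambda>s. (1 / ?t s) ^ n)"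
    using landau_o.big.compose[OF p filterlim_strip_affine[OF \<alpha>]] .
  \<comment> \<open>Small enough that \<open>norm (\<beta> * u) < \<alpha>\<close> on the
    disc.\<close>
  define r where "r = \<alpha> / (norm \<beta> + 1)"
  have r: "r > 0" using \<alpha> by (simp add: r_def add_nonneg_pos)
  have ne: "complex_of_real \<alpha> + \<beta> * u \<noteq> 0" if "u \<in> ball 0 r" for u
  proof
    assume "complex_of_real \<alpha> + \<beta> * u = 0"
    then have "norm (\<beta> * u) = \<alpha>" using \<alpha> by (metis add_eq_0_iff norm_minus_cancel norm_of_real abs_of_pos)
    moreover have "norm (\<beta> * u) \<le> norm \<beta> * r" using that by (auto simp: norm_mult intro!: mult_left_mono)
    moreover have "norm \<beta> * r < (norm \<beta> + 1) * r" using r by simp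
    moreover have "(norm \<beta> + 1) * r = \<alpha>" using add_nonneg_pos[of "norm \<beta>" 1] by (simp add: r_def)
    ultimately show False by simp
  qed
  have inv: "eventually (\<lambda>s. 1 / ?t s = (1 / s) * (1 / (of_real \<alpha> + \<beta> * (1 / s)))) (strip B)"
    using eventually_strip_ne_0 by eventually_elim (simp add: field_simps)
  have 2: "(\<lambda>s. 1 / ?t s) \<in> O[strip B](\<lambda>s. 1 / s)"
  proof -
    have "((\<lambda>s. 1 / (of_real \<alpha> + \<beta> * (1 / s))) \<longlongrightarrow> 1 / (of_real \<alpha> + \<beta> * 0)) (strip B)"
      using \<alpha> by (intro tendsto_intros tendsto_inverse_strip) auto
    then have "(\<lambda>s. 1 / (of_real \<alpha> + \<beta> * (1 / s))) \<in> O[strip B](\<lambda>s. 1)"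
      by (intro bigoI_tendsto[where c = "1 / (of_real \<alpha> + \<beta> * 0)"]) auto
    then have "(\<lambda>s. (1 / s) * (1 / (of_real \<alpha> + \<beta> * (1 / s)))) \<in> O[strip B](\<lambda>s. (1 / s) * 1)"
      by (intro landau_o.big.mult landau_o.big_refl)
    then show ?thesis by (subst landau_o.big.in_cong[OF inv]) simp
  qed
  have 3: "(\<lambda>s. (1 / ?t s) ^ n) \<in> O[strip B](\<lambda>s. (1 / s) ^ n)"
    by (rule landau_o.big_power[OF 2])
  have 4: "(\<lambda>s. h (?t s) - (1 / ?t s) ^ m * poly p (1 / ?t s)) \<in> O[strip B](\<lambda>s. (1 / s) ^ n)"
    by (rule landau_o.big_trans[OF 1 3])
  define k where "k = (\<lambda>u. (1 / (of_real \<alpha> + \<beta> * u)) ^ m * poly p (u * (1 / (of_real \<alpha> + \<beta> * u))))"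
  have "k holomorphic_on ball 0 r"
    unfolding k_def using ne by (intro holomorphic_intros) auto
  from expansionD[OF expansion_analytic[OF this r]]
  obtain q where q: "(\<lambda>s. (1 / s) ^ m * k (1 / s) - (1 / s) ^ m * poly q (1 / s)) \<in> O[strip B](\<lambda>s. (1 / s) ^ n)" by blast
  have "eventually (\<lambda>s. (1 / ?t s) ^ m * poly p (1 / ?t s) = (1 / s) ^ m * k (1 / s)) (strip B)"
    using inv by eventually_elim (simp only: k_def power_mult_distrib mult.assoc)
  then have "eventually (\<lambda>s. (h (?t s) - (1 / ?t s) ^ m * poly p (1 / ?t s)) + ((1 / s) ^ m * k (1 / s) - (1 / s) ^ m * poly q (1 / s)) =
      h (?t s) - (1 / s) ^ m * poly q (1 / s)) (strip B)"
    by eventually_elim simp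
  from landau_o.big.in_cong[OF this, THEN iffD1, OF sum_in_bigo(1)[OF 4 q]]
  show "\<exists>q. (\<lambda>s. h (?t s) - (1 / s) ^ m * poly q (1 / s)) \<in> O[strip B](\<lambda>s. (1 / s) ^ n)"
    by (rule exI)
qed

section \<open>Continuation of a Mellin integral by subtracting its expansion\<close>

text \<open>Used with \<open>w = s + j - 2\<close>: the subtracted term \<open>a j / x ^ j\<close>
  then contributes \<open>a j / (s + j - 3)\<close>.\<close>

lemma powr_tail_integral:
  fixes w :: complex
  assumes w: "Re w > 1"
  shows "integrable lpos (\<lambda>x. indicator {1<..} x *\<^sub>R complex_of_real x powr (- w))"
    and "(\<integral>x. indicator {1<..} x *\<^sub>R complex_of_real x powr (- w) \<partial>lpos) = 1 / (w - 1)"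
proof -
  show int: "integrable lpos (\<lambda>x. indicator {1<..} x *\<^sub>R complex_of_real x powr (- w))"
  proof (rule integrable_lpos_powr[where C = 1 and a = 0 and b = "- Re w"])
    have "(\<lambda>x. complex_of_real x powr (- w)) \<in> borel_measurable lpos"
      by (intro borel_measurable_lpos continuous_intros) auto
    then show "(\<lambda>x. indicator {1<..} x *\<^sub>R complex_of_real x powr (- w)) \<in> borel_measurable lpos"
      by (intro borel_measurable_scaleR borel_measurable_indicator) (auto simp: sets_restrict_space)
  qed (use w in \<open>auto simp: powr_bound_def indicator_def norm_of_real_powr\<close>)
  have eq: "indicator {0<..} x *\<^sub>R (indicator {1<..} x *\<^sub>R complex_of_real x powr (- w)) = indicator {1<..} x *\<^sub>R (complex_of_real x powr (- w))" for x :: real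
    by (auto simp: indicator_def)
  have eint: "einterval 1 \<infinity> = {1<..}"
    by (auto simp: einterval_def one_ereal_def)
  have set_int: "set_integrable lborel {1<..} (\<lambda>x. complex_of_real x powr (- w))"
  proof -
    have "integrable lborel (\<lambda>x. indicator {0<..} x *\<^sub>R (indicator {1<..} x *\<^sub>R complex_of_real x powr (- w)))"
      using int by (rule integrable_restrict_space[THEN iffD1, rotated]) simp
    then show ?thesis unfolding eq set_integrable_def .
  qed
  have w1: "1 - w \<noteq> 0" using w by auto
  have "(LBINT x=1..\<infinity>. complex_of_real x powr (- w)) = 0 - 1 / (1 - w)"
  proof (rule interval_integral_FTC_integrable[where F = "\<lambda>x. complex_of_real x powr (1 - w) / (1 - w)"])
    fix x assume "1 < ereal x" "ereal x < \<infinity>"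
    then have x: "x > 1" by (simp add: one_ereal_def)
    have "((\<lambda>z. z powr (1 - w) / (1 - w)) has_field_derivative (of_real x powr (- w))) (at (complex_of_real x))"
      using x w1 by (auto intro!: derivative_eq_intros simp: complex_nonpos_Reals_iff)
    then show "((\<lambda>x. complex_of_real x powr (1 - w) / (1 - w)) has_vector_derivative of_real x powr (- w)) (at x)"
      by (rule has_vector_derivative_real_field)
    show "isCont (\<lambda>x. complex_of_real x powr (- w)) x"
      using x by (intro continuous_intros) (auto simp: complex_nonpos_Reals_iff)
  next
    show "set_integrable lborel (einterval 1 \<infinity>) (\<lambda>x. complex_of_real x powr (- w))"
      using set_int by (simp add: eint)
    have "isCont (\<lambda>x. complex_of_real x powr (1 - w) / (1 - w)) 1"
      using w1 by (intro continuous_intros) (auto simp: complex_nonpos_Reals_iff)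
    then have "((\<lambda>x. complex_of_real x powr (1 - w) / (1 - w)) \<longlongrightarrow> 1 / (1 - w)) (at_right 1)"
      by (simp add: isCont_def filterlim_at_split)
    then show "(((\<lambda>x. complex_of_real x powr (1 - w) / (1 - w)) \<circ> real_of_ereal) \<longlongrightarrow> 1 / (1 - w)) (at_right 1)"
      unfolding one_ereal_def by (subst ereal_tendsto_simps)
    have "((\<lambda>x. complex_of_real x powr (1 - w) / (1 - w)) \<longlongrightarrow> 0) at_top"
    proof (rule tendsto_norm_zero_cancel)
      have "((\<lambda>x. x powr (1 - Re w) / norm (1 - w)) \<longlongrightarrow> 0 / norm (1 - w)) at_top"
        using w w1 by (intro tendsto_intros) (auto intro!: tendsto_neg_powr filterlim_ident)
      then have "((\<lambda>x. x powr (1 - Re w) / norm (1 - w)) \<longlongrightarrow> 0) at_top" by simp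
      moreover have "\<forall>\<^sub>F x in at_top. x powr (1 - Re w) / norm (1 - w) = norm (complex_of_real x powr (1 - w) / (1 - w))"
        using eventually_gt_at_top[of 0] by eventually_elim (simp add: norm_divide norm_of_real_powr)
      ultimately show "((\<lambda>x. norm (complex_of_real x powr (1 - w) / (1 - w))) \<longlongrightarrow> 0) at_top"
        by (rule Lim_transform_eventually)
    qed
    then show "(((\<lambda>x. complex_of_real x powr (1 - w) / (1 - w)) \<circ> real_of_ereal) \<longlongrightarrow> 0) (at_left \<infinity>)"
      by (subst ereal_tendsto_simps)
  qed simp
  also have "(LBINT x=1..\<infinity>. complex_of_real x powr (- w)) = (LINT x:{1<..}|lborel. complex_of_real x powr (- w))"
    by (simp add: interval_lebesgue_integral_def eint)
  also have "\<dots> = (\<integral>x. indicator {1<..} x *\<^sub>R complex_of_real x powr (- w) \<partial>lpos)"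
  proof -
    have "(\<integral>x. indicator {1<..} x *\<^sub>R complex_of_real x powr (- w) \<partial>lpos) =
        (\<integral>x. indicator {0<..} x *\<^sub>R (indicator {1<..} x *\<^sub>R complex_of_real x powr (- w)) \<partial>lborel)"
      by (rule integral_restrict_space) simp
    then show ?thesis unfolding eq set_lebesgue_integral_def by simp
  qed
  also have "0 - 1 / (1 - w) = 1 / (w - 1)" using w1 by (simp add: field_simps)
  finally show "(\<integral>x. indicator {1<..} x *\<^sub>R complex_of_real x powr (- w) \<partial>lpos) = 1 / (w - 1)" .
qed

definition sinc :: "complex \<Rightarrow> complex" where "sinc w = (if w = 0 then 1 else sin w / w)"

lemma sinc_holomorphic: "sinc holomorphic_on A"
proof -
  have "sinc holomorphic_on UNIV"
  proof (rule no_isolated_singularity[where K = "{0}"])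
    have "(\<lambda>w. sin w / w) holomorphic_on UNIV - {0}" by (intro holomorphic_intros) auto
    then show h: "sinc holomorphic_on UNIV - {0}"
      by (rule holomorphic_transform) (simp add: sinc_def)
    have "isCont sinc 0"
      using has_field_derivative_sin_z_over_z[where 'a = complex and A = UNIV] DERIV_isCont
      unfolding sinc_def[abs_def] by blast
    moreover have "isCont sinc w" if "w \<noteq> 0" for w
      using holomorphic_on_imp_continuous_on[OF h] that
      by (auto simp: continuous_on_eq_continuous_at open_delete)
    ultimately show "continuous_on UNIV sinc" by (metis continuous_at_imp_continuous_on)
  qed auto
  then show ?thesis by (rule holomorphic_on_subset) simp
qed

lemma sin_plus_of_real_pi: "sin (x + of_real pi) = - sin (x :: complex)"
  by (simp add: sin_add flip: sin_of_real cos_of_real)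

text \<open>Shifting the sine by \<open>(3 - j) * pi\<close> gives the sign of parity
  \<open>3 - j\<close>; the exponent \<open>Suc j\<close> has the same parity and stays in the
  naturals.\<close>

lemma sinc_shift: "of_real pi * w \<noteq> 0 \<Longrightarrow> (-1) ^ Suc j * sinc (of_real pi * w) = sin (of_real pi * (w + 3 - of_nat j)) / (of_real pi * w)"
proof -
  assume w: "of_real pi * w \<noteq> 0"
  have "sin (of_real pi * (w + 3 - of_nat j)) = (-1) ^ Suc j * sin (of_real pi * w)"
  proof (induction j)
    case 0
    have "complex_of_real pi * (w + 3 - of_nat 0) = ((of_real pi * w + of_real pi) + of_real pi) + of_real pi"
      by (simp add: algebra_simps)
    then have "sin (complex_of_real pi * (w + 3 - of_nat 0)) = - sin (of_real pi * w)"
      by (simp only: sin_plus_of_real_pi minus_minus)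
    then show ?case by simp
  next
    case (Suc j)
    have "sin (of_real pi * (w + 3 - of_nat (Suc j)) + of_real pi) = - sin (of_real pi * (w + 3 - of_nat (Suc j)))" by (rule sin_plus_of_real_pi)
    moreover have "of_real pi * (w + 3 - of_nat (Suc j)) + of_real pi = of_real pi * (w + 3 - of_nat j)"
      by (simp add: algebra_simps)
    ultimately have "sin (of_real pi * (w + 3 - of_nat (Suc j))) = - sin (of_real pi * (w + 3 - of_nat j))"
      by (metis minus_minus)
    then show ?case unfolding Suc.IH by simp
  qed
  then show ?thesis using w by (simp add: sinc_def)
qed

text \<open>The expansion is subtracted on \<open>x > 1\<close> only: the negative powers would ruin
  integrability at 0, where \<open>F\<close> itself is bounded.\<close>

definition mellin_rest :: "(real \<Rightarrow> complex) \<Rightarrow> (nat \<Rightarrow> complex) \<Rightarrow> nat \<Rightarrow> real \<Rightarrow> complex" where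
  "mellin_rest F a N x = F x - indicator {1<..} x *\<^sub>R (\<Sum>j=1..N. a j / of_real x ^ j)"

text \<open>The signed \<open>sinc\<close> is \<open>sin (\<pi> s) / (\<pi> (s + j - 3))\<close> with its singularity at \<open>s = 3 - j\<close> removed.\<close>

definition mellin_ext :: "(real \<Rightarrow> complex) \<Rightarrow> (nat \<Rightarrow> complex) \<Rightarrow> nat \<Rightarrow> complex \<Rightarrow> complex" where
  "mellin_ext F a N s = sin (of_real pi * s) / of_real pi * (\<integral>x. of_real x powr (2 - s) * mellin_rest F a N x \<partial>lpos) +
     (\<Sum>j=1..N. a j * ((-1) ^ Suc j * sinc (of_real pi * (s + of_nat j - 3))))"

lemma
  assumes cont: "continuous_on {0..} F"
    and exp: "\<And>x. x \<ge> X \<Longrightarrow> norm (F x - (\<Sum>j=1..N. a j / of_real x ^ j)) \<le> C * x powr (- real M - 1)"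
  shows mellin_rest_bound: "\<exists>K. \<forall>x>0. norm (mellin_rest F a N x) \<le> K * powr_bound 0 (- real M - 1) x"
    and mellin_rest_measurable: "mellin_rest F a N \<in> borel_measurable lpos"
proof -
  define G where "G = (\<lambda>x. F x - (\<Sum>j=1..N. a j / of_real x ^ j))"
  define X' where "X' = max X 1"
  obtain B1 where B1: "\<And>x. x \<in> {0..1} \<Longrightarrow> norm (F x) \<le> B1"
  proof -
    have "compact (F ` {0..1})"
      by (intro compact_continuous_image continuous_on_subset[OF cont]) auto
    then show thesis using that by (meson bounded_iff compact_imp_bounded imageI)
  qed
  have contG: "continuous_on {0<..} G" unfolding G_def
    by (intro continuous_intros continuous_on_subset[OF cont]) auto
  obtain B2 where B2: "\<And>x. x \<in> {1..X'} \<Longrightarrow> norm (G x) \<le> B2"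
  proof -
    have "compact (G ` {1..X'})"
      by (intro compact_continuous_image continuous_on_subset[OF contG]) auto
    then show thesis using that by (meson bounded_iff compact_imp_bounded imageI)
  qed
  \<comment> \<open>\<open>B1\<close> covers \<open>x \<le> 1\<close> and \<open>C\<close> the range
    of the expansion; on the compact piece between them the factor
    \<open>X' powr (real M + 1)\<close> makes up for the decay of the majorant.\<close>
  define K where "K = max B1 (max C (B2 * X' powr (real M + 1)))"
  have "norm (mellin_rest F a N x) \<le> K * powr_bound 0 (- real M - 1) x" if x: "x > 0" for x
  proof (cases "x \<le> 1")
    case True
    then show ?thesis using B1[of x] x by (auto simp: mellin_rest_def powr_bound_def K_def)
  next
    case False
    then have eq: "mellin_rest F a N x = G x" by (simp add: mellin_rest_def G_def)
    show ?thesis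
    proof (cases "x \<ge> X")
      case True
      have "norm (G x) \<le> C * x powr (- real M - 1)" using exp[OF True] by (simp add: G_def)
      also have "\<dots> \<le> K * x powr (- real M - 1)" by (intro mult_right_mono) (auto simp: K_def)
      finally show ?thesis using eq False by (simp add: powr_bound_def)
    next
      case 2: False
      have xX: "x \<in> {1..X'}" using 2 False by (auto simp: X'_def)
      have B20: "B2 \<ge> 0" using B2[OF xX] norm_ge_zero[of "G x"] by linarith
      have "norm (G x) \<le> B2 * 1" using B2[OF xX] by simp
      also have "\<dots> \<le> B2 * (X' powr (real M + 1) * x powr (- real M - 1))"
      proof (intro mult_left_mono B20)
        have "x powr (real M + 1) * x powr (- real M - 1) \<le> X' powr (real M + 1) * x powr (- real M - 1)"
          using xX by (intro mult_right_mono powr_mono2) auto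
        then show "1 \<le> X' powr (real M + 1) * x powr (- real M - 1)"
          using x by (simp add: powr_add[symmetric])
      qed
      also have "\<dots> \<le> K * x powr (- real M - 1)"
        unfolding mult.assoc[symmetric] by (intro mult_right_mono) (auto simp: K_def)
      finally show ?thesis using eq False by (simp add: powr_bound_def)
    qed
  qed
  then show "\<exists>K. \<forall>x>0. norm (mellin_rest F a N x) \<le> K * powr_bound 0 (- real M - 1) x" by blast
  have "F \<in> borel_measurable lpos"
    by (intro borel_measurable_lpos continuous_on_subset[OF cont]) auto
  moreover have "(\<lambda>x. \<Sum>j=1..N. a j / of_real x ^ j) \<in> borel_measurable lpos"
    by (intro borel_measurable_lpos continuous_intros) auto
  moreover have "indicator {1<..} \<in> borel_measurable lpos"
    by (intro borel_measurable_indicator) (auto simp: sets_restrict_space)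
  ultimately show "mellin_rest F a N \<in> borel_measurable lpos"
    unfolding mellin_rest_def[abs_def] by (intro borel_measurable_diff borel_measurable_scaleR)
qed

lemma powr_bound_mult: "x powr e * powr_bound a b x = powr_bound (a + e) (b + e) x" if "x > 0"
  using that by (simp add: powr_bound_def powr_add mult.commute)

text \<open>The rest is bounded near 0 and decays like \<open>x powr (- real M - 1)\<close>, so its
  integral is holomorphic on the strip. The subtracted tails would give simple poles at
  \<open>s = 3 - j\<close>, which the sine removes; on \<open>2 < Re s < 3\<close> both pieces add
  up to the original integral.\<close>

lemma
  assumes cont: "continuous_on {0..} F"
    and exp: "\<And>x. x \<ge> X \<Longrightarrow> norm (F x - (\<Sum>j=1..N. a j / of_real x ^ j)) \<le> C * x powr (- real M - 1)"
  shows mellin_rest_integrable: "\<And>s. s \<in> {s. 2 - real M < Re s \<and> Re s < 3} \<Longrightarrow> integrable lpos (\<lambda>x. of_real x powr (2 - s) * mellin_rest F a N x)"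
    and mellin_rest_holomorphic: "(\<lambda>s. \<integral>x. of_real x powr (2 - s) * mellin_rest F a N x \<partial>lpos) holomorphic_on {s. 2 - real M < Re s \<and> Re s < 3}"
    and mellin_ext_holomorphic: "mellin_ext F a N holomorphic_on {s. 2 - real M < Re s \<and> Re s < 3}"
    and mellin_ext_eq: "\<And>s. 2 < Re s \<Longrightarrow> Re s < 3 \<Longrightarrow> mellin_ext F a N s =
          sin (of_real pi * s) / of_real pi * (\<integral>x. of_real x powr (2 - s) * F x \<partial>lpos)"
proof -
  let ?S = "{s. 2 - real M < Re s \<and> Re s < 3}"
  let ?g = "\<lambda>s x. complex_of_real x powr (2 - s) * mellin_rest F a N x"
  obtain K where K: "\<And>x. x > 0 \<Longrightarrow> norm (mellin_rest F a N x) \<le> K * powr_bound 0 (- real M - 1) x"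
    using mellin_rest_bound[OF cont exp] by blast
  have "norm (mellin_rest F a N 1) \<le> K" using K[of 1] by (simp add: powr_bound_def)
  then have K0: "K \<ge> 0" by (rule order_trans[OF norm_ge_zero])
  have meas: "?g s \<in> borel_measurable lpos" for s
    by (intro borel_measurable_times mellin_rest_measurable[OF cont exp] borel_measurable_lpos continuous_intros) auto
  have bnd: "norm (?g s x) \<le> K * powr_bound (2 - Re s) (1 - real M - Re s) x" if "x > 0" for s x
  proof -
    have "norm (?g s x) \<le> x powr (2 - Re s) * (K * powr_bound 0 (- real M - 1) x)"
      unfolding norm_mult using that K by (intro mult_mono) (auto simp: norm_of_real_powr)
    also have "\<dots> = K * (x powr (2 - Re s) * powr_bound 0 (- real M - 1) x)" by simp
    also have "\<dots> = K * powr_bound (2 - Re s) (1 - real M - Re s) x"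
      by (subst powr_bound_mult[OF that]) (simp add: algebra_simps)
    finally show ?thesis .
  qed
  show int: "integrable lpos (?g s)" if "s \<in> ?S" for s
    using that by (intro integrable_lpos_powr[OF meas _ _ bnd]) auto
  show hol: "(\<lambda>s. \<integral>x. ?g s x \<partial>lpos) holomorphic_on ?S"
  proof (rule holomorphic_on_integral)
    have "?S = {s. Re s > 2 - real M} \<inter> {s. Re s < 3}" by auto
    then show "open ?S" by (simp only: open_Int open_halfspace_Re_gt open_halfspace_Re_lt)
    show "\<And>w. w \<in> ?S \<Longrightarrow> ?g w \<in> borel_measurable lpos" by (rule meas)
    show "(\<lambda>w. ?g w x) holomorphic_on ?S" if "x \<in> space lpos" for x
      using that by (intro holomorphic_intros) auto
    fix s assume s: "s \<in> ?S"
    define r where "r = min (Re s - (2 - real M)) (3 - Re s) / 2"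
    have r: "r > 0" "2 - real M < Re s - r" "Re s + r < 3" using s by (auto simp: r_def min_def field_simps)
    have R: "\<bar>Re v - Re s\<bar> \<le> r" if "v \<in> cball s r" for v
      using that abs_Re_le_cmod[of "s - v"] by (simp add: dist_norm abs_minus_commute)
    have "norm (?g v x) \<le> K * powr_bound (2 - (Re s + r)) (1 - real M - (Re s - r)) x" if v: "v \<in> cball s r" and x: "x \<in> space lpos" for v x
    proof -
      have "powr_bound (2 - Re v) (1 - real M - Re v) x \<le> powr_bound (2 - (Re s + r)) (1 - real M - (Re s - r)) x"
      proof (cases "x \<le> 1")
        case True
        then show ?thesis using x R[OF v] by (simp add: powr_bound_def powr_mono')
      next
        case False
        then show ?thesis using x R[OF v] by (simp add: powr_bound_def powr_mono)
      qed
      then show ?thesis using bnd[of x v] x mult_left_mono[OF _ K0] by fastforce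
    qed
    moreover have "cball s r \<subseteq> ?S"
    proof
      fix v assume "v \<in> cball s r"
      then have "Re v - Re s \<le> r" "Re s - Re v \<le> r" using R[of v] by linarith+
      then show "v \<in> ?S" using r by auto
    qed
    moreover have "integrable lpos (\<lambda>x. K * powr_bound (2 - (Re s + r)) (1 - real M - (Re s - r)) x)"
      using r by (intro integrable_mult_right integrable_powr_bound) auto
    ultimately show "\<exists>r>0. \<exists>B. cball s r \<subseteq> ?S \<and> integrable lpos B \<and> (\<forall>v\<in>cball s r. \<forall>x\<in>space lpos. norm (?g v x) \<le> B x)"
      using r(1) by blast
  qed
  have sincj: "(\<lambda>s. sinc (of_real pi * (s + of_nat j - 3))) holomorphic_on ?S" for j
  proof -
    have "(\<lambda>s. of_real pi * (s + of_nat j - 3)) holomorphic_on ?S" by (intro holomorphic_intros)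
    from holomorphic_on_compose[OF this sinc_holomorphic] show ?thesis unfolding o_def .
  qed
  show "mellin_ext F a N holomorphic_on ?S"
    unfolding mellin_ext_def[abs_def] using hol sincj by (intro holomorphic_intros) auto
  show "mellin_ext F a N s = sin (of_real pi * s) / of_real pi * (\<integral>x. of_real x powr (2 - s) * F x \<partial>lpos)"
    if s: "2 < Re s" "Re s < 3" for s
  proof -
    let ?t = "\<lambda>j x. a j * (indicator {1<..} x *\<^sub>R complex_of_real x powr (- (s + of_nat j - 2)))"
    have sS: "s \<in> ?S" using s by auto
    have tail: "integrable lpos (?t j)" "(\<integral>x. ?t j x \<partial>lpos) = a j * (1 / (s + of_nat j - 3))" if "j \<in> {1..N}" for j
    proof -
      have R: "Re (s + of_nat j - 2) > 1" using s that by simp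
      show "integrable lpos (?t j)" by (intro integrable_mult_right powr_tail_integral(1)[OF R])
      have "s + of_nat j - 2 - 1 = s + of_nat j - 3" by simp
      then show "(\<integral>x. ?t j x \<partial>lpos) = a j * (1 / (s + of_nat j - 3))"
        by (simp only: integral_mult_right_zero powr_tail_integral(2)[OF R])
    qed
    have "(\<integral>x. of_real x powr (2 - s) * F x \<partial>lpos) = (\<integral>x. ?g s x + (\<Sum>j=1..N. ?t j x) \<partial>lpos)"
    proof (rule Bochner_Integration.integral_cong[OF refl])
      fix x assume "x \<in> space lpos"
      then have x: "x > 0" by simp
      have "complex_of_real x powr (2 - s) * (a j / of_real x ^ j) = a j * of_real x powr (- (s + of_nat j - 2))" for j
      proof -
        have "complex_of_real x powr (- (s + of_nat j - 2)) = of_real x powr (2 - s - of_nat j)" by (simp add: algebra_simps)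
        also have "\<dots> = of_real x powr (2 - s) / of_real x ^ j" using x by (simp add: powr_diff powr_nat')
        finally show ?thesis by simp
      qed
      then show "of_real x powr (2 - s) * F x = ?g s x + (\<Sum>j=1..N. ?t j x)"
        by (auto simp: mellin_rest_def indicator_def algebra_simps sum_distrib_left)
    qed
    also have "\<dots> = (\<integral>x. ?g s x \<partial>lpos) + (\<integral>x. (\<Sum>j=1..N. ?t j x) \<partial>lpos)"
      by (intro Bochner_Integration.integral_add int[OF sS] Bochner_Integration.integrable_sum tail)
    also have "(\<integral>x. (\<Sum>j=1..N. ?t j x) \<partial>lpos) = (\<Sum>j=1..N. \<integral>x. ?t j x \<partial>lpos)"
      by (rule Bochner_Integration.integral_sum) (rule tail)
    also have "\<dots> = (\<Sum>j=1..N. a j * (1 / (s + of_nat j - 3)))"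
      by (rule sum.cong[OF refl]) (rule tail)
    finally have "sin (of_real pi * s) / of_real pi * (\<integral>x. of_real x powr (2 - s) * F x \<partial>lpos) =
       sin (of_real pi * s) / of_real pi * (\<integral>x. ?g s x \<partial>lpos) +
       (\<Sum>j=1..N. a j * (sin (of_real pi * s) / (of_real pi * (s + of_nat j - 3))))"
      by (simp add: distrib_left sum_distrib_left mult_ac divide_inverse)
    also have "(\<Sum>j=1..N. a j * (sin (of_real pi * s) / (of_real pi * (s + of_nat j - 3)))) =
       (\<Sum>j=1..N. a j * ((-1) ^ Suc j * sinc (of_real pi * (s + of_nat j - 3))))"
    proof (rule sum.cong[OF refl])
      fix j assume "j \<in> {1..N}"
      then have "Re (s + of_nat j - 3) > 0" using s by simp
      then have "s + of_nat j - 3 \<noteq> 0" by (metis less_irrefl zero_complex.sel(1))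
      then have ne: "of_real pi * (s + of_nat j - 3) \<noteq> 0" by simp
      have "(s + of_nat j - 3) + 3 - of_nat j = s" by simp
      then show "a j * (sin (of_real pi * s) / (of_real pi * (s + of_nat j - 3))) = a j * ((-1) ^ Suc j * sinc (of_real pi * (s + of_nat j - 3)))"
        using sinc_shift[OF ne, of j] by simp
    qed
    finally show ?thesis by (simp only: mellin_ext_def)
  qed
qed

text \<open>Two partial continuations agree on \<open>2 < Re s < 3\<close>, hence on the narrower of
  their strips, which is connected; so all of them glue.\<close>

lemma entire_extension:
  fixes h :: "complex \<Rightarrow> complex"
  assumes h: "h holomorphic_on {s. Re s > 2}"
    and ext: "\<And>M::nat. M \<ge> 1 \<Longrightarrow> \<exists>k. k holomorphic_on {s. 2 - real M < Re s \<and> Re s < 3} \<and>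
        (\<forall>s. 2 < Re s \<and> Re s < 3 \<longrightarrow> k s = h s)"
  obtains H where "H holomorphic_on UNIV" "\<And>s. Re s > 2 \<Longrightarrow> H s = h s"
    "\<And>M k s. k holomorphic_on {s. 2 - real M < Re s \<and> Re s < 3} \<Longrightarrow>
        (\<And>s. 2 < Re s \<Longrightarrow> Re s < 3 \<Longrightarrow> k s = h s) \<Longrightarrow> 2 - real M < Re s \<Longrightarrow> Re s < 3 \<Longrightarrow> H s = k s"
proof -
  let ?S = "\<lambda>M::nat. {s. 2 - real M < Re s \<and> Re s < 3}"
  have op: "open (?S M)" for M
  proof -
    have "?S M = {s. Re s > 2 - real M} \<inter> {s. Re s < 3}" by auto
    then show ?thesis by (simp only: open_Int open_halfspace_Re_gt open_halfspace_Re_lt)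
  qed
  have cn: "connected (?S M)" for M
  proof -
    have "?S M = {s. Re s > 2 - real M} \<inter> {s. Re s < 3}" by auto
    then show ?thesis by (simp only: convex_connected convex_Int convex_halfspace_Re_gt convex_halfspace_Re_lt)
  qed
  obtain k where k: "\<And>M. M \<ge> 1 \<Longrightarrow> k M holomorphic_on ?S M" "\<And>M s. M \<ge> 1 \<Longrightarrow> 2 < Re s \<Longrightarrow> Re s < 3 \<Longrightarrow> k M s = h s"
    using ext by metis
  have uniq: "k1 s = k2 s" if "k1 holomorphic_on ?S M1" "k2 holomorphic_on ?S M2"
     "\<And>s. 2 < Re s \<Longrightarrow> Re s < 3 \<Longrightarrow> k1 s = h s" "\<And>s. 2 < Re s \<Longrightarrow> Re s < 3 \<Longrightarrow> k2 s = h s"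
     "s \<in> ?S M1" "s \<in> ?S M2" for k1 k2 M1 M2 s
  proof (rule analytic_continuation_open[where s = "?S 0" and s' = "?S (min M1 M2)" and f = k1 and g = k2])
    have "Complex (5/2) 0 \<in> ?S 0" by simp
    then show "?S 0 \<noteq> {}" by blast
    show "k1 holomorphic_on ?S (min M1 M2)" "k2 holomorphic_on ?S (min M1 M2)"
      by (rule holomorphic_on_subset[OF that(1)], force) (rule holomorphic_on_subset[OF that(2)], force)
  qed (use that op op[of 0] cn in \<open>auto simp: min_def\<close>)
  \<comment> \<open>Chooses a strip reaching beyond \<open>s\<close> on the left.\<close>
  define m where "m = (\<lambda>s. Suc (nat \<lceil>2 - Re s\<rceil>))"
  have m: "2 - real (m s) < Re s" "m s \<ge> 1" for s
    unfolding m_def by linarith+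
  define H where "H = (\<lambda>s. if Re s > 2 then h s else k (m s) s)"
  have Hh: "H s = h s" if "Re s > 2" for s using that by (simp add: H_def)
  have Hk: "H s = k' s" if "k' holomorphic_on ?S M" "\<And>s. 2 < Re s \<Longrightarrow> Re s < 3 \<Longrightarrow> k' s = h s" "2 - real M < Re s" "Re s < 3" for k' M s
  proof (cases "Re s > 2")
    case True
    then show ?thesis using that(2,4) Hh by simp
  next
    case False
    have "k (m s) s = k' s"
      by (rule uniq[of _ "m s" _ M]) (use k m that in auto)
    then show ?thesis using False by (simp add: H_def)
  qed
  have "H holomorphic_on {s. Re s > 2} \<union> (\<Union>M\<in>{1..}. ?S M)"
  proof (intro holomorphic_on_Un holomorphic_on_UN_open)
    show "H holomorphic_on {s. Re s > 2}" using h by (rule holomorphic_transform) (simp add: Hh)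
    show "H holomorphic_on ?S M" if "M \<in> {1..}" for M
      by (rule holomorphic_transform[OF k(1)[of M]]) (use that k Hk[of "k M" M] in auto)
  qed (use op open_halfspace_Re_gt in auto)
  also have "{s. Re s > 2} \<union> (\<Union>M\<in>{1..}. ?S M) = UNIV"
  proof -
    have "s \<in> {s. Re s > 2} \<union> (\<Union>M\<in>{1..}. ?S M)" for s
      using m[of s] by (cases "Re s > 2") auto
    then show ?thesis by blast
  qed
  finally have "H holomorphic_on UNIV" .
  then show thesis using that Hh Hk by blast
qed

section \<open>Expansions of derivatives and of sums over integer shifts\<close>

text \<open>The relation may be differentiated because it holds in a complex neighbourhood: Cauchy's
  inequality on unit discs inside the strip of width \<open>B + 1\<close> bounds the derivative of
  the error on the strip of width \<open>B\<close>.\<close>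

lemma expansion_deriv:
  assumes h: "expansion m h" and an: "\<And>B. eventually (\<lambda>s. h analytic_on {s}) (strip B)"
  shows "expansion (Suc m) (deriv h)"
proof (rule expansionI)
  fix B n
  obtain p where p: "(\<lambda>s. h s - (1 / s) ^ m * poly p (1 / s)) \<in> O[strip (B + 1)](\<lambda>s. (1 / s) ^ n)"
    using expansionD[OF h] by blast
  \<comment> \<open>For \<open>u = 1 / s\<close> the derivative of \<open>u ^ m * p u\<close> with
    respect to \<open>s\<close> is \<open>- u ^ (m + 1) * (m * p u + u * p' u)\<close>.\<close>
  define q where "q = - (smult (of_nat m) p + pCons 0 (pderiv p))"
  define g where "g = (\<lambda>s. (1 / s) ^ m * poly p (1 / s))"
  have dg: "(g has_field_derivative (1 / s) ^ Suc m * poly q (1 / s)) (at s)" if "s \<noteq> 0" for s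
  proof -
    have 1: "((\<lambda>s. 1 / s) has_field_derivative - ((1 / s) * (1 / s))) (at s)"
      using that by (auto intro!: derivative_eq_intros simp: power2_eq_square divide_inverse)
    have "((\<lambda>u. u ^ m * poly p u) has_field_derivative (of_nat m * u ^ (m - 1) * poly p u + u ^ m * poly (pderiv p) u)) (at u)" for u
      by (auto intro!: derivative_eq_intros poly_DERIV)
    from DERIV_chain2[OF this 1] have "(g has_field_derivative (of_nat m * (1 / s) ^ (m - 1) * poly p (1 / s) + (1 / s) ^ m * poly (pderiv p) (1 / s)) * - ((1 / s) * (1 / s))) (at s)"
      by (simp only: g_def)
    also have "(of_nat m * (1 / s) ^ (m - 1) * poly p (1 / s) + (1 / s) ^ m * poly (pderiv p) (1 / s)) * - ((1 / s) * (1 / s)) = (1 / s) ^ Suc m * poly q (1 / s)"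
      by (cases m) (auto simp: q_def algebra_simps)
    finally show ?thesis .
  qed
  obtain C where C: "C > 0" "eventually (\<lambda>s. norm (h s - g s) \<le> C * norm ((1 / s) ^ n)) (strip (B + 1))"
    using p unfolding g_def by (elim landau_o.bigE) auto
  obtain R where R: "\<And>s. Re s \<ge> R \<Longrightarrow> \<bar>Im s\<bar> \<le> B + 1 \<Longrightarrow> norm (h s - g s) \<le> C * norm ((1 / s) ^ n) \<and> h analytic_on {s}"
    using eventually_conj[OF C(2) an[of "B + 1"]] unfolding eventually_strip by blast
  have "eventually (\<lambda>s. norm (deriv h s - (1 / s) ^ Suc m * poly q (1 / s)) \<le> C * 2 ^ n * norm ((1 / s) ^ n)) (strip B)"
    using eventually_strip_Re_ge[of "max 2 (R + 1)"] eventually_strip_Im_le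
  proof eventually_elim
    case (elim s)
    have near: "Re v \<ge> R" "\<bar>Im v\<bar> \<le> B + 1" "norm v \<ge> norm s / 2" "v \<noteq> 0" if "v \<in> cball s 1" for v
    proof -
      have "\<bar>Re (s - v)\<bar> \<le> 1" "\<bar>Im (s - v)\<bar> \<le> 1"
        using that abs_Re_le_cmod[of "s - v"] abs_Im_le_cmod[of "s - v"] by (auto simp: dist_norm)
      then show "Re v \<ge> R" "\<bar>Im v\<bar> \<le> B + 1" using elim by auto
      have "norm s \<le> norm v + norm (s - v)" using norm_triangle_ineq[of v "s - v"] by simp
      moreover have "norm s \<ge> 2" using elim complex_Re_le_cmod[of s] by simp
      moreover have "norm (s - v) \<le> 1" using that by (simp add: dist_norm)
      ultimately show "norm v \<ge> norm s / 2" "v \<noteq> 0" by auto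
    qed
    have an1: "(\<lambda>v. h v - g v) analytic_on {v}" if "v \<in> cball s 1" for v
    proof -
      have "g holomorphic_on - {0}" unfolding g_def by (intro holomorphic_intros) auto
      then have "g analytic_on - {0}" by (simp add: analytic_on_open open_Compl)
      then have "g analytic_on {v}" by (rule analytic_on_subset) (use near(4)[OF that] in auto)
      moreover have "h analytic_on {v}" using R near[OF that] by blast
      ultimately show ?thesis by (intro analytic_intros)
    qed
    then have an2: "(\<lambda>v. h v - g v) analytic_on cball s 1" using analytic_on_analytic_at by blast
    then have hol: "(\<lambda>v. h v - g v) holomorphic_on cball s 1" by (rule analytic_imp_holomorphic)
    have "norm ((deriv ^^ 1) (\<lambda>v. h v - g v) s) \<le> fact 1 * (C * (2 / norm s) ^ n) / 1 ^ 1"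
    proof (rule Cauchy_inequality)
      show "(\<lambda>v. h v - g v) holomorphic_on ball s 1" using hol by (rule holomorphic_on_subset) auto
      show "continuous_on (cball s 1) (\<lambda>v. h v - g v)" using hol by (rule holomorphic_on_imp_continuous_on)
      fix v assume "norm (s - v) = 1"
      then have v: "v \<in> cball s 1" by (simp add: dist_norm)
      have "norm (h v - g v) \<le> C * norm ((1 / v) ^ n)" using R near[OF v] by blast
      also have "norm ((1 / v) ^ n) = (1 / norm v) ^ n" by (simp add: norm_power norm_divide)
      also have "\<dots> \<le> (2 / norm s) ^ n"
      proof (rule power_mono)
        have "norm s > 0" using elim complex_Re_le_cmod[of s] by auto
        then show "1 / norm v \<le> 2 / norm s" using near(3,4)[OF v] by (simp add: field_simps)
      qed simp
      finally show "norm (h v - g v) \<le> C * (2 / norm s) ^ n" using C(1) by simp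
    qed simp
    moreover have "deriv (\<lambda>v. h v - g v) s = deriv h s - (1 / s) ^ Suc m * poly q (1 / s)"
    proof -
      have s: "s \<in> cball s 1" by simp
      have "h field_differentiable at s" using R near[OF s] analytic_on_imp_differentiable_at by blast
      moreover have "g field_differentiable at s" using dg[OF near(4)[OF s]] unfolding field_differentiable_def by blast
      ultimately show ?thesis using DERIV_imp_deriv[OF dg[OF near(4)[OF s]]] by simp
    qed
    ultimately show ?case by (simp add: norm_power norm_divide power_divide)
  qed
  then show "\<exists>q. (\<lambda>s. deriv h s - (1 / s) ^ Suc m * poly q (1 / s)) \<in> O[strip B](\<lambda>s. (1 / s) ^ n)"
    by (intro exI[of _ q] bigoI)
qed

lemma holomorphic_factor_zero:
  assumes k: "k holomorphic_on ball 0 r" and r: "r > 0" and z: "k 0 = 0"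
  shows "\<exists>k'. k' holomorphic_on ball 0 r \<and> (\<forall>u\<in>ball 0 r. k u = u * k' u)"
proof -
  have "(\<lambda>u. if u = 0 then deriv k 0 else (k u - k 0) / (u - 0)) holomorphic_on ball 0 r"
    using k r by (intro pole_lemma) auto
  then show ?thesis using z by (intro exI[of _ "\<lambda>u. if u = 0 then deriv k 0 else (k u - k 0) / (u - 0)"]) auto
qed

text \<open>The shift from \<open>s\<close> to \<open>s + 1\<close> is \<open>u / (1 + u)\<close> in
  the variable \<open>u = 1 / s\<close>. The difference equation with right-hand side
  \<open>u ^ Suc m * k u\<close> is solved formally, one coefficient per step: adding
  \<open>c * u ^ (m + N)\<close> changes the difference by
  \<open>c * (m + N) * u ^ (m + N + 1)\<close> to leading order, and \<open>m + N\<close> is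
  nonzero.\<close>

lemma telescoping_poly:
  assumes k: "k holomorphic_on ball 0 r" and r: "0 < r" "r \<le> 1" and m: "m \<ge> 1"
  shows "\<exists>p k'. k' holomorphic_on ball 0 r \<and> (\<forall>u\<in>ball 0 r. u ^ m * poly p u -
     (u / (1 + u)) ^ m * poly p (u / (1 + u)) - u ^ Suc m * k u = u ^ (Suc m + N) * k' u)"
proof (induction N)
  case 0
  have "(\<lambda>u. - k u) holomorphic_on ball 0 r" using k by (intro holomorphic_intros)
  then show ?case by (intro exI[of _ 0] exI[of _ "\<lambda>u. - k u"]) auto
next
  case (Suc N)
  then obtain p k1 where k1: "k1 holomorphic_on ball 0 r"
    "\<And>u. u \<in> ball 0 r \<Longrightarrow> u ^ m * poly p u - (u / (1 + u)) ^ m * poly p (u / (1 + u)) - u ^ Suc m * k u = u ^ (Suc m + N) * k1 u"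
    by blast
  have ne: "1 + u \<noteq> 0" if "u \<in> ball 0 r" for u :: complex
  proof
    assume "1 + u = 0"
    then have "u = -1" by (simp add: add_eq_0_iff)
    then show False using that r by simp
  qed
  define f where "f = (\<lambda>u::complex. 1 - (1 / (1 + u)) ^ (m + N))"
  have fh: "f holomorphic_on ball 0 r" unfolding f_def using ne by (intro holomorphic_intros) auto
  obtain g where g: "g holomorphic_on ball 0 r" "\<And>u. u \<in> ball 0 r \<Longrightarrow> f u = u * g u"
    using holomorphic_factor_zero[OF fh r(1)] by (auto simp: f_def)
  have g0: "g 0 = of_nat (m + N)"
  proof -
    have "(f has_field_derivative of_nat (m + N)) (at 0)"
      unfolding f_def by (auto intro!: derivative_eq_intros)
    moreover have "((\<lambda>u. u * g u) has_field_derivative g 0) (at 0)"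
    proof -
      have "(g has_field_derivative deriv g 0) (at 0)" using g(1) r(1) by (intro holomorphic_derivI) auto
      then show ?thesis by (auto intro!: derivative_eq_intros)
    qed
    then have "(f has_field_derivative g 0) (at 0)"
      by (rule has_field_derivative_transform_within_open[of _ _ _ "ball 0 r"]) (use r g(2) in auto)
    ultimately show ?thesis using DERIV_unique by blast
  qed
  \<comment> \<open>Cancels the constant term of the previous error \<open>k1\<close>.\<close>
  define c where "c = - k1 0 / of_nat (m + N)"
  have mN: "of_nat (m + N) \<noteq> (0 :: complex)" using m by (simp del: of_nat_add)
  have "(\<lambda>u. k1 u + c * g u) holomorphic_on ball 0 r" using k1(1) g(1) by (intro holomorphic_intros)
  moreover have "k1 0 + c * g 0 = 0" using mN by (simp add: c_def g0 del: of_nat_add)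
  ultimately obtain k2 where k2: "k2 holomorphic_on ball 0 r" "\<And>u. u \<in> ball 0 r \<Longrightarrow> k1 u + c * g u = u * k2 u"
    using holomorphic_factor_zero[OF _ r(1)] by blast
  have "u ^ m * poly (p + monom c N) u - (u / (1 + u)) ^ m * poly (p + monom c N) (u / (1 + u)) - u ^ Suc m * k u = u ^ (Suc m + Suc N) * k2 u"
    if u: "u \<in> ball 0 r" for u
  proof -
    have "u ^ m * poly (p + monom c N) u - (u / (1 + u)) ^ m * poly (p + monom c N) (u / (1 + u)) - u ^ Suc m * k u =
       (u ^ m * poly p u - (u / (1 + u)) ^ m * poly p (u / (1 + u)) - u ^ Suc m * k u) + c * (u ^ m * u ^ N - (u / (1 + u)) ^ m * (u / (1 + u)) ^ N)"
      by (simp add: poly_monom algebra_simps)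
    also have "u ^ m * u ^ N - (u / (1 + u)) ^ m * (u / (1 + u)) ^ N = u ^ (m + N) * f u"
      by (simp add: f_def power_add power_divide algebra_simps)
    also have "\<dots> = u ^ (m + N) * (u * g u)" using g(2)[OF u] by simp
    also have "(u ^ m * poly p u - (u / (1 + u)) ^ m * poly p (u / (1 + u)) - u ^ Suc m * k u) = u ^ (Suc m + N) * k1 u"
      by (rule k1(2)[OF u])
    also have "u ^ (Suc m + N) * k1 u + c * (u ^ (m + N) * (u * g u)) = u ^ (Suc m + N) * (k1 u + c * g u)"
      by (simp add: algebra_simps)
    also have "\<dots> = u ^ (Suc m + Suc N) * k2 u" using k2(2)[OF u] by simp
    finally show ?thesis .
  qed
  then show ?case using k2(1) by blast
qed

text \<open>A substitute for Euler-Maclaurin summation: up to remainders the terms are differences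
  of consecutive values of one polynomial in \<open>1 / (s + j)\<close>, so the sum collapses to its
  value at \<open>j = 0\<close>.\<close>

lemma expansion_telescoping_sum:
  assumes k: "k holomorphic_on ball 0 r" and r: "0 < r" "r \<le> 1" and m: "m \<ge> 1"
    and sums: "\<And>B. eventually (\<lambda>s. (\<lambda>j. (1 / (s + of_nat j)) ^ Suc m * k (1 / (s + of_nat j))) sums S s) (strip B)"
  shows "expansion m S"
proof (rule expansionI)
  fix B and N :: nat
  obtain p k' where k': "k' holomorphic_on ball 0 r"
    "\<And>u. u \<in> ball 0 r \<Longrightarrow> u ^ m * poly p u - (u / (1 + u)) ^ m * poly p (u / (1 + u)) - u ^ Suc m * k u = u ^ (Suc m + N) * k' u"
    using telescoping_poly[OF k r m, of N] by blast
  have "compact (k' ` cball 0 (r / 2))"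
    using r by (intro compact_continuous_image holomorphic_on_imp_continuous_on holomorphic_on_subset[OF k'(1)]) auto
  then obtain K where K: "\<And>u. u \<in> cball 0 (r / 2) \<Longrightarrow> norm (k' u) \<le> K"
    by (meson bounded_iff compact_imp_bounded imageI)
  have "norm (k' 0) \<le> K" using K[of 0] r by simp
  then have K0: "K \<ge> 0" by (rule order_trans[OF norm_ge_zero])
  define C where "C = K * (\<Sum>j. (1 / real (Suc j)) ^ 2)"
  have summ: "summable (\<lambda>j. (1 / real (Suc j)) ^ 2)"
    using inverse_squares_sums by (auto simp: sums_iff power_divide add.commute)
  have "eventually (\<lambda>s. norm (S s - (1 / s) ^ m * poly p (1 / s)) \<le> C * 2 ^ N * norm ((1 / s) ^ N)) (strip B)"
    using sums[of B] eventually_strip_norm_le eventually_strip_Re_ge[of "max 1 (2 / r)"]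
  proof eventually_elim
    case (elim s)
    define u where "u = (\<lambda>j. 1 / (s + of_nat j))"
    define P where "P = (\<lambda>u. u ^ m * poly p u)"
    have Rs: "Re s \<ge> 1" "Re s \<ge> 2 / r" using elim by auto
    have ns: "norm (s + of_nat j) \<ge> Re s + real j" for j
      using complex_Re_le_cmod[of "s + of_nat j"] by simp
    have nz: "s + of_nat j \<noteq> 0" for j using ns[of j] Rs by auto
    have u1: "norm (u j) \<le> 1 / (Re s + real j)" for j
      using ns[of j] Rs by (simp add: u_def norm_divide frac_le)
    have ur: "u j \<in> cball 0 (r / 2)" for j
    proof -
      have "1 / (Re s + real j) \<le> 1 / (2 / r)" using Rs r by (intro divide_left_mono) auto
      then show ?thesis using u1[of j] by simp
    qed
    have urb: "u j \<in> ball 0 r" for j using ur[of j] r by simp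
    have uS: "u j / (1 + u j) = u (Suc j)" for j
      using nz[of j] nz[of "Suc j"] by (simp add: u_def field_simps)
    have step: "(u j) ^ Suc m * k (u j) = (P (u j) - P (u (Suc j))) - (u j) ^ (Suc m + N) * k' (u j)" for j
      using k'(2)[OF urb[of j]] unfolding uS P_def by (simp add: algebra_simps)
    have lim: "u \<longlonglongrightarrow> 0"
    proof (rule Lim_null_comparison)
      show "\<forall>\<^sub>F j in sequentially. norm (u j) \<le> 1 / (Re s + real j)" using u1 by simp
      show "(\<lambda>j. 1 / (Re s + real j)) \<longlonglongrightarrow> 0" by real_asymp
    qed
    have "(\<lambda>j. P (u j)) \<longlonglongrightarrow> P 0"
      unfolding P_def by (intro tendsto_intros lim)
    moreover have "P 0 = 0" using m by (simp add: P_def)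
    ultimately have "(\<lambda>j. P (u j)) \<longlonglongrightarrow> 0" by simp
    then have "(\<lambda>j. P (u j) - P (u (Suc j))) sums (P (u 0) - 0)"
      by (rule telescope_sums')
    from sums_diff[OF this elim(1)[folded u_def]]
    have "(\<lambda>j. (u j) ^ (Suc m + N) * k' (u j)) sums (P (u 0) - S s)"
      using step by (simp add: u_def)
    then have eq: "P (u 0) - S s = (\<Sum>j. (u j) ^ (Suc m + N) * k' (u j))" by (simp add: sums_iff)
    \<comment> \<open>\<open>N\<close> of the factors give the decay in \<open>s\<close>; the
      remaining \<open>m + 1\<close>, at least two, make the sum over \<open>j\<close>
      converge.\<close>
    have bnd: "norm ((u j) ^ (Suc m + N) * k' (u j)) \<le> K * (1 / Re s) ^ N * (1 / real (Suc j)) ^ 2" for j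
    proof -
      have "norm (u j) ^ (Suc m + N) \<le> (1 / (Re s + real j)) ^ (Suc m + N)"
        by (intro power_mono u1) simp
      also have "\<dots> = (1 / (Re s + real j)) ^ N * (1 / (Re s + real j)) ^ Suc m" by (simp add: power_add mult_ac)
      also have "\<dots> \<le> (1 / Re s) ^ N * (1 / real (Suc j)) ^ 2"
      proof (rule mult_mono)
        show "(1 / (Re s + real j)) ^ N \<le> (1 / Re s) ^ N" using Rs by (intro power_mono divide_left_mono) auto
        have "(1 / (Re s + real j)) ^ Suc m \<le> (1 / real (Suc j)) ^ Suc m"
          using Rs by (intro power_mono divide_left_mono) auto
        also have "\<dots> \<le> (1 / real (Suc j)) ^ 2" using m by (intro power_decreasing) auto
        finally show "(1 / (Re s + real j)) ^ Suc m \<le> (1 / real (Suc j)) ^ 2" .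
      qed (use Rs in auto)
      finally have "norm (u j) ^ (Suc m + N) * norm (k' (u j)) \<le> ((1 / Re s) ^ N * (1 / real (Suc j)) ^ 2) * K"
        using K[OF ur[of j]] Rs by (intro mult_mono) auto
      then show ?thesis by (simp only: norm_mult norm_power mult_ac)
    qed
    have sm: "summable (\<lambda>j. K * (1 / Re s) ^ N * (1 / real (Suc j)) ^ 2)"
      by (intro summable_mult summ)
    have "norm (P (u 0) - S s) \<le> (\<Sum>j. K * (1 / Re s) ^ N * (1 / real (Suc j)) ^ 2)"
      unfolding eq by (rule norm_suminf_le[OF bnd sm])
    also have "\<dots> = K * (1 / Re s) ^ N * (\<Sum>j. (1 / real (Suc j)) ^ 2)"
      by (rule suminf_mult[OF summ])
    also have "\<dots> = C * (1 / Re s) ^ N" by (simp add: C_def)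
    also have "\<dots> \<le> C * (2 / norm s) ^ N"
    proof (intro mult_left_mono power_mono)
      show "C \<ge> 0" unfolding C_def using K0 summ by (intro mult_nonneg_nonneg suminf_nonneg) auto
      show "1 / Re s \<le> 2 / norm s" using elim Rs nz[of 0] by (simp add: field_simps)
    qed (use Rs in auto)
    finally show ?case by (simp add: P_def u_def norm_minus_commute norm_power norm_divide power_divide)
  qed
  then show "\<exists>p. (\<lambda>s. S s - (1 / s) ^ m * poly p (1 / s)) \<in> O[strip B](\<lambda>s. (1 / s) ^ N)"
    by (intro exI[of _ p] bigoI)
qed

section \<open>Functions with a tame logarithmic derivative\<close>

definition ev_strips :: "(complex \<Rightarrow> bool) \<Rightarrow> bool" where
  "ev_strips P \<longleftrightarrow> (\<forall>B. eventually P (strip B))"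

lemma ev_stripsD: "ev_strips P \<Longrightarrow> eventually P (strip B)" by (simp add: ev_strips_def)

lemma ev_strips_mono: "ev_strips P \<Longrightarrow> (\<And>s. P s \<Longrightarrow> Q s) \<Longrightarrow> ev_strips Q"
  unfolding ev_strips_def by (metis (mono_tags, lifting) eventually_mono)

lemma ev_strips_conj: "ev_strips P \<Longrightarrow> ev_strips Q \<Longrightarrow> ev_strips (\<lambda>s. P s \<and> Q s)"
  by (simp add: ev_strips_def eventually_conj)

lemma ev_strips_all: "(\<And>s. P s) \<Longrightarrow> ev_strips P"
  by (auto simp: ev_strips_def intro: always_eventually)

lemma analytic_affine:
  assumes "f analytic_on {a * s + b}" shows "(\<lambda>s. f (a * s + b)) analytic_on {s}"
proof -
  have "(\<lambda>s. a * s + b) analytic_on {s}" by (intro analytic_intros)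
  from analytic_on_compose[OF this, of f] assms show ?thesis by (simp add: o_def)
qed

lemma ev_strips_Re_ge: "ev_strips (\<lambda>s. Re s \<ge> c)"
  by (simp add: ev_strips_def eventually_strip_Re_ge)

lemma ev_strips_affine:
  assumes "ev_strips P" "\<alpha> > 0" shows "ev_strips (\<lambda>s. P (complex_of_real \<alpha> * s + \<beta>))"
  using assms(1) filterlim_strip_affine[OF assms(2)] unfolding ev_strips_def filterlim_iff by blast

text \<open>An identity valid in all strips holds near every far point, one unit of width being
  spent; this is what permits differentiating both sides.\<close>

lemma ev_strips_nhds:
  assumes "ev_strips P" shows "ev_strips (\<lambda>s. eventually P (nhds s))"
  unfolding ev_strips_def
proof
  fix B
  obtain R where R: "\<And>s. Re s \<ge> R \<Longrightarrow> \<bar>Im s\<bar> \<le> B + 1 \<Longrightarrow> P s"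
    using ev_stripsD[OF assms, of "B + 1"] unfolding eventually_strip by blast
  show "\<forall>\<^sub>F s in strip B. eventually P (nhds s)"
    unfolding eventually_strip
  proof (intro exI[of _ "R + 1"] allI impI)
    fix s assume s: "R + 1 \<le> Re s" "\<bar>Im s\<bar> \<le> B"
    have "P v" if "v \<in> ball s 1" for v
    proof (rule R)
      have "\<bar>Re (s - v)\<bar> < 1" "\<bar>Im (s - v)\<bar> < 1"
        using that abs_Re_le_cmod[of "s - v"] abs_Im_le_cmod[of "s - v"] by (auto simp: dist_norm)
      then show "R \<le> Re v" "\<bar>Im v\<bar> \<le> B + 1" using s by auto
    qed
    then show "eventually P (nhds s)"
      by (meson centre_in_ball eventually_nhds open_ball zero_less_one)
  qed
qed

lemma ev_strips_deriv_cong: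
  assumes "ev_strips (\<lambda>s. f s = g s)" shows "ev_strips (\<lambda>s. deriv f s = deriv g s)"
  using ev_strips_nhds[OF assms] by (rule ev_strips_mono) (rule deriv_cong_ev, auto)

lemma expansion_cong_ev_strips: "ev_strips (\<lambda>s. f s = g s) \<Longrightarrow> expansion m g \<Longrightarrow> expansion m f"
  unfolding ev_strips_def by (rule expansion_cong) auto

lemma ev_strips_analytic_deriv: "ev_strips (\<lambda>s. f analytic_on {s}) \<Longrightarrow> ev_strips (\<lambda>s. deriv f analytic_on {s})"
  by (erule ev_strips_mono) (rule analytic_deriv)

lemma ev_strips_analytic_cong:
  assumes "ev_strips (\<lambda>s. f s = g s)" "ev_strips (\<lambda>s. g analytic_on {s})"
  shows "ev_strips (\<lambda>s. f analytic_on {s})"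
  using ev_strips_conj[OF ev_strips_nhds[OF assms(1)] assms(2)]
  by (rule ev_strips_mono) (use analytic_at_cong in blast)

text \<open>Meant for logarithmic derivatives \<open>l\<close>. These may grow like log s or s log s
  themselves; only after two derivatives is an expansion in powers left.\<close>

definition tame :: "(complex \<Rightarrow> complex) \<Rightarrow> bool" where
  "tame l \<longleftrightarrow> ev_strips (\<lambda>s. l analytic_on {s}) \<and> expansion 1 (deriv (deriv l))"

lemma tame_cong:
  assumes "ev_strips (\<lambda>s. f s = g s)" "tame g" shows "tame f"
  using assms ev_strips_analytic_cong[OF assms(1)] expansion_cong_ev_strips[OF ev_strips_deriv_cong[OF ev_strips_deriv_cong[OF assms(1)]]]
  by (auto simp: tame_def)

lemma tame_add:
  assumes "tame f" "tame g" shows "tame (\<lambda>s. f s + g s)"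
proof -
  have an: "ev_strips (\<lambda>s. f analytic_on {s} \<and> g analytic_on {s})"
    using assms by (auto simp: tame_def intro: ev_strips_conj)
  have d: "ev_strips (\<lambda>s. deriv (\<lambda>s. f s + g s) s = deriv f s + deriv g s)"
    using an by (rule ev_strips_mono) (auto intro!: deriv_add analytic_on_imp_differentiable_at)
  have "ev_strips (\<lambda>s. deriv (deriv (\<lambda>s. f s + g s)) s = deriv (\<lambda>s. deriv f s + deriv g s) s)"
    by (rule ev_strips_deriv_cong[OF d])
  moreover have "ev_strips (\<lambda>s. deriv (\<lambda>s. deriv f s + deriv g s) s = deriv (deriv f) s + deriv (deriv g) s)"
    using an by (rule ev_strips_mono) (auto intro!: deriv_add analytic_on_imp_differentiable_at[OF analytic_deriv])
  ultimately have "ev_strips (\<lambda>s. deriv (deriv (\<lambda>s. f s + g s)) s = deriv (deriv f) s + deriv (deriv g) s)"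
    by (rule ev_strips_mono[OF ev_strips_conj]) auto
  then have "expansion 1 (deriv (deriv (\<lambda>s. f s + g s)))"
    by (rule expansion_cong_ev_strips) (use assms in \<open>auto simp: tame_def intro: expansion_add\<close>)
  moreover have "ev_strips (\<lambda>s. (\<lambda>s. f s + g s) analytic_on {s})"
    using an by (rule ev_strips_mono) (auto intro: analytic_intros)
  ultimately show ?thesis by (simp add: tame_def)
qed

lemma tame_affine_fun: "tame (\<lambda>s. a * s + b)"
proof -
  have "deriv (\<lambda>s. a * s + b) = (\<lambda>s. a)" by (rule ext, rule DERIV_imp_deriv) (auto intro!: derivative_eq_intros)
  then show ?thesis unfolding tame_def by (auto simp: expansion_zero intro!: ev_strips_all analytic_intros)
qed

lemma tame_const: "tame (\<lambda>s. b)" using tame_affine_fun[of 0 b] by simp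

lemma tame_affine:
  assumes "tame f" and \<alpha>: "\<alpha> > 0" shows "tame (\<lambda>s. c * f (complex_of_real \<alpha> * s + \<beta>))"
proof -
  let ?t = "\<lambda>s. complex_of_real \<alpha> * s + \<beta>"
  have an0: "ev_strips (\<lambda>s. f analytic_on {s})" using assms by (simp add: tame_def)
  have an: "ev_strips (\<lambda>s. f analytic_on {?t s})" by (rule ev_strips_affine[OF an0 \<alpha>])
  have t: "(?t has_field_derivative of_real \<alpha>) (at s)" for s by (auto intro!: derivative_eq_intros)
  have chain: "deriv (\<lambda>s. k * h (?t s)) s = k * (of_real \<alpha> * deriv h (?t s))" if "h analytic_on {?t s}" for h k s
  proof -
    have "(h has_field_derivative deriv h (?t s)) (at (?t s))"
      using analytic_on_imp_differentiable_at[OF that] by (simp add: field_differentiable_derivI)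
    from DERIV_chain2[OF this t] have "((\<lambda>s. k * h (?t s)) has_field_derivative k * (deriv h (?t s) * of_real \<alpha>)) (at s)"
      by (rule DERIV_cmult)
    then show ?thesis by (simp add: DERIV_imp_deriv mult_ac)
  qed
  have "ev_strips (\<lambda>s. deriv (\<lambda>s. c * f (?t s)) s = c * of_real \<alpha> * deriv f (?t s))"
    using an by (rule ev_strips_mono) (simp add: chain mult.assoc)
  from ev_strips_deriv_cong[OF this] have "ev_strips (\<lambda>s. deriv (deriv (\<lambda>s. c * f (?t s))) s = deriv (\<lambda>s. c * of_real \<alpha> * deriv f (?t s)) s)" .
  moreover have "ev_strips (\<lambda>s. deriv (\<lambda>s. c * of_real \<alpha> * deriv f (?t s)) s = c * of_real \<alpha> * of_real \<alpha> * deriv (deriv f) (?t s))"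
    using an
  proof (rule ev_strips_mono)
    fix s assume "f analytic_on {?t s}"
    from chain[OF analytic_deriv[OF this], of "c * of_real \<alpha>"]
    show "deriv (\<lambda>s. c * of_real \<alpha> * deriv f (?t s)) s = c * of_real \<alpha> * of_real \<alpha> * deriv (deriv f) (?t s)"
      by (simp only: mult.assoc)
  qed
  ultimately have "ev_strips (\<lambda>s. deriv (deriv (\<lambda>s. c * f (?t s))) s = c * of_real \<alpha> * of_real \<alpha> * deriv (deriv f) (?t s))"
    by (rule ev_strips_mono[OF ev_strips_conj]) auto
  then have "expansion 1 (deriv (deriv (\<lambda>s. c * f (?t s))))"
    by (rule expansion_cong_ev_strips) (use assms in \<open>auto simp: tame_def intro!: expansion_cmult expansion_affine\<close>)
  moreover have "ev_strips (\<lambda>s. (\<lambda>s. c * f (?t s)) analytic_on {s})"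
    using an
  proof (rule ev_strips_mono)
    fix s assume "f analytic_on {?t s}"
    then have "(\<lambda>s. f (?t s)) analytic_on {s}" by (rule analytic_affine)
    then show "(\<lambda>s. c * f (?t s)) analytic_on {s}" by (intro analytic_intros)
  qed
  ultimately show ?thesis by (simp add: tame_def)
qed

lemma tame_cmult: "tame f \<Longrightarrow> tame (\<lambda>s. c * f s)"
  using tame_affine[of f 1 c 0] by simp

lemma tame_expansion: "ev_strips (\<lambda>s. l analytic_on {s}) \<Longrightarrow> expansion m l \<Longrightarrow> tame l"
proof -
  assume an: "ev_strips (\<lambda>s. l analytic_on {s})" and "expansion m l"
  then have "expansion (Suc (Suc m)) (deriv (deriv l))"
    by (intro expansion_deriv ev_stripsD ev_strips_analytic_deriv)
  then have "expansion (1 + Suc m) (deriv (deriv l))" by simp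
  then show ?thesis using expansion_mono an by (simp add: tame_def)
qed

definition ev_sector :: "(complex \<Rightarrow> bool) \<Rightarrow> bool" where
  "ev_sector P \<longleftrightarrow> (\<exists>\<epsilon>>0. \<exists>R. \<forall>s. Re s \<ge> R \<longrightarrow> \<bar>Im s\<bar> \<le> \<epsilon> * Re s \<longrightarrow> P s)"

lemma ev_sector_ev_strips: "ev_sector P \<Longrightarrow> ev_strips P"
proof -
  assume "ev_sector P"
  then obtain \<epsilon> R where \<epsilon>: "\<epsilon> > 0" "\<And>s. Re s \<ge> R \<Longrightarrow> \<bar>Im s\<bar> \<le> \<epsilon> * Re s \<Longrightarrow> P s"
    unfolding ev_sector_def by blast
  show ?thesis unfolding ev_strips_def eventually_strip
  proof (intro allI exI impI)
    fix B s assume s: "max R (B / \<epsilon>) \<le> Re s" "\<bar>Im s\<bar> \<le> B"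
    then have "B \<le> \<epsilon> * Re s" using \<epsilon>(1) by (simp add: field_simps)
    then show "P s" using s \<epsilon>(2) by auto
  qed
qed

lemma ev_sector_mono: "ev_sector P \<Longrightarrow> (\<And>s. P s \<Longrightarrow> Q s) \<Longrightarrow> ev_sector Q"
  unfolding ev_sector_def by meson

lemma ev_sector_conj:
  assumes "ev_sector P" "ev_sector Q" shows "ev_sector (\<lambda>s. P s \<and> Q s)"
proof -
  obtain \<epsilon>1 R1 where 1: "\<epsilon>1 > 0" "\<And>s. Re s \<ge> R1 \<Longrightarrow> \<bar>Im s\<bar> \<le> \<epsilon>1 * Re s \<Longrightarrow> P s"
    using assms(1) unfolding ev_sector_def by blast
  obtain \<epsilon>2 R2 where 2: "\<epsilon>2 > 0" "\<And>s. Re s \<ge> R2 \<Longrightarrow> \<bar>Im s\<bar> \<le> \<epsilon>2 * Re s \<Longrightarrow> Q s"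
    using assms(2) unfolding ev_sector_def by blast
  show ?thesis unfolding ev_sector_def
  proof (intro exI conjI allI impI)
    show "min \<epsilon>1 \<epsilon>2 > 0" using 1 2 by simp
    fix s assume s: "max 0 (max R1 R2) \<le> Re s" "\<bar>Im s\<bar> \<le> min \<epsilon>1 \<epsilon>2 * Re s"
    have "min \<epsilon>1 \<epsilon>2 * Re s \<le> \<epsilon>1 * Re s" "min \<epsilon>1 \<epsilon>2 * Re s \<le> \<epsilon>2 * Re s"
      using s by (intro mult_right_mono; simp)+
    then show "P s" "Q s" using s 1(2)[of s] 2(2)[of s] by auto
  qed
qed

lemma ev_sector_Re_gt:
  assumes "\<And>s. Re s > R \<Longrightarrow> P s" shows "ev_sector P"
  unfolding ev_sector_def by (intro exI[of _ 1] exI[of _ "R + 1"] conjI) (auto intro!: assms)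

lemma ev_sector_affine:
  assumes "ev_sector P" and \<alpha>: "\<alpha> > 0" shows "ev_sector (\<lambda>s. P (complex_of_real \<alpha> * s + \<beta>))"
proof -
  obtain \<epsilon> R where \<epsilon>: "\<epsilon> > 0" "\<And>s. Re s \<ge> R \<Longrightarrow> \<bar>Im s\<bar> \<le> \<epsilon> * Re s \<Longrightarrow> P s"
    using assms(1) unfolding ev_sector_def by blast
  \<comment> \<open>Beyond \<open>R'\<close> the given half of the opening leaves room for the shift
    by \<open>\<beta>\<close>.\<close>
  define R' where "R' = max ((R - Re \<beta>) / \<alpha>) ((\<bar>Im \<beta>\<bar> - \<epsilon> * Re \<beta>) / (\<epsilon> / 2 * \<alpha>))"
  show ?thesis unfolding ev_sector_def
  proof (intro exI conjI allI impI)
    show "\<epsilon> / 2 > 0" using \<epsilon> by simp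
    fix s assume s: "R' \<le> Re s" "\<bar>Im s\<bar> \<le> \<epsilon> / 2 * Re s"
    show "P (complex_of_real \<alpha> * s + \<beta>)"
    proof (rule \<epsilon>(2))
      have "(R - Re \<beta>) / \<alpha> \<le> Re s" using s by (simp add: R'_def)
      then show "R \<le> Re (complex_of_real \<alpha> * s + \<beta>)" using \<alpha> by (simp add: field_simps)
      have "(\<bar>Im \<beta>\<bar> - \<epsilon> * Re \<beta>) / (\<epsilon> / 2 * \<alpha>) \<le> Re s" using s by (simp add: R'_def)
      then have 1: "\<bar>Im \<beta>\<bar> - \<epsilon> * Re \<beta> \<le> \<epsilon> / 2 * \<alpha> * Re s" using \<alpha> \<epsilon>(1) by (simp add: field_simps)
      have "\<bar>Im (complex_of_real \<alpha> * s + \<beta>)\<bar> \<le> \<bar>\<alpha> * Im s\<bar> + \<bar>Im \<beta>\<bar>"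
        using abs_triangle_ineq[of "\<alpha> * Im s" "Im \<beta>"] by simp
      also have "\<bar>\<alpha> * Im s\<bar> = \<alpha> * \<bar>Im s\<bar>" using \<alpha> by (simp add: abs_mult)
      also have "\<alpha> * \<bar>Im s\<bar> \<le> \<alpha> * (\<epsilon> / 2 * Re s)" using \<alpha> s by (intro mult_left_mono) auto
      finally show "\<bar>Im (complex_of_real \<alpha> * s + \<beta>)\<bar> \<le> \<epsilon> * Re (complex_of_real \<alpha> * s + \<beta>)"
        using 1 by (simp add: algebra_simps)
    qed
  qed
qed

definition log_deriv :: "(complex \<Rightarrow> complex) \<Rightarrow> complex \<Rightarrow> complex" where
  "log_deriv f = (\<lambda>w. deriv f w / f w)"

lemma log_deriv3_eq: "log_deriv3 f = deriv (deriv (log_deriv f))"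
  by (simp add: log_deriv3_def log_deriv_def)

text \<open>A sector, and not only strips, has to be free of zeros \<open>y\<close>, so that \<open>\<bar>z - y + x\<bar>\<close> is at least a
  constant multiple of \<open>\<bar>z - y\<bar> + x\<close>.\<close>

definition nice :: "(complex \<Rightarrow> complex) \<Rightarrow> bool" where
  "nice f \<longleftrightarrow> ev_sector (\<lambda>s. f analytic_on {s} \<and> f s \<noteq> 0) \<and> tame (log_deriv f)"

lemma nice_mult:
  assumes "nice f" "nice g" shows "nice (\<lambda>s. f s * g s)"
proof -
  have an: "ev_sector (\<lambda>s. (f analytic_on {s} \<and> f s \<noteq> 0) \<and> (g analytic_on {s} \<and> g s \<noteq> 0))"
    by (rule ev_sector_conj) (use assms in \<open>simp_all add: nice_def\<close>)
  have "ev_strips (\<lambda>s. log_deriv (\<lambda>s. f s * g s) s = log_deriv f s + log_deriv g s)"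
    using ev_sector_ev_strips[OF an]
  proof (rule ev_strips_mono)
    fix s assume s: "(f analytic_on {s} \<and> f s \<noteq> 0) \<and> (g analytic_on {s} \<and> g s \<noteq> 0)"
    then have "deriv (\<lambda>s. f s * g s) s = f s * deriv g s + deriv f s * g s"
      by (intro complex_derivative_mult_at) (auto intro: analytic_on_imp_differentiable_at)
    then show "log_deriv (\<lambda>s. f s * g s) s = log_deriv f s + log_deriv g s"
      using s by (simp add: log_deriv_def field_simps)
  qed
  then have "tame (log_deriv (\<lambda>s. f s * g s))"
    by (rule tame_cong) (use assms in \<open>auto simp: nice_def intro: tame_add\<close>)
  moreover have "ev_sector (\<lambda>s. (\<lambda>s. f s * g s) analytic_on {s} \<and> f s * g s \<noteq> 0)"
    using an by (rule ev_sector_mono) (auto intro: analytic_intros)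
  ultimately show ?thesis by (simp add: nice_def)
qed

lemma nice_inverse:
  assumes "nice f" shows "nice (\<lambda>s. inverse (f s))"
proof -
  have an: "ev_sector (\<lambda>s. f analytic_on {s} \<and> f s \<noteq> 0)" using assms by (simp add: nice_def)
  have "ev_strips (\<lambda>s. log_deriv (\<lambda>s. inverse (f s)) s = (-1) * log_deriv f s)"
    using ev_sector_ev_strips[OF an]
  proof (rule ev_strips_mono)
    fix s assume s: "f analytic_on {s} \<and> f s \<noteq> 0"
    have "(f has_field_derivative deriv f s) (at s)"
      using s analytic_on_imp_differentiable_at[of f "{s}" s] by (simp add: field_differentiable_derivI)
    from DERIV_inverse'[OF this] s have "deriv (\<lambda>s. inverse (f s)) s = - (inverse (f s) * deriv f s * inverse (f s))"
      by (intro DERIV_imp_deriv) auto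
    then show "log_deriv (\<lambda>s. inverse (f s)) s = (-1) * log_deriv f s"
      using s by (simp add: log_deriv_def field_simps)
  qed
  then have "tame (log_deriv (\<lambda>s. inverse (f s)))"
    by (rule tame_cong) (rule tame_cmult, use assms in \<open>simp add: nice_def\<close>)
  moreover have "ev_sector (\<lambda>s. (\<lambda>s. inverse (f s)) analytic_on {s} \<and> inverse (f s) \<noteq> 0)"
    using an by (rule ev_sector_mono) (auto intro: analytic_intros)
  ultimately show ?thesis by (simp add: nice_def)
qed

lemma nice_const: "c \<noteq> 0 \<Longrightarrow> nice (\<lambda>s. c)"
  using tame_const[of 0] ev_sector_Re_gt[of 0 "\<lambda>s. (\<lambda>s. c) analytic_on {s} \<and> c \<noteq> 0"]
  by (simp add: nice_def log_deriv_def)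

lemma nice_divide: "nice f \<Longrightarrow> nice g \<Longrightarrow> nice (\<lambda>s. f s / g s)"
  unfolding divide_inverse by (intro nice_mult nice_inverse)

lemma nice_power: "nice f \<Longrightarrow> nice (\<lambda>s. f s ^ n)"
  by (induction n) (auto intro: nice_mult nice_const)

lemma nice_power_int: "nice f \<Longrightarrow> nice (\<lambda>s. f s powi n)"
  unfolding power_int_def by (cases "n \<ge> 0") (auto intro: nice_power nice_inverse)

lemma nice_prod: "(\<And>i. i \<in> I \<Longrightarrow> nice (f i)) \<Longrightarrow> nice (\<lambda>s. \<Prod>i\<in>I. f i s)"
  by (induction I rule: infinite_finite_induct) (auto intro: nice_mult nice_const)

lemma nice_affine:
  assumes "nice f" and \<alpha>: "\<alpha> > 0" shows "nice (\<lambda>s. f (complex_of_real \<alpha> * s + \<beta>))"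
proof -
  let ?t = "\<lambda>s. complex_of_real \<alpha> * s + \<beta>"
  have an: "ev_sector (\<lambda>s. f analytic_on {?t s} \<and> f (?t s) \<noteq> 0)"
    using ev_sector_affine[OF _ \<alpha>] assms(1) unfolding nice_def by blast
  have "ev_strips (\<lambda>s. log_deriv (\<lambda>s. f (?t s)) s = of_real \<alpha> * log_deriv f (?t s))"
    using ev_sector_ev_strips[OF an]
  proof (rule ev_strips_mono)
    fix s assume s: "f analytic_on {?t s} \<and> f (?t s) \<noteq> 0"
    have t: "(?t has_field_derivative of_real \<alpha>) (at s)" by (auto intro!: derivative_eq_intros)
    have "(f has_field_derivative deriv f (?t s)) (at (?t s))"
      using s analytic_on_imp_differentiable_at[of f "{?t s}" "?t s"] by (simp add: field_differentiable_derivI)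
    from DERIV_imp_deriv[OF DERIV_chain2[OF this t]]
    show "log_deriv (\<lambda>s. f (?t s)) s = of_real \<alpha> * log_deriv f (?t s)"
      by (simp add: log_deriv_def)
  qed
  then have "tame (log_deriv (\<lambda>s. f (?t s)))"
    by (rule tame_cong) (use assms in \<open>auto simp: nice_def intro: tame_affine\<close>)
  moreover have "ev_sector (\<lambda>s. (\<lambda>s. f (?t s)) analytic_on {s} \<and> f (?t s) \<noteq> 0)"
    using an
  proof (rule ev_sector_mono)
    fix s assume s: "f analytic_on {?t s} \<and> f (?t s) \<noteq> 0"
    then show "(\<lambda>s. f (?t s)) analytic_on {s} \<and> f (?t s) \<noteq> 0"
      by (auto intro: analytic_affine)
  qed
  ultimately show ?thesis by (simp add: nice_def)
qed

lemma nice_cong: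
  assumes "ev_sector (\<lambda>s. f s = g s)" "ev_sector (\<lambda>s. f analytic_on {s})" "nice g"
  shows "nice f"
proof -
  have eq: "ev_strips (\<lambda>s. f s = g s)" by (rule ev_sector_ev_strips[OF assms(1)])
  have "ev_strips (\<lambda>s. log_deriv f s = log_deriv g s)"
    unfolding log_deriv_def by (rule ev_strips_mono[OF ev_strips_conj[OF eq ev_strips_deriv_cong[OF eq]]]) auto
  then have "tame (log_deriv f)" by (rule tame_cong) (use assms in \<open>simp add: nice_def\<close>)
  moreover have "ev_sector (\<lambda>s. f analytic_on {s} \<and> f s \<noteq> 0)"
    by (rule ev_sector_mono[OF ev_sector_conj[OF ev_sector_conj[OF assms(1,2)]]]) (use assms(3) in \<open>auto simp: nice_def\<close>)
  ultimately show ?thesis by (simp add: nice_def)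
qed

section \<open>The gamma factors\<close>

lemma nonpos_Ints_Re: "Re s > 0 \<Longrightarrow> s \<notin> \<int>\<^sub>\<le>\<^sub>0"
  by (auto elim!: nonpos_Ints_cases)

text \<open>The trigamma function is the sum of \<open>1 / (s + j) ^ 2\<close>, a telescoping
  situation with \<open>k = 1\<close>. Expansions of the higher Polygamma functions then follow by
  differentiation.\<close>

lemma expansion_Polygamma_1: "expansion 1 (Polygamma 1)"
proof (rule expansion_telescoping_sum[where k = "\<lambda>_. 1" and r = 1])
  fix B
  show "\<forall>\<^sub>F s in strip B. (\<lambda>j. (1 / (s + of_nat j)) ^ Suc 1 * 1) sums Polygamma 1 s"
    using eventually_strip_ne_0
  proof eventually_elim
    case (elim s)
    then show ?case using Polygamma_LIMSEQ[of s 1] by (simp add: power_divide divide_inverse)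
  qed
qed auto

lemma ev_strips_deriv_Polygamma: "ev_strips (\<lambda>s. deriv (Polygamma n) s = Polygamma (Suc n) s)"
  using ev_strips_Re_ge[of 1] by (rule ev_strips_mono) (auto intro!: deriv_Polygamma nonpos_Ints_Re)

lemma Polygamma_analytic: "Re s > 0 \<Longrightarrow> Polygamma n analytic_on {s}"
  using nonpos_Ints_Re by (intro analytic_on_Polygamma) auto

lemma ev_strips_Polygamma_analytic: "ev_strips (\<lambda>s. Polygamma n analytic_on {s})"
  using ev_strips_Re_ge[of 1] by (rule ev_strips_mono) (auto intro!: Polygamma_analytic)

lemma expansion_Polygamma: "expansion (Suc n) (Polygamma (Suc n))"
proof (induction n)
  case 0
  then show ?case using expansion_Polygamma_1 by simp
next
  case (Suc n)
  have "expansion (Suc (Suc n)) (deriv (Polygamma (Suc n)))"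
    by (intro expansion_deriv Suc ev_stripsD ev_strips_Polygamma_analytic)
  moreover have "ev_strips (\<lambda>s. Polygamma (Suc (Suc n)) s = deriv (Polygamma (Suc n)) s)"
    using ev_strips_deriv_Polygamma[of "Suc n"] by (rule ev_strips_mono) simp
  ultimately show ?case using expansion_cong_ev_strips by blast
qed

lemma tame_Digamma: "tame Digamma"
proof -
  have 1: "ev_strips (\<lambda>s. deriv (deriv Digamma) s = deriv (Polygamma 1) s)"
    using ev_strips_deriv_cong[OF ev_strips_deriv_Polygamma[of 0]] by simp
  have "expansion (1 + 1) (deriv (Polygamma 1))"
    using expansion_deriv[OF expansion_Polygamma_1 ev_stripsD[OF ev_strips_Polygamma_analytic]] by simp
  then have "expansion 1 (deriv (Polygamma 1))" by (rule expansion_mono)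
  from expansion_cong_ev_strips[OF 1 this] show ?thesis
    unfolding tame_def using ev_strips_Polygamma_analytic by blast
qed

text \<open>This is the non-polynomial part of the logarithmic derivative of the Barnes function.
  Its second derivative combines \<open>Polygamma 1\<close> and \<open>s * Polygamma 2\<close>, both
  free of logarithms.\<close>

lemma tame_mult_Digamma: "tame (\<lambda>s. s * Digamma (s + 1))"
proof -
  have P: "((\<lambda>s. Polygamma n (s + 1)) has_field_derivative Polygamma (Suc n) (s + 1)) (at s)" if "Re s > 0" for n and s :: complex
  proof -
    have "(Polygamma n has_field_derivative Polygamma (Suc n) (s + 1)) (at (s + 1))"
      using that by (intro has_field_derivative_Polygamma nonpos_Ints_Re) simp
    moreover have "((\<lambda>s. s + 1) has_field_derivative 1) (at s)" by (auto intro!: derivative_eq_intros)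
    ultimately show ?thesis
      using DERIV_chain2[where f = "Polygamma n" and g = "\<lambda>s. s + 1" and x = s] by fastforce
  qed
  have d1: "deriv (\<lambda>s. s * Digamma (s + 1)) s = Digamma (s + 1) + s * Polygamma 1 (s + 1)" if "Re s > 0" for s :: complex
    using DERIV_imp_deriv[OF DERIV_mult[OF DERIV_ident P[OF that, of 0]]] by (simp add: mult.commute)
  have d2: "deriv (\<lambda>s. Digamma (s + 1) + s * Polygamma 1 (s + 1)) s = 2 * Polygamma 1 (s + 1) + s * Polygamma 2 (s + 1)" if "Re s > 0" for s :: complex
    using DERIV_imp_deriv[OF DERIV_add[OF P[OF that, of 0] DERIV_mult[OF DERIV_ident P[OF that, of 1]]]]
    by (simp add: mult.commute numeral_2_eq_2)
  have e1: "ev_strips (\<lambda>s. deriv (\<lambda>s. s * Digamma (s + 1)) s = Digamma (s + 1) + s * Polygamma 1 (s + 1))"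
    using ev_strips_Re_ge[of 1] by (rule ev_strips_mono) (rule d1, linarith)
  have e2: "ev_strips (\<lambda>s. deriv (\<lambda>s. Digamma (s + 1) + s * Polygamma 1 (s + 1)) s = 2 * Polygamma 1 (s + 1) + s * Polygamma 2 (s + 1))"
    using ev_strips_Re_ge[of 1] by (rule ev_strips_mono) (rule d2, linarith)
  have e3: "ev_strips (\<lambda>s. deriv (deriv (\<lambda>s. s * Digamma (s + 1))) s = 2 * Polygamma 1 (s + 1) + s * Polygamma 2 (s + 1))"
    by (rule ev_strips_mono[OF ev_strips_conj[OF ev_strips_deriv_cong[OF e1] e2]]) auto
  have a1: "expansion 1 (\<lambda>s. Polygamma 1 (s + 1))" using expansion_affine[OF expansion_Polygamma_1, of 1 1] by simp
  have "expansion (Suc 1) (\<lambda>s. Polygamma 2 (s + 1))"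
    using expansion_affine[OF expansion_Polygamma[of 1], of 1 1] by (simp add: numeral_2_eq_2)
  then have a2: "expansion 1 (\<lambda>s. s * Polygamma 2 (s + 1))" by (rule expansion_mult_ident)
  have "expansion 1 (deriv (deriv (\<lambda>s. s * Digamma (s + 1))))"
    by (rule expansion_cong_ev_strips[OF e3]) (intro expansion_add expansion_cmult a1 a2)
  moreover have "ev_strips (\<lambda>s. (\<lambda>s. s * Digamma (s + 1)) analytic_on {s})"
    using ev_strips_Re_ge[of 1]
  proof (rule ev_strips_mono)
    fix s :: complex assume "1 \<le> Re s"
    then have "(\<lambda>s. Digamma (1 * s + 1)) analytic_on {s}"
      by (intro analytic_affine Polygamma_analytic) simp
    then show "(\<lambda>s. s * Digamma (s + 1)) analytic_on {s}" by (auto intro!: analytic_intros)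
  qed
  ultimately show ?thesis by (simp add: tame_def)
qed

lemma nice_Gamma: "nice Gamma"
proof -
  have "ev_strips (\<lambda>s. log_deriv Gamma s = Digamma s)"
    using ev_strips_Re_ge[of 1]
  proof (rule ev_strips_mono)
    fix s :: complex assume "1 \<le> Re s"
    then have s: "s \<notin> \<int>\<^sub>\<le>\<^sub>0" by (intro nonpos_Ints_Re) simp
    show "log_deriv Gamma s = Digamma s"
      using DERIV_imp_deriv[OF has_field_derivative_Gamma[OF s]] Gamma_nonzero[OF s] by (simp add: log_deriv_def)
  qed
  then have "tame (log_deriv Gamma)" by (rule tame_cong) (rule tame_Digamma)
  moreover have "ev_sector (\<lambda>s. Gamma analytic_on {s} \<and> Gamma s \<noteq> (0 :: complex))"
    using nonpos_Ints_Re by (intro ev_sector_Re_gt[of 0]) (auto intro!: analytic_Gamma simp: Gamma_eq_zero_iff)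
  ultimately show ?thesis by (simp add: nice_def)
qed

lemma nice_powr:
  fixes a :: real assumes "a > 0" shows "nice (\<lambda>s. complex_of_real a powr (- s))"
proof -
  have ne: "complex_of_real a \<noteq> 0" using assms by simp
  have "log_deriv (\<lambda>s. complex_of_real a powr (- s)) = (\<lambda>s. - of_real (ln a))"
  proof
    fix s :: complex
    have "((\<lambda>s. exp (- s * of_real (ln a))) has_field_derivative exp (- s * of_real (ln a)) * - of_real (ln a)) (at s)"
      by (auto intro!: derivative_eq_intros)
    then show "log_deriv (\<lambda>s. complex_of_real a powr (- s)) s = - of_real (ln a)"
      using assms by (simp add: log_deriv_def powr_def DERIV_imp_deriv Ln_of_real)
  qed
  moreover have "(\<lambda>s. complex_of_real a powr (- s)) analytic_on {s}" for s
    using assms unfolding powr_def by (auto intro!: analytic_intros)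
  ultimately show ?thesis
    using ne tame_const by (auto simp: nice_def intro!: ev_sector_Re_gt[of 0])
qed

text \<open>Each factor is \<open>exp (t n s)\<close>, and \<open>t n\<close> has the derivative
  \<open>s\<^sup>2 / ((n + 1) * (n + 1 + s)) = s * (1 / (n + 1) - 1 / (n + 1 + s))\<close>, which
  sums to a Digamma series. For \<open>Re s > -1/2\<close> the number \<open>1 + s / (n + 1)\<close>
  has real part above 1/2 and avoids the cut of the logarithm.\<close>

lemma barnes_product:
  fixes s :: complex
  assumes s: "Re s > -1/2"
  defines "t \<equiv> \<lambda>n s. of_nat (Suc n) * Ln (1 + s / of_nat (Suc n)) + (- s + s\<^sup>2 / (2 * of_nat (Suc n)))"
  shows "(\<Prod>k. (1 + s / of_nat (Suc k)) ^ Suc k * exp (- s + s\<^sup>2 / (2 * of_nat (Suc k)))) = exp (\<Sum>n. t n s)"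
    and "((\<lambda>s. \<Sum>n. t n s) has_field_derivative s * (Digamma (s + 1) + euler_mascheroni)) (at s)"
proof -
  define R where "R = norm s + 1"
  \<comment> \<open>Bounded, convex, and containing 0 and \<open>s\<close>: boundedness makes the
    derivatives converge uniformly, and at 0 all \<open>t n\<close> vanish, which anchors the series
    of primitives.\<close>
  define S where "S = {s. Re s > -1/2} \<inter> ball 0 R"
  have S: "open S" "convex S" "s \<in> S" "0 \<in> S"
    using s by (auto simp: S_def R_def open_halfspace_Re_gt convex_halfspace_Re_gt intro!: open_Int convex_Int add_nonneg_pos)
  have ReA: "Re (of_nat (Suc n) + v) \<ge> real (Suc n) / 2" if "v \<in> S" for n v
    using that by (simp add: S_def)
  have ne: "of_nat (Suc n) + v \<noteq> 0" if "v \<in> S" for n v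
  proof -
    have "0 < real (Suc n) / 2" by simp
    then have "0 < Re (of_nat (Suc n) + v)" using ReA[OF that, of n] by (rule less_le_trans)
    then show ?thesis by (metis less_irrefl zero_complex.sel(1))
  qed
  have arg: "1 + v / of_nat (Suc n) \<notin> \<real>\<^sub>\<le>\<^sub>0" if "v \<in> S" for n v
  proof -
    have "Re (1 + v / of_nat (Suc n)) = Re (of_nat (Suc n) + v) / real (Suc n)"
      by (simp add: Re_divide_of_nat add_divide_distrib del: of_nat_Suc)
    then have "Re (1 + v / of_nat (Suc n)) > 0" using ReA[OF that, of n] by (simp add: divide_pos_pos del: of_nat_Suc)
    then show ?thesis by (simp add: complex_nonpos_Reals_iff)
  qed
  let ?t' = "\<lambda>n v. v\<^sup>2 / (of_nat (Suc n) * (of_nat (Suc n) + v))"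
  have ident: "a * (inverse (1 + v / a) * (1 / a)) + (- 1 + v / a) = v\<^sup>2 / (a * (a + v))"
    if "a \<noteq> 0" "a + v \<noteq> 0" for a v :: complex
  proof -
    have "1 + v / a = (a + v) / a" using that by (simp add: add_divide_distrib)
    then have "a * (inverse (1 + v / a) * (1 / a)) = a / (a + v)" using that by simp
    then show ?thesis using that by (simp add: field_simps power2_eq_square)
  qed
  have der: "(t n has_field_derivative ?t' n v) (at v within S)" if v: "v \<in> S" for n v
  proof -
    let ?a = "of_nat (Suc n) :: complex"
    have a: "?a \<noteq> 0" by (rule of_nat_neq_0)
    have "1 + v / ?a \<noteq> 0" using arg[OF v, of n] by auto
    have "((\<lambda>v. 1 + v / ?a) has_field_derivative 1 / ?a) (at v)"
      using a by (auto intro!: derivative_eq_intros simp del: of_nat_Suc)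
    from DERIV_chain2[OF has_field_derivative_Ln[OF arg[OF v, of n]] this]
    have l: "((\<lambda>v. Ln (1 + v / ?a)) has_field_derivative inverse (1 + v / ?a) * (1 / ?a)) (at v)" .
    have "((\<lambda>v. - v + v\<^sup>2 / (2 * ?a)) has_field_derivative - 1 + v / ?a) (at v)"
      using a by (auto intro!: derivative_eq_intros simp del: of_nat_Suc)
    from DERIV_add[OF DERIV_cmult[OF l] this]
    have "((\<lambda>v. ?a * Ln (1 + v / ?a) + (- v + v\<^sup>2 / (2 * ?a))) has_field_derivative
        ?a * (inverse (1 + v / ?a) * (1 / ?a)) + (- 1 + v / ?a)) (at v)" .
    also have "?a * (inverse (1 + v / ?a) * (1 / ?a)) + (- 1 + v / ?a) = ?t' n v"
      using ident[OF a ne[OF v, of n]] .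
    finally show ?thesis unfolding t_def by (rule has_field_derivative_at_within)
  qed
  have unif: "uniformly_convergent_on S (\<lambda>n v. \<Sum>i<n. ?t' i v)"
  proof (rule Weierstrass_m_test')
    show "summable (\<lambda>n. 2 * R\<^sup>2 * (1 / real (Suc n) ^ 2))"
      using inverse_squares_sums by (intro summable_mult) (auto simp: sums_iff add.commute)
    fix n v assume v: "v \<in> S"
    have "norm (of_nat (Suc n) + v) \<ge> real (Suc n) / 2"
      using ReA[OF v, of n] complex_Re_le_cmod order_trans by blast
    then have le: "real (Suc n) * (real (Suc n) / 2) \<le> norm (of_nat (Suc n) * (of_nat (Suc n) + v))"
      unfolding norm_mult norm_of_nat by (intro mult_left_mono) auto
    have "norm (?t' n v) = (norm v)\<^sup>2 / norm (of_nat (Suc n) * (of_nat (Suc n) + v))"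
      by (simp only: norm_divide norm_power)
    also have "\<dots> \<le> R\<^sup>2 / (real (Suc n) * (real (Suc n) / 2))"
      using v le by (intro frac_le power_mono) (auto simp: S_def simp del: of_nat_Suc)
    also have "\<dots> = 2 * R\<^sup>2 * (1 / real (Suc n) ^ 2)" by (simp add: power2_eq_square)
    finally show "norm (?t' n v) \<le> 2 * R\<^sup>2 * (1 / real (Suc n) ^ 2)" .
  qed
  have int: "s \<in> interior S" using S by (simp add: interior_open)
  have "summable (\<lambda>n. t n 0)" by (simp add: t_def)
  note ser = has_field_derivative_series'[OF S(2) der unif S(4) this int]
  have "(\<lambda>n. exp (t n s)) has_prod exp (\<Sum>n. t n s)"
    using sums_imp_has_prod_exp[OF summable_sums[OF ser(1)]] by (auto simp: has_prod_def)
  moreover have "(\<lambda>n. exp (t n s)) = (\<lambda>k. (1 + s / of_nat (Suc k)) ^ Suc k * exp (- s + s\<^sup>2 / (2 * of_nat (Suc k))))"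
  proof
    fix n
    have "1 + s / of_nat (Suc n) \<noteq> 0" using arg[OF S(3), of n] by auto
    then show "exp (t n s) = (1 + s / of_nat (Suc n)) ^ Suc n * exp (- s + s\<^sup>2 / (2 * of_nat (Suc n)))"
      unfolding t_def exp_add exp_of_nat_mult by (simp del: of_nat_Suc)
  qed
  ultimately show "(\<Prod>k. (1 + s / of_nat (Suc k)) ^ Suc k * exp (- s + s\<^sup>2 / (2 * of_nat (Suc k)))) = exp (\<Sum>n. t n s)"
    using has_prod_unique by metis
  have s1: "s + 1 \<noteq> 0" using ne[OF S(3), of 0] by (simp add: add.commute)
  have "(\<Sum>n. ?t' n s) = (\<Sum>n. s * (inverse (of_nat (Suc n)) - inverse (s + 1 + of_nat n)))"
  proof (rule suminf_cong)
    fix n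
    have ident2: "v\<^sup>2 / (a * (a + v)) = v * (inverse a - inverse (a + v))" if "a \<noteq> 0" "a + v \<noteq> 0" for a v :: complex
      using that by (simp add: field_simps power2_eq_square)
    have e: "s + 1 + of_nat n = of_nat (Suc n) + s" by simp
    show "?t' n s = s * (inverse (of_nat (Suc n)) - inverse (s + 1 + of_nat n))"
      unfolding e by (rule ident2[OF of_nat_neq_0 ne[OF S(3)]])
  qed
  also have "\<dots> = s * (\<Sum>n. inverse (of_nat (Suc n)) - inverse (s + 1 + of_nat n))"
    by (rule suminf_mult[OF summable_Digamma[OF s1]])
  also have "\<dots> = s * (Digamma (s + 1) + euler_mascheroni)" by (simp add: Digamma_def)
  finally show "((\<lambda>s. \<Sum>n. t n s) has_field_derivative s * (Digamma (s + 1) + euler_mascheroni)) (at s)"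
    using ser(2) by (simp only:)
qed

text \<open>The multiples of Euler's constant cancel, leaving the logarithmic derivative
  \<open>s * Digamma (s + 1) - s + (ln (2 * pi) - 1) / 2\<close>.\<close>

lemma nice_barnes: "nice barnes_G_Suc"
proof -
  define t where "t = (\<lambda>n (s :: complex). of_nat (Suc n) * Ln (1 + s / of_nat (Suc n)) + (- s + s\<^sup>2 / (2 * of_nat (Suc n))))"
  define H where "H = (\<lambda>s. s / 2 * of_real (ln (2 * pi)) + (- (1/2) * ((1 + euler_mascheroni) * s\<^sup>2 + s)) + (\<Sum>n. t n s))"
  have eq: "barnes_G_Suc s = exp (H s)" if "Re s > -1/2" for s
  proof -
    have "Ln (of_real (2 * pi)) = complex_of_real (ln (2 * pi))" by (rule Ln_of_real) simp
    then have "complex_of_real (2 * pi) powr (s / 2) = exp (s / 2 * of_real (ln (2 * pi)))"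
      unfolding powr_def by (simp only: of_real_eq_0_iff) simp
    then show ?thesis
      unfolding barnes_G_Suc_def H_def t_def barnes_product(1)[OF that] by (simp only: exp_add)
  qed
  have dH: "(H has_field_derivative (s * Digamma (s + 1) + ((- 1) * s + (of_real (ln (2 * pi)) / 2 - 1/2)))) (at s)" if "Re s > -1/2" for s
  proof -
    have "(H has_field_derivative (1 / 2 * of_real (ln (2 * pi)) + (- (1/2) * ((1 + euler_mascheroni) * (2 * s) + 1)) + s * (Digamma (s + 1) + euler_mascheroni))) (at s)"
    proof -
      have "((\<lambda>s. s / 2 * of_real (ln (2 * pi)) + (- (1/2) * ((1 + euler_mascheroni) * s\<^sup>2 + s))) has_field_derivative
         (1 / 2 * of_real (ln (2 * pi)) + (- (1/2) * ((1 + euler_mascheroni) * (2 * s) + 1)))) (at s)"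
        by (auto intro!: derivative_eq_intros)
      from DERIV_add[OF this barnes_product(2)[OF that]] show ?thesis unfolding H_def t_def .
    qed
    also have "1 / 2 * of_real (ln (2 * pi)) + (- (1/2) * ((1 + euler_mascheroni) * (2 * s) + 1)) + s * (Digamma (s + 1) + euler_mascheroni) =
      s * Digamma (s + 1) + ((- 1) * s + (of_real (ln (2 * pi)) / 2 - 1/2))"
      by (simp add: algebra_simps)
    finally show ?thesis .
  qed
  have op: "open {s. Re s > -1/2}" by (rule open_halfspace_Re_gt)
  have dG: "(barnes_G_Suc has_field_derivative exp (H s) * (s * Digamma (s + 1) + ((- 1) * s + (of_real (ln (2 * pi)) / 2 - 1/2)))) (at s)" if "Re s > -1/2" for s
    by (rule has_field_derivative_transform_within_open[OF DERIV_chain2[OF DERIV_exp dH[OF that]] op]) (use that eq in auto)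
  have "ev_strips (\<lambda>s. log_deriv barnes_G_Suc s = s * Digamma (s + 1) + ((- 1) * s + (of_real (ln (2 * pi)) / 2 - 1/2)))"
    using ev_strips_Re_ge[of 0]
  proof (rule ev_strips_mono)
    fix s :: complex assume "0 \<le> Re s"
    then have s: "Re s > -1/2" by simp
    show "log_deriv barnes_G_Suc s = s * Digamma (s + 1) + ((- 1) * s + (of_real (ln (2 * pi)) / 2 - 1/2))"
      using DERIV_imp_deriv[OF dG[OF s]] eq[OF s] by (simp add: log_deriv_def)
  qed
  then have "tame (log_deriv barnes_G_Suc)"
    by (rule tame_cong) (intro tame_add tame_mult_Digamma tame_affine_fun)
  moreover have "barnes_G_Suc holomorphic_on {s. Re s > -1/2}"
    using dG op by (auto simp: holomorphic_on_open)
  then have "barnes_G_Suc analytic_on {s. Re s > -1/2}" using op by (simp add: analytic_on_open)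
  then have "ev_sector (\<lambda>s. barnes_G_Suc analytic_on {s} \<and> barnes_G_Suc s \<noteq> 0)"
    by (intro ev_sector_Re_gt[of 0] conjI) (auto simp: eq elim!: analytic_on_subset)
  ultimately show ?thesis by (simp add: nice_def)
qed

lemma nice_G_E: "nice (G_E \<Gamma>)"
proof -
  have "nice (\<lambda>s. \<Prod>K\<in>elliptic_classes \<Gamma>. \<Prod>m<elliptic_order K. barnes_G ((s + of_nat m) / of_nat (elliptic_order K) + 1))"
  proof (intro nice_prod)
    fix K m assume m: "m \<in> {..<elliptic_order K}"
    let ?d = "elliptic_order K"
    have d: "?d > 0" using m by (cases ?d) auto
    have "nice (\<lambda>s. barnes_G_Suc (complex_of_real (1 / ?d) * s + of_nat m / of_nat ?d))"
      by (rule nice_affine[OF nice_barnes]) (use d in simp)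
    moreover have "(\<lambda>s. barnes_G_Suc (complex_of_real (1 / ?d) * s + of_nat m / of_nat ?d)) = (\<lambda>s. barnes_G ((s + of_nat m) / of_nat ?d + 1))"
      by (rule ext) (simp add: barnes_G_def add_divide_distrib)
    ultimately show "nice (\<lambda>s. barnes_G ((s + of_nat m) / of_nat ?d + 1))" by simp
  qed
  then show ?thesis unfolding G_E_def[abs_def] .
qed

lemma nice_G_1: "nice (G_1 \<Gamma>)"
proof -
  have 1: "nice (\<lambda>s. of_real (2 * pi) powr (- s) * barnes_G (s + 1) ^ 2)"
  proof -
    have eq: "barnes_G (s + 1) = barnes_G_Suc s" for s by (simp add: barnes_G_def)
    show ?thesis unfolding eq by (intro nice_mult nice_power nice_powr nice_barnes) simp
  qed
  show ?thesis unfolding G_1_def[abs_def]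
    by (intro nice_mult nice_power nice_power_int nice_divide nice_Gamma nice_G_E 1)
qed

section \<open>The Selberg zeta function and the scattering determinant\<close>

definition rapid_decay :: "(complex \<Rightarrow> complex) \<Rightarrow> bool" where
  "rapid_decay h \<longleftrightarrow> (\<forall>B n. h \<in> O[strip B](\<lambda>s. (1 / s) ^ n))"

lemma rapid_decay_imp_expansion: "rapid_decay h \<Longrightarrow> expansion m h"
  by (rule expansion_negligible) (simp add: rapid_decay_def)

lemma expansion_imp_rapid_decay:
  assumes "\<And>m. expansion m h" shows "rapid_decay h"
  unfolding rapid_decay_def
proof (intro allI)
  fix B n
  obtain p where p: "(\<lambda>s. h s - (1 / s) ^ n * poly p (1 / s)) \<in> O[strip B](\<lambda>s. (1 / s) ^ n)"
    using expansionD[OF assms] by blast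
  have "((\<lambda>s. poly p (1 / s)) \<longlongrightarrow> poly p 0) (strip B)"
    by (intro tendsto_intros tendsto_inverse_strip)
  then have "(\<lambda>s. poly p (1 / s)) \<in> O[strip B](\<lambda>s. 1)"
    by (intro bigoI_tendsto[where c = "poly p 0"]) auto
  then have "(\<lambda>s. (1 / s) ^ n * poly p (1 / s)) \<in> O[strip B](\<lambda>s. (1 / s) ^ n * 1)"
    by (intro landau_o.big.mult landau_o.big_refl)
  then have t: "(\<lambda>s. (1 / s) ^ n * poly p (1 / s)) \<in> O[strip B](\<lambda>s. (1 / s) ^ n)" by simp
  from sum_in_bigo(1)[OF p t] show "h \<in> O[strip B](\<lambda>s. (1 / s) ^ n)" by simp
qed

text \<open>Rapid decay is the same as an expansion starting at every order \<open>m\<close>, and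
  expansions can be differentiated.\<close>

lemma rapid_decay_deriv:
  assumes "rapid_decay h" "ev_strips (\<lambda>s. h analytic_on {s})" shows "rapid_decay (deriv h)"
proof (rule expansion_imp_rapid_decay)
  fix m
  have "expansion (m + 1) (deriv h)"
    using expansion_deriv[OF rapid_decay_imp_expansion[OF assms(1)] ev_stripsD[OF assms(2)], of m] by simp
  then show "expansion m (deriv h)" by (rule expansion_mono)
qed

lemma rapid_decay_mult_bounded:
  assumes "rapid_decay h" "\<And>B. g \<in> O[strip B](\<lambda>s. 1)" shows "rapid_decay (\<lambda>s. h s * g s)"
  unfolding rapid_decay_def
proof (intro allI)
  fix B n
  have "(\<lambda>s. h s * g s) \<in> O[strip B](\<lambda>s. (1 / s) ^ n * 1)"
    by (rule landau_o.big.mult) (use assms in \<open>auto simp: rapid_decay_def\<close>)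
  then show "(\<lambda>s. h s * g s) \<in> O[strip B](\<lambda>s. (1 / s) ^ n)" by simp
qed

lemma filterlim_Re_strip: "filterlim Re at_top (strip B)"
  unfolding filterlim_at_top using eventually_strip_Re_ge by blast

lemma exp_decay_rapid_decay:
  assumes q: "0 < q" "q < 1" and h: "ev_strips (\<lambda>s. norm (h s) \<le> C * q powr Re s)"
  shows "rapid_decay h"
  unfolding rapid_decay_def
proof (intro allI)
  fix B n
  have "((\<lambda>x. q powr x * x ^ n) \<longlongrightarrow> 0) at_top" using q by real_asymp
  then have "((\<lambda>s. q powr Re s * Re s ^ n) \<longlongrightarrow> 0) (strip B)"
    using filterlim_compose[OF _ filterlim_Re_strip] by blast
  then have "\<forall>\<^sub>F s in strip B. q powr Re s * Re s ^ n < 1"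
    by (rule order_tendstoD) simp
  then have "\<forall>\<^sub>F s in strip B. norm (h s) \<le> \<bar>C\<bar> * 2 ^ n * norm ((1 / s) ^ n)"
    using ev_stripsD[OF h, of B] eventually_strip_norm_le[of B]
  proof eventually_elim
    case (elim s)
    have R: "Re s \<ge> 1" "norm s \<le> 2 * Re s" "norm s > 0" using elim by auto
    have "q powr Re s \<le> (1 / Re s) ^ n" using elim(1) R by (simp add: power_divide pos_le_divide_eq less_imp_le)
    also have "\<dots> \<le> (2 / norm s) ^ n" using R by (intro power_mono) (auto simp: field_simps)
    finally have "\<bar>C\<bar> * q powr Re s \<le> \<bar>C\<bar> * (2 / norm s) ^ n" by (rule mult_left_mono) simp
    moreover have "C * q powr Re s \<le> \<bar>C\<bar> * q powr Re s" by (intro mult_right_mono) auto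
    ultimately show ?case using elim(2) by (simp add: norm_power norm_divide power_divide)
  qed
  then show "h \<in> O[strip B](\<lambda>s. (1 / s) ^ n)" by (rule bigoI)
qed

text \<open>Near \<open>c\<close> the function is bounded away from 0. The exponentially small
  difference decays faster than all powers, a property that passes to the derivative and survives
  division by \<open>f\<close>.\<close>

lemma
  assumes c: "c \<noteq> 0" and q: "0 < q" "q < 1" and an: "ev_sector (\<lambda>s. f analytic_on {s})"
    and f: "ev_sector (\<lambda>s. norm (f s - c) \<le> C * q powr Re s)"
  shows nice_near_const: "nice f" and rapid_decay_log_deriv: "rapid_decay (log_deriv f)"
proof -
  have "((\<lambda>x. \<bar>C\<bar> * q powr x) \<longlongrightarrow> 0) at_top" using q by real_asymp
  then have "\<forall>\<^sub>F x in at_top. \<bar>C\<bar> * q powr x < norm c / 2" using c by (intro order_tendstoD) auto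
  then obtain R where R: "\<And>x. x \<ge> R \<Longrightarrow> \<bar>C\<bar> * q powr x < norm c / 2" by (auto simp: eventually_at_top_linorder)
  have small: "ev_sector (\<lambda>s. \<bar>C\<bar> * q powr Re s < norm c / 2)" using R by (intro ev_sector_Re_gt[of R]) auto
  have near: "ev_sector (\<lambda>s. norm (f s - c) \<le> norm c / 2)"
    using ev_sector_conj[OF small f]
  proof (rule ev_sector_mono)
    fix s assume "\<bar>C\<bar> * q powr Re s < norm c / 2 \<and> norm (f s - c) \<le> C * q powr Re s"
    moreover have "C * q powr Re s \<le> \<bar>C\<bar> * q powr Re s" by (intro mult_right_mono) auto
    ultimately show "norm (f s - c) \<le> norm c / 2" by linarith
  qed
  have ge: "norm (f s) \<ge> norm c / 2" if "norm (f s - c) \<le> norm c / 2" for s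
    using that norm_triangle_ineq2[of c "c - f s"] by (simp add: norm_minus_commute)
  have ne: "ev_sector (\<lambda>s. f analytic_on {s} \<and> f s \<noteq> 0)"
    using ev_sector_conj[OF an near] by (rule ev_sector_mono) (use ge c in force)
  have anc: "ev_strips (\<lambda>s. (\<lambda>s. f s - c) analytic_on {s})"
    using ev_sector_ev_strips[OF an] by (rule ev_strips_mono) (auto intro: analytic_intros)
  have "rapid_decay (\<lambda>s. f s - c)" by (rule exp_decay_rapid_decay[OF q ev_sector_ev_strips[OF f]])
  then have d: "rapid_decay (deriv (\<lambda>s. f s - c))" by (rule rapid_decay_deriv[OF _ anc])
  have bd: "(\<lambda>s. 1 / f s) \<in> O[strip B](\<lambda>s. 1)" for B
  proof (rule bigoI)
    show "\<forall>\<^sub>F s in strip B. norm (1 / f s) \<le> 2 / norm c * norm (1 :: complex)"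
      using ev_stripsD[OF ev_sector_ev_strips[OF near]]
    proof eventually_elim
      case (elim s)
      have "1 / norm (f s) \<le> 1 / (norm c / 2)" using ge[OF elim] c by (intro divide_left_mono mult_pos_pos) (auto intro: less_le_trans[rotated])
      then show ?case by (simp add: norm_divide)
    qed
  qed
  have rapid_decay': "rapid_decay (\<lambda>s. deriv (\<lambda>s. f s - c) s * (1 / f s))" by (rule rapid_decay_mult_bounded[OF d bd])
  have eq: "ev_strips (\<lambda>s. log_deriv f s = deriv (\<lambda>s. f s - c) s * (1 / f s))"
    using ev_sector_ev_strips[OF an]
  proof (rule ev_strips_mono)
    fix s assume "f analytic_on {s}"
    then have "f field_differentiable at s" by (auto intro: analytic_on_imp_differentiable_at)
    then show "log_deriv f s = deriv (\<lambda>s. f s - c) s * (1 / f s)" by (simp add: log_deriv_def)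
  qed
  show "rapid_decay (log_deriv f)"
    by (rule expansion_imp_rapid_decay, rule expansion_cong_ev_strips[OF eq], rule rapid_decay_imp_expansion[OF rapid_decay'])
  have "ev_strips (\<lambda>s. log_deriv f analytic_on {s})"
    using ev_sector_ev_strips[OF ne] unfolding log_deriv_def by (rule ev_strips_mono) (auto intro!: analytic_intros analytic_deriv)
  then have "tame (log_deriv f)" by (rule tame_expansion) (rule rapid_decay_imp_expansion[OF \<open>rapid_decay (log_deriv f)\<close>, of 0])
  then show "nice f" using ne by (simp add: nice_def)
qed

text \<open>A nicely meromorphic function has the value 0 at its poles, so its value at
  \<open>s\<close> reveals nothing; a bound in a punctured neighbourhood does exclude a
  pole.\<close>

lemma nicely_meromorphic_bounded_analytic:
  assumes "f nicely_meromorphic_on UNIV" "eventually (\<lambda>v. norm (f v) \<le> B) (at s)"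
  shows "f analytic_on {s}"
proof (rule nicely_meromorphic_on_imp_analytic_at[OF assms(1)])
  show "\<not> is_pole f s"
  proof
    assume "is_pole f s"
    then have "filterlim (\<lambda>v. norm (f v)) at_top (at s)"
      unfolding is_pole_def by (rule filterlim_at_infinity_imp_norm_at_top)
    then have "eventually (\<lambda>v. norm (f v) \<ge> B + 1) (at s)"
      unfolding filterlim_at_top by blast
    with assms(2) have "eventually (\<lambda>v. False) (at s)" by eventually_elim simp
    then show False by simp
  qed
qed simp

lemma ev_sector_nhds:
  assumes "ev_sector P" shows "ev_sector (\<lambda>s. eventually P (nhds s))"
proof -
  obtain \<epsilon> R where \<epsilon>: "\<epsilon> > 0" "\<And>s. Re s \<ge> R \<Longrightarrow> \<bar>Im s\<bar> \<le> \<epsilon> * Re s \<Longrightarrow> P s"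
    using assms unfolding ev_sector_def by blast
  show ?thesis unfolding ev_sector_def
  proof (intro exI conjI allI impI)
    show "\<epsilon> / 2 > 0" using \<epsilon> by simp
    fix s assume s: "max (R + 1) (2 * (1 + \<epsilon>) / \<epsilon>) \<le> Re s" "\<bar>Im s\<bar> \<le> \<epsilon> / 2 * Re s"
    have "2 * (1 + \<epsilon>) / \<epsilon> \<le> Re s" using s by simp
    then have big: "1 + \<epsilon> \<le> \<epsilon> / 2 * Re s" using \<epsilon>(1) by (simp add: field_simps)
    have "P v" if "v \<in> ball s 1" for v
    proof (rule \<epsilon>(2))
      have d: "\<bar>Re (s - v)\<bar> < 1" "\<bar>Im (s - v)\<bar> < 1"
        using that abs_Re_le_cmod[of "s - v"] abs_Im_le_cmod[of "s - v"] by (auto simp: dist_norm)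
      then show "R \<le> Re v" using s by auto
      have "\<bar>Im v\<bar> \<le> \<epsilon> / 2 * Re s + 1" using d s by auto
      also have "\<dots> \<le> \<epsilon> * (Re s - 1)" using big by (simp add: algebra_simps)
      also have "\<dots> \<le> \<epsilon> * Re v" using d \<epsilon>(1) by (intro mult_left_mono) auto
      finally show "\<bar>Im v\<bar> \<le> \<epsilon> * Re v" .
    qed
    then show "eventually P (nhds s)"
      by (meson centre_in_ball eventually_nhds open_ball zero_less_one)
  qed
qed

lemma norm_prod_minus_1_le:
  fixes b :: "'a \<Rightarrow> complex"
  assumes "finite F"
  shows "norm ((\<Prod>i\<in>F. 1 - b i) - 1) \<le> exp (\<Sum>i\<in>F. norm (b i)) - 1"
  using assms
proof induction
  case (insert i F)
  let ?P = "\<Prod>i\<in>F. 1 - b i" and ?E = "exp (\<Sum>i\<in>F. norm (b i))"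
  have n: "norm (1 - b i) \<le> exp (norm (b i))"
    by (rule order_trans[OF norm_triangle_ineq4]) (simp add: exp_ge_add_one_self)
  have "norm (?P * (1 - b i) - 1) = norm ((?P - 1) * (1 - b i) - b i)" by (simp add: algebra_simps)
  also have "\<dots> \<le> norm (?P - 1) * norm (1 - b i) + norm (b i)"
    using norm_triangle_ineq4[of "(?P - 1) * (1 - b i)" "b i"] by (simp add: norm_mult)
  also have "\<dots> \<le> (?E - 1) * exp (norm (b i)) + (exp (norm (b i)) - 1)"
  proof (intro add_mono mult_mono insert.IH n)
    show "0 \<le> ?E - 1" by (simp add: sum_nonneg)
    show "norm (b i) \<le> exp (norm (b i)) - 1" using exp_ge_add_one_self[of "norm (b i)"] by linarith
  qed simp
  also have "\<dots> = exp (\<Sum>i\<in>insert i F. norm (b i)) - 1"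
    using insert by (simp add: exp_add algebra_simps)
  finally show ?case using insert by (simp add: mult.commute)
qed simp

lemma norm_powr_of_real_exponent: "norm (w powr complex_of_real r) = norm w powr r" if "w \<noteq> 0"
  using that by (simp add: powr_def)

text \<open>Absolute convergence at \<open>s = 2\<close> already yields a gap: a norm at most 1
  would contribute infinitely many large terms, and only finitely many classes can have a norm close
  to 1. The factors at \<open>s\<close> are then compared with the convergent series at 2.\<close>

lemma selberg_near_1:
  assumes Z: "selberg_zeta \<Gamma> Z"
  shows "\<exists>q C. 0 < q \<and> q < 1 \<and> ev_sector (\<lambda>s. norm (Z s - 1) \<le> C * q powr Re s)"
proof -
  define I where "I = primitive_hyperbolic_classes \<Gamma> \<times> (UNIV :: nat set)"
  define N where "N = class_norm"
  define b where "b = (\<lambda>(K, n). \<bar>N K\<bar> powr (- (2 + real n)))"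
  have b_eq: "norm (complex_of_real (N K) powr (- (2 + of_nat n))) = b (K, n)" for K and n :: nat
  proof (cases "N K = 0")
    case False
    then show ?thesis
      using norm_powr_of_real_exponent[of "complex_of_real (N K)" "- (2 + real n)"] by (simp add: b_def)
  qed (simp add: b_def)
  have prod: "selberg_product \<Gamma> s (Z s)" if "Re s > 1" for s
    using Z that by (simp add: selberg_zeta_def)
  have "(\<lambda>(K, n). norm (complex_of_real (N K) powr (- (2 + of_nat n)))) summable_on I"
    using prod[of 2] by (simp add: selberg_product_def N_def I_def)
  moreover have "(\<lambda>(K, n). norm (complex_of_real (N K) powr (- (2 + of_nat n)))) = b"
    by (rule ext) (simp only: b_eq split_paired_all case_prod_conv)
  ultimately have bs: "b summable_on I" by (simp only:)
  have b0: "b i \<ge> 0" for i by (simp add: b_def split: prod.splits)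
  define S where "S = infsum b I"
  have S0: "S \<ge> 0" unfolding S_def by (rule infsum_nonneg) (rule b0)
  have finL: "finite {i\<in>I. b i \<ge> 1/2}"
  proof (rule ccontr)
    assume "infinite {i\<in>I. b i \<ge> 1/2}"
    then obtain F where F: "finite F" "card F = nat \<lceil>2 * S + 1\<rceil>" "F \<subseteq> {i\<in>I. b i \<ge> 1/2}"
      using infinite_arbitrarily_large by blast
    have "(\<Sum>i\<in>F. 1/2) \<le> sum b F" using F(3) by (intro sum_mono) auto
    also have "\<dots> \<le> S" unfolding S_def
      by (rule finite_sum_le_infsum[OF bs F(1)]) (use F(3) b0 in auto)
    finally have "real (card F) \<le> 2 * S" by simp
    moreover have "real (card F) \<ge> 2 * S + 1" unfolding F(2) by linarith
    ultimately show False by simp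
  qed
  define C where "C = primitive_hyperbolic_classes \<Gamma>"
  have lt1: "b (K, 0) < 1" if K: "K \<in> C" for K
  proof (rule ccontr)
    assume "\<not> b (K, 0) < 1"
    then have ge: "1 \<le> \<bar>N K\<bar> powr (- 2)" by (simp add: b_def)
    then have nz: "N K \<noteq> 0" by auto
    have "\<bar>N K\<bar> \<le> 1"
    proof (rule ccontr)
      assume "\<not> \<bar>N K\<bar> \<le> 1"
      then have "\<bar>N K\<bar> powr (- 2) < \<bar>N K\<bar> powr 0" by (intro powr_less_mono) auto
      then show False using ge nz by simp
    qed
    \<comment> \<open>A modulus at most 1 keeps the terms from decreasing in \<open>n\<close>, so
      infinitely many would exceed 1/2.\<close>
    then have "1/2 \<le> b (K, n)" for n
      using powr_mono'[of "- (2 + real n)" 0 "\<bar>N K\<bar>"] nz by (simp add: b_def)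
    then have "(\<lambda>n. (K, n)) ` UNIV \<subseteq> {i\<in>I. b i \<ge> 1/2}" using K by (auto simp: I_def C_def)
    then have "finite ((\<lambda>n. (K, n)) ` (UNIV :: nat set))" using finL finite_subset by blast
    then show False by (simp add: finite_image_iff inj_on_def)
  qed
  define L where "L = {K\<in>C. b (K, 0) \<ge> 1/2}"
  have finL': "finite L"
  proof (rule finite_subset)
    show "L \<subseteq> fst ` {i\<in>I. b i \<ge> 1/2}" by (force simp: L_def I_def C_def)
  qed (use finL in auto)
  \<comment> \<open>Dominates every \<open>b (K, 0)\<close>: those of at least 1/2 are finitely many
    and each is below 1.\<close>
  define \<theta> where "\<theta> = Max (insert (1/2) ((\<lambda>K. b (K, 0)) ` L))"
  have \<theta>: "0 < \<theta>" "\<theta> < 1"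
  proof -
    have "1/2 \<le> \<theta>" unfolding \<theta>_def using finL' by (intro Max_ge) auto
    then show "0 < \<theta>" by simp
    show "\<theta> < 1" unfolding \<theta>_def using finL' lt1 by (subst Max_less_iff) (auto simp: L_def)
  qed
  have b\<theta>: "b (K, 0) \<le> \<theta>" if "K \<in> C" for K
  proof (cases "K \<in> L")
    case True
    then show ?thesis unfolding \<theta>_def using finL' by (intro Max_ge) auto
  next
    case False
    then have "b (K, 0) \<le> 1/2" using that by (simp add: L_def)
    also have "1/2 \<le> \<theta>" unfolding \<theta>_def using finL' by (intro Max_ge) auto
    finally show ?thesis .
  qed
  \<comment> \<open>The estimate allows any nonzero real \<open>N K\<close>, whose complex power may
    carry a factor \<open>exp (pi * \<bar>Im s\<bar>)\<close>. In this sector the factor is at most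
    \<open>\<theta> powr (- Re s / 4)\<close>, which consumes half of the gain
    \<open>\<theta> powr (Re s / 2)\<close>; the other half is \<open>q powr Re s\<close>.\<close>
  define \<epsilon> where "\<epsilon> = - ln \<theta> / (4 * pi)"
  have \<epsilon>: "\<epsilon> > 0" using \<theta> by (simp add: \<epsilon>_def divide_neg_pos)
  define q where "q = \<theta> powr (1/4)"
  have q: "0 < q" "q < 1"
    using \<theta> powr_less_mono2[of "1/4" \<theta> 1] unfolding q_def by simp_all
  define x where "x = (\<lambda>s. S / \<theta> * q powr Re s)"
  have bound: "norm (Z s - 1) \<le> exp (x s) - 1" if s: "Re s \<ge> 2" "\<bar>Im s\<bar> \<le> \<epsilon> * Re s" for s
  proof -
    have tm: "norm (complex_of_real (N K) powr (- (s + of_nat n))) \<le> b (K, n) * (q powr Re s / \<theta>)"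
      if K: "K \<in> C" for K n
    proof (cases "N K = 0")
      case False
      have "norm (complex_of_real (N K) powr (- (s + of_nat n))) \<le> \<bar>N K\<bar> powr (- (Re s + real n)) * exp (pi * \<bar>Im s\<bar>)"
        using norm_powr_le[of "complex_of_real (N K)" "- (s + of_nat n)"] by simp
      \<comment> \<open>\<open>b (K, n)\<close> keeps the summability at 2, and the excess
        \<open>Re s - 2\<close> becomes a power of \<open>b (K, 0)\<close>, a number at most
        \<open>\<theta>\<close>.\<close>
      also have "\<bar>N K\<bar> powr (- (Re s + real n)) = b (K, n) * b (K, 0) powr ((Re s - 2) / 2)"
      proof -
        have e: "- (2 + real 0) * ((Re s - 2) / 2) = 2 - Re s" by simp
        have "b (K, 0) powr ((Re s - 2) / 2) = \<bar>N K\<bar> powr (2 - Re s)"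
          unfolding b_def case_prod_conv powr_powr e ..
        moreover have "b (K, n) * \<bar>N K\<bar> powr (2 - Re s) = \<bar>N K\<bar> powr (- (2 + real n) + (2 - Re s))"
          unfolding b_def case_prod_conv powr_add ..
        moreover have "- (2 + real n) + (2 - Re s) = - (Re s + real n)" by simp
        ultimately show ?thesis by (simp only:)
      qed
      also have "b (K, n) * b (K, 0) powr ((Re s - 2) / 2) * exp (pi * \<bar>Im s\<bar>) \<le>
          b (K, n) * \<theta> powr ((Re s - 2) / 2) * exp (- (ln \<theta> / 4 * Re s))"
      proof (intro mult_mono mult_left_mono powr_mono2 b\<theta> K)
        have "pi * \<bar>Im s\<bar> \<le> pi * (\<epsilon> * Re s)" using s by (intro mult_left_mono) auto
        also have "\<dots> = - (ln \<theta> / 4 * Re s)" by (simp add: \<epsilon>_def)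
        finally show "exp (pi * \<bar>Im s\<bar>) \<le> exp (- (ln \<theta> / 4 * Re s))" by simp
      qed (use b0 s in auto)
      also have "\<theta> powr ((Re s - 2) / 2) = exp (ln \<theta> * (Re s / 2) - ln \<theta>)"
      proof -
        have "(Re s - 2) / 2 * ln \<theta> = ln \<theta> * (Re s / 2) - ln \<theta>" by (simp add: algebra_simps diff_divide_distrib)
        then show ?thesis using \<theta> by (simp only: powr_def) simp
      qed
      also have "b (K, n) * exp (ln \<theta> * (Re s / 2) - ln \<theta>) * exp (- (ln \<theta> / 4 * Re s)) = b (K, n) * exp (ln \<theta> / 4 * Re s - ln \<theta>)"
      proof -
        have "ln \<theta> * (Re s / 2) - ln \<theta> + - (ln \<theta> / 4 * Re s) = ln \<theta> / 4 * Re s - ln \<theta>" by simp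
        then show ?thesis by (simp only: mult.assoc exp_add[symmetric])
      qed
      also have "exp (ln \<theta> / 4 * Re s - ln \<theta>) = q powr Re s / \<theta>"
      proof -
        have "q powr Re s = \<theta> powr (1 / 4 * Re s)" unfolding q_def powr_powr ..
        also have "\<dots> = exp (ln \<theta> / 4 * Re s)" using \<theta> by (simp add: powr_def mult.commute)
        finally show ?thesis using \<theta> by (simp add: exp_diff)
      qed
      finally show ?thesis .
    qed (use b0[of "(K, n)"] q \<theta> in simp)
    have part: "norm ((\<Prod>(K, n)\<in>F. 1 - complex_of_real (N K) powr (- (s + of_nat n))) - 1) \<le> exp (x s) - 1"
      if F: "finite F" "F \<subseteq> I" for F
    proof -
      let ?b = "\<lambda>i. complex_of_real (N (fst i)) powr (- (s + of_nat (snd i)))"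
      have "(\<Sum>i\<in>F. norm (?b i)) \<le> (\<Sum>i\<in>F. b i * (q powr Re s / \<theta>))"
      proof (rule sum_mono)
        fix i assume "i \<in> F"
        then have "fst i \<in> C" using F by (auto simp: I_def C_def)
        from tm[OF this, of "snd i"] show "norm (?b i) \<le> b i * (q powr Re s / \<theta>)" by simp
      qed
      also have "\<dots> = sum b F * (q powr Re s / \<theta>)" by (rule sum_distrib_right[symmetric])
      also have "\<dots> \<le> S * (q powr Re s / \<theta>)"
      proof (rule mult_right_mono)
        show "sum b F \<le> S" unfolding S_def
          by (rule finite_sum_le_infsum[OF bs F(1)]) (use F b0 in auto)
      qed (use \<theta> in auto)
      finally have "(\<Sum>i\<in>F. norm (?b i)) \<le> x s" by (simp add: x_def)
      then have "exp (\<Sum>i\<in>F. norm (?b i)) - 1 \<le> exp (x s) - 1" by simp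
      from order_trans[OF norm_prod_minus_1_le[OF F(1), of ?b] this] show ?thesis
        unfolding case_prod_unfold .
    qed
    have s1: "Re s > 1" using s by simp
    have "((\<lambda>F. \<Prod>(K, n)\<in>F. 1 - complex_of_real (N K) powr (- (s + of_nat n))) \<longlongrightarrow> Z s) (finite_subsets_at_top I)"
      using prod[OF s1] unfolding selberg_product_def N_def I_def by (rule conjunct2)
    then have "((\<lambda>F. norm ((\<Prod>(K, n)\<in>F. 1 - complex_of_real (N K) powr (- (s + of_nat n))) - 1)) \<longlongrightarrow> norm (Z s - 1)) (finite_subsets_at_top I)"
      by (intro tendsto_intros)
    then show ?thesis
      by (rule tendsto_upperbound) (intro eventually_finite_subsets_at_top_weakI part, simp_all)
  qed
  have "((\<lambda>t. S / \<theta> * q powr t) \<longlongrightarrow> 0) at_top" using q by real_asymp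
  then have "\<forall>\<^sub>F t in at_top. S / \<theta> * q powr t < 1" by (rule order_tendstoD) simp
  then obtain R where R: "\<And>t. t \<ge> R \<Longrightarrow> S / \<theta> * q powr t < 1" by (auto simp: eventually_at_top_linorder)
  have "norm (Z s - 1) \<le> (2 * (S / \<theta>)) * q powr Re s" if s: "Re s \<ge> max 2 R" "\<bar>Im s\<bar> \<le> \<epsilon> * Re s" for s
  proof -
    have x: "0 \<le> x s" "x s \<le> 1" using R[of "Re s"] s S0 \<theta> by (auto simp: x_def less_imp_le)
    have "exp (x s) \<le> 1 + x s + (x s)\<^sup>2" by (rule exp_bound[OF x])
    also have "(x s)\<^sup>2 \<le> x s" using x by (simp add: power2_eq_square mult_left_le_one_le)
    finally have "exp (x s) - 1 \<le> 2 * x s" by simp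
    then show ?thesis using bound[of s] s by (simp add: x_def)
  qed
  then have "ev_sector (\<lambda>s. norm (Z s - 1) \<le> (2 * (S / \<theta>)) * q powr Re s)"
    unfolding ev_sector_def using \<epsilon> by blast
  then show ?thesis using q by blast
qed

lemma nice_selberg:
  assumes "selberg_zeta \<Gamma> Z" shows "nice Z"
proof -
  obtain q C where q: "0 < q" "q < 1" and Z: "ev_sector (\<lambda>s. norm (Z s - 1) \<le> C * q powr Re s)"
    using selberg_near_1[OF assms] by blast
  have "ev_sector (\<lambda>s. norm (Z s - 1) \<le> \<bar>C\<bar>)"
    using ev_sector_conj[OF Z ev_sector_Re_gt[of 0 "\<lambda>s. Re s > 0"]]
  proof (rule ev_sector_mono)
    fix s assume *: "norm (Z s - 1) \<le> C * q powr Re s \<and> 0 < Re s"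
    have "C * q powr Re s \<le> \<bar>C\<bar> * 1" using q * by (intro mult_mono powr_le1) auto
    then show "norm (Z s - 1) \<le> \<bar>C\<bar>" using * by simp
  qed simp
  from ev_sector_nhds[OF this] have "ev_sector (\<lambda>s. Z analytic_on {s})"
  proof (rule ev_sector_mono)
    fix s assume "\<forall>\<^sub>F v in nhds s. norm (Z v - 1) \<le> \<bar>C\<bar>"
    then have "\<forall>\<^sub>F v in at s. norm (Z v) \<le> \<bar>C\<bar> + 1"
      unfolding eventually_nhds_conv_at
    proof (elim conjE eventually_mono)
      fix v assume "norm (Z v - 1) \<le> \<bar>C\<bar>"
      then show "norm (Z v) \<le> \<bar>C\<bar> + 1" using norm_triangle_sub[of "Z v" 1] by simp
    qed
    then show "Z analytic_on {s}"
      using assms by (intro nicely_meromorphic_bounded_analytic) (auto simp: selberg_zeta_def)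
  qed
  then show ?thesis using nice_near_const[of 1 q Z C] q Z by simp
qed

lemma Re_ge_1_neq:
  assumes "Re w \<ge> 1"
  shows "w \<noteq> 0" "w + 1 \<noteq> 0" "w - 1/2 \<noteq> 0"
proof -
  have "Re w \<noteq> Re 0" "Re (w + 1) \<noteq> Re 0" "Re (w - 1/2) \<noteq> Re 0" using assms by simp_all
  then show "w \<noteq> 0" "w + 1 \<noteq> 0" "w - 1/2 \<noteq> 0" by metis+
qed

text \<open>The difference behaves like \<open>- 1 / (2 * s)\<close>. Adding
  \<open>1 / (2 * s)\<close> as a telescoping series makes the summand at \<open>w = s + j\<close>
  equal to \<open>- (3/4) / (w * (w + 1) * (w - 1/2))\<close>, which in \<open>u = 1 / w\<close> is
  \<open>u ^ 3\<close> times the given \<open>k\<close>; the cubic decay is the reason for order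
  2.\<close>

lemma expansion_Digamma_diff: "expansion 2 (\<lambda>s. Digamma (s - 1/2) - Digamma s + 1/2 * (1 / s))"
proof (rule expansion_telescoping_sum[where k = "\<lambda>u. - (3/4) / ((1 + u) * (1 - u / 2))" and r = 1])
  show "(\<lambda>u. - (3/4) / ((1 + u) * (1 - u / 2))) holomorphic_on ball 0 (1 :: real)"
  proof (intro holomorphic_intros)
    fix u :: complex assume "u \<in> ball 0 1"
    then have u: "norm u < 1" by simp
    have "1 + u \<noteq> 0" using u by (metis add_eq_0_iff norm_minus_cancel norm_one less_irrefl)
    moreover have "u \<noteq> 2" using u by auto
    ultimately show "(1 + u) * (1 - u / 2) \<noteq> 0" by simp
  qed simp_all
  fix B
  show "\<forall>\<^sub>F s in strip B. (\<lambda>j. (1 / (s + of_nat j)) ^ Suc 2 * (- (3/4) / ((1 + 1 / (s + of_nat j)) * (1 - 1 / (s + of_nat j) / 2)))) sums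
     (Digamma (s - 1/2) - Digamma s + 1/2 * (1 / s))"
    using eventually_strip_Re_ge[of 1]
  proof eventually_elim
    case (elim s)
    note ne = Re_ge_1_neq(1)[OF elim] Re_ge_1_neq(3)[OF elim]
    have l1: "(\<lambda>m. (of_real (ln (real m)) - (\<Sum>n<m. inverse (s - 1/2 + of_nat n))) - (of_real (ln (real m)) - (\<Sum>n<m. inverse (s + of_nat n))))
       \<longlonglongrightarrow> Digamma (s - 1/2) - Digamma s"
      by (intro tendsto_diff Digamma_LIMSEQ ne)
    have "(\<lambda>n. inverse (s + of_nat n)) \<longlonglongrightarrow> 0"
      by (intro filterlim_compose[OF tendsto_inverse_0] tendsto_add_filterlim_at_infinity[OF tendsto_const] tendsto_of_nat)
    then have "(\<lambda>n. inverse (s + of_nat n) - inverse (s + of_nat (Suc n))) sums (inverse (s + of_nat 0) - 0)"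
      by (rule telescope_sums')
    then have l2: "(\<lambda>m. 1/2 * (\<Sum>n<m. inverse (s + of_nat n) - inverse (s + of_nat (Suc n)))) \<longlonglongrightarrow> 1/2 * (1 / s)"
      unfolding sums_def by (intro tendsto_mult tendsto_const) (simp add: divide_inverse)
    have "(\<lambda>m. \<Sum>n<m. inverse (s + of_nat n) - inverse (s - 1/2 + of_nat n) + 1/2 * (inverse (s + of_nat n) - inverse (s + of_nat (Suc n))))
      \<longlonglongrightarrow> Digamma (s - 1/2) - Digamma s + 1/2 * (1 / s)"
    proof -
      have "(\<Sum>n<m. a n - b n + 1/2 * c n) = ((x - (\<Sum>n<m. b n)) - (x - (\<Sum>n<m. a n))) + 1/2 * (\<Sum>n<m. c n)"
        for a b c :: "nat \<Rightarrow> complex" and x m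
        by (simp add: sum.distrib sum_subtractf sum_distrib_left)
      from tendsto_add[OF l1 l2, folded this] show ?thesis .
    qed
    moreover have "inverse w - inverse (w - 1/2) + 1/2 * (inverse w - inverse (w + 1)) =
       (1 / w) ^ Suc 2 * (- (3/4) / ((1 + 1 / w) * (1 - 1 / w / 2)))" if "w \<noteq> 0" "w + 1 \<noteq> 0" "w - 1/2 \<noteq> 0" for w :: complex
    proof -
      have "(1 + 1 / w) * (1 - 1 / w / 2) = (w + 1) * (w - 1/2) / w ^ 2"
        using that by (simp add: field_simps power2_eq_square)
      then have "(1 / w) ^ Suc 2 * (- (3/4) / ((1 + 1 / w) * (1 - 1 / w / 2))) = - (3/4) / (w * ((w + 1) * (w - 1/2)))"
        using that by (simp add: power2_eq_square power3_eq_cube field_simps)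
      moreover have "inverse w - inverse (w - 1/2) = - (1/2) / (w * (w - 1/2))"
        using that by (simp add: field_simps)
      moreover have "inverse w - inverse (w + 1) = 1 / (w * (w + 1))"
        using that by (simp add: field_simps)
      moreover have "- (1/2) / (w * (w - 1/2)) + 1/2 * (1 / (w * (w + 1))) = - (3/4) / (w * ((w + 1) * (w - 1/2)))"
      proof -
        have "- (1/2) / (w * (w - 1/2)) = - (1/2) * (w + 1) / (w * ((w + 1) * (w - 1/2)))"
          using that by simp
        moreover have "1/2 * (1 / (w * (w + 1))) = (1/2) * (w - 1/2) / (w * ((w + 1) * (w - 1/2)))"
          using that by simp
        moreover have "- (1/2) * (w + 1) + (1/2) * (w - 1/2) = - (3/4)" by (simp add: algebra_simps)
        ultimately show ?thesis by (simp only: add_divide_distrib[symmetric])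
      qed
      ultimately show ?thesis by (simp only:)
    qed
    note w = this
    have "inverse (s + of_nat n) - inverse (s - 1/2 + of_nat n) + 1/2 * (inverse (s + of_nat n) - inverse (s + of_nat (Suc n))) =
       (1 / (s + of_nat n)) ^ Suc 2 * (- (3/4) / ((1 + 1 / (s + of_nat n)) * (1 - 1 / (s + of_nat n) / 2)))" for n
    proof -
      have "Re (s + of_nat n) \<ge> 1" using elim by simp
      from w[OF Re_ge_1_neq[OF this]] show ?thesis by (simp only: diff_add_eq of_nat_Suc add.commute[of 1] add.assoc)
    qed
    ultimately show ?case unfolding sums_def by (simp only:)
  qed
qed auto

text \<open>Relative to the leading term, those with \<open>n \<ge> 2\<close> are smaller by
  \<open>(g 1 / g 2) powr (2 * Re s)\<close>, up to a constant supplied by absolute convergence at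
  \<open>s = 2\<close>.\<close>

lemma dirichlet_near_leading:
  fixes d g :: "nat \<Rightarrow> real"
  assumes g: "0 < g 1" "strict_mono_on {1..} g"
    and sm: "\<And>s. Re s > 1 \<Longrightarrow> (\<lambda>n. norm (of_real (d n) * of_real (g n) powr (- 2 * s))) summable_on {1..}"
  shows "\<exists>q C. 0 < q \<and> q < 1 \<and> (\<forall>s. Re s \<ge> 2 \<longrightarrow>
    norm ((\<Sum>\<^sub>\<infinity>n\<in>{1..}. of_real (d n) * of_real (g n) powr (- 2 * s)) * of_real (g 1) powr (2 * s) - of_real (d 1)) \<le> C * q powr Re s)"
proof -
  let ?a = "\<lambda>s n. complex_of_real (d n) * of_real (g n) powr (- 2 * s)"
  have gmono: "g 1 \<le> g n" "n \<ge> 2 \<Longrightarrow> g 2 \<le> g n" if "n \<ge> 1" for n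
    using strict_mono_on_leD[OF g(2)] that by auto
  have g12: "g 1 < g 2" using strict_mono_onD[OF g(2), of 1 2] by simp
  have gpos: "g n > 0" if "n \<ge> 1" for n using gmono(1)[OF that] g(1) by linarith
  define q where "q = (g 1 / g 2) powr 2"
  have q: "0 < q" "q < 1" using g(1) g12 powr_less_mono2[of 2 "g 1 / g 2" 1] by (auto simp: q_def)
  define A where "A = infsum (\<lambda>n. norm (?a 2 n)) {2..}"
  have nrm: "norm (?a s n) = \<bar>d n\<bar> * g n powr (- 2 * Re s)" if "n \<ge> 1" for s n
    using gpos[OF that] by (simp add: norm_mult norm_of_real_powr)
  have bnd: "norm (?a s 1 * of_real (g 1) powr (2 * s) + infsum (?a s) {2..} * of_real (g 1) powr (2 * s) - of_real (d 1)) \<le> A * g 2 powr 4 * q powr Re s"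
    if s: "Re s \<ge> 2" for s
  proof -
    have "?a s 1 * of_real (g 1) powr (2 * s) = of_real (d 1) * (of_real (g 1) powr (- 2 * s) * of_real (g 1) powr (2 * s))"
      by (simp only: mult.assoc)
    also have "complex_of_real (g 1) powr (- 2 * s) * of_real (g 1) powr (2 * s) = 1"
      using g(1) by (simp flip: powr_add)
    finally have 1: "?a s 1 * of_real (g 1) powr (2 * s) = of_real (d 1)" by simp
    have sm2: "(\<lambda>n. norm (?a v n)) summable_on {2..}" if "Re v > 1" for v
      by (rule summable_on_subset_banach[OF sm[OF that]]) auto
    \<comment> \<open>The part \<open>g n powr (- 4)\<close> belongs to the series at 2; in the
      excess exponent, which is not positive, \<open>g n\<close> is replaced by its least value
      \<open>g 2\<close>.\<close>
    have tm: "norm (?a s n) \<le> norm (?a 2 n) * g 2 powr (4 - 2 * Re s)" if n: "n \<in> {2..}" for n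
    proof -
      have n1: "n \<ge> 1" using n by simp
      have "g n powr (- 2 * Re s) = g n powr (- 4) * g n powr (4 - 2 * Re s)" by (simp flip: powr_add)
      also have "\<dots> \<le> g n powr (- 4) * g 2 powr (4 - 2 * Re s)"
        using gmono(2)[OF n1] n g12 g(1) s by (intro mult_left_mono powr_mono2') auto
      finally have "\<bar>d n\<bar> * g n powr (- 2 * Re s) \<le> \<bar>d n\<bar> * (g n powr (- 4) * g 2 powr (4 - 2 * Re s))"
        by (rule mult_left_mono) simp
      then show ?thesis using nrm[OF n1, of s] nrm[OF n1, of 2] by (simp add: mult.assoc)
    qed
    have "norm (infsum (?a s) {2..}) \<le> infsum (\<lambda>n. norm (?a s n)) {2..}"
      by (rule norm_infsum_bound) (rule sm2, use s in simp)
    also have "\<dots> \<le> infsum (\<lambda>n. norm (?a 2 n) * g 2 powr (4 - 2 * Re s)) {2..}"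
      by (rule infsum_mono) (use sm2[of s] sm2[of 2] s tm in \<open>auto intro: summable_on_cmult_left\<close>)
    also have "\<dots> = A * g 2 powr (4 - 2 * Re s)"
      unfolding A_def by (rule infsum_cmult_left) (use sm2[of 2] in auto)
    finally have 2: "norm (infsum (?a s) {2..}) \<le> A * g 2 powr (4 - 2 * Re s)" .
    have "norm (infsum (?a s) {2..} * of_real (g 1) powr (2 * s)) \<le> A * g 2 powr (4 - 2 * Re s) * g 1 powr (2 * Re s)"
      unfolding norm_mult using 2 g(1) by (intro mult_mono) (auto simp: norm_of_real_powr intro: order_trans[OF norm_ge_zero])
    also have "\<dots> = A * g 2 powr 4 * q powr Re s"
    proof -
      have "g 2 powr (4 - 2 * Re s) = g 2 powr 4 / g 2 powr (2 * Re s)" by (simp only: powr_diff)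
      moreover have "q powr Re s = (g 1 / g 2) powr (2 * Re s)" unfolding q_def powr_powr ..
      moreover have "(g 1 / g 2) powr (2 * Re s) = g 1 powr (2 * Re s) / g 2 powr (2 * Re s)"
        by (rule powr_divide)
      ultimately show ?thesis by simp
    qed
    finally show ?thesis unfolding 1 by (simp only: add_diff_cancel_left')
  qed
  have split: "infsum (?a s) {1..} = ?a s 1 + infsum (?a s) {2..}" if "Re s \<ge> 2" for s
  proof -
    have "{1..} = insert 1 {2::nat..}" by auto
    moreover have "?a s summable_on {2..}"
      by (rule abs_summable_summable, rule summable_on_subset_banach[OF sm[of s]]) (use that in auto)
    ultimately show ?thesis by (simp add: infsum_insert)
  qed
  have "norm (infsum (?a s) {1..} * of_real (g 1) powr (2 * s) - of_real (d 1)) \<le> A * g 2 powr 4 * q powr Re s" if "Re s \<ge> 2" for s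
    using bnd[OF that] unfolding split[OF that] distrib_right .
  then show ?thesis using q by blast
qed

text \<open>Divide Euler's limit formula at \<open>w - 1/2\<close> by the one at \<open>w\<close>:
  the factorials cancel, and the exponentials leave the square root of \<open>n\<close>.\<close>

lemma Gamma_ratio_LIMSEQ:
  assumes w: "Re w > 1"
  shows "(\<lambda>n. Gamma (w + of_nat n - 1/2) / Gamma (w + of_nat n) * exp (of_real (ln (real n)) / 2)) \<longlonglongrightarrow> 1"
proof -
  have ni: "w \<notin> \<int>\<^sub>\<le>\<^sub>0" "w - 1/2 \<notin> \<int>\<^sub>\<le>\<^sub>0" using w by (auto intro!: nonpos_Ints_Re)
  have lim: "(\<lambda>n. (Gamma (w - 1/2) / Gamma_series' (w - 1/2) n) / (Gamma w / Gamma_series' w n)) \<longlonglongrightarrow> (Gamma (w - 1/2) / Gamma (w - 1/2)) / (Gamma w / Gamma w)"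
    using ni by (intro tendsto_intros Gamma_series'_LIMSEQ) (auto simp: Gamma_eq_zero_iff)
  have p: "pochhammer v n = Gamma (v + of_nat n) / Gamma v" if "v \<notin> \<int>\<^sub>\<le>\<^sub>0" for v :: complex and n
    using pochhammer_Gamma[OF that] .
  have eq: "(Gamma (w - 1/2) / Gamma_series' (w - 1/2) n) / (Gamma w / Gamma_series' w n) =
     Gamma (w + of_nat n - 1/2) / Gamma (w + of_nat n) * exp (of_real (ln (real n)) / 2)" for n
  proof -
    define l where "l = complex_of_real (ln (real n))"
    have e: "exp (w * l) = exp ((w - 1/2) * l) * exp (l / 2)"
      by (simp add: algebra_simps flip: exp_add)
    have f: "fact (n - 1) \<noteq> (0 :: complex)" by simp
    have G: "Gamma w \<noteq> 0" "Gamma (w - 1/2) \<noteq> 0" "Gamma (w + of_nat n) \<noteq> 0"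
      using ni w by (auto simp: Gamma_eq_zero_iff intro!: nonpos_Ints_Re)
    have 1: "Gamma (w - 1/2) / Gamma_series' (w - 1/2) n = Gamma (w - 1/2 + of_nat n) / (fact (n - 1) * exp ((w - 1/2) * l))"
      using G by (simp add: Gamma_series'_def p[OF ni(2)] l_def)
    have 2: "Gamma w / Gamma_series' w n = Gamma (w + of_nat n) / (fact (n - 1) * (exp ((w - 1/2) * l) * exp (l / 2)))"
      using G by (simp add: Gamma_series'_def p[OF ni(1)] l_def flip: e[unfolded l_def])
    have 3: "w + of_nat n - 1/2 = w - 1/2 + of_nat n" by simp
    show ?thesis unfolding 1 2 3 l_def[symmetric] using f G by simp
  qed
  show ?thesis using lim ni unfolding eq by (simp add: Gamma_eq_zero_iff)
qed

lemma log_deriv_mult: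
  assumes "f analytic_on {s}" "f s \<noteq> 0" "g analytic_on {s}" "g s \<noteq> 0"
  shows "log_deriv (\<lambda>s. f s * g s) s = log_deriv f s + log_deriv g s"
proof -
  have "deriv (\<lambda>s. f s * g s) s = f s * deriv g s + deriv f s * g s"
    using assms by (intro complex_derivative_mult_at) (auto intro: analytic_on_imp_differentiable_at)
  then show ?thesis using assms by (simp add: log_deriv_def field_simps)
qed

lemma log_deriv_const: "log_deriv (\<lambda>_. k) s = 0" by (simp add: log_deriv_def)

lemma log_deriv_power:
  assumes "f analytic_on {s}" "f s \<noteq> 0"
  shows "log_deriv (\<lambda>s. f s ^ n) s = of_nat n * log_deriv f s"
proof (induction n)
  case (Suc n)
  have "log_deriv (\<lambda>s. f s * f s ^ n) s = log_deriv f s + log_deriv (\<lambda>s. f s ^ n) s"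
    using assms by (intro log_deriv_mult) (auto intro: analytic_intros)
  then show ?case using Suc by (simp add: algebra_simps)
qed (simp add: log_deriv_const)

lemma log_deriv_divide:
  assumes "f analytic_on {s}" "f s \<noteq> 0" "g analytic_on {s}" "g s \<noteq> 0"
  shows "log_deriv (\<lambda>s. f s / g s) s = log_deriv f s - log_deriv g s"
proof -
  have an: "(\<lambda>s. f s / g s) analytic_on {s}" using assms by (intro analytic_intros) auto
  have "isCont g s" using assms(3) by (simp add: analytic_at_imp_isCont)
  then have "\<forall>\<^sub>F v in nhds s. g v \<noteq> 0"
    using assms(4) by (simp add: continuous_within tendsto_imp_eventually_ne eventually_nhds_conv_at)
  then have "\<forall>\<^sub>F v in nhds s. f v / g v * g v = f v" by eventually_elim simp
  then have "deriv (\<lambda>s. f s / g s * g s) s = deriv f s" by (rule deriv_cong_ev) simp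
  then have "log_deriv (\<lambda>s. f s / g s * g s) s = log_deriv f s"
    using assms by (simp add: log_deriv_def)
  then show ?thesis using log_deriv_mult[OF an _ assms(3,4)] assms by simp
qed

lemma log_deriv_Gamma_shift:
  assumes "Re s > Re \<beta>"
  shows "(\<lambda>s. Gamma (s - \<beta>)) analytic_on {s}" "Gamma (s - \<beta>) \<noteq> 0"
    "log_deriv (\<lambda>s. Gamma (s - \<beta>)) s = Digamma (s - \<beta>)"
proof -
  have n: "s - \<beta> \<notin> \<int>\<^sub>\<le>\<^sub>0" using assms by (intro nonpos_Ints_Re) simp
  show "(\<lambda>s. Gamma (s - \<beta>)) analytic_on {s}"
    using n by (intro analytic_on_Gamma' analytic_intros) auto
  show G: "Gamma (s - \<beta>) \<noteq> 0" using n by (simp add: Gamma_eq_zero_iff)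
  have "((\<lambda>s. s - \<beta>) has_field_derivative 1) (at s)" by (auto intro!: derivative_eq_intros)
  from DERIV_imp_deriv[OF DERIV_chain2[where f = Gamma and g = "\<lambda>s. s - \<beta>" and x = s, OF has_field_derivative_Gamma[OF n] this]]
  show "log_deriv (\<lambda>s. Gamma (s - \<beta>)) s = Digamma (s - \<beta>)" using G by (simp add: log_deriv_def)
qed

lemma powr_exp_form:
  fixes a :: real assumes "a > 0"
  shows "(\<lambda>s. complex_of_real a powr (k * s)) analytic_on {s}" "complex_of_real a powr (k * s) \<noteq> 0"
    "log_deriv (\<lambda>s. complex_of_real a powr (k * s)) s = k * of_real (ln a)"
proof -
  have eq: "complex_of_real a powr (k * s) = exp (k * s * of_real (ln a))" for s
    using assms by (simp add: powr_def Ln_of_real)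
  show "(\<lambda>s. complex_of_real a powr (k * s)) analytic_on {s}" unfolding eq by (intro analytic_intros)
  show "complex_of_real a powr (k * s) \<noteq> 0" unfolding eq by simp
  have "((\<lambda>s. exp (k * s * of_real (ln a))) has_field_derivative exp (k * s * of_real (ln a)) * (k * of_real (ln a))) (at s)"
    by (auto intro!: derivative_eq_intros)
  then show "log_deriv (\<lambda>s. complex_of_real a powr (k * s)) s = k * of_real (ln a)"
    unfolding log_deriv_def eq by (simp add: DERIV_imp_deriv)
qed

text \<open>Factor \<open>\<phi> = b * E\<close> into the explicit leading behaviour
  \<open>b\<close> and a quotient \<open>E\<close> that tends to \<open>d 1\<close> exponentially
  fast. Only the Gamma quotient in \<open>b\<close> shows up in the powers of the expansion; the
  power of \<open>g 1\<close> adds the constant \<open>- 2 * ln (g 1)\<close>.\<close>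

lemma
  fixes d g :: "nat \<Rightarrow> real" and c :: nat and K :: complex
  assumes mero: "\<phi> nicely_meromorphic_on UNIV"
    and g: "0 < g 1" "strict_mono_on {1..} g" and d: "d 1 \<noteq> 0" and K: "K \<noteq> 0"
    and sm: "\<And>s. Re s > 1 \<Longrightarrow> (\<lambda>n. norm (of_real (d n) * of_real (g n) powr (- 2 * s))) summable_on {1..}"
    and dir: "\<And>s. Re s > 1 \<Longrightarrow> \<phi> s = K * (Gamma (s - 1/2) / Gamma s) ^ c *
              (\<Sum>\<^sub>\<infinity>n\<in>{1..}. of_real (d n) * of_real (g n) powr (- 2 * s))"
  shows nice_scattering: "nice \<phi>"
    and expansion_scattering: "expansion 2 (\<lambda>s. log_deriv \<phi> s + (2 * of_real (ln (g 1)) + of_nat c / 2 * (1 / s)))"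
    and scattering_LIMSEQ: "\<And>w. Re w > 1 \<Longrightarrow> (\<lambda>n. \<phi> (w + of_nat n) * of_real (g 1) powr (2 * (w + of_nat n)) * exp (of_nat c * of_real (ln (real n)) / 2)) \<longlonglongrightarrow> K * of_real (d 1)"
proof -
  let ?D = "\<lambda>s. \<Sum>\<^sub>\<infinity>n\<in>{1..}. complex_of_real (d n) * of_real (g n) powr (- 2 * s)"
  define G where "G = (\<lambda>s :: complex. (Gamma (s - 1/2) / Gamma s) ^ c)"
  define b where "b = (\<lambda>s. K * G s * of_real (g 1) powr (-2 * s))"
  define E where "E = (\<lambda>s. \<phi> s / b s)"
  obtain q C where q: "0 < q" "q < 1" and C: "\<And>s. Re s \<ge> 2 \<Longrightarrow> norm (?D s * of_real (g 1) powr (2 * s) - of_real (d 1)) \<le> C * q powr Re s"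
    using dirichlet_near_leading[OF g sm] by blast
  have d1: "complex_of_real (d 1) \<noteq> 0" using d by simp
  have Gan: "G analytic_on {s}" "G s \<noteq> 0" "log_deriv G s = of_nat c * (Digamma (s - 1/2) - Digamma s)" if "Re s > 1" for s
  proof -
    have 1: "Re s > Re (1/2)" "Re s > Re 0" using that by auto
    note a = log_deriv_Gamma_shift[OF 1(1)] and a' = log_deriv_Gamma_shift[OF 1(2), simplified]
    have q: "(\<lambda>s. Gamma (s - 1/2) / Gamma s) analytic_on {s}" "Gamma (s - 1/2) / Gamma s \<noteq> 0"
      using a a' by (auto intro!: analytic_intros(8) analytic_on_divide)
    show "G analytic_on {s}" "G s \<noteq> 0" unfolding G_def using q by (auto intro: analytic_on_power)
    show "log_deriv G s = of_nat c * (Digamma (s - 1/2) - Digamma s)"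
      unfolding G_def log_deriv_power[OF q] log_deriv_divide[OF a(1,2) a'(1,2)] a(3) a'(3) ..
  qed
  have ban: "b analytic_on {s}" "b s \<noteq> 0" "log_deriv b s = of_nat c * (Digamma (s - 1/2) - Digamma s) + - 2 * of_real (ln (g 1))" if "Re s > 1" for s
  proof -
    note a = Gan[OF that] and p = powr_exp_form[OF g(1), of "-2" s]
    have KG: "(\<lambda>s. K * G s) analytic_on {s}" "K * G s \<noteq> 0" using a K by (auto intro!: analytic_intros)
    show "b analytic_on {s}" "b s \<noteq> 0" unfolding b_def using KG p by (auto intro!: analytic_on_mult)
    have "log_deriv (\<lambda>s. K * G s) s = log_deriv G s"
      using log_deriv_mult[of "\<lambda>_. K" s G] a K by (simp add: log_deriv_const)
    then show "log_deriv b s = of_nat c * (Digamma (s - 1/2) - Digamma s) + - 2 * of_real (ln (g 1))"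
      unfolding b_def log_deriv_mult[OF KG p(1,2)] p(3) a(3)[symmetric] by simp
  qed
  have phi_b: "\<phi> s = b s * E s" if "Re s > 1" for s using ban(2)[OF that] by (simp add: E_def)
  have cancel1: "k * p * (x * m) = k * x" if "p * m = 1" for k p m x :: complex
  proof -
    have "k * p * (x * m) = k * x * (p * m)" by (simp only: mult_ac)
    then show ?thesis using that by simp
  qed
  have cancel2: "k * y * p * x * m * e = k * (y * e) * x" if "p * m = 1" for k y p m x e :: complex
  proof -
    have "k * y * p * x * m * e = k * (y * e) * x * (p * m)" by (simp only: mult_ac)
    then show ?thesis using that by simp
  qed
  have E_eq: "E s = ?D s * of_real (g 1) powr (2 * s)" if "Re s > 1" for s
  proof -
    have "complex_of_real (g 1) powr (-2 * s) * of_real (g 1) powr (2 * s) = 1"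
      using g(1) by (simp flip: powr_add)
    then have "K * G s * of_real (g 1) powr (-2 * s) * (?D s * of_real (g 1) powr (2 * s)) = K * G s * ?D s"
      by (rule cancel1)
    also have "\<dots> = \<phi> s" using dir[OF that] by (simp only: G_def)
    finally have e: "b s * (?D s * of_real (g 1) powr (2 * s)) = \<phi> s" by (simp only: b_def)
    show ?thesis unfolding E_def e[symmetric] using ban(2)[OF that] by (rule nonzero_mult_div_cancel_left)
  qed
  have EC: "norm (E s - of_real (d 1)) \<le> C * q powr Re s" if "Re s \<ge> 2" for s
    using C[OF that] E_eq[of s] that by simp
  \<comment> \<open>So far \<open>\<phi>\<close> is only known to be meromorphic; the bounds on
    \<open>b\<close> and \<open>E\<close> near \<open>s\<close> exclude a pole.\<close>
  have phian: "\<phi> analytic_on {s}" if s: "Re s > 2" for s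
  proof (rule nicely_meromorphic_bounded_analytic[OF mero])
    have "isCont b s" using ban(1)[of s] s by (intro analytic_at_imp_isCont) auto
    then have "((\<lambda>v. norm (b v)) \<longlongrightarrow> norm (b s)) (at s)" by (intro tendsto_norm) (simp add: isCont_def)
    then have "\<forall>\<^sub>F v in at s. norm (b v) < norm (b s) + 1" by (rule order_tendstoD) simp
    moreover have "\<forall>\<^sub>F v in at s. Re v > 2"
      using eventually_at_in_open'[OF open_halfspace_Re_gt[of 2], of s] s by simp
    ultimately show "\<forall>\<^sub>F v in at s. norm (\<phi> v) \<le> (norm (b s) + 1) * (\<bar>C\<bar> + \<bar>d 1\<bar>)"
    proof eventually_elim
      case (elim v)
      have "C * q powr Re v \<le> \<bar>C\<bar> * 1" using q elim by (intro mult_mono powr_le1) auto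
      then have "norm (E v - of_real (d 1)) \<le> \<bar>C\<bar>" using EC[of v] elim by simp
      then have "norm (E v) \<le> \<bar>C\<bar> + \<bar>d 1\<bar>" using norm_triangle_sub[of "E v" "of_real (d 1)"] by simp
      then have "norm (b v) * norm (E v) \<le> (norm (b s) + 1) * (\<bar>C\<bar> + \<bar>d 1\<bar>)"
        using elim by (intro mult_mono) auto
      then show ?case using phi_b[of v] elim by (simp add: norm_mult)
    qed
  qed
  have Ean: "E analytic_on {s}" if "Re s > 2" for s
    unfolding E_def using phian[OF that] ban[of s] that by (intro analytic_on_divide) auto
  have secE: "ev_sector (\<lambda>s. E analytic_on {s})" using Ean by (rule ev_sector_Re_gt)
  have secC: "ev_sector (\<lambda>s. norm (E s - of_real (d 1)) \<le> C * q powr Re s)"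
    using EC by (intro ev_sector_Re_gt[of 2]) auto
  have niceE: "nice E" by (rule nice_near_const[OF d1 q secE secC])
  have neglE: "rapid_decay (log_deriv E)" by (rule rapid_decay_log_deriv[OF d1 q secE secC])
  have niceb: "nice b"
  proof -
    have gs: "nice (\<lambda>s. Gamma (s - 1/2))" using nice_affine[OF nice_Gamma, of 1 "-1/2"] by simp
    have "nice (\<lambda>s. complex_of_real (g 1) powr (- (of_real 2 * s + 0)))"
      by (rule nice_affine[OF nice_powr[OF g(1)]]) simp
    then have "nice (\<lambda>s. complex_of_real (g 1) powr (-2 * s))" by simp
    then show ?thesis unfolding b_def G_def
      by (intro nice_mult nice_power nice_divide nice_const K gs nice_Gamma)
  qed
  show nphi: "nice \<phi>"
  proof (rule nice_cong)
    show "ev_sector (\<lambda>s. \<phi> s = b s * E s)" using phi_b by (rule ev_sector_Re_gt)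
    show "ev_sector (\<lambda>s. \<phi> analytic_on {s})" using phian by (rule ev_sector_Re_gt)
    show "nice (\<lambda>s. b s * E s)" by (rule nice_mult[OF niceb niceE])
  qed
  have En: "ev_strips (\<lambda>s. E s \<noteq> 0)"
    using niceE ev_sector_ev_strips unfolding nice_def by (blast intro: ev_strips_mono)
  have "ev_strips (\<lambda>s. log_deriv \<phi> s + (2 * of_real (ln (g 1)) + of_nat c / 2 * (1 / s)) =
      of_nat c * (Digamma (s - 1/2) - Digamma s + 1/2 * (1 / s)) + log_deriv E s)"
    using ev_strips_conj[OF En ev_strips_Re_ge[of 3]]
  proof (rule ev_strips_mono)
    fix s assume s: "E s \<noteq> 0 \<and> 3 \<le> Re s"
    have "\<forall>\<^sub>F v in nhds s. \<phi> v = b v * E v"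
      using eventually_nhds_in_open[OF open_halfspace_Re_gt[of 1], of s] s phi_b by (auto elim!: eventually_mono)
    then have "log_deriv \<phi> s = log_deriv (\<lambda>v. b v * E v) s"
      unfolding log_deriv_def using deriv_cong_ev[of \<phi> "\<lambda>v. b v * E v" s s] phi_b[of s] s by simp
    also have "\<dots> = log_deriv b s + log_deriv E s"
      using ban[of s] Ean[of s] s by (intro log_deriv_mult) auto
    finally show "log_deriv \<phi> s + (2 * of_real (ln (g 1)) + of_nat c / 2 * (1 / s)) =
      of_nat c * (Digamma (s - 1/2) - Digamma s + 1/2 * (1 / s)) + log_deriv E s"
      using ban(3)[of s] s by (simp add: algebra_simps)
  qed
  then show "expansion 2 (\<lambda>s. log_deriv \<phi> s + (2 * of_real (ln (g 1)) + of_nat c / 2 * (1 / s)))"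
    by (rule expansion_cong_ev_strips) (intro expansion_add expansion_cmult expansion_Digamma_diff rapid_decay_imp_expansion neglE)
  fix w assume w: "Re w > 1"
  have Elim: "(\<lambda>n. E (w + of_nat n)) \<longlonglongrightarrow> of_real (d 1)"
  proof (rule LIM_zero_cancel, rule Lim_null_comparison)
    show "\<forall>\<^sub>F n in sequentially. norm (E (w + of_nat n) - of_real (d 1)) \<le> \<bar>C\<bar> * q powr (Re w + real n)"
      using eventually_ge_at_top[of 1]
    proof eventually_elim
      case (elim n)
      have "norm (E (w + of_nat n) - of_real (d 1)) \<le> C * q powr Re (w + of_nat n)" using w elim by (intro EC) simp
      also have "\<dots> \<le> \<bar>C\<bar> * q powr (Re w + real n)" by (simp add: mult_right_mono)
      finally show ?case .
    qed
    show "(\<lambda>n. \<bar>C\<bar> * q powr (Re w + real n)) \<longlonglongrightarrow> 0" using q by real_asymp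
  qed
  have "(\<lambda>n. K * (Gamma (w + of_nat n - 1/2) / Gamma (w + of_nat n) * exp (of_real (ln (real n)) / 2)) ^ c * E (w + of_nat n)) \<longlonglongrightarrow> K * 1 ^ c * of_real (d 1)"
    by (intro tendsto_intros Gamma_ratio_LIMSEQ Elim w)
  moreover have "K * (Gamma (w + of_nat n - 1/2) / Gamma (w + of_nat n) * exp (of_real (ln (real n)) / 2)) ^ c * E (w + of_nat n) =
     \<phi> (w + of_nat n) * of_real (g 1) powr (2 * (w + of_nat n)) * exp (of_nat c * of_real (ln (real n)) / 2)" for n
  proof -
    have w1: "Re (w + of_nat n) > 1" using w by simp
    define v where "v = w + of_nat n"
    have "complex_of_real (g 1) powr (-2 * v) * of_real (g 1) powr (2 * v) = 1"
      using g(1) by (simp flip: powr_add)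
    note c2 = cancel2[OF this]
    have "exp (of_real (ln (real n)) / 2) ^ c = exp (of_nat c * complex_of_real (ln (real n)) / 2)"
      by (simp flip: exp_of_nat_mult)
    moreover have "\<phi> v = K * G v * of_real (g 1) powr (-2 * v) * E v" using phi_b[OF w1] by (simp only: b_def v_def)
    ultimately show ?thesis
      unfolding v_def[symmetric] power_mult_distrib by (simp only: c2 G_def)
  qed
  ultimately show "(\<lambda>n. \<phi> (w + of_nat n) * of_real (g 1) powr (2 * (w + of_nat n)) * exp (of_nat c * of_real (ln (real n)) / 2)) \<longlonglongrightarrow> K * of_real (d 1)"
    by simp
qed

section \<open>Expansions on the real axis\<close>

lemma expansion_real_bound:
  assumes "expansion m h"
  shows "\<exists>C X. \<forall>x\<ge>X. norm (h (of_real x)) \<le> C * x powr (- real m)"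
proof -
  obtain p where p: "(\<lambda>s. h s - (1 / s) ^ m * poly p (1 / s)) \<in> O[strip 0](\<lambda>s. (1 / s) ^ m)"
    using expansionD[OF assms] by blast
  have "((\<lambda>s. poly p (1 / s)) \<longlongrightarrow> poly p 0) (strip 0)"
    by (intro tendsto_intros tendsto_inverse_strip)
  then have "(\<lambda>s. poly p (1 / s)) \<in> O[strip 0](\<lambda>s. 1)"
    by (intro bigoI_tendsto[where c = "poly p 0"]) auto
  then have "(\<lambda>s. (1 / s) ^ m * poly p (1 / s)) \<in> O[strip 0](\<lambda>s. (1 / s) ^ m * 1)"
    by (intro landau_o.big.mult landau_o.big_refl)
  then have t: "(\<lambda>s. (1 / s) ^ m * poly p (1 / s)) \<in> O[strip 0](\<lambda>s. (1 / s) ^ m)" by simp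
  from sum_in_bigo(1)[OF p t] have "h \<in> O[strip 0](\<lambda>s. (1 / s) ^ m)" by simp
  then obtain C where "\<forall>\<^sub>F s in strip 0. norm (h s) \<le> C * norm ((1 / s) ^ m)"
    by (elim landau_o.bigE)
  then obtain R where R: "\<And>s. Re s \<ge> R \<Longrightarrow> \<bar>Im s\<bar> \<le> 0 \<Longrightarrow> norm (h s) \<le> C * norm ((1 / s) ^ m)"
    unfolding eventually_strip by blast
  have "norm (h (of_real x)) \<le> C * x powr (- real m)" if x: "x \<ge> max R 1" for x
  proof -
    have "norm ((1 / complex_of_real x) ^ m) = x powr (- real m)"
    proof -
      have "norm ((1 / complex_of_real x) ^ m) = (1 / x) ^ m" using x by (simp add: norm_power norm_divide)
      also have "\<dots> = x powr (- real m)"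
        using x by (simp add: powr_minus powr_realpow power_one_over inverse_eq_divide)
      finally show ?thesis .
    qed
    then show ?thesis using R[of "of_real x"] x by simp
  qed
  then show ?thesis by blast
qed

lemma expansion_real_expansion:
  assumes "expansion 1 h"
  shows "\<exists>N a C X. \<forall>x\<ge>X. norm (h (of_real x) - (\<Sum>j=1..N. a j / of_real x ^ j)) \<le> C * x powr (- real M - 1)"
proof -
  obtain p where p: "(\<lambda>s. h s - (1 / s) ^ 1 * poly p (1 / s)) \<in> O[strip 0](\<lambda>s. (1 / s) ^ Suc M)"
    using expansionD[OF assms] by blast
  then obtain C where "\<forall>\<^sub>F s in strip 0. norm (h s - (1 / s) ^ 1 * poly p (1 / s)) \<le> C * norm ((1 / s) ^ Suc M)"
    by (elim landau_o.bigE)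
  then obtain R where R: "\<And>s. Re s \<ge> R \<Longrightarrow> \<bar>Im s\<bar> \<le> 0 \<Longrightarrow> norm (h s - (1 / s) ^ 1 * poly p (1 / s)) \<le> C * norm ((1 / s) ^ Suc M)"
    unfolding eventually_strip by blast
  define N where "N = Suc (degree p)"
  \<comment> \<open>The expansion starts with \<open>1 / s\<close>, so the coefficient of the
    \<open>j\<close>-th power has index \<open>j - 1\<close> in \<open>p\<close>.\<close>
  define a where "a = (\<lambda>j. coeff p (j - 1))"
  have ps: "(1 / s) ^ 1 * poly p (1 / s) = (\<Sum>j=1..N. a j / s ^ j)" for s :: complex
  proof -
    have "(\<Sum>j=1..N. a j / s ^ j) = (\<Sum>i=0..degree p. a (Suc i) / s ^ Suc i)"
      unfolding N_def One_nat_def by (rule sum.shift_bounds_cl_Suc_ivl)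
    also have "\<dots> = (\<Sum>i\<le>degree p. (1 / s) * (coeff p i * (1 / s) ^ i))"
      by (rule sum.cong) (auto simp: a_def power_divide)
    finally show ?thesis by (simp only: poly_altdef sum_distrib_left power_one_right)
  qed
  have "norm (h (of_real x) - (\<Sum>j=1..N. a j / of_real x ^ j)) \<le> C * x powr (- real M - 1)" if x: "x \<ge> max R 1" for x
  proof -
    have "norm ((1 / complex_of_real x) ^ Suc M) = (1 / x) ^ Suc M" using x by (simp add: norm_power norm_divide)
    also have "\<dots> = x powr (- real (Suc M))"
      using x by (simp add: powr_minus powr_realpow power_one_over inverse_eq_divide del: power_Suc of_nat_Suc)
    also have "- real (Suc M) = - real M - 1" by simp
    finally have n: "norm ((1 / complex_of_real x) ^ Suc M) = x powr (- real M - 1)" .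
    show ?thesis using R[of "of_real x"] x unfolding ps n by simp
  qed
  then show ?thesis by blast
qed

section \<open>Continuation of superzeta functions and their derivative at zero\<close>

lemma log_deriv_analytic: "f analytic_on {s} \<Longrightarrow> f s \<noteq> 0 \<Longrightarrow> log_deriv f analytic_on {s}"
  unfolding log_deriv_def by (auto intro!: analytic_on_divide analytic_deriv)

lemma isCont_ray:
  assumes "h analytic_on {z + of_real x}"
  shows "isCont (\<lambda>x. h (z + of_real x)) x"
proof -
  have "isCont h (z + of_real x)" using assms by (rule analytic_at_imp_isCont)
  moreover have "isCont (\<lambda>x. z + complex_of_real x) x" by (intro continuous_intros)
  ultimately show ?thesis using isCont_o2 by blast
qed

text \<open>The identity theorem is applied to the difference with its removable singularities
  filled in. At common poles the two functions agree as well, since both have the default value 0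
  there.\<close>

lemma nicely_meromorphic_eq_UNIV:
  assumes f: "f nicely_meromorphic_on UNIV" and g: "g nicely_meromorphic_on UNIV"
    and U: "open U" "U \<noteq> {}" and eq: "\<And>s. s \<in> U \<Longrightarrow> f s = g s"
  shows "f = g"
proof
  fix w
  have mf: "f meromorphic_on UNIV" "g meromorphic_on UNIV"
    using f g by (auto simp: nicely_meromorphic_on_def)
  define h where "h = remove_sings (\<lambda>s. f s - g s)"
  have mh: "(\<lambda>s. f s - g s) meromorphic_on UNIV" using mf by (intro meromorphic_on_diff)
  then have nh: "h nicely_meromorphic_on UNIV" unfolding h_def by (rule remove_sings_nicely_meromorphic)
  obtain u where u: "u \<in> U" using U by blast
  have "\<forall>\<^sub>F s in at u. f s - g s = 0"
    using eventually_at_in_open'[OF U(1) u] eq by (auto elim!: eventually_mono)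
  moreover have "\<forall>\<^sub>F s in at u. h s = f s - g s"
    unfolding h_def by (rule eventually_remove_sings_eq_at)
      (use mh in \<open>auto intro: meromorphic_on_isolated_singularity meromorphic_on_subset\<close>)
  ultimately have "\<forall>\<^sub>F s in at u. h s = 0" by eventually_elim simp
  then have "\<exists>\<^sub>F s in at u. h s = 0" by (simp add: eventually_frequently)
  from frequently_eq_meromorphic_imp_constant[OF this nh open_UNIV connected_UNIV UNIV_I]
  have h0: "h s = 0" for s by simp
  have "\<forall>\<^sub>F s in at w. h s = f s - g s"
    unfolding h_def by (rule eventually_remove_sings_eq_at)
      (use mh in \<open>auto intro: meromorphic_on_isolated_singularity meromorphic_on_subset\<close>)
  then have ev: "\<forall>\<^sub>F s in at w. f s = g s" by eventually_elim (simp add: h0)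
  have f': "(is_pole f w \<and> f w = 0) \<or> f \<midarrow>w\<rightarrow> f w" and g': "(is_pole g w \<and> g w = 0) \<or> g \<midarrow>w\<rightarrow> g w"
    using f g by (auto simp: nicely_meromorphic_on_def)
  have pole: "is_pole f w \<longleftrightarrow> is_pole g w" using is_pole_cong[OF ev refl] .
  show "f w = g w"
  proof (cases "is_pole f w")
    case True
    then have "\<not> f \<midarrow>w\<rightarrow> f w" "\<not> g \<midarrow>w\<rightarrow> g w"
      using pole not_tendsto_and_filterlim_at_infinity[of "at w"] by (auto simp: is_pole_def)
    then show ?thesis using f' g' by auto
  next
    case False
    then have "f \<midarrow>w\<rightarrow> f w" "g \<midarrow>w\<rightarrow> g w" using f' g' pole by auto
    then have "f \<midarrow>w\<rightarrow> g w" using tendsto_cong[OF ev] by blast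
    then show ?thesis using \<open>f \<midarrow>w\<rightarrow> f w\<close> by (rule LIM_unique[rotated])
  qed
qed

text \<open>Lets the final formula speak of arbitrary continuations although it is proved for the
  constructed ones.\<close>

lemma superzeta_continuation_unique:
  assumes "superzeta_continuation f z F1" "superzeta_continuation f z F2"
  shows "F1 = F2"
proof (rule nicely_meromorphic_eq_UNIV)
  show "open {s. Re s > 2}" by (rule open_halfspace_Re_gt)
  have "3 \<in> {s. Re s > 2}" by simp
  then show "{s. Re s > 2} \<noteq> {}" by blast
qed (use assms in \<open>auto simp: superzeta_continuation_def\<close>)

context order_two
begin

lemma analytic: "f analytic_on {s}"
  using hol by (metis analytic_on_holomorphic open_UNIV subset_UNIV)

lemma log_deriv3_ray_continuous: "continuous_on {0..} (\<lambda>x. log_deriv3 f (z + of_real x))"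
proof (rule continuous_at_imp_continuous_on, rule ballI)
  fix x :: real assume "x \<in> {0..}"
  then have "log_deriv f analytic_on {z + of_real x}"
    using nonzero[of x] by (intro log_deriv_analytic analytic) auto
  then show "isCont (\<lambda>x. log_deriv3 f (z + of_real x)) x"
    unfolding log_deriv3_eq by (intro isCont_ray analytic_deriv)
qed

context
  assumes nice: "nice f"
begin

lemma expansion_log_deriv3: "expansion 1 (\<lambda>s. log_deriv3 f (z + s))"
proof -
  have "expansion 1 (log_deriv3 f)" using nice by (simp add: nice_def tame_def log_deriv3_eq)
  from expansion_affine[OF this, of 1 z] show ?thesis by (simp add: add.commute)
qed

lemma zero_free_sector: "\<exists>\<epsilon>>0. \<exists>R. \<forall>y. f y = 0 \<longrightarrow> Re y \<ge> R \<longrightarrow> \<bar>Im y\<bar> \<ge> \<epsilon> * Re y"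
proof -
  have "ev_sector (\<lambda>s. f analytic_on {s} \<and> f s \<noteq> 0)" using nice by (simp add: nice_def)
  then obtain \<epsilon> R where "\<epsilon> > 0" "\<And>s. Re s \<ge> R \<Longrightarrow> \<bar>Im s\<bar> \<le> \<epsilon> * Re s \<Longrightarrow> f s \<noteq> 0"
    unfolding ev_sector_def by blast
  then show ?thesis by (meson linear)
qed

lemma log_deriv3_ray_integrable:
  assumes "2 < Re s" "Re s < 3"
  shows "integrable lpos (\<lambda>x. of_real x powr (2 - s) * log_deriv3 f (z + of_real x))"
proof -
  obtain C X where C: "\<And>x. x \<ge> X \<Longrightarrow> norm (log_deriv3 f (z + of_real x)) \<le> C * x powr (- real 1)"
    using expansion_real_bound[OF expansion_log_deriv3] by blast
  \<comment> \<open>With \<open>N = 0\<close> nothing is subtracted, and decay like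
    \<open>1 / x\<close>, the case \<open>M = 0\<close>, already covers the strip
    \<open>2 < Re s < 3\<close>.\<close>
  have "integrable lpos (\<lambda>x. of_real x powr (2 - s) * mellin_rest (\<lambda>x. log_deriv3 f (z + of_real x)) (\<lambda>_. 0) 0 x)"
    by (rule mellin_rest_integrable[where M = 0 and X = X and C = C])
       (use log_deriv3_ray_continuous C assms in auto)
  then show ?thesis by (simp add: mellin_rest_def)
qed

lemma superzeta_entire:
  obtains H where "H holomorphic_on UNIV"
    "\<And>s. Re s > 2 \<Longrightarrow> H s = (1 - s) * (2 - s) * superzeta f s z"
    "\<And>s. 2 < Re s \<Longrightarrow> Re s < 3 \<Longrightarrow> H s = sin (of_real pi * s) / of_real pi *
        (\<integral>x. of_real x powr (2 - s) * log_deriv3 f (z + of_real x) \<partial>lpos)"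
proof -
  let ?h = "\<lambda>s. (1 - s) * (2 - s) * superzeta f s z"
  let ?F = "\<lambda>x. log_deriv3 f (z + complex_of_real x)"
  obtain \<epsilon> R where \<epsilon>: "\<epsilon> > 0" "\<And>y. f y = 0 \<Longrightarrow> Re y \<ge> R \<Longrightarrow> \<bar>Im y\<bar> \<ge> \<epsilon> * Re y"
    using zero_free_sector by blast
  have mel: "?h s = sin (of_real pi * s) / of_real pi * (\<integral>x. of_real x powr (2 - s) * ?F x \<partial>lpos)"
    if "2 < Re s" "Re s < 3" for s
    by (rule superzeta_mellin[OF that \<epsilon>])
  have hh: "?h holomorphic_on {s. Re s > 2}"
    by (intro holomorphic_intros superzeta_holomorphic)
  have ext: "\<exists>k. k holomorphic_on {s. 2 - real M < Re s \<and> Re s < 3} \<and> (\<forall>s. 2 < Re s \<and> Re s < 3 \<longrightarrow> k s = ?h s)" for M :: nat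
  proof -
    obtain N a C X where e: "\<And>x. x \<ge> X \<Longrightarrow> norm (?F x - (\<Sum>j=1..N. a j / of_real x ^ j)) \<le> C * x powr (- real M - 1)"
      using expansion_real_expansion[OF expansion_log_deriv3] by blast
    have "mellin_ext ?F a N holomorphic_on {s. 2 - real M < Re s \<and> Re s < 3}"
      by (rule mellin_ext_holomorphic[OF log_deriv3_ray_continuous e])
    moreover have "mellin_ext ?F a N s = ?h s" if "2 < Re s" "Re s < 3" for s
      unfolding mel[OF that] by (rule mellin_ext_eq[OF log_deriv3_ray_continuous e that])
    ultimately show ?thesis by blast
  qed
  show thesis
  proof (rule entire_extension[OF hh ext])
    fix H assume H: "H holomorphic_on UNIV" "\<And>s. Re s > 2 \<Longrightarrow> H s = ?h s"
    show thesis
    proof (rule that[OF H])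
      fix s :: complex assume "2 < Re s" "Re s < 3"
      then show "H s = sin (of_real pi * s) / of_real pi * (\<integral>x. of_real x powr (2 - s) * ?F x \<partial>lpos)"
        using H(2)[of s] mel[of s] by simp
    qed
  qed
qed

text \<open>Dividing the entire \<open>H\<close> by \<open>(1 - s) * (2 - s)\<close> leaves at most
  poles at 1 and 2, and \<open>remove_sings\<close> supplies the normalised values there.\<close>

lemma continuation_exists:
  obtains H F where "H holomorphic_on UNIV"
    "\<And>s. 2 < Re s \<Longrightarrow> Re s < 3 \<Longrightarrow> H s = sin (of_real pi * s) / of_real pi *
        (\<integral>x. of_real x powr (2 - s) * log_deriv3 f (z + of_real x) \<partial>lpos)"
    "superzeta_continuation f z F" "F analytic_on {0}"
    "\<And>s. s \<noteq> 1 \<Longrightarrow> s \<noteq> 2 \<Longrightarrow> F s = H s / ((1 - s) * (2 - s))"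
proof -
  obtain H where H: "H holomorphic_on UNIV"
    "\<And>s. Re s > 2 \<Longrightarrow> H s = (1 - s) * (2 - s) * superzeta f s z"
    "\<And>s. 2 < Re s \<Longrightarrow> Re s < 3 \<Longrightarrow> H s = sin (of_real pi * s) / of_real pi *
        (\<integral>x. of_real x powr (2 - s) * log_deriv3 f (z + of_real x) \<partial>lpos)"
    using superzeta_entire by blast
  let ?G = "\<lambda>s. H s / ((1 - s) * (2 - s))"
  define F where "F = remove_sings ?G"
  have Han: "H analytic_on A" for A using H(1) by (metis analytic_on_holomorphic open_UNIV subset_UNIV)
  have Gan: "?G analytic_on {s}" if "s \<noteq> 1" "s \<noteq> 2" for s
    using that by (intro analytic_on_divide Han analytic_on_mult analytic_on_diff analytic_on_const analytic_on_ident) auto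
  have FG: "F s = ?G s" if "s \<noteq> 1" "s \<noteq> 2" for s
    unfolding F_def using Gan[OF that] by (rule remove_sings_at_analytic)
  have "?G meromorphic_on UNIV"
    by (intro meromorphic_on_divide meromorphic_on_mult meromorphic_on_diff meromorphic_on_const meromorphic_on_id
        analytic_on_imp_meromorphic_on Han)
  then have nm: "F nicely_meromorphic_on UNIV" unfolding F_def by (rule remove_sings_nicely_meromorphic)
  have "F s = superzeta f s z" if "Re s > 2" for s
  proof -
    have "s \<noteq> 1" "s \<noteq> 2" using that by auto
    then show ?thesis using FG[of s] H(2)[OF that] by simp
  qed
  then have "superzeta_continuation f z F"
    unfolding superzeta_continuation_def using nm superzeta_abs_summable by blast
  moreover have "F analytic_on {0}" unfolding F_def using Gan[of 0] by (intro remove_sings_analytic_on) auto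
  ultimately show thesis using that H(1,3) FG by blast
qed

end

end

section \<open>The derivative at zero\<close>

text \<open>At 0 the sine factor vanishes with slope 1, so only the value of the integral survives,
  while \<open>sinc\<close> has value 1 and slope 0. Thus \<open>mellin_ext\<close> has value
  \<open>a 3\<close> and slope \<open>I 0\<close>; dividing by \<open>(1 - s) * (2 - s)\<close>, of
  value 2 and slope -3, gives \<open>(2 * I 0 + 3 * a 3) / 4\<close>.\<close>

lemma mellin_ext_deriv_0:
  assumes cont: "continuous_on {0..} F" and a: "a 1 = 0" "a 2 = 0"
    and exp: "\<And>x. x \<ge> X \<Longrightarrow> norm (F x - (\<Sum>j=1..3. a j / of_real x ^ j)) \<le> C * x powr (- real 3 - 1)"
  shows "((\<lambda>s. mellin_ext F a 3 s / ((1 - s) * (2 - s))) has_field_derivative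
     ((\<integral>x. of_real x powr 2 * mellin_rest F a 3 x \<partial>lpos) / 2 + 3 / 4 * a 3)) (at 0)"
proof -
  define I where "I = (\<lambda>s. \<integral>x. of_real x powr (2 - s) * mellin_rest F a 3 x \<partial>lpos)"
  have op: "open {s. 2 - real 3 < Re s \<and> Re s < 3}"
  proof -
    have "{s. 2 - real 3 < Re s \<and> Re s < 3} = {s. Re s > -1} \<inter> {s. Re s < 3}" by auto
    then show ?thesis by (simp only: open_Int open_halfspace_Re_gt open_halfspace_Re_lt)
  qed
  have "I holomorphic_on {s. 2 - real 3 < Re s \<and> Re s < 3}"
    unfolding I_def by (rule mellin_rest_holomorphic[OF cont exp])
  then have dI: "(I has_field_derivative deriv I 0) (at 0)"
    using op by (intro holomorphic_derivI) auto
  have eq: "mellin_ext F a 3 = (\<lambda>s. sin (of_real pi * s) / of_real pi * I s + a 3 * sinc (of_real pi * s))"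
  proof
    fix s
    have "(\<Sum>j=1..3. a j * ((-1) ^ Suc j * sinc (of_real pi * (s + of_nat j - 3)))) = a 3 * sinc (of_real pi * s)"
    proof -
      have "{1..3::nat} = {1, 2, 3}" by auto
      then show ?thesis using a by (simp add: eval_nat_numeral)
    qed
    then show "mellin_ext F a 3 s = sin (of_real pi * s) / of_real pi * I s + a 3 * sinc (of_real pi * s)"
      unfolding mellin_ext_def I_def by simp
  qed
  have "(sinc has_field_derivative 0) (at 0)"
    using has_field_derivative_sin_z_over_z[where 'a = complex and A = UNIV] unfolding sinc_def[abs_def] .
  then have "(sinc has_field_derivative 0) (at (of_real pi * 0))" by simp
  moreover have "((\<lambda>s. of_real pi * s) has_field_derivative of_real pi) (at (0 :: complex))"
    by (auto intro!: derivative_eq_intros)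
  ultimately have ds: "((\<lambda>s. sinc (of_real pi * s)) has_field_derivative 0 * of_real pi) (at 0)"
    by (rule DERIV_chain2)
  have dS: "((\<lambda>s. sin (of_real pi * s) / of_real pi) has_field_derivative 1) (at (0 :: complex))"
    by (auto intro!: derivative_eq_intros)
  have dH: "(mellin_ext F a 3 has_field_derivative I 0) (at 0)"
    unfolding eq using DERIV_add[OF DERIV_mult[OF dS dI] DERIV_cmult[OF ds, of "a 3"]] by simp
  have H0: "mellin_ext F a 3 0 = a 3" unfolding eq by (simp add: sinc_def)
  have dQ: "((\<lambda>s. (1 - s) * (2 - s)) has_field_derivative -3) (at (0 :: complex))"
    by (auto intro!: derivative_eq_intros)
  have "((\<lambda>s. mellin_ext F a 3 s / ((1 - s) * (2 - s))) has_field_derivative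
      (I 0 * ((1 - 0) * (2 - 0)) - mellin_ext F a 3 0 * - 3) / (((1 - 0) * (2 - 0)) * ((1 - 0) * (2 - 0)))) (at 0)"
    by (rule DERIV_divide[OF dH dQ]) simp
  moreover have "(I 0 * ((1 - 0) * (2 - 0)) - mellin_ext F a 3 0 * - 3) / (((1 - 0) * (2 - 0)) * ((1 - 0) * (2 - 0))) = I 0 / 2 + 3 / 4 * a 3"
    unfolding H0 by (simp add: field_simps)
  moreover have "(\<integral>x. of_real x powr 2 * mellin_rest F a 3 x \<partial>lpos) = I 0" by (simp add: I_def)
  ultimately show ?thesis by (simp only:)
qed

text \<open>Integration by parts in closed form: \<open>x\<^sup>2 * F\<close> is the derivative of
  \<open>x\<^sup>2 * l1 - 2 * x * l + 2 * G\<close>, and the subtracted \<open>a 3 / x\<close> that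
  of \<open>a 3 * ln x\<close>.\<close>

lemma ray_integral_limit:
  fixes F l1 l G :: "real \<Rightarrow> complex"
  assumes F: "continuous_on {0..} F"
    and d1: "\<And>x. x \<ge> 0 \<Longrightarrow> (l1 has_vector_derivative F x) (at x within {0..})"
    and d0: "\<And>x. x \<ge> 0 \<Longrightarrow> (l has_vector_derivative l1 x) (at x within {0..})"
    and dG: "\<And>x. x \<ge> 0 \<Longrightarrow> (G has_vector_derivative l x) (at x within {0..})"
    and a: "a 1 = 0" "a 2 = 0"
    and exp: "\<And>x. x \<ge> X \<Longrightarrow> norm (F x - (\<Sum>j=1..3. a j / of_real x ^ j)) \<le> C * x powr (- real 3 - 1)"
  shows "((\<lambda>x. of_real (x\<^sup>2) * l1 x - of_real (2 * x) * l x + 2 * G x - a 3 * of_real (ln x)) \<longlongrightarrow>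
    (\<integral>x. of_real x powr 2 * mellin_rest F a 3 x \<partial>lpos) + 2 * G 0) at_top"
proof -
  let ?g = "\<lambda>x. complex_of_real (x\<^sup>2) * mellin_rest F a 3 x"
  \<comment> \<open>The \<open>max\<close> switches the logarithm on at 1, like the indicator in
    \<open>mellin_rest\<close>; the kink at 1 is the exceptional point in the fundamental theorem of
    calculus.\<close>
  define U where "U = (\<lambda>x. of_real (x\<^sup>2) * l1 x - of_real (2 * x) * l x + 2 * G x - a 3 * of_real (ln (max 1 x)))"
  have sum3: "(\<Sum>j=1..3. a j / of_real x ^ j) = a 3 / complex_of_real x ^ 3" for x
  proof -
    have "{1..3::nat} = {1, 2, 3}" by auto
    then show ?thesis using a by simp
  qed
  have "integrable lpos (\<lambda>x. of_real x powr (2 - 0) * mellin_rest F a 3 x)"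
    by (rule mellin_rest_integrable[OF F exp]) auto
  also have "?this \<longleftrightarrow> integrable lpos ?g"
    by (rule Bochner_Integration.integrable_cong[OF refl]) simp
  finally have intg: "integrable lpos ?g" .
  have I_eq: "(\<integral>x. of_real x powr 2 * mellin_rest F a 3 x \<partial>lpos) = integral\<^sup>L lpos ?g"
    by (rule Bochner_Integration.integral_cong[OF refl]) simp
  let ?gi = "\<lambda>x. indicator {0<..} x *\<^sub>R ?g x"
  have intl: "integrable lborel ?gi" using intg by (simp add: integrable_restrict_space)
  have "((\<lambda>y. \<integral>x. indicator {..y} x *\<^sub>R ?gi x \<partial>lborel) \<longlongrightarrow> integral\<^sup>L lborel ?gi) at_top"
    by (rule tendsto_integral_at_top) (use intl in auto)
  also have "integral\<^sup>L lborel ?gi = integral\<^sup>L lpos ?g" by (simp add: integral_restrict_space)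
  finally have lim: "((\<lambda>y. \<integral>x. indicator {..y} x *\<^sub>R ?gi x \<partial>lborel) \<longlongrightarrow> integral\<^sup>L lpos ?g) at_top" .
  have val: "(\<integral>x. indicator {..y} x *\<^sub>R ?gi x \<partial>lborel) = U y - U 0" if y: "y \<ge> 1" for y
  proof -
    have sub: "at x within {0..y} \<le> at x within {0..}" for x by (intro at_le) auto
    have der: "(U has_vector_derivative ?g x) (at x)" if x: "x \<in> {0<..<y} - {1}" for x
    proof -
      have at: "at x within {0..} = at x" by (rule at_within_nhd[of _ "{0<..}"]) (use x in auto)
      note d = d1[of x, unfolded at] d0[of x, unfolded at] dG[of x, unfolded at]
      have p2: "((\<lambda>x. complex_of_real (x\<^sup>2)) has_vector_derivative of_real (2 * x)) (at x)"
        by (intro has_vector_derivative_of_real) (auto intro!: derivative_eq_intros)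
      have p1: "((\<lambda>x. complex_of_real (2 * x)) has_vector_derivative of_real 2) (at x)"
        by (intro has_vector_derivative_of_real) (auto intro!: derivative_eq_intros)
      have lg: "((\<lambda>x. complex_of_real (ln (max 1 x))) has_vector_derivative of_real (if x > 1 then 1 / x else 0)) (at x)"
      proof (intro has_vector_derivative_of_real)
        show "((\<lambda>x. ln (max 1 x)) has_real_derivative (if x > 1 then 1 / x else 0)) (at x)"
        proof (cases "x > 1")
          case True
          have "(ln has_real_derivative 1 / x) (at x)" using True by (auto intro!: derivative_eq_intros)
          then have "((\<lambda>x. ln (max 1 x)) has_real_derivative 1 / x) (at x)"
            by (rule has_field_derivative_transform_within_open[of _ _ _ "{1<..}"]) (use True in auto)
          then show ?thesis using True by simp
        next
          case False
          have "((\<lambda>x. 0) has_real_derivative 0) (at x)" by simp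
          then have "((\<lambda>x. ln (max 1 x)) has_real_derivative 0) (at x)"
            by (rule has_field_derivative_transform_within_open[of _ _ _ "{..<1}"]) (use False x in \<open>auto simp: max_def\<close>)
          then show ?thesis using False by simp
        qed
      qed
      have "(U has_vector_derivative
         ((of_real (x\<^sup>2) * F x + of_real (2 * x) * l1 x) - (of_real (2 * x) * l1 x + of_real 2 * l x) + 2 * l x
          - a 3 * of_real (if x > 1 then 1 / x else 0))) (at x)"
        unfolding U_def using x
        by (intro has_vector_derivative_diff has_vector_derivative_add has_vector_derivative_mult has_vector_derivative_mult_right p2 p1 lg d) auto
      moreover have "(of_real (x\<^sup>2) * F x + of_real (2 * x) * l1 x) - (of_real (2 * x) * l1 x + of_real 2 * l x) + 2 * l x
          - a 3 * of_real (if x > 1 then 1 / x else 0) = ?g x"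
        using x unfolding mellin_rest_def sum3 by (auto simp: power2_eq_square power3_eq_cube field_simps)
      ultimately show ?thesis by simp
    qed
    have contU: "continuous_on {0..y} U"
    proof -
      have "continuous_on {0..} h" if "\<And>x. x \<ge> 0 \<Longrightarrow> (h has_vector_derivative h' x) (at x within {0..})" for h h' :: "real \<Rightarrow> complex"
        using that has_vector_derivative_continuous by (force simp: continuous_on_eq_continuous_within)
      then have "continuous_on {0..} l1" "continuous_on {0..} l" "continuous_on {0..} G"
        using d1 d0 dG by blast+
      then have "continuous_on {0..y} l1" "continuous_on {0..y} l" "continuous_on {0..y} G"
        by (auto elim: continuous_on_subset)
      then show ?thesis unfolding U_def by (intro continuous_intros) (auto simp: max_def)
    qed
    have hi: "(?g has_integral (U y - U 0)) {0..y}"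
      by (rule fundamental_theorem_of_calculus_interior_strong[of "{1}"]) (use y der contU in auto)
    have "(\<integral>x. indicator {..y} x *\<^sub>R ?gi x \<partial>lborel) = (LINT x:{0<..y}|lborel. ?g x)"
      unfolding set_lebesgue_integral_def by (intro Bochner_Integration.integral_cong) (auto simp: indicator_def)
    also have "\<dots> = integral {0<..y} ?g"
    proof (rule set_borel_integral_eq_integral)
      have "integrable lborel (\<lambda>x. indicator {..y} x *\<^sub>R ?gi x)"
        by (rule integrable_mult_indicator[OF _ intl]) simp
      moreover have "(\<lambda>x. indicator {..y} x *\<^sub>R ?gi x) = (\<lambda>x. indicator {0<..y} x *\<^sub>R ?g x)"
        by (auto simp: indicator_def)
      ultimately show "set_integrable lborel {0<..y} ?g" unfolding set_integrable_def by simp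
    qed
    also have "\<dots> = integral {0..y} ?g"
    proof (rule integral_spike_set)
      have "{x \<in> {0<..y} - {0..y}. ?g x \<noteq> 0} = {}" by auto
      then show "negligible {x \<in> {0<..y} - {0..y}. ?g x \<noteq> 0}" by (simp only: negligible_empty)
      have "{x \<in> {0..y} - {0<..y}. ?g x \<noteq> 0} \<subseteq> {0}" by auto
      then show "negligible {x \<in> {0..y} - {0<..y}. ?g x \<noteq> 0}" using negligible_subset negligible_sing by blast
    qed
    also have "\<dots> = U y - U 0" using hi by (rule integral_unique)
    finally show ?thesis .
  qed
  have "((\<lambda>y. U y - U 0) \<longlongrightarrow> integral\<^sup>L lpos ?g) at_top"
    by (rule Lim_transform_eventually[OF lim eventually_mono[OF eventually_ge_at_top[of 1] val]])
  then have "((\<lambda>y. (U y - U 0) + U 0) \<longlongrightarrow> integral\<^sup>L lpos ?g + U 0) at_top" by (intro tendsto_intros)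
  moreover have "U 0 = 2 * G 0" by (simp add: U_def)
  ultimately have "(U \<longlongrightarrow> integral\<^sup>L lpos ?g + 2 * G 0) at_top" by simp
  then show ?thesis unfolding I_eq
    by (rule Lim_transform_eventually[OF _ eventually_mono[OF eventually_ge_at_top[of 1]]]) (simp add: U_def max_absorb2)
qed

text \<open>Serves as the logarithm along the ray, so that no branch has to be continued.\<close>

lemma primitive_exists:
  fixes l :: "real \<Rightarrow> complex"
  assumes "continuous_on {0..} l"
  obtains G where "G 0 = 0" "\<And>x. x \<ge> 0 \<Longrightarrow> (G has_vector_derivative l x) (at x within {0..})"
proof (rule that[of "\<lambda>u. integral {0..u} l"])
  show "integral {0..0::real} l = 0" by simp
  fix x :: real assume x: "x \<ge> 0"
  have "((\<lambda>u. integral {0..u} l) has_vector_derivative l x) (at x within {0..x + 1})"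
    by (rule integral_has_vector_derivative) (use x assms in \<open>auto elim: continuous_on_subset\<close>)
  also have "at x within {0..x + 1} = at x within {0..}"
    by (rule at_within_nhd[of _ "{..<x + 1}"]) auto
  finally show "((\<lambda>u. integral {0..u} l) has_vector_derivative l x) (at x within {0..})" .
qed

lemma nice_remove_sings:
  assumes "nice h" shows "nice (remove_sings h)"
proof (rule nice_cong[OF _ _ assms])
  have an: "ev_sector (\<lambda>s. h analytic_on {s})" by (rule ev_sector_mono[of "\<lambda>s. h analytic_on {s} \<and> h s \<noteq> 0"]) (use assms in \<open>auto simp: nice_def\<close>)
  show "ev_sector (\<lambda>s. remove_sings h s = h s)" by (rule ev_sector_mono[OF an]) simp
  show "ev_sector (\<lambda>s. remove_sings h analytic_on {s})"
    by (rule ev_sector_mono[OF an]) (simp add: analytic_at_cong[OF eventually_remove_sings_eq_nhds refl])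
qed

text \<open>Where \<open>f\<close> and \<open>g\<close> are nonzero, their quotient is finite and
  nonzero. As \<open>g\<close> comes from \<open>remove_sings\<close>, the product formula is first
  known on a punctured neighbourhood, and the value of \<open>\<phi>\<close> at the point is
  recovered as a limit.\<close>

lemma analytic_quotient:
  assumes f: "f holomorphic_on UNIV" and \<phi>: "\<phi> nicely_meromorphic_on UNIV"
    and g: "g = remove_sings (\<lambda>s. f s * \<phi> s)" "g holomorphic_on UNIV" and nz: "f w \<noteq> 0" "g w \<noteq> 0"
  shows "\<phi> analytic_on {w}" "\<phi> w \<noteq> 0" "\<forall>\<^sub>F s in nhds w. g s = f s * \<phi> s"
proof -
  have "f analytic_on UNIV" "g analytic_on UNIV" using f g(2) by (simp_all add: analytic_on_open)
  then have an: "f analytic_on {w}" "g analytic_on {w}" by (meson analytic_on_subset subset_UNIV)+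
  have "\<phi> meromorphic_on UNIV" using \<phi> by (simp add: nicely_meromorphic_on_def)
  then have "(\<lambda>s. f s * \<phi> s) meromorphic_on UNIV"
    using f by (intro meromorphic_on_mult analytic_on_imp_meromorphic_on[of f]) (simp_all add: analytic_on_open)
  then have "isolated_singularity_at (\<lambda>s. f s * \<phi> s) w"
    by (rule meromorphic_on_isolated_singularity[OF meromorphic_on_subset]) auto
  then have ev: "\<forall>\<^sub>F s in at w. g s = f s * \<phi> s"
    unfolding g(1) by (rule eventually_remove_sings_eq_at)
  have ct: "f \<midarrow>w\<rightarrow> f w" "g \<midarrow>w\<rightarrow> g w" using an by (auto dest: analytic_at_imp_isCont simp: isCont_def)
  have "\<forall>\<^sub>F s in at w. f s \<noteq> 0" by (rule tendsto_imp_eventually_ne[OF ct(1) nz(1)])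
  with ev have "\<forall>\<^sub>F s in at w. g s / f s = \<phi> s" by eventually_elim simp
  moreover have "((\<lambda>s. g s / f s) \<longlongrightarrow> g w / f w) (at w)" by (intro tendsto_divide ct nz)
  ultimately have lim: "\<phi> \<midarrow>w\<rightarrow> g w / f w" by (rule Lim_transform_eventually[rotated])
  then have np: "\<not> is_pole \<phi> w"
    unfolding is_pole_def using not_tendsto_and_filterlim_at_infinity[OF at_neq_bot lim] by blast
  show an\<phi>: "\<phi> analytic_on {w}" by (rule nicely_meromorphic_on_imp_analytic_at[OF \<phi> UNIV_I np])
  then have "\<phi> \<midarrow>w\<rightarrow> \<phi> w" by (auto dest: analytic_at_imp_isCont simp: isCont_def)
  from LIM_unique[OF this lim] have val: "\<phi> w = g w / f w" .
  then show "\<phi> w \<noteq> 0" using nz by simp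
  show "\<forall>\<^sub>F s in nhds w. g s = f s * \<phi> s"
    unfolding eventually_nhds_conv_at using ev val nz by simp
qed

lemma log_deriv3_quotient:
  assumes an: "f analytic_on {w}" "f w \<noteq> 0" "h analytic_on {w}" "h w \<noteq> 0" and ev: "\<forall>\<^sub>F s in nhds w. g s = f s * h s"
  shows "log_deriv3 h w = log_deriv3 g w - log_deriv3 f w"
proof -
  have ne: "\<forall>\<^sub>F s in nhds w. k analytic_on {s} \<and> k s \<noteq> 0" if k: "k analytic_on {w}" "k w \<noteq> 0" for k :: "complex \<Rightarrow> complex"
  proof (rule eventually_conj)
    obtain S where S: "open S" "w \<in> S" "k holomorphic_on S" using k(1) unfolding analytic_at by blast
    then have "k analytic_on {s}" if "s \<in> S" for s using that unfolding analytic_at by blast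
    then show "\<forall>\<^sub>F s in nhds w. k analytic_on {s}" using S(1,2) unfolding eventually_nhds by blast
    have "k \<midarrow>w\<rightarrow> k w" using analytic_at_imp_isCont[OF k(1)] by (simp only: isCont_def)
    from tendsto_imp_eventually_ne[OF this k(2)] show "\<forall>\<^sub>F s in nhds w. k s \<noteq> 0"
      unfolding eventually_nhds_conv_at using k(2) by simp
  qed
  have "\<forall>\<^sub>F s in nhds w. log_deriv g s = log_deriv f s + log_deriv h s"
    using ne[OF an(1,2)] ne[OF an(3,4)] eventually_eventually[THEN iffD2, OF ev]
  proof eventually_elim
    case (elim s)
    have "deriv g s = deriv (\<lambda>s. f s * h s) s" "g s = f s * h s"
      using deriv_cong_ev[OF elim(3) refl] eventually_nhds_x_imp_x[OF elim(3)] .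
    then have "log_deriv g s = log_deriv (\<lambda>s. f s * h s) s" by (simp only: log_deriv_def)
    also have "\<dots> = log_deriv f s + log_deriv h s" using elim(1,2) by (intro log_deriv_mult) auto
    finally show ?case .
  qed
  then have "\<forall>\<^sub>F v in nhds w. \<forall>\<^sub>F s in nhds v. log_deriv g s = log_deriv f s + log_deriv h s"
    by (simp only: eventually_eventually)
  then have "\<forall>\<^sub>F v in nhds w. deriv (log_deriv g) v = deriv (\<lambda>s. log_deriv f s + log_deriv h s) v"
    by eventually_elim (rule deriv_cong_ev[OF _ refl])
  then have 1: "log_deriv3 g w = deriv (deriv (\<lambda>s. log_deriv f s + log_deriv h s)) w"
    unfolding log_deriv3_eq by (rule deriv_cong_ev[OF _ refl])
  have "\<forall>\<^sub>F s in nhds w. deriv (\<lambda>s. log_deriv f s + log_deriv h s) s = deriv (log_deriv f) s + deriv (log_deriv h) s"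
    using ne[OF an(1,2)] ne[OF an(3,4)]
  proof eventually_elim
    case (elim s)
    then show ?case
      by (intro deriv_add analytic_on_imp_differentiable_at[of _ "{s}"] log_deriv_analytic) auto
  qed
  then have "deriv (deriv (\<lambda>s. log_deriv f s + log_deriv h s)) w = deriv (\<lambda>s. deriv (log_deriv f) s + deriv (log_deriv h) s) w"
    by (rule deriv_cong_ev[OF _ refl])
  also have "\<dots> = log_deriv3 f w + log_deriv3 h w"
    unfolding log_deriv3_eq using an
    by (intro deriv_add analytic_on_imp_differentiable_at[of _ "{w}"] analytic_deriv log_deriv_analytic) auto
  finally show ?thesis using 1 by simp
qed

text \<open>Recentring at \<open>z\<close> replaces \<open>b / (z + s)\<close> by
  \<open>b / s\<close> at the price of \<open>b * z / (s * (s + z))\<close>, which already fits an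
  expansion from order 2 on. Each derivative then gains one order, and the first one removes
  \<open>A\<close>.\<close>

lemma expansion_log_deriv_ray:
  assumes h: "expansion 2 (\<lambda>s. l s + (A + b * (1 / s)))" and an: "ev_strips (\<lambda>s. l analytic_on {s})"
  shows "\<exists>C X. \<forall>x\<ge>X. norm (l (z + of_real x) + A + b / of_real x) \<le> C * x powr (- real 2)"
    and "\<exists>C X. \<forall>x\<ge>X. norm (deriv l (z + of_real x) - b / of_real x ^ 2) \<le> C * x powr (- real 3)"
    and "\<exists>C X. \<forall>x\<ge>X. norm (deriv (deriv l) (z + of_real x) + 2 * b / of_real x ^ 3) \<le> C * x powr (- real 4)"
proof -
  define k where "k = (\<lambda>s. l (z + s) + (A + b * (1 / s)))"
  define k1 where "k1 = (\<lambda>s. deriv l (z + s) - b / s ^ 2)"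
  define k2 where "k2 = (\<lambda>s. deriv (deriv l) (z + s) + 2 * b / s ^ 3)"
  have anz: "ev_strips (\<lambda>s. l analytic_on {z + s})"
    using ev_strips_affine[OF an, of 1 z] by (simp add: add.commute)
  have big: "ev_strips (\<lambda>s. Re s > norm z + 1)" by (rule ev_strips_mono[OF ev_strips_Re_ge[of "norm z + 2"]]) simp
  have an_shift: "(\<lambda>s. m (z + s)) analytic_on {s}" if "m analytic_on {z + s}" for m :: "complex \<Rightarrow> complex" and s
    using analytic_affine[of m 1 s z] that by (simp add: add.commute)
  have d_shift: "((\<lambda>s. m (z + s)) has_field_derivative deriv m (z + s)) (at s)" if "m analytic_on {z + s}" for m :: "complex \<Rightarrow> complex" and s
    using DERIV_shift[THEN iffD1, OF analytic_derivI[of m "s + z"]] that by (simp add: add.commute)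
  have s0: "s \<noteq> 0" if "Re s > norm z + 1" for s using that norm_ge_zero[of z] by (intro notI) simp
  have a0: "expansion 2 k"
  proof -
    define r where "r = 1 / (norm z + 1)"
    have r: "r > 0" unfolding r_def by (simp add: add_nonneg_pos)
    have ne: "1 + z * u \<noteq> 0" if "u \<in> ball 0 r" for u
    proof
      assume "1 + z * u = 0"
      then have "norm (z * u) = 1" by (metis add.inverse_unique norm_minus_cancel norm_one)
      moreover have "norm z * norm u \<le> norm z * r" using that by (intro mult_left_mono) auto
      moreover have "norm z * r < 1" by (simp add: r_def divide_less_eq add_nonneg_pos)
      ultimately show False by (simp add: norm_mult)
    qed
    have "expansion 2 (\<lambda>s. (1 / s) ^ 2 * (b * z / (1 + z * (1 / s))))"
      by (rule expansion_analytic[OF _ r]) (use ne in \<open>auto intro!: holomorphic_intros\<close>)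
    from expansion_add[OF expansion_affine[OF h, of 1 z] this]
    have "expansion 2 (\<lambda>s. l (s + z) + (A + b * (1 / (s + z))) + (1 / s) ^ 2 * (b * z / (1 + z * (1 / s))))" by simp
    moreover have "ev_strips (\<lambda>s. k s = l (s + z) + (A + b * (1 / (s + z))) + (1 / s) ^ 2 * (b * z / (1 + z * (1 / s))))"
      using big
    proof (rule ev_strips_mono)
      fix s assume s: "Re s > norm z + 1"
      have "s \<noteq> 0" by (rule s0[OF s])
      moreover have "s + z \<noteq> 0"
      proof
        assume "s + z = 0"
        then have "Re (s + z) = 0" by (simp only: zero_complex.sel)
        then have "Re s = - Re z" by simp
        then show False using s abs_Re_le_cmod[of z] by linarith
      qed
      moreover have "b * (1 / s) = b * (1 / t) + (1 / s) ^ 2 * (b * (t - s) / (t / s))" if "s \<noteq> 0" "t \<noteq> 0" for t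
        using that by (simp add: field_simps power2_eq_square)
      moreover from \<open>s \<noteq> 0\<close> have "1 + z * (1 / s) = (s + z) / s" by (simp add: field_simps)
      ultimately have "b * (1 / s) = b * (1 / (s + z)) + (1 / s) ^ 2 * (b * z / (1 + z * (1 / s)))"
        by (metis add_diff_cancel_left')
      then show "k s = l (s + z) + (A + b * (1 / (s + z))) + (1 / s) ^ 2 * (b * z / (1 + z * (1 / s)))"
        unfolding k_def by (simp add: add.commute)
    qed
    ultimately show ?thesis by (rule expansion_cong_ev_strips[rotated])
  qed
  have "ev_strips (\<lambda>s. deriv k s = k1 s \<and> k analytic_on {s})" using ev_strips_conj[OF anz big]
  proof (rule ev_strips_mono)
    fix s assume s: "l analytic_on {z + s} \<and> norm z + 1 < Re s"
    then have "(k has_field_derivative k1 s) (at s)"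
      unfolding k_def k1_def using s0[of s]
      by (auto intro!: derivative_eq_intros d_shift simp: power2_eq_square)
    moreover have "k analytic_on {s}" unfolding k_def using s s0[of s] by (auto intro!: analytic_intros an_shift)
    ultimately show "deriv k s = k1 s \<and> k analytic_on {s}" by (simp add: DERIV_imp_deriv)
  qed
  then have e1: "ev_strips (\<lambda>s. deriv k s = k1 s)" and ak: "ev_strips (\<lambda>s. k analytic_on {s})" by (auto elim: ev_strips_mono)
  have a1: "expansion 3 k1"
  proof -
    have "expansion (Suc 2) (deriv k)" using expansion_deriv[OF a0] ak ev_stripsD by blast
    moreover have "ev_strips (\<lambda>s. k1 s = deriv k s)" by (rule ev_strips_mono[OF e1]) simp
    ultimately show ?thesis using expansion_cong_ev_strips by (auto simp: eval_nat_numeral)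
  qed
  have "ev_strips (\<lambda>s. deriv k1 s = k2 s \<and> k1 analytic_on {s})" using ev_strips_conj[OF anz big]
  proof (rule ev_strips_mono)
    fix s assume s: "l analytic_on {z + s} \<and> norm z + 1 < Re s"
    then have dl: "deriv l analytic_on {z + s}" by (auto intro: analytic_deriv)
    have "((\<lambda>s. b / s ^ 2) has_field_derivative - (2 * b / s ^ 3)) (at s)"
      using s0[of s] s by (auto intro!: derivative_eq_intros simp: eval_nat_numeral field_simps)
    from DERIV_diff[OF d_shift[OF dl] this] have "(k1 has_field_derivative k2 s) (at s)"
      unfolding k1_def k2_def by simp
    moreover have "k1 analytic_on {s}" unfolding k1_def using s s0[of s] dl by (auto intro!: analytic_intros an_shift)
    ultimately show "deriv k1 s = k2 s \<and> k1 analytic_on {s}" by (simp add: DERIV_imp_deriv)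
  qed
  then have e2: "ev_strips (\<lambda>s. deriv k1 s = k2 s)" and ak1: "ev_strips (\<lambda>s. k1 analytic_on {s})" by (auto elim: ev_strips_mono)
  have a2: "expansion 4 k2"
  proof -
    have "expansion (Suc 3) (deriv k1)" using expansion_deriv[OF a1] ak1 ev_stripsD by blast
    moreover have "ev_strips (\<lambda>s. k2 s = deriv k1 s)" by (rule ev_strips_mono[OF e2]) simp
    ultimately show ?thesis using expansion_cong_ev_strips by (auto simp: eval_nat_numeral)
  qed
  show "\<exists>C X. \<forall>x\<ge>X. norm (l (z + of_real x) + A + b / of_real x) \<le> C * x powr (- real 2)"
    using expansion_real_bound[OF a0] by (simp add: k_def add.assoc)
  show "\<exists>C X. \<forall>x\<ge>X. norm (deriv l (z + of_real x) - b / of_real x ^ 2) \<le> C * x powr (- real 3)"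
    using expansion_real_bound[OF a1] by (simp add: k1_def)
  show "\<exists>C X. \<forall>x\<ge>X. norm (deriv (deriv l) (z + of_real x) + 2 * b / of_real x ^ 3) \<le> C * x powr (- real 4)"
    using expansion_real_bound[OF a2] by (simp add: k2_def)
qed


text \<open>For the difference a remainder of size \<open>x powr (- 4)\<close> is enough: with
  \<open>M = 3\<close> the strip is \<open>-1 < Re s < 3\<close> and contains 0. There the
  difference of the two continuations is the explicit \<open>mellin_ext\<close>, by analytic
  continuation from \<open>2 < Re s < 3\<close>.\<close>

lemma superzeta_difference_deriv:
  assumes f: "order_two f z" "nice f" and h: "order_two h z" "nice h"
    and eq: "\<And>x. x \<ge> 0 \<Longrightarrow> F x = log_deriv3 h (z + of_real x) - log_deriv3 f (z + of_real x)"
    and a: "a 1 = 0" "a 2 = 0"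
    and exp: "\<And>x. x \<ge> X \<Longrightarrow> norm (F x - (\<Sum>j=1..3. a j / of_real x ^ j)) \<le> C * x powr (- real 3 - 1)"
    and cf: "superzeta_continuation f z Ff" and ch: "superzeta_continuation h z Fh"
  shows "((\<lambda>s. Fh s - Ff s) has_field_derivative
     ((\<integral>x. of_real x powr 2 * mellin_rest F a 3 x \<partial>lpos) / 2 + 3 / 4 * a 3)) (at 0)"
proof -
  let ?S = "{s. 2 - real 3 < Re s \<and> Re s < 3}"
  let ?T = "{s. 2 < Re s \<and> Re s < 3}"
  obtain Hf F1 where Hf: "Hf holomorphic_on UNIV"
    "\<And>s. 2 < Re s \<Longrightarrow> Re s < 3 \<Longrightarrow> Hf s = sin (of_real pi * s) / of_real pi *
        (\<integral>x. of_real x powr (2 - s) * log_deriv3 f (z + of_real x) \<partial>lpos)"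
    "superzeta_continuation f z F1" "\<And>s. s \<noteq> 1 \<Longrightarrow> s \<noteq> 2 \<Longrightarrow> F1 s = Hf s / ((1 - s) * (2 - s))"
    by (rule order_two.continuation_exists[OF f]) (rule that)
  obtain Hh F2 where Hh: "Hh holomorphic_on UNIV"
    "\<And>s. 2 < Re s \<Longrightarrow> Re s < 3 \<Longrightarrow> Hh s = sin (of_real pi * s) / of_real pi *
        (\<integral>x. of_real x powr (2 - s) * log_deriv3 h (z + of_real x) \<partial>lpos)"
    "superzeta_continuation h z F2" "\<And>s. s \<noteq> 1 \<Longrightarrow> s \<noteq> 2 \<Longrightarrow> F2 s = Hh s / ((1 - s) * (2 - s))"
    by (rule order_two.continuation_exists[OF h]) (rule that)
  have F12: "F1 = Ff" "F2 = Fh"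
    using superzeta_continuation_unique[OF Hf(3) cf] superzeta_continuation_unique[OF Hh(3) ch] .
  have cont: "continuous_on {0..} F"
  proof -
    have "continuous_on {0..} (\<lambda>x. log_deriv3 h (z + of_real x) - log_deriv3 f (z + of_real x))"
      by (intro continuous_intros order_two.log_deriv3_ray_continuous f h)
    then show ?thesis by (rule continuous_on_cong[THEN iffD1, rotated -1]) (auto simp: eq)
  qed
  have op: "open ?S" "open ?T"
    by (auto simp: Collect_conj_eq intro!: open_Int open_halfspace_Re_gt open_halfspace_Re_lt)
  have conn: "connected ?S"
    by (auto simp: Collect_conj_eq intro!: convex_connected convex_Int convex_halfspace_Re_gt convex_halfspace_Re_lt)
  have eqT: "Hh s - Hf s = mellin_ext F a 3 s" if s: "s \<in> ?T" for s
  proof -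
    have Re: "2 < Re s" "Re s < 3" using s by auto
    have "(\<integral>x. of_real x powr (2 - s) * F x \<partial>lpos) = (\<integral>x. of_real x powr (2 - s) * log_deriv3 h (z + of_real x)
        - of_real x powr (2 - s) * log_deriv3 f (z + of_real x) \<partial>lpos)"
      by (rule Bochner_Integration.integral_cong) (auto simp: eq space_restrict_space algebra_simps)
    also have "\<dots> = (\<integral>x. of_real x powr (2 - s) * log_deriv3 h (z + of_real x) \<partial>lpos)
        - (\<integral>x. of_real x powr (2 - s) * log_deriv3 f (z + of_real x) \<partial>lpos)"
      by (rule Bochner_Integration.integral_diff) (rule order_two.log_deriv3_ray_integrable[OF h Re] order_two.log_deriv3_ray_integrable[OF f Re])+
    finally have int: "(\<integral>x. of_real x powr (2 - s) * F x \<partial>lpos) = (\<integral>x. of_real x powr (2 - s) * log_deriv3 h (z + of_real x) \<partial>lpos)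
        - (\<integral>x. of_real x powr (2 - s) * log_deriv3 f (z + of_real x) \<partial>lpos)" .
    have "mellin_ext F a 3 s = sin (of_real pi * s) / of_real pi * (\<integral>x. of_real x powr (2 - s) * F x \<partial>lpos)"
      by (rule mellin_ext_eq[OF cont exp Re])
    then show ?thesis unfolding int Hh(2)[OF Re] Hf(2)[OF Re] by (simp only: right_diff_distrib)
  qed
  have eqS: "Hh s - Hf s = mellin_ext F a 3 s" if "s \<in> ?S" for s
  proof (rule analytic_continuation_open[of ?T ?S "\<lambda>s. Hh s - Hf s" "mellin_ext F a 3"])
    have "Complex (5 / 2) 0 \<in> ?T" by simp
    then show "?T \<noteq> {}" by blast
    show "(\<lambda>s. Hh s - Hf s) holomorphic_on ?S" using Hf(1) Hh(1) by (auto intro!: holomorphic_intros elim: holomorphic_on_subset)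
    show "mellin_ext F a 3 holomorphic_on ?S" by (rule mellin_ext_holomorphic[OF cont exp])
  qed (use that op conn eqT in auto)
  have "((\<lambda>s. mellin_ext F a 3 s / ((1 - s) * (2 - s))) has_field_derivative
     ((\<integral>x. of_real x powr 2 * mellin_rest F a 3 x \<partial>lpos) / 2 + 3 / 4 * a 3)) (at 0)"
    by (rule mellin_ext_deriv_0[OF cont a exp])
  then show ?thesis
  proof (rule has_field_derivative_transform_within_open[of _ _ _ "ball 0 1"])
    fix s :: complex assume s: "s \<in> ball 0 1"
    then have "s \<noteq> 1" "s \<noteq> 2" by auto
    moreover have "s \<in> ?S" using s abs_Re_le_cmod[of s] by auto
    ultimately show "mellin_ext F a 3 s / ((1 - s) * (2 - s)) = Fh s - Ff s"
      using eqS Hf(4) Hh(4) unfolding F12 by (simp add: diff_divide_distrib[symmetric])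
  qed auto
qed

lemma tendsto_mult_of_remainder:
  fixes h :: "real \<Rightarrow> complex"
  assumes "\<exists>C X. \<forall>x\<ge>X. norm (h x - b / of_real x ^ m) \<le> C * x powr (- real (Suc m))"
  shows "((\<lambda>x. of_real (x ^ m) * h x) \<longlongrightarrow> b) at_top"
proof -
  obtain C X where C: "\<And>x. x \<ge> X \<Longrightarrow> norm (h x - b / of_real x ^ m) \<le> C * x powr (- real (Suc m))"
    using assms by blast
  have "((\<lambda>x. of_real (x ^ m) * h x - b) \<longlongrightarrow> 0) at_top"
  proof (rule Lim_null_comparison)
    show "\<forall>\<^sub>F x in at_top. norm (of_real (x ^ m) * h x - b) \<le> C * x powr (-1)"
      using eventually_ge_at_top[of X] eventually_gt_at_top[of 0]
    proof eventually_elim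
      case (elim x)
      have "of_real (x ^ m) * h x - b = of_real (x ^ m) * (h x - b / of_real x ^ m)"
        using elim by (simp add: field_simps)
      then have "norm (of_real (x ^ m) * h x - b) = x powr real m * norm (h x - b / of_real x ^ m)"
        using elim by (simp add: norm_mult norm_power powr_realpow del: of_real_power)
      also have "\<dots> \<le> x powr real m * (C * x powr (- real (Suc m)))"
        by (intro mult_left_mono C elim) simp
      also have "\<dots> = C * (x powr real m * x powr (- real (Suc m)))" by simp
      also have "x powr real m * x powr (- real (Suc m)) = x powr (-1)"
        unfolding powr_add[symmetric] by simp
      finally show ?case .
    qed
    show "((\<lambda>x. C * x powr (-1)) \<longlongrightarrow> 0) at_top" by real_asymp
  qed
  then show ?thesis by (rule LIM_zero_cancel)
qed

lemma ray_has_vector_derivative: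
  assumes "m analytic_on {z + of_real x}"
  shows "((\<lambda>x. m (z + of_real x)) has_vector_derivative deriv m (z + of_real x)) (at x within A)"
proof -
  have "((\<lambda>s. m (z + s)) has_field_derivative deriv m (z + of_real x)) (at (of_real x))"
    using DERIV_shift[THEN iffD1, OF analytic_derivI[of m "of_real x + z"]] assms by (simp add: add.commute)
  then show ?thesis by (rule has_vector_derivative_real_field)
qed

text \<open>Multiplying \<open>\<phi>\<close> by \<open>q powr (2 * s)\<close> removes the constant
  from the logarithmic derivative, so \<open>l\<close> is of order \<open>1 / x\<close> and its
  primitive \<open>G\<close> grows only logarithmically. The limits of \<open>x\<^sup>2 * l1\<close>
  and \<open>x * l\<close> turn the integrated identity into the limit of
  \<open>G x + (c / 2) * ln x\<close>; the boundary contributions \<open>- c / 4\<close> and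
  \<open>- c / 2\<close> make up \<open>3 / 4 * a 3\<close>, so the limit is the derivative at 0 of
  the superzeta difference.\<close>

lemma scattering_value:
  assumes an: "\<And>x. x \<ge> 0 \<Longrightarrow> \<phi> analytic_on {z + of_real x}" "\<And>x. x \<ge> 0 \<Longrightarrow> \<phi> (z + of_real x) \<noteq> 0"
    and an': "ev_strips (\<lambda>s. log_deriv \<phi> analytic_on {s})"
    and as: "expansion 2 (\<lambda>s. log_deriv \<phi> s + (2 * of_real (ln q) + of_nat c / 2 * (1 / s)))" and q: "q > 0"
    and lim: "\<And>w. Re w > 1 \<Longrightarrow> (\<lambda>n. \<phi> (w + of_nat n) * of_real q powr (2 * (w + of_nat n)) *
      exp (of_nat c * of_real (ln (real n)) / 2)) \<longlonglongrightarrow> L"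
    and exp: "\<And>x. x \<ge> X \<Longrightarrow> norm (log_deriv3 \<phi> (z + of_real x) - (\<Sum>j=1..3. a j / of_real x ^ j)) \<le> C * x powr (- real 3 - 1)"
    and a: "a 1 = 0" "a 2 = 0" "a 3 = - of_nat c"
  shows "\<phi> z = L * of_real q powr (- 2 * z) *
    exp (- ((\<integral>x. of_real x powr 2 * mellin_rest (\<lambda>x. log_deriv3 \<phi> (z + of_real x)) a 3 x \<partial>lpos) / 2 + 3 / 4 * a 3))"
proof -
  define A where "A = 2 * complex_of_real (ln q)"
  define l where "l = (\<lambda>x. log_deriv \<phi> (z + of_real x) + A)"
  define l1 where "l1 = (\<lambda>x. deriv (log_deriv \<phi>) (z + complex_of_real x))"
  define F where "F = (\<lambda>x. log_deriv3 \<phi> (z + complex_of_real x))"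
  define I where "I = (\<integral>x. of_real x powr 2 * mellin_rest F a 3 x \<partial>lpos)"
  have al: "log_deriv \<phi> analytic_on {z + of_real x}" if "x \<ge> 0" for x
    using that by (intro log_deriv_analytic an)
  have contF: "continuous_on {0..} F"
    unfolding F_def log_deriv3_eq
    by (intro continuous_at_imp_continuous_on ballI isCont_ray analytic_deriv al) auto
  have dl1: "(l1 has_vector_derivative F x) (at x within {0..})" if "x \<ge> 0" for x
    unfolding l1_def F_def log_deriv3_eq by (intro ray_has_vector_derivative analytic_deriv al that)
  have dl: "(l has_vector_derivative l1 x) (at x within {0..})" if "x \<ge> 0" for x
    unfolding l_def l1_def using ray_has_vector_derivative[OF al[OF that]]
    by (auto intro: has_vector_derivative_add_const[THEN iffD2])
  have "continuous_on {0..} l"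
    unfolding l_def by (intro continuous_intros continuous_at_imp_continuous_on ballI isCont_ray al) auto
  then obtain G where G: "G 0 = 0" "\<And>x. x \<ge> 0 \<Longrightarrow> (G has_vector_derivative l x) (at x within {0..})"
    using primitive_exists by blast
  have expF: "norm (F x - (\<Sum>j=1..3. a j / of_real x ^ j)) \<le> C * x powr (- real 3 - 1)" if "x \<ge> X" for x
    unfolding F_def by (rule exp[OF that])
  have lim3: "((\<lambda>x. of_real (x\<^sup>2) * l1 x - of_real (2 * x) * l x + 2 * G x - a 3 * of_real (ln x)) \<longlongrightarrow> I) at_top"
    using ray_integral_limit[OF contF dl1 dl G(2) a(1,2) expF] G(1) unfolding I_def by simp
  have lim1: "((\<lambda>x. of_real (x ^ 2) * l1 x) \<longlongrightarrow> of_nat c / 2) at_top"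
    by (rule tendsto_mult_of_remainder) (use expansion_log_deriv_ray(2)[OF as an', of z] in \<open>simp add: l1_def\<close>)
  have lim0: "((\<lambda>x. of_real (x ^ 1) * l x) \<longlongrightarrow> - (of_nat c / 2)) at_top"
    by (rule tendsto_mult_of_remainder) (use expansion_log_deriv_ray(1)[OF as an', of z] in \<open>simp add: l_def A_def\<close>)
  have "((\<lambda>x. ((of_real (x\<^sup>2) * l1 x - of_real (2 * x) * l x + 2 * G x - a 3 * of_real (ln x))
       - of_real (x ^ 2) * l1 x + 2 * (of_real (x ^ 1) * l x)) / 2)
     \<longlongrightarrow> (I - of_nat c / 2 + 2 * (- (of_nat c / 2))) / 2) at_top"
    by (intro tendsto_intros lim3 lim1 lim0) simp
  moreover have "(I - of_nat c / 2 + 2 * (- (of_nat c / 2))) / 2 = I / 2 + 3 / 4 * a 3"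
    by (simp add: a field_simps)
  moreover have "((of_real (x\<^sup>2) * l1 x - of_real (2 * x) * l x + 2 * G x - a 3 * of_real (ln x))
       - of_real (x ^ 2) * l1 x + 2 * (of_real (x ^ 1) * l x)) / 2 = G x + of_nat c * of_real (ln x) / 2" for x
    by (simp add: a algebra_simps add_divide_distrib)
  ultimately have "((\<lambda>x. G x + of_nat c * of_real (ln x) / 2) \<longlongrightarrow> I / 2 + 3 / 4 * a 3) at_top"
    by (simp only:)
  then have limE: "((\<lambda>x. exp (G x + of_nat c * of_real (ln x) / 2)) \<longlongrightarrow> exp (I / 2 + 3 / 4 * a 3)) at_top"
    by (rule tendsto_exp)
  define \<Phi> where "\<Phi> = (\<lambda>s. \<phi> s * exp (A * s))"
  have qp: "of_real q powr (2 * s) = exp (A * s)" for s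
    using q by (simp add: powr_def A_def Ln_of_real mult_ac)
  have \<Phi>: "\<Phi> (z + of_real x) = \<Phi> z * exp (G x)" if x: "x \<ge> 0" for x
  proof -
    \<comment> \<open>\<open>\<Phi>\<close> on the ray and \<open>exp G\<close> solve the same
      linear differential equation, so their quotient is constant.\<close>
    define u where "u = (\<lambda>x. \<Phi> (z + of_real x) * exp (- G x))"
    have "(u has_vector_derivative 0) (at x within {0..})" if x: "x \<in> {0..}" for x
    proof -
      let ?w = "z + complex_of_real x"
      have nz: "\<phi> ?w \<noteq> 0" and an0: "\<phi> analytic_on {?w}" using an x by auto
      have "(\<Phi> has_field_derivative deriv \<phi> ?w * exp (A * ?w) + \<phi> ?w * (exp (A * ?w) * A)) (at ?w)"
        unfolding \<Phi>_def using analytic_derivI[OF an0] by (auto intro!: derivative_eq_intros)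
      then have d\<Phi>: "deriv \<Phi> ?w = l x * \<Phi> ?w"
        using nz by (simp add: DERIV_imp_deriv l_def log_deriv_def \<Phi>_def field_simps)
      have "\<Phi> analytic_on {?w}" unfolding \<Phi>_def by (intro analytic_intros an0)
      from ray_has_vector_derivative[OF this]
      have 1: "((\<lambda>x. \<Phi> (z + of_real x)) has_vector_derivative l x * \<Phi> ?w) (at x within {0..})"
        unfolding d\<Phi> .
      have "((exp \<circ> (\<lambda>x. - G x)) has_vector_derivative - l x * exp (- G x)) (at x within {0..})"
        by (rule field_vector_diff_chain_within) (use G(2)[of x] x in \<open>auto intro!: has_vector_derivative_minus DERIV_subset[OF DERIV_exp]\<close>)
      then have 2: "((\<lambda>x. exp (- G x)) has_vector_derivative - l x * exp (- G x)) (at x within {0..})"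
        by (simp add: o_def)
      from has_vector_derivative_mult[OF 1 2] show ?thesis
        unfolding u_def by (simp add: algebra_simps)
    qed
    then obtain k where "\<And>x. x \<in> {0..} \<Longrightarrow> u x = k"
      using has_vector_derivative_zero_constant[of "{0..}" u] by auto
    then have "u x = u 0" using x by simp
    then show ?thesis using G(1) by (simp add: u_def exp_minus field_simps)
  qed
  \<comment> \<open>The limit along the integers is available from points of real part above 1,
    which the shift by \<open>N0\<close> reaches. The resulting discrepancy between
    \<open>ln (N0 + n)\<close> and \<open>ln n\<close> tends to 0.\<close>
  obtain N0 :: nat where N0: "real N0 > 1 - Re z" using reals_Archimedean2 by blast
  let ?y = "\<lambda>n::nat. real N0 + real n"
  have "filterlim ?y at_top sequentially" by real_asymp
  from filterlim_compose[OF limE this]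
  have "(\<lambda>n. \<Phi> z * exp (G (?y n) + of_nat c * of_real (ln (?y n)) / 2)) \<longlonglongrightarrow> \<Phi> z * exp (I / 2 + 3 / 4 * a 3)"
    by (rule tendsto_mult_left)
  moreover have "(\<lambda>n. exp (of_nat c * complex_of_real (ln (?y n) - ln (real n)) / 2)) \<longlonglongrightarrow> exp (of_nat c * complex_of_real 0 / 2)"
    by (intro tendsto_intros tendsto_of_real) (real_asymp, simp)
  ultimately have "(\<lambda>n. \<Phi> z * exp (G (?y n) + of_nat c * of_real (ln (?y n)) / 2) / exp (of_nat c * complex_of_real (ln (?y n) - ln (real n)) / 2))
     \<longlonglongrightarrow> \<Phi> z * exp (I / 2 + 3 / 4 * a 3) / exp (of_nat c * complex_of_real 0 / 2)"
    by (intro tendsto_divide) auto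
  moreover have "\<Phi> z * exp (G (?y n) + of_nat c * of_real (ln (?y n)) / 2) / exp (of_nat c * complex_of_real (ln (?y n) - ln (real n)) / 2)
     = \<phi> ((z + of_nat N0) + of_nat n) * of_real q powr (2 * ((z + of_nat N0) + of_nat n)) * exp (of_nat c * of_real (ln (real n)) / 2)" for n
  proof -
    have w: "(z + of_nat N0) + of_nat n = z + complex_of_real (?y n)" by simp
    have "exp (G (?y n) + of_nat c * of_real (ln (?y n)) / 2) / exp (of_nat c * complex_of_real (ln (?y n) - ln (real n)) / 2)
      = exp (G (?y n)) * exp (of_nat c * of_real (ln (real n)) / 2)"
      unfolding exp_diff[symmetric] exp_add[symmetric] by (simp add: algebra_simps diff_divide_distrib)
    moreover have "\<phi> (z + of_real (?y n)) * of_real q powr (2 * (z + of_real (?y n))) = \<Phi> z * exp (G (?y n))"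
      using \<Phi>[of "?y n"] unfolding qp by (simp add: \<Phi>_def)
    ultimately show ?thesis unfolding w by (metis mult.assoc times_divide_eq_right)
  qed
  ultimately have "(\<lambda>n. \<phi> ((z + of_nat N0) + of_nat n) * of_real q powr (2 * ((z + of_nat N0) + of_nat n)) * exp (of_nat c * of_real (ln (real n)) / 2))
     \<longlonglongrightarrow> \<Phi> z * exp (I / 2 + 3 / 4 * a 3)" by simp
  moreover have "Re (z + of_nat N0) > 1" using N0 by simp
  ultimately have "\<Phi> z * exp (I / 2 + 3 / 4 * a 3) = L" using lim LIMSEQ_unique by blast
  then have L: "\<phi> z * exp (A * z) * exp (I / 2 + 3 / 4 * a 3) = L" by (simp add: \<Phi>_def)
  have "of_real q powr (- 2 * z) = exp (- (A * z))" using qp[of "- z"] by simp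
  then have "L * of_real q powr (- 2 * z) * exp (- (I / 2 + 3 / 4 * a 3)) = \<phi> z"
    unfolding L[symmetric] by (simp add: exp_minus field_simps)
  then show ?thesis unfolding I_def F_def by simp
qed

theorem theorem4p2:
  fixes \<Gamma> :: "(real^2^2) set set"
    and \<sigma> :: "'n::finite \<Rightarrow> (real^2^2) set"
    and c :: nat
    and Z \<phi> Zp Zm :: "complex \<Rightarrow> complex"
    and d g :: "nat \<Rightarrow> real"
  assumes fuchsian: "fuchsian_first_kind \<Gamma>" "finite_covolume \<Gamma>"
    and cusps: "c = num_cusps \<Gamma>" "c > 0"
    and scaling: "scaling_system \<Gamma> \<sigma>"
    and Z: "selberg_zeta \<Gamma> Z"
    and phi: "scattering_determinant \<Gamma> \<sigma> \<phi>"
    and g: "0 < g 1" "strict_mono_on {1..} g"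
    and d: "d 1 \<noteq> 0"
    and dirichlet_summable: "\<And>s. Re s > 1 \<Longrightarrow>
        (\<lambda>n. norm (of_real (d n) * of_real (g n) powr (- 2 * s))) summable_on {1..}"
    and dirichlet: "\<And>s. Re s > 1 \<Longrightarrow>
        \<phi> s = of_real (pi powr (real c / 2)) * (Gamma (s - 1/2) / Gamma s) ^ c *
              (\<Sum>\<^sub>\<infinity>n\<in>{1..}. of_real (d n) * of_real (g n) powr (- 2 * s))"
    and Zp: "Zp = remove_sings (\<lambda>s. Z s / (G_1 \<Gamma> s * Gamma (s - 1/2) ^ c))"
    and Zm: "Zm = remove_sings (\<lambda>s. Zp s * \<phi> s)"
    and Zp_entire: "Zp holomorphic_on UNIV" "growth_order Zp = 2"
    and Zm_entire: "Zm holomorphic_on UNIV" "growth_order Zm = 2"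
  shows "(\<forall>z\<in>superzeta_domain Zp. \<exists>F. superzeta_continuation Zp z F \<and> F analytic_on {0}) \<and>
         (\<forall>z\<in>superzeta_domain Zm. \<exists>F. superzeta_continuation Zm z F \<and> F analytic_on {0}) \<and>
         (\<forall>z\<in>superzeta_domain Zp \<inter> superzeta_domain Zm. \<forall>Fp Fm.
            superzeta_continuation Zp z Fp \<longrightarrow> superzeta_continuation Zm z Fm \<longrightarrow>
            \<phi> z = of_real (pi powr (real c / 2)) * of_real (d 1) * of_real (g 1) powr (- 2 * z) *
                  exp (- deriv (\<lambda>s. Fm s - Fp s) 0))"
proof -
  define K where "K = complex_of_real (pi powr (real c / 2))"
  have K: "K \<noteq> 0" by (simp add: K_def)
  have m\<phi>: "\<phi> nicely_meromorphic_on UNIV" using phi by (simp add: scattering_determinant_def)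
  note sc = m\<phi> g d K dirichlet_summable dirichlet[folded K_def]
  have nice\<phi>: "nice \<phi>" by (rule nice_scattering[OF sc])
  then have an\<phi>: "ev_strips (\<lambda>s. log_deriv \<phi> analytic_on {s})" by (simp add: nice_def tame_def)
  have as: "expansion 2 (\<lambda>s. log_deriv \<phi> s + (2 * of_real (ln (g 1)) + of_nat c / 2 * (1 / s)))"
    by (rule expansion_scattering[OF sc])
  have "nice (\<lambda>s. Gamma (s - 1 / 2))" using nice_affine[OF nice_Gamma, of 1 "- 1 / 2"] by simp
  then have nZp: "nice Zp"
    unfolding Zp by (intro nice_remove_sings nice_divide nice_mult nice_power nice_selberg[OF Z] nice_G_1)
  have nZm: "nice Zm"
    unfolding Zm by (intro nice_remove_sings nice_mult nZp nice\<phi>)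
  have op: "order_two Zp z" if "z \<in> superzeta_domain Zp" for z
    by (rule order_two.intro[OF Zp_entire(1) growth_order_bound[OF Zp_entire(2)] that])
  have om: "order_two Zm z" if "z \<in> superzeta_domain Zm" for z
    by (rule order_two.intro[OF Zm_entire(1) growth_order_bound[OF Zm_entire(2)] that])
  have "\<phi> z = K * of_real (d 1) * of_real (g 1) powr (- 2 * z) * exp (- deriv (\<lambda>s. Fm s - Fp s) 0)"
    if z: "z \<in> superzeta_domain Zp" "z \<in> superzeta_domain Zm"
      and cp: "superzeta_continuation Zp z Fp" and cm: "superzeta_continuation Zm z Fm" for z Fp Fm
  proof -
    interpret p: order_two Zp z by (rule op[OF z(1)])
    interpret m: order_two Zm z by (rule om[OF z(2)])
    \<comment> \<open>Both entire functions are zero-free on the ray, so \<open>\<phi>\<close> has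
      neither poles nor zeros there.\<close>
    have q: "\<phi> analytic_on {z + of_real x}" "\<phi> (z + of_real x) \<noteq> 0"
      "\<forall>\<^sub>F s in nhds (z + of_real x). Zm s = Zp s * \<phi> s" if "x \<ge> 0" for x
      using analytic_quotient[OF Zp_entire(1) m\<phi> Zm Zm_entire(1) p.nonzero[OF that] m.nonzero[OF that]] .
    have eq: "log_deriv3 \<phi> (z + of_real x) = log_deriv3 Zm (z + of_real x) - log_deriv3 Zp (z + of_real x)" if "x \<ge> 0" for x
      by (rule log_deriv3_quotient[OF p.analytic p.nonzero[OF that] q[OF that]])
    \<comment> \<open>The leading term of the third logarithmic derivative is
      \<open>- 2 * b / x ^ 3\<close> with \<open>b = c / 2\<close>.\<close>
    define a where "a = (\<lambda>j :: nat. if j = 3 then - complex_of_nat c else 0)"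
    have a: "a 1 = 0" "a 2 = 0" "a 3 = - of_nat c" by (simp_all add: a_def)
    obtain C X where C: "\<And>x. x \<ge> X \<Longrightarrow>
        norm (deriv (deriv (log_deriv \<phi>)) (z + of_real x) + 2 * (of_nat c / 2) / of_real x ^ 3) \<le> C * x powr (- real 4)"
      using expansion_log_deriv_ray(3)[OF as an\<phi>, of z] by blast
    have exp: "norm (log_deriv3 \<phi> (z + of_real x) - (\<Sum>j=1..3. a j / of_real x ^ j)) \<le> C * x powr (- real 3 - 1)"
      if "x \<ge> X" for x
    proof -
      have "{1..3::nat} = {1, 2, 3}" by auto
      then have "(\<Sum>j=1..3. a j / of_real x ^ j) = - (of_nat c / complex_of_real x ^ 3)" using a by simp
      then show ?thesis using C[OF that] unfolding log_deriv3_eq by simp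
    qed
    let ?D = "(\<integral>x. of_real x powr 2 * mellin_rest (\<lambda>x. log_deriv3 \<phi> (z + of_real x)) a 3 x \<partial>lpos) / 2 + 3 / 4 * a 3"
    have "((\<lambda>s. Fm s - Fp s) has_field_derivative ?D) (at 0)"
      by (rule superzeta_difference_deriv[OF p.order_two_axioms nZp m.order_two_axioms nZm eq a(1,2) exp cp cm])
    then have "deriv (\<lambda>s. Fm s - Fp s) 0 = ?D" by (rule DERIV_imp_deriv)
    moreover have "\<phi> z = K * of_real (d 1) * of_real (g 1) powr (- 2 * z) * exp (- ?D)"
      by (rule scattering_value[OF q(1,2) an\<phi> as g(1) scattering_LIMSEQ[OF sc] exp a])
    ultimately show ?thesis by (simp only:)
  qed
  moreover have "\<exists>F. superzeta_continuation Zp z F \<and> F analytic_on {0}" if "z \<in> superzeta_domain Zp" for z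
    by (rule order_two.continuation_exists[OF op[OF that] nZp]) blast
  moreover have "\<exists>F. superzeta_continuation Zm z F \<and> F analytic_on {0}" if "z \<in> superzeta_domain Zm" for z
    by (rule order_two.continuation_exists[OF om[OF that] nZm]) blast
  ultimately show ?thesis unfolding K_def by blast
qed

end
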